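(* Let $r\ge 2$ be an integer, let $P$ be a collectable $r$-pattern, and let $b_P>0$ be the constant such that, for a uniformly random $r$-matching $M$ of size $n$, $L_P(M)/n^{1/r}\to b_P$ in probability as $n\to\infty$. \begin{enumerate} \item If $P$ has type $r$ (i.e., the block partition of $P$ has a single block), then $b_P=1/\Gamma((r+1)/r)$. \item If $P$ has type $1+\dots+1$ (i.e., $P$ is $r$-partite), then $b_P=c_r\,(r!)^{1/r}/r>1/\Gamma((r+1)/r)$, where $c_r$ is the Bollobás–Winkler constant. \end{enumerate}
   Context: An (ordered) $r$-matching is an $r$-uniform hypergraph on a totally ordered vertex set in which every vertex is contained in exactly one edge; its size is its number of edges. A random $r$-matching of size $n$ is uniform over $r$-matchings on $\{1,\dots,rn\}$. An $r$-matching is $r$-partite if, when the vertex set is divided into $r$ contiguous intervals of equal length, every edge has exactly one vertex in each interval. An $r$-pattern is an $r$-matching of size $2$ on the vertex set $\{1,\dots,2r\}$. For an $r$-pattern $P$, an $r$-matching is a $P$-clique if every pair of its edges (with the induced ordering on their $2r$ vertices) is order-isomorphic to $P$; $L_P(M)$ is the size of the largest $P$-clique formed by a subset of the edges of $M$. An $r$-pattern $P$ is collectable if there are arbitrarily large $P$-cliques. For collectable $P$, the limit constant $b_P$ exists (another theorem of the paper). A run in a pattern is a sequence of consecutive vertices in the same edge. A pattern is splittable if its vertex set can be partitioned into blocks of consecutive vertices, each consisting of two runs of the same length coming from different edges; this partition is then unique and is called the block partition of $P$. It is known that an $r$-pattern is collectable if and only if it is splittable. If $P$ has block partition $J_1\cup\dots\cup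 J_\ell$, the type of $P$ is the unordered partition $|J_1|/2+\dots+|J_\ell|/2$ of $r$. Bollobás–Winkler constant: $c_r>0$ is the constant such that the expected length of the longest common increasing subsequence in $r-1$ independent uniformly random permutations of $\{1,\dots,n\}$ is asymptotic to $c_r n^{1/r}$; equivalently, $c_rn^{1/r}$ is the asymptotic expected size of the longest chain (in the coordinatewise order) among $n$ independent uniformly random points in $[0,1]^r$. $\Gamma$ is the Gamma function. *)

theory Defs
  imports "HOL-Probability.Probability" "HOL-Probability.Product_PMF"
    "HOL-Combinatorics.Multiset_Permutations"
    "HOL-Library.Sublist" "HOL-Library.Landau_Symbols" "HOL-Library.Disjoint_Sets"
begin

text \<open>A hypergraph is represented by its set of edges.\<close>

definition is_matching :: "nat \<Rightarrow> 'a::linorder set \<Rightarrow> 'a set set \<Rightarrow> bool" where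
  "is_matching r V M \<longleftrightarrow> finite V \<and> partition_on V M \<and> (\<forall>e\<in>M. card e = r)"

definition random_matching :: "nat \<Rightarrow> nat \<Rightarrow> nat set set pmf" where
  "random_matching r n = pmf_of_set {M. is_matching r {1..r * n} M}"

definition is_pattern :: "nat \<Rightarrow> nat set set \<Rightarrow> bool" where
  "is_pattern r P \<longleftrightarrow> is_matching r {1..2 * r} P \<and> card P = 2"

text \<open>Isomorphism of ordered hypergraphs without isolated vertices: the vertex set is the
  union of the edges.\<close>

definition order_isomorphic :: "'a::linorder set set \<Rightarrow> 'b::linorder set set \<Rightarrow> bool" where
  "order_isomorphic M N \<longleftrightarrow>
     (\<exists>\<phi>. bij_betw \<phi> (\<Union>M) (\<Union>N) \<and> strict_mono_on (\<Union>M) \<phi> \<and> (\<lambda>e. \<phi> ` e) ` M = N)"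

definition is_clique :: "nat set set \<Rightarrow> 'a::linorder set set \<Rightarrow> bool" where
  "is_clique P K \<longleftrightarrow> (\<forall>e\<in>K. \<forall>f\<in>K. e \<noteq> f \<longrightarrow> order_isomorphic {e, f} P)"

definition max_clique :: "nat set set \<Rightarrow> 'a::linorder set set \<Rightarrow> nat" where
  "max_clique P M = Max (card ` {K. K \<subseteq> M \<and> is_clique P K})"

text \<open>Taking the vertices in \<^typ>\<open>nat\<close> is no restriction, as every finite totally ordered set
  embeds into it.\<close>

definition collectable :: "nat \<Rightarrow> nat set set \<Rightarrow> bool" where
  "collectable r P \<longleftrightarrow>
     (\<forall>N. \<exists>(V :: nat set) M. is_matching r V M \<and> is_clique P M \<and> N \<le> card M)"

text \<open>Runs need not be maximal: in the pattern ABBA the blocks are AB and BA.\<close>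

definition is_block :: "nat set set \<Rightarrow> nat set \<Rightarrow> bool" where
  "is_block P J \<longleftrightarrow>
     (\<exists>a k. \<exists>e\<in>P. \<exists>f\<in>P. k > 0 \<and> e \<noteq> f \<and> J = {a..<a + 2 * k} \<and>
        {a..<a + k} \<subseteq> e \<and> {a + k..<a + 2 * k} \<subseteq> f)"

definition is_block_partition :: "nat set set \<Rightarrow> nat set set \<Rightarrow> bool" where
  "is_block_partition P Js \<longleftrightarrow> partition_on (\<Union>P) Js \<and> (\<forall>J\<in>Js. is_block P J)"

text \<open>The type is an unordered integer partition, i.e. a multiset. It is given as a relation;
  since block partitions are unique, a pattern has at most one type, and it has one if and only
  if it is splittable.\<close>

definition has_type :: "nat set set \<Rightarrow> nat multiset \<Rightarrow> bool" where
  "has_type P \<mu> \<longleftrightarrow>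
     (\<exists>Js. is_block_partition P Js \<and> \<mu> = image_mset (\<lambda>J. card J div 2) (mset_set Js))"

text \<open>Convergence in probability to a constant, the matchings of different sizes living on
  different probability spaces.\<close>

definition is_limit_constant :: "nat \<Rightarrow> nat set set \<Rightarrow> real \<Rightarrow> bool" where
  "is_limit_constant r P b \<longleftrightarrow> b > 0 \<and>
     (\<forall>\<epsilon>>0. (\<lambda>n. measure_pmf.prob (random_matching r n)
                {M. \<bar>real (max_clique P M) / real n powr (1 / real r) - b\<bar> \<ge> \<epsilon>})
              \<longlonglongrightarrow> 0)"

text \<open>Longest common increasing subsequence of the words \<open>\<pi> 0, \<dots>, \<pi> (k - 1)\<close>, for \<open>k > 0\<close>.\<close>

definition lcis :: "nat \<Rightarrow> (nat \<Rightarrow> nat list) \<Rightarrow> nat" where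
  "lcis k \<pi> = Max (length ` {xs. sorted_wrt (<) xs \<and> (\<forall>i<k. subseq xs (\<pi> i))})"

text \<open>Permutations of \<open>{1..n}\<close> are words containing each of its elements exactly once; the product
  distribution makes \<open>\<pi> 0, \<dots>, \<pi> (k - 1)\<close> independent.\<close>

definition random_permutations :: "nat \<Rightarrow> nat \<Rightarrow> (nat \<Rightarrow> nat list) pmf" where
  "random_permutations k n = Pi_pmf {..<k} [] (\<lambda>_. pmf_of_set (permutations_of_set {1..n}))"

definition is_bollobas_winkler_constant :: "nat \<Rightarrow> real \<Rightarrow> bool" where
  "is_bollobas_winkler_constant r c \<longleftrightarrow> c > 0 \<and>
     (\<lambda>n. measure_pmf.expectation (random_permutations (r - 1) n) (\<lambda>\<pi>. real (lcis (r - 1) \<pi>)))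
       \<sim>[at_top] (\<lambda>n. c * real n powr (1 / real r))"

end

theory Submission imports Defs "HOL-Real_Asymp.Real_Asymp"
begin

text \<open>The uniform models are replaced by independent ones. Let every \<open>r\<close>-subset of \<open>{1..m}\<close> be an edge
  independently with probability \<open>p\<close>. If \<open>m\<close> grows while the mean number \<open>l\<close> of edges stays fixed,
  edges sharing a vertex become unlikely, and conditioned on consisting of \<open>N\<close> disjoint edges the
  random hypergraph is, up to a monotone relabelling, a uniformly random matching of size \<open>N\<close>.
  Likewise a random subset of a grid \<open>{1..u 0} \<times> \<dots> \<times> {1..u (r - 1)}\<close> in which no two points share a
  coordinate is encoded by \<open>r - 1\<close> independent uniform permutations, whose longest common increasing
  subsequence is the longest chain of points. All quantities of interest are sizes of largest
  subsets with a hereditary property, and by the Efron--Stein inequality the variance of such a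
  quantity is at most its mean (\<open>largest_variance_le_mean\<close>). This turns the limit constant \<open>b\<close> of a
  pattern into an asymptotic \<open>b * l powr (1 / r)\<close> of expectations in the independent model
  (\<open>matching_mean_constant\<close>, and \<open>points_mean_constant\<close> for points), and it makes the expected maximum
  of boundedly many such quantities asymptotic to the largest of their expectations
  (\<open>bexp_max_le\<close>).

  If the pattern has a single block, a clique is a sequence of edges each of which ends before the
  next begins. Always taking the edge that ends first is optimal, the steps of this greedy procedure
  are renewals, and a step is longer than \<open>u\<close> with probability \<open>(1 - p) ^ (u choose r)\<close>. Its mean
  length is therefore asymptotic to \<open>(fact r / p) powr (1 / r)\<close> times the integral of \<open>exp (- (x ^ r))\<close>
  over \<open>x \<ge> 0\<close>, which is \<open>Gamma (1 + 1 / r)\<close>; as \<open>l\<close> is asymptotic to \<open>p * m ^ r / fact r\<close>, this gives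
  \<open>b = 1 / Gamma (1 + 1 / r)\<close> (\<open>interval_constant\<close>).

  If the pattern is \<open>r\<close>-partite, cut \<open>{1..m}\<close> into \<open>r\<close> intervals. The edges with one vertex in each of
  them form a random set of points in a box, and cliques among them are chains of points. Equal
  intervals give a lower bound for \<open>b\<close>. Conversely every clique is separated by some choice of
  cuts; rounding the cuts leaves boundedly many choices, and by the inequality of arithmetic and
  geometric means none of the boxes is better than the cube (\<open>partite_constant\<close>).

  For the strict inequality consider chains among random points \<open>x\<close> with positive coordinates and
  \<open>x 0 + \<dots> + x (r - 1) \<le> t\<close>. Covering by boxes shows that their mean length is asymptotically at most
  \<open>c / r * p powr (1 / r) * t\<close>. A greedy chain, which always takes the point of least coordinate sum,
  grows at least as fast as the greedy sequence of edges above, at rate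
  \<open>p powr (1 / r) / (Gamma (1 + 1 / r) * fact r powr (1 / r))\<close>. But it can be improved: with
  probability bounded away from \<open>0\<close> the first greedy point has no point above it for a long time,
  while a different point is already the beginning of a chain of length two (\<open>trap\<close>). So a renewal
  in steps of two points is faster than the greedy one by a constant factor
  (\<open>points_constant_gt\<close>).\<close>

section \<open>Expectations over random subsets\<close>

text \<open>The expectation of \<open>F\<close> at the random subset of \<open>S\<close> that contains every element independently
  with probability \<open>p\<close>, as a finite sum: everything below takes place on finite sets, and
  conditioning on one element is the recursion \<open>bexp_insert\<close>.\<close>

definition bexp :: "real \<Rightarrow> 'a set \<Rightarrow> ('a set \<Rightarrow> real) \<Rightarrow> real" where
  "bexp p S F = (\<Sum>G\<in>Pow S. p ^ card G * (1 - p) ^ card (S - G) * F G)"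

lemma bexp_empty [simp]: "bexp p {} F = F {}"
  by (simp add: bexp_def)

lemma bexp_cong:
  assumes "S = T" "\<And>G. G \<subseteq> T \<Longrightarrow> F G = F' G"
  shows "bexp p S F = bexp p T F'"
  using assms by (auto simp: bexp_def intro!: sum.cong)

lemma bexp_insert:
  assumes "finite S" "x \<notin> S"
  shows "bexp p (insert x S) F = p * bexp p S (\<lambda>G. F (insert x G)) + (1 - p) * bexp p S F"
proof -
  have fin: "finite G" if "G \<subseteq> S" for G using that assms(1) finite_subset by blast
  have disj: "Pow S \<inter> insert x ` Pow S = {}" using assms(2) by auto
  have inj: "inj_on (insert x) (Pow S)"
    using assms(2) unfolding inj_on_def by (metis PowD insert_ident subsetD)
  have c1: "card (insert x G) = Suc (card G)" if "G \<in> Pow S" for G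
    using that assms(2) fin by (subst card_insert_disjoint) auto
  have c2: "S - insert x G = S - G" if "G \<in> Pow S" for G
    using that assms(2) by auto
  have c3: "card (insert x S - G) = Suc (card (S - G))" if "G \<in> Pow S" for G
  proof -
    have "insert x S - G = insert x (S - G)" using that assms(2) by auto
    then show ?thesis using assms by simp
  qed
  have "bexp p (insert x S) F
      = (\<Sum>G\<in>Pow S. p ^ card G * (1 - p) ^ card (insert x S - G) * F G)
        + (\<Sum>G\<in>insert x ` Pow S. p ^ card G * (1 - p) ^ card (insert x S - G) * F G)"
    unfolding bexp_def Pow_insert using disj assms(1) by (subst sum.union_disjoint) auto
  also have "(\<Sum>G\<in>Pow S. p ^ card G * (1 - p) ^ card (insert x S - G) * F G) = (1 - p) * bexp p S F"
    unfolding bexp_def sum_distrib_left by (intro sum.cong) (auto simp: c3 algebra_simps)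
  also have "(\<Sum>G\<in>insert x ` Pow S. p ^ card G * (1 - p) ^ card (insert x S - G) * F G)
      = p * bexp p S (\<lambda>G. F (insert x G))"
    unfolding bexp_def sum_distrib_left sum.reindex[OF inj]
    by (intro sum.cong refl) (auto simp: c1 c2)
  finally show ?thesis by simp
qed

lemma bexp_add: "bexp p S (\<lambda>G. F G + F' G) = bexp p S F + bexp p S F'"
  by (simp add: bexp_def sum.distrib algebra_simps)

lemma bexp_diff: "bexp p S (\<lambda>G. F G - F' G) = bexp p S F - bexp p S F'"
  by (simp add: bexp_def sum_subtractf algebra_simps)

lemma bexp_cmult: "bexp p S (\<lambda>G. c * F G) = c * bexp p S F"
  by (simp add: bexp_def sum_distrib_left algebra_simps)

lemma bexp_sum: "bexp p S (\<lambda>G. \<Sum>i\<in>I. F i G) = (\<Sum>i\<in>I. bexp p S (F i))"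
  unfolding bexp_def sum_distrib_left by (subst sum.swap) simp

lemma bexp_const [simp]: "finite S \<Longrightarrow> bexp p S (\<lambda>_. c) = c"
  by (induction S rule: finite_induct) (auto simp: bexp_insert algebra_simps)

lemma bexp_mono:
  assumes "0 \<le> p" "p \<le> 1" "\<And>G. G \<subseteq> S \<Longrightarrow> F G \<le> F' G"
  shows "bexp p S F \<le> bexp p S F'"
  unfolding bexp_def using assms by (intro sum_mono mult_left_mono) auto

lemma bexp_nonneg:
  assumes "0 \<le> p" "p \<le> 1" "\<And>G. G \<subseteq> S \<Longrightarrow> 0 \<le> F G"
  shows "0 \<le> bexp p S F"
  unfolding bexp_def using assms by (intro sum_nonneg mult_nonneg_nonneg) auto

lemma bexp_union:
  assumes "finite A" "finite B" "A \<inter> B = {}"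
  shows "bexp p (A \<union> B) F = bexp p A (\<lambda>G. bexp p B (\<lambda>G'. F (G \<union> G')))"
  using assms(1,3)
proof (induction A arbitrary: F rule: finite_induct)
  case (insert x A)
  have "bexp p (insert x (A \<union> B)) F = p * bexp p (A \<union> B) (\<lambda>G. F (insert x G)) + (1 - p) * bexp p (A \<union> B) F"
    using insert assms by (intro bexp_insert) auto
  then show ?case using insert by (simp add: bexp_insert)
qed simp

lemma bexp_restrict:
  assumes "finite S" "A \<subseteq> S"
  shows "bexp p S (\<lambda>G. F (G \<inter> A)) = bexp p A F"
proof -
  have "bexp p S (\<lambda>G. F (G \<inter> A)) = bexp p (A \<union> (S - A)) (\<lambda>G. F (G \<inter> A))"
    using assms by (intro bexp_cong) auto
  also have "\<dots> = bexp p A (\<lambda>G. bexp p (S - A) (\<lambda>G'. F ((G \<union> G') \<inter> A)))"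
    using assms finite_subset by (intro bexp_union) auto
  also have "\<dots> = bexp p A (\<lambda>G. bexp p (S - A) (\<lambda>G'. F G))"
    by (intro bexp_cong refl arg_cong[where f=F]) auto
  finally show ?thesis using assms by simp
qed

lemma bexp_image:
  assumes "inj_on h S"
  shows "bexp p (h ` S) F = bexp p S (\<lambda>G. F (h ` G))"
proof -
  have inj: "inj_on ((`) h) (Pow S)"
    by (rule inj_on_image_Pow[OF assms])
  have c1: "card (h ` G) = card G" if "G \<in> Pow S" for G
    using that assms by (auto intro!: card_image intro: inj_on_subset)
  have c2: "card (h ` S - h ` G) = card (S - G)" if "G \<in> Pow S" for G
  proof -
    have "h ` S - h ` G = h ` (S - G)" using that assms by (auto simp: inj_on_def)
    then show ?thesis using assms by (auto intro!: card_image intro: inj_on_subset)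
  qed
  show ?thesis
    unfolding bexp_def image_Pow_surj[OF refl, symmetric] sum.reindex[OF inj]
    by (intro sum.cong) (auto simp: c1 c2)
qed

lemma bexp_prob_superset:
  assumes "finite S" "A \<subseteq> S"
  shows "bexp p S (\<lambda>G. of_bool (A \<subseteq> G)) = p ^ card A"
proof -
  have fA: "finite A" using assms finite_subset by blast
  have "bexp p S (\<lambda>G. of_bool (A \<subseteq> G)) = bexp p S (\<lambda>G. of_bool (A \<subseteq> G \<inter> A))" by simp
  also have "\<dots> = bexp p A (\<lambda>G. of_bool (A \<subseteq> G))"
    using bexp_restrict[OF assms, of p "\<lambda>G. of_bool (A \<subseteq> G)"] by simp
  also have "\<dots> = (\<Sum>G\<in>Pow A. if A = G then p ^ card A else 0)"
    unfolding bexp_def by (intro sum.cong) auto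
  also have "\<dots> = p ^ card A" using fA by simp
  finally show ?thesis .
qed

lemma bexp_prob_disjoint:
  assumes "finite S" "A \<subseteq> S"
  shows "bexp p S (\<lambda>G. of_bool (G \<inter> A = {})) = (1 - p) ^ card A"
proof -
  have fA: "finite A" using assms finite_subset by blast
  have "bexp p S (\<lambda>G. of_bool (G \<inter> A = {})) = bexp p A (\<lambda>G. of_bool (G = {}))"
    by (rule bexp_restrict[OF assms])
  also have "\<dots> = (\<Sum>G\<in>Pow A. if {} = G then (1 - p) ^ card A else 0)"
    unfolding bexp_def by (intro sum.cong) auto
  also have "\<dots> = (1 - p) ^ card A" using fA by simp
  finally show ?thesis .
qed

lemma bexp_square_le:
  assumes "finite S" "0 \<le> p" "p \<le> 1"
  shows "(bexp p S F)\<^sup>2 \<le> bexp p S (\<lambda>G. (F G)\<^sup>2)"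
proof -
  define m where "m = bexp p S F"
  have "0 \<le> bexp p S (\<lambda>G. (F G - m)\<^sup>2)" using assms by (intro bexp_nonneg) auto
  also have "\<dots> = bexp p S (\<lambda>G. ((F G)\<^sup>2 - (2 * m) * F G) + m\<^sup>2)"
    by (intro bexp_cong) (auto simp: power2_eq_square algebra_simps)
  also have "\<dots> = bexp p S (\<lambda>G. (F G)\<^sup>2) - m\<^sup>2"
    using assms(1) by (simp only: bexp_add bexp_diff bexp_cmult bexp_const)
      (simp add: m_def power2_eq_square)
  finally show ?thesis by (simp add: m_def)
qed

lemma bexp_variance:
  assumes "finite S"
  shows "bexp p S (\<lambda>G. (F G - bexp p S F)\<^sup>2) = bexp p S (\<lambda>G. (F G)\<^sup>2) - (bexp p S F)\<^sup>2"
proof -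
  define m where "m = bexp p S F"
  have "bexp p S (\<lambda>G. (F G - m)\<^sup>2) = bexp p S (\<lambda>G. ((F G)\<^sup>2 - (2 * m) * F G) + m\<^sup>2)"
    by (intro bexp_cong) (auto simp: power2_eq_square algebra_simps)
  also have "\<dots> = bexp p S (\<lambda>G. (F G)\<^sup>2) - m\<^sup>2"
    using assms(1) by (simp only: bexp_add bexp_diff bexp_cmult bexp_const)
      (simp add: m_def power2_eq_square)
  finally show ?thesis by (simp add: m_def)
qed

text \<open>Induction on \<open>S\<close>: conditioning on the element \<open>a\<close> splits the variance into the mean of the
  conditional variances, treated by the induction hypothesis, and the variance of the conditional
  mean, which is \<open>p * (1 - p)\<close> times the square of an expected difference and hence at most
  \<open>p * (1 - p)\<close> times the expected squared difference.\<close>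

lemma efron_stein:
  assumes "finite S" "0 \<le> p" "p \<le> 1"
  shows "bexp p S (\<lambda>G. (F G)\<^sup>2) - (bexp p S F)\<^sup>2
    \<le> p * (1 - p) * (\<Sum>x\<in>S. bexp p S (\<lambda>G. (F (insert x G) - F (G - {x}))\<^sup>2))"
  using assms(1)
proof (induction S arbitrary: F rule: finite_induct)
  case (insert a S)
  define F1 where "F1 = (\<lambda>G. F (insert a G))"
  define V where "V = (\<lambda>F. bexp p S (\<lambda>G. (F G)\<^sup>2) - (bexp p S F)\<^sup>2 :: real)"
  define D where "D = (\<lambda>F x. bexp p S (\<lambda>G. (F (insert x G) - F (G - {x}))\<^sup>2 :: real))"
  have IH: "V F' \<le> p * (1 - p) * (\<Sum>x\<in>S. D F' x)" for F'
    using insert.IH unfolding V_def D_def by blast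
  have Da: "bexp p (insert a S) (\<lambda>G. (F (insert a G) - F (G - {a}))\<^sup>2) = bexp p S (\<lambda>G. (F1 G - F G)\<^sup>2)"
  proof -
    have "bexp p S (\<lambda>G. (F (insert a G) - F (G - {a}))\<^sup>2) = bexp p S (\<lambda>G. (F1 G - F G)\<^sup>2)"
      unfolding F1_def using insert.hyps
      by (intro bexp_cong refl) (metis Diff_empty Diff_insert0 subset_iff)
    moreover have "bexp p S (\<lambda>G. (F (insert a (insert a G)) - F (insert a G - {a}))\<^sup>2) = bexp p S (\<lambda>G. (F1 G - F G)\<^sup>2)"
      unfolding F1_def using insert.hyps
      by (intro bexp_cong refl) (metis Diff_insert_absorb insert_absorb2 subset_iff)
    ultimately show ?thesis using insert.hyps by (simp add: bexp_insert algebra_simps)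
  qed
  have Dx: "bexp p (insert a S) (\<lambda>G. (F (insert x G) - F (G - {x}))\<^sup>2) = p * D F1 x + (1 - p) * D F x"
    if "x \<in> S" for x
  proof -
    have "x \<noteq> a" using that insert.hyps by auto
    then show ?thesis using insert.hyps
      by (simp add: bexp_insert D_def F1_def insert_commute insert_Diff_if)
  qed
  have "bexp p (insert a S) (\<lambda>G. (F G)\<^sup>2) - (bexp p (insert a S) F)\<^sup>2
      = p * V F1 + (1 - p) * V F + p * (1 - p) * (bexp p S F1 - bexp p S F)\<^sup>2"
    using insert.hyps unfolding V_def F1_def
    by (simp add: bexp_insert power2_eq_square algebra_simps)
  also have "\<dots> \<le> p * (p * (1 - p) * (\<Sum>x\<in>S. D F1 x)) + (1 - p) * (p * (1 - p) * (\<Sum>x\<in>S. D F x))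
      + p * (1 - p) * bexp p S (\<lambda>G. (F1 G - F G)\<^sup>2)"
    using bexp_square_le[OF insert.hyps(1) assms(2,3), of "\<lambda>G. F1 G - F G"] assms IH[of F1] IH[of F]
    by (intro add_mono mult_left_mono) (auto simp: bexp_diff)
  also have "\<dots> = p * (1 - p) * (bexp p S (\<lambda>G. (F1 G - F G)\<^sup>2) + (\<Sum>x\<in>S. p * D F1 x + (1 - p) * D F x))"
    by (simp only: sum.distrib sum_distrib_left[symmetric]) (simp add: algebra_simps)
  also have "\<dots> = p * (1 - p) * (\<Sum>x\<in>insert a S. bexp p (insert a S) (\<lambda>G. (F (insert x G) - F (G - {x}))\<^sup>2))"
    using insert.hyps by (simp add: Da Dx)
  finally show ?case .
qed simp

text \<open>The presence of \<open>x\<close> is independent of the rest of the random set.\<close>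

lemma bexp_thin:
  assumes "finite S" "x \<in> S"
  shows "bexp p S (\<lambda>G. of_bool (x \<in> G) * H (G - {x})) = p * bexp p S (\<lambda>G. H (G - {x}))"
proof -
  define T where "T = S - {x}"
  have S: "S = insert x T" "x \<notin> T" "finite T" using assms by (auto simp: T_def)
  have a: "bexp p T (\<lambda>G. of_bool (x \<in> G) * H (G - {x})) = 0"
  proof -
    have "bexp p T (\<lambda>G. of_bool (x \<in> G) * H (G - {x})) = bexp p T (\<lambda>_. 0)"
      using S by (intro bexp_cong) auto
    then show ?thesis using S by simp
  qed
  have b: "bexp p T (\<lambda>G. H (insert x G - {x})) = bexp p T H"
    using S by (intro bexp_cong refl) (metis Diff_insert_absorb subset_iff)
  have c: "bexp p T (\<lambda>G. H (G - {x})) = bexp p T H"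
    using S by (intro bexp_cong refl) (metis Diff_empty Diff_insert0 subset_iff)
  show ?thesis unfolding S(1) using S(2,3) a b c by (simp add: bexp_insert algebra_simps)
qed

lemma bexp_card: 
  assumes "finite S"
  shows "bexp p S (\<lambda>G. real (card G)) = p * real (card S)"
  using assms
proof (induction S rule: finite_induct)
  case (insert x S)
  have "bexp p S (\<lambda>G. real (card (insert x G))) = bexp p S (\<lambda>G. real (card G) + 1)"
    using insert.hyps finite_subset by (intro bexp_cong refl) (fastforce simp: card_insert_if)
  then show ?case using insert by (simp add: bexp_insert bexp_add algebra_simps)
qed simp

text \<open>Every difference in the Efron--Stein inequality equals one.\<close>

lemma bexp_card_variance:
  assumes "finite S" "0 \<le> p" "p \<le> 1"
  shows "bexp p S (\<lambda>G. (real (card G) - p * real (card S))\<^sup>2) \<le> p * real (card S)"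
proof -
  have "bexp p S (\<lambda>G. (real (card G) - p * real (card S))\<^sup>2)
      = bexp p S (\<lambda>G. (real (card G))\<^sup>2) - (bexp p S (\<lambda>G. real (card G)))\<^sup>2"
    using bexp_variance[OF assms(1), of p "\<lambda>G. real (card G)"] bexp_card[OF assms(1)] by simp
  also have "\<dots> \<le> p * (1 - p) * (\<Sum>x\<in>S. bexp p S (\<lambda>G. (real (card (insert x G)) - real (card (G - {x})))\<^sup>2))"
    by (rule efron_stein[OF assms])
  also have "(\<Sum>x\<in>S. bexp p S (\<lambda>G. (real (card (insert x G)) - real (card (G - {x})))\<^sup>2)) = (\<Sum>x\<in>S. 1)"
  proof (intro sum.cong refl)
    fix x assume "x \<in> S"
    have "real (card (insert x G)) - real (card (G - {x})) = 1" if "G \<subseteq> S" for G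
    proof -
      have "finite G" using that assms(1) finite_subset by blast
      then have "card (insert x G) = Suc (card (G - {x}))" by (simp add: card.insert_remove)
      then show ?thesis by simp
    qed
    then have "bexp p S (\<lambda>G. (real (card (insert x G)) - real (card (G - {x})))\<^sup>2) = bexp p S (\<lambda>_. 1)"
      by (intro bexp_cong) auto
    then show "bexp p S (\<lambda>G. (real (card (insert x G)) - real (card (G - {x})))\<^sup>2) = 1"
      using assms(1) by simp
  qed
  also have "p * (1 - p) * (\<Sum>x\<in>S. 1) \<le> p * real (card S)"
    using assms by (simp add: mult_right_mono mult_left_le)
  finally show ?thesis .
qed

lemma bexp_markov:
  assumes "finite S" "0 \<le> p" "p \<le> 1" "0 < a"
    and "\<And>G. G \<subseteq> S \<Longrightarrow> 0 \<le> F G" "\<And>G. G \<subseteq> S \<Longrightarrow> A G \<Longrightarrow> a \<le> F G"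
  shows "bexp p S (\<lambda>G. of_bool (A G)) \<le> bexp p S F / a"
proof -
  have "a * bexp p S (\<lambda>G. of_bool (A G)) = bexp p S (\<lambda>G. a * of_bool (A G))"
    by (simp add: bexp_cmult)
  also have "\<dots> \<le> bexp p S F" using assms by (intro bexp_mono) auto
  finally show ?thesis using assms(4) by (simp add: field_simps)
qed

lemma bexp_abs_le:
  assumes "finite S" "0 \<le> p" "p \<le> 1" "bexp p S (\<lambda>G. (F G)\<^sup>2) \<le> v"
  shows "bexp p S (\<lambda>G. \<bar>F G\<bar>) \<le> sqrt v"
proof -
  have "(bexp p S (\<lambda>G. \<bar>F G\<bar>))\<^sup>2 \<le> v"
    using bexp_square_le[OF assms(1-3), of "\<lambda>G. \<bar>F G\<bar>"] assms(4) by simp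
  then show ?thesis by (rule real_le_rsqrt)
qed

text \<open>The maximum of the \<open>H j\<close> exceeds \<open>M\<close> by at most the sum of the absolute deviations from their
  means. What makes this useful is that for a fixed number of indices the error term is of lower
  order than \<open>M\<close>.\<close>

lemma bexp_max_le:
  assumes S: "finite S" "0 \<le> p" "p \<le> 1" and J: "finite J"
    and dom: "\<And>G. G \<subseteq> S \<Longrightarrow> \<exists>j\<in>J. F G \<le> H j G"
    and mean: "\<And>j. j \<in> J \<Longrightarrow> bexp p S (H j) \<le> M"
    and var: "\<And>j. j \<in> J \<Longrightarrow> bexp p S (\<lambda>G. (H j G - bexp p S (H j))\<^sup>2) \<le> M"
  shows "bexp p S F \<le> M + real (card J) * sqrt M"
proof -
  have "F G \<le> M + (\<Sum>j\<in>J. \<bar>H j G - bexp p S (H j)\<bar>)" if "G \<subseteq> S" for G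
  proof -
    obtain j where j: "j \<in> J" "F G \<le> H j G" using dom \<open>G \<subseteq> S\<close> by blast
    have "\<bar>H j G - bexp p S (H j)\<bar> \<le> (\<Sum>j\<in>J. \<bar>H j G - bexp p S (H j)\<bar>)"
      using j J by (intro member_le_sum) auto
    then show ?thesis using j mean[of j] by linarith
  qed
  then have "bexp p S F \<le> bexp p S (\<lambda>G. M + (\<Sum>j\<in>J. \<bar>H j G - bexp p S (H j)\<bar>))"
    using S by (intro bexp_mono) auto
  also have "\<dots> = M + (\<Sum>j\<in>J. bexp p S (\<lambda>G. \<bar>H j G - bexp p S (H j)\<bar>))"
    using S by (simp add: bexp_add bexp_sum)
  also have "\<dots> \<le> M + (\<Sum>j\<in>J. sqrt M)"
    using bexp_abs_le[OF S var] by (intro add_left_mono sum_mono) auto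
  finally show ?thesis by simp
qed

section \<open>Largest subsets with a hereditary property\<close>

definition hereditary :: "('a set \<Rightarrow> bool) \<Rightarrow> bool" where
  "hereditary Q \<longleftrightarrow> Q {} \<and> (\<forall>K L. Q K \<longrightarrow> L \<subseteq> K \<longrightarrow> Q L)"

definition largest :: "('a set \<Rightarrow> bool) \<Rightarrow> 'a set \<Rightarrow> nat" where
  "largest Q G = Max (card ` {K. K \<subseteq> G \<and> Q K})"

lemma largest_cong:
  assumes "\<And>K. K \<subseteq> G \<Longrightarrow> Q K \<longleftrightarrow> Q' K"
  shows "largest Q G = largest Q' G"
proof -
  have "{K. K \<subseteq> G \<and> Q K} = {K. K \<subseteq> G \<and> Q' K}" using assms by auto
  then show ?thesis by (simp add: largest_def)
qed

lemma largest_ge: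
  assumes "finite G" "K \<subseteq> G" "Q K"
  shows "card K \<le> largest Q G"
  unfolding largest_def using assms by (intro Max_ge) auto

lemma largest_witness:
  assumes "hereditary Q" "finite G"
  obtains K where "K \<subseteq> G" "Q K" "card K = largest Q G"
proof -
  have "finite (card ` {K. K \<subseteq> G \<and> Q K})" "card ` {K. K \<subseteq> G \<and> Q K} \<noteq> {}"
    using assms by (auto simp: hereditary_def)
  from Max_in[OF this] show ?thesis using that unfolding largest_def by auto
qed

lemma largest_le:
  assumes "hereditary Q" "finite G" "\<And>K. K \<subseteq> G \<Longrightarrow> Q K \<Longrightarrow> card K \<le> n"
  shows "largest Q G \<le> n"
  using assms largest_witness by metis

lemma largest_mono:
  assumes "hereditary Q" "finite G" "H \<subseteq> G"
  shows "largest Q H \<le> largest Q G"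
  using assms by (intro largest_le) (auto intro: finite_subset largest_ge)

lemma largest_le_card: "hereditary Q \<Longrightarrow> finite G \<Longrightarrow> largest Q G \<le> card G"
  by (intro largest_le) (auto intro: card_mono)

lemma largest_empty: "hereditary Q \<Longrightarrow> largest Q {} = 0"
  using largest_le_card[of Q "{}"] by simp

lemma largest_insert_le:
  assumes "hereditary Q" "finite G"
  shows "largest Q (insert x G) \<le> largest Q (G - {x}) + 1"
proof (rule largest_le)
  fix K assume K: "K \<subseteq> insert x G" "Q K"
  have "finite K" using K assms finite_subset by blast
  have "card (K - {x}) \<le> largest Q (G - {x})"
    using K assms by (intro largest_ge) (auto simp: hereditary_def)
  then show "card K \<le> largest Q (G - {x}) + 1" using \<open>finite K\<close>
    by (cases "x \<in> K") (auto simp: card_Diff_singleton)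
qed (use assms in auto)

text \<open>An element whose removal decreases the largest size lies in every optimal subset, and its
  removal costs only one.\<close>

lemma largest_critical:
  assumes "hereditary Q" "finite G"
  shows "(\<Sum>x\<in>G. real (largest Q G) - real (largest Q (G - {x}))) \<le> real (largest Q G)"
proof -
  obtain K where K: "K \<subseteq> G" "Q K" "card K = largest Q G" using largest_witness[OF assms] .
  have "real (largest Q G) - real (largest Q (G - {x})) \<le> of_bool (x \<in> K)" if "x \<in> G" for x
  proof (cases "x \<in> K")
    case True
    have "largest Q G = largest Q (insert x G)" using that by (simp add: insert_absorb)
    then show ?thesis using largest_insert_le[OF assms, of x] True by simp
  next
    case False
    then have "card K \<le> largest Q (G - {x})" using K assms by (intro largest_ge) auto
    then show ?thesis using K False by simp
  qed
  then have "(\<Sum>x\<in>G. real (largest Q G) - real (largest Q (G - {x}))) \<le> (\<Sum>x\<in>G. of_bool (x \<in> K))"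
    by (intro sum_mono)
  also have "\<dots> = real (card (G \<inter> K))"
    using assms(2) by (simp add: of_bool_def sum.If_cases Int_def)
  also have "G \<inter> K = K" using K by auto
  finally show ?thesis using K by simp
qed

lemma largest_image:
  assumes "inj_on h G" "\<And>K. K \<subseteq> G \<Longrightarrow> Q' (h ` K) \<longleftrightarrow> Q K"
  shows "largest Q' (h ` G) = largest Q G"
proof -
  have "{K. K \<subseteq> h ` G \<and> Q' K} = (\<lambda>K. h ` K) ` {K. K \<subseteq> G \<and> Q K}"
    using assms(2) by (auto simp: subset_image_iff)
  moreover have "card (h ` K) = card K" if "K \<subseteq> G" for K
    using that assms(1) by (intro card_image) (auto intro: inj_on_subset)
  ultimately show ?thesis unfolding largest_def
    by (intro arg_cong[where f=Max]) (auto simp: image_image image_iff; metis)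
qed

text \<open>A difference in the Efron--Stein inequality is \<open>0\<close> or \<open>1\<close>, so its square is the loss caused by
  removing \<open>x\<close>. The factor \<open>p\<close> restricts to the \<open>x\<close> that belong to the random set, and by
  \<open>largest_critical\<close> these losses add up to at most the value itself.\<close>

lemma largest_variance_le_mean:
  assumes "hereditary Q" "finite S" "0 \<le> p" "p \<le> 1"
  shows "bexp p S (\<lambda>G. (real (largest Q G) - bexp p S (\<lambda>G. real (largest Q G)))\<^sup>2)
    \<le> bexp p S (\<lambda>G. real (largest Q G))"
proof -
  define L where "L = (\<lambda>G. real (largest Q G))"
  have fin: "finite G" if "G \<subseteq> S" for G using that assms(2) finite_subset by blast
  have "bexp p S (\<lambda>G. (L G - bexp p S L)\<^sup>2) \<le> p * (1 - p) * (\<Sum>x\<in>S. bexp p S (\<lambda>G. (L (insert x G) - L (G - {x}))\<^sup>2))"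
    using efron_stein[OF assms(2-4), of L] bexp_variance[OF assms(2), of p L] by simp
  also have "\<dots> \<le> p * 1 * (\<Sum>x\<in>S. bexp p S (\<lambda>G. L (insert x (G - {x})) - L (G - {x})))"
  proof (intro mult_mono sum_mono bexp_mono)
    fix x G assume "x \<in> S" "G \<subseteq> S"
    have "L (insert x G) \<le> L (G - {x}) + 1"
      using largest_insert_le[OF assms(1) fin[OF \<open>G \<subseteq> S\<close>], of x] by (simp add: L_def)
    moreover have "L (G - {x}) \<le> L (insert x G)"
      unfolding L_def using fin[OF \<open>G \<subseteq> S\<close>] by (auto intro!: largest_mono[OF assms(1)])
    ultimately have "(L (insert x G) - L (G - {x}))\<^sup>2 \<le> L (insert x G) - L (G - {x})"
      unfolding power2_eq_square by (intro mult_left_le) auto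
    then show "(L (insert x G) - L (G - {x}))\<^sup>2 \<le> L (insert x (G - {x})) - L (G - {x})" by simp
  qed (use assms in \<open>auto intro!: sum_nonneg bexp_nonneg\<close>)
  also have "\<dots> = (\<Sum>x\<in>S. bexp p S (\<lambda>G. of_bool (x \<in> G) * (L (insert x (G - {x})) - L (G - {x}))))"
    unfolding sum_distrib_left mult_1_right
  proof (intro sum.cong refl)
    fix x assume "x \<in> S"
    from bexp_thin[OF assms(2) this, of p "\<lambda>G. L (insert x G) - L G"]
    show "p * bexp p S (\<lambda>G. L (insert x (G - {x})) - L (G - {x}))
        = bexp p S (\<lambda>G. of_bool (x \<in> G) * (L (insert x (G - {x})) - L (G - {x})))" by simp
  qed
  also have "\<dots> = bexp p S (\<lambda>G. \<Sum>x\<in>S. of_bool (x \<in> G) * (L (insert x (G - {x})) - L (G - {x})))"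
    by (simp add: bexp_sum)
  also have "\<dots> = bexp p S (\<lambda>G. \<Sum>x\<in>G. L G - L (G - {x}))"
  proof (intro bexp_cong refl)
    fix G assume "G \<subseteq> S"
    have "(\<Sum>x\<in>S. of_bool (x \<in> G) * (L (insert x (G - {x})) - L (G - {x})))
        = (\<Sum>x\<in>G. of_bool (x \<in> G) * (L (insert x (G - {x})) - L (G - {x})))"
      using assms(2) \<open>G \<subseteq> S\<close> by (intro sum.mono_neutral_right) auto
    also have "\<dots> = (\<Sum>x\<in>G. L G - L (G - {x}))"
      by (intro sum.cong) (auto simp: insert_absorb)
    finally show "(\<Sum>x\<in>S. of_bool (x \<in> G) * (L (insert x (G - {x})) - L (G - {x}))) = \<dots>" .
  qed
  also have "\<dots> \<le> bexp p S L"
    using assms fin largest_critical[OF assms(1)] unfolding L_def by (intro bexp_mono) auto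
  finally show ?thesis unfolding L_def .
qed

section \<open>Conflict-free random subsets\<close>

definition conflict_free :: "('a \<Rightarrow> 'a \<Rightarrow> bool) \<Rightarrow> 'a set \<Rightarrow> bool" where
  "conflict_free R G \<longleftrightarrow> (\<forall>x\<in>G. \<forall>y\<in>G. x \<noteq> y \<longrightarrow> \<not> R x y)"

definition conflicts :: "('a \<Rightarrow> 'a \<Rightarrow> bool) \<Rightarrow> 'a set \<Rightarrow> ('a \<times> 'a) set" where
  "conflicts R S = {(x, y) \<in> S \<times> S. x \<noteq> y \<and> R x y}"

text \<open>For every \<open>N\<close>, \<open>\<psi> N\<close> is the expectation of \<open>F\<close> at a uniformly random conflict-free \<open>N\<close>-element
  subset of \<open>S\<close>. The equation is multiplied out, so that it says nothing when there is no such
  subset.\<close>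

definition averages :: "('a \<Rightarrow> 'a \<Rightarrow> bool) \<Rightarrow> 'a set \<Rightarrow> ('a set \<Rightarrow> real) \<Rightarrow> (nat \<Rightarrow> real) \<Rightarrow> bool" where
  "averages R S F \<psi> \<longleftrightarrow> (\<forall>N. (\<Sum>G | G \<subseteq> S \<and> card G = N \<and> conflict_free R G. F G)
     = \<psi> N * real (card {G. G \<subseteq> S \<and> card G = N \<and> conflict_free R G}))"

text \<open>Union bound over the conflicting pairs, each of which is present with probability \<open>p\<^sup>2\<close>.\<close>

lemma bexp_conflict_le:
  assumes S: "finite S" "0 \<le> p" "p \<le> 1"
  shows "bexp p S (\<lambda>G. of_bool (\<not> conflict_free R G)) \<le> p\<^sup>2 * real (card (conflicts R S))"
proof -
  have fin: "finite (conflicts R S)"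
    using S(1) by (auto simp: conflicts_def intro: finite_subset[of _ "S \<times> S"])
  have "bexp p S (\<lambda>G. of_bool (\<not> conflict_free R G))
      \<le> bexp p S (\<lambda>G. \<Sum>d\<in>conflicts R S. of_bool ({fst d, snd d} \<subseteq> G))"
  proof (intro bexp_mono S)
    fix G :: "'a set" assume "G \<subseteq> S"
    show "(of_bool (\<not> conflict_free R G) :: real) \<le> (\<Sum>d\<in>conflicts R S. of_bool ({fst d, snd d} \<subseteq> G))"
    proof (cases "conflict_free R G")
      case False
      then obtain x y where xy: "x \<in> G" "y \<in> G" "x \<noteq> y" "R x y" by (auto simp: conflict_free_def)
      then have "(x, y) \<in> conflicts R S" using \<open>G \<subseteq> S\<close> by (auto simp: conflicts_def)
      then have "(of_bool ({fst (x, y), snd (x, y)} \<subseteq> G) :: real)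
          \<le> (\<Sum>d\<in>conflicts R S. of_bool ({fst d, snd d} \<subseteq> G))"
        using fin by (intro member_le_sum) auto
      then show ?thesis using False xy by simp
    qed (auto intro!: sum_nonneg)
  qed
  also have "\<dots> = (\<Sum>d\<in>conflicts R S. p ^ card {fst d, snd d})"
    unfolding bexp_sum using S(1)
    by (intro sum.cong refl bexp_prob_superset) (auto simp: conflicts_def)
  also have "\<dots> = (\<Sum>d\<in>conflicts R S. p\<^sup>2)"
    by (intro sum.cong refl arg_cong[where f="(^) p"]) (auto simp: conflicts_def)
  finally show ?thesis by (simp add: mult.commute)
qed

text \<open>Conditioned on its size \<open>N\<close> and on being conflict-free, the random set is uniform among the
  conflict-free sets of size \<open>N\<close>, because all sets of the same size have the same weight.\<close>

lemma bexp_averages: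
  assumes S: "finite S" and av: "averages R S F \<psi>"
  shows "bexp p S (\<lambda>G. of_bool (conflict_free R G) * (g (card G) * F G))
    = bexp p S (\<lambda>G. of_bool (conflict_free R G) * (g (card G) * \<psi> (card G)))"
proof -
  define W where "W = (\<lambda>N. p ^ N * (1 - p) ^ (card S - N))"
  define C where "C = (\<lambda>N. {G. G \<subseteq> S \<and> card G = N \<and> conflict_free R G})"
  have finC: "finite (C N)" for N using S by (auto simp: C_def)
  have *: "bexp p S (\<lambda>G. of_bool (conflict_free R G) * (g (card G) * F' G))
      = (\<Sum>N\<le>card S. W N * g N * (\<Sum>G\<in>C N. F' G))" for F'
  proof -
    have "bexp p S (\<lambda>G. of_bool (conflict_free R G) * (g (card G) * F' G))
      = (\<Sum>N\<le>card S. \<Sum>G | G \<in> Pow S \<and> card G = N. p ^ card G * (1 - p) ^ card (S - G) *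
           (of_bool (conflict_free R G) * (g (card G) * F' G)))"
      unfolding bexp_def using S
      by (intro sum.group[symmetric]) (auto intro: card_mono)
    also have "\<dots> = (\<Sum>N\<le>card S. \<Sum>G\<in>C N. p ^ card G * (1 - p) ^ card (S - G) *
           (of_bool (conflict_free R G) * (g (card G) * F' G)))"
      using S by (intro sum.cong refl sum.mono_neutral_right) (auto simp: C_def)
    also have "\<dots> = (\<Sum>N\<le>card S. \<Sum>G\<in>C N. W N * g N * F' G)"
      using S finite_subset[OF _ S]
      by (intro sum.cong refl) (simp add: C_def W_def card_Diff_subset)
    finally show ?thesis by (simp add: sum_distrib_left)
  qed
  have "(\<Sum>G\<in>C N. F G) = (\<Sum>G\<in>C N. \<psi> (card G))" for N
  proof -
    have "(\<Sum>G\<in>C N. \<psi> (card G)) = (\<Sum>G\<in>C N. \<psi> N)" by (intro sum.cong) (auto simp: C_def)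
    then show ?thesis using av by (simp add: averages_def C_def)
  qed
  then show ?thesis unfolding * by simp
qed

lemma bexp_card_tail:
  assumes S: "finite S" "0 \<le> p" "p \<le> 1" and l: "l = p * real (card S)" "0 < l" and d: "0 < d"
  shows "bexp p S (\<lambda>G. of_bool (d * l \<le> \<bar>real (card G) - l\<bar>)) \<le> 1 / (d\<^sup>2 * l)"
proof -
  have "bexp p S (\<lambda>G. of_bool (d * l \<le> \<bar>real (card G) - l\<bar>))
      \<le> bexp p S (\<lambda>G. (real (card G) - l)\<^sup>2) / (d * l)\<^sup>2"
  proof (intro bexp_markov S)
    fix G :: "'a set" assume "d * l \<le> \<bar>real (card G) - l\<bar>"
    then show "(d * l)\<^sup>2 \<le> (real (card G) - l)\<^sup>2" using d l
      by (metis abs_of_nonneg abs_le_square_iff less_imp_le mult_pos_pos)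
  qed (use l(2) d in auto)
  also have "\<dots> \<le> l / (d * l)\<^sup>2"
    using bexp_card_variance[OF S] l by (intro divide_right_mono) auto
  also have "\<dots> = 1 / (d\<^sup>2 * l)" using l d by (simp add: power2_eq_square)
  finally show ?thesis .
qed

lemma bexp_typical:
  assumes S: "finite S" "0 \<le> p" "p \<le> 1" and l: "l = p * real (card S)" "0 < l" and d: "0 < d"
    and "1 / (d\<^sup>2 * l) \<le> d" "p\<^sup>2 * real (card (conflicts R S)) \<le> d"
  shows "bexp p S (\<lambda>G. of_bool (conflict_free R G) * of_bool (\<bar>real (card G) - l\<bar> < d * l)) \<ge> 1 - 2 * d"
proof -
  have "1 - bexp p S (\<lambda>G. of_bool (\<not> conflict_free R G)) - bexp p S (\<lambda>G. of_bool (d * l \<le> \<bar>real (card G) - l\<bar>))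
      = bexp p S (\<lambda>G. 1 - of_bool (\<not> conflict_free R G) - of_bool (d * l \<le> \<bar>real (card G) - l\<bar>))"
    using S by (simp add: bexp_diff)
  also have "\<dots> \<le> bexp p S (\<lambda>G. of_bool (conflict_free R G) * of_bool (\<bar>real (card G) - l\<bar> < d * l))"
    using S by (intro bexp_mono) auto
  finally show ?thesis
    using bexp_card_tail[OF S l d] bexp_conflict_le[OF S, of R] assms by linarith
qed

text \<open>Concavity: the power function stays below its tangent at \<open>l\<close>.\<close>

lemma powr_le_tangent:
  fixes a l x :: real
  assumes "0 < a" "a \<le> 1" "0 < l" "0 \<le> x"
  shows "x powr a \<le> l powr a * (1 + a * (x / l - 1))"
proof (cases "x = 0")
  case False
  then have "(x / l) powr a * 1 powr (1 - a) \<le> a * (x / l) + (1 - a) * 1"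
    using assms by (intro Youngs_inequality_0) auto
  then have "x powr a / l powr a \<le> 1 + a * (x / l - 1)"
    using assms by (simp add: powr_divide algebra_simps)
  then show ?thesis using assms by (simp add: field_simps)
qed (use assms in auto)

lemma bexp_card_powr_le:
  assumes S: "finite S" "0 \<le> p" "p \<le> 1" and l: "l = p * real (card S)" "0 < l" and a: "0 < a" "a \<le> 1"
  shows "bexp p S (\<lambda>G. real (card G) powr a) \<le> l powr a"
proof -
  have "bexp p S (\<lambda>G. real (card G) powr a) \<le> bexp p S (\<lambda>G. l powr a * (1 + a * (real (card G) / l - 1)))"
    using S l a by (intro bexp_mono powr_le_tangent) auto
  also have "\<dots> = bexp p S (\<lambda>G. (l powr a * (1 - a)) + (l powr a * a / l) * real (card G))"
    by (intro bexp_cong) (auto simp: algebra_simps)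
  also have "\<dots> = l powr a" 
    using S(1) l bexp_card[OF S(1), of p] 
    by (simp only: bexp_add bexp_cmult bexp_const) (simp add: field_simps)
  finally show ?thesis .
qed

text \<open>Transfer for a quantity whose conditional mean \<open>\<theta> N\<close> given the size \<open>N\<close> is asymptotic to
  \<open>c * N powr a\<close>: the size is concentrated around \<open>l\<close>, and concavity of the power function controls
  large sizes. The admissible conflict probability \<open>\<eta>\<close> depends on an upper bound \<open>U\<close> for \<open>l\<close>, since on
  conflicting sets there is only the bound \<open>card G\<close>.\<close>

lemma bexp_mean_asymp:
  fixes \<theta> :: "nat \<Rightarrow> real"
  assumes a: "0 < a" "a \<le> 1" and c: "0 < c"
    and lim: "(\<lambda>N. \<theta> N / real N powr a) \<longlonglongrightarrow> c"
    and bnd: "\<And>N. 0 \<le> \<theta> N \<and> \<theta> N \<le> real N"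
    and \<epsilon>: "0 < \<epsilon>"
  shows "\<exists>l0>0. \<forall>U. \<exists>\<eta>>0. \<forall>(S :: 'a set) p l R F. finite S \<longrightarrow> 0 \<le> p \<longrightarrow> p \<le> 1 \<longrightarrow>
    l = p * real (card S) \<longrightarrow> l0 \<le> l \<longrightarrow> l \<le> U \<longrightarrow> p\<^sup>2 * real (card (conflicts R S)) \<le> \<eta> \<longrightarrow>
    averages R S F \<theta> \<longrightarrow> (\<forall>G\<subseteq>S. 0 \<le> F G \<and> F G \<le> real (card G)) \<longrightarrow>
    \<bar>bexp p S F - c * l powr a\<bar> \<le> \<epsilon> * l powr a"
proof -
  define d where "d = Min {\<epsilon> / 2, \<epsilon> / (1 + 3 * c), c / 2, 1 / 4}"
  have d: "0 < d" "d \<le> \<epsilon> / 2" "d \<le> \<epsilon> / (1 + 3 * c)" "d \<le> c / 2" "d \<le> 1 / 4"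
  proof -
    show "0 < d" using c \<epsilon> by (simp add: d_def)
    have "d \<le> x" if "x \<in> {\<epsilon> / 2, \<epsilon> / (1 + 3 * c), c / 2, 1 / 4}" for x
      unfolding d_def using that by (intro Min_le) simp_all
    then show "d \<le> \<epsilon> / 2" "d \<le> \<epsilon> / (1 + 3 * c)" "d \<le> c / 2" "d \<le> 1 / 4" by blast+
  qed
  have d2: "d * (1 + 3 * c) \<le> \<epsilon>" using d(3) c by (simp add: field_simps)
  have "eventually (\<lambda>N. \<bar>\<theta> N / real N powr a - c\<bar> < d) sequentially"
    using tendstoD[OF lim d(1)] by (simp add: dist_real_def)
  then obtain M where M: "\<And>N. N \<ge> M \<Longrightarrow> \<bar>\<theta> N / real N powr a - c\<bar> < d"
    by (auto simp: eventually_sequentially)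
  define N0 where "N0 = max M 1"
  have N0: "\<And>N. N \<ge> N0 \<Longrightarrow> \<bar>\<theta> N / real N powr a - c\<bar> < d" "N0 \<ge> 1"
    using M by (auto simp: N0_def)
  have up: "\<theta> N \<le> (c + d) * real N powr a + real N0" for N
  proof (cases "N \<ge> N0")
    case True
    then show ?thesis using N0(1)[of N] N0(2) by (simp add: abs_less_iff field_simps)
  next
    case False
    have "0 \<le> (c + d) * real N powr a" using c d by simp
    then show ?thesis using bnd[of N] False by linarith
  qed
  have low: "(c - d) * real N powr a \<le> \<theta> N" if "N \<ge> N0" for N
    using N0(1)[OF that] N0(2) that by (simp add: abs_less_iff field_simps)
  define l0 where "l0 = Max {1, 1 / d ^ 3, 2 * real N0, ((real N0 + 1) / d) powr (1 / a)}"
  have l0: "1 \<le> l0" "1 / d ^ 3 \<le> l0" "2 * real N0 \<le> l0" "((real N0 + 1) / d) powr (1 / a) \<le> l0"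
    by (auto simp: l0_def)
  have l0pos: "0 < l0" using l0 by linarith
  show ?thesis
  proof (rule exI[of _ l0], rule conjI[OF l0pos], rule allI)
    fix U :: real
    \<comment> \<open>\<open>1 / t\<close> bounds the second moment \<open>l\<^sup>2 + l\<close> of the number of elements.\<close>
    define t where "t = 1 / (\<bar>U\<bar>\<^sup>2 + \<bar>U\<bar> + 1)"
    have t: "0 < t" by (auto simp: t_def intro: add_nonneg_pos)
    show "\<exists>\<eta>>0. \<forall>(S :: 'a set) p l R F. finite S \<longrightarrow> 0 \<le> p \<longrightarrow> p \<le> 1 \<longrightarrow>
      l = p * real (card S) \<longrightarrow> l0 \<le> l \<longrightarrow> l \<le> U \<longrightarrow> p\<^sup>2 * real (card (conflicts R S)) \<le> \<eta> \<longrightarrow>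
      averages R S F \<theta> \<longrightarrow> (\<forall>G\<subseteq>S. 0 \<le> F G \<and> F G \<le> real (card G)) \<longrightarrow>
      \<bar>bexp p S F - c * l powr a\<bar> \<le> \<epsilon> * l powr a"
    proof (intro exI[of _ "min d t"] conjI allI impI)
      show "0 < min d t" using d t by simp
    next
      fix S :: "'a set" and p l :: real and R F
      assume S: "finite S" "0 \<le> p" "p \<le> 1" and l: "l = p * real (card S)" and ll: "l0 \<le> l" "l \<le> U"
        and conf: "p\<^sup>2 * real (card (conflicts R S)) \<le> min d t"
        and av: "averages R S F \<theta>" and F: "\<forall>G\<subseteq>S. 0 \<le> F G \<and> F G \<le> real (card G)"
      have lpos: "0 < l" "1 \<le> l" using l0 ll by auto
      have X: "(real N0 + 1) / d \<le> l powr a"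
      proof -
        have "(((real N0 + 1) / d) powr (1 / a)) powr a \<le> l powr a"
          using l0 ll a by (intro powr_mono2) auto
        then show ?thesis using a d by (simp add: powr_powr)
      qed
      have split: "bexp p S F = bexp p S (\<lambda>G. of_bool (conflict_free R G) * (1 * F G))
          + bexp p S (\<lambda>G. of_bool (\<not> conflict_free R G) * F G)"
        unfolding bexp_add[symmetric] by (intro bexp_cong) auto
      have main: "bexp p S (\<lambda>G. of_bool (conflict_free R G) * (1 * F G))
          = bexp p S (\<lambda>G. of_bool (conflict_free R G) * (1 * \<theta> (card G)))"
        by (rule bexp_averages[OF S(1) av])
      have "bexp p S (\<lambda>G. of_bool (conflict_free R G) * (1 * \<theta> (card G)))
          \<le> bexp p S (\<lambda>G. (c + d) * real (card G) powr a + real N0)"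
        using S up bnd c d by (intro bexp_mono) (auto simp: intro!: add_nonneg_nonneg)
      also have "\<dots> \<le> (c + d) * l powr a + real N0"
        using bexp_card_powr_le[OF S l lpos(1) a] S(1) c d by (simp add: bexp_add bexp_cmult)
      finally have u1: "bexp p S (\<lambda>G. of_bool (conflict_free R G) * (1 * F G)) \<le> (c + d) * l powr a + real N0"
        using main by simp
      \<comment> \<open>\<open>card G\<close> is at most \<open>t / 2 * (card G)\<^sup>2 + 1 / (2 * t)\<close>, and the second term is needed only on conflicting
        sets, whose probability is at most \<open>t\<close>.\<close>
      have u2: "bexp p S (\<lambda>G. of_bool (\<not> conflict_free R G) * F G) \<le> 1"
      proof -
        have "bexp p S (\<lambda>G. of_bool (\<not> conflict_free R G) * F G)
          \<le> bexp p S (\<lambda>G. (t / 2) * (real (card G))\<^sup>2 + (1 / (2 * t)) * of_bool (\<not> conflict_free R G))"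
        proof (intro bexp_mono S)
          fix G :: "'a set" assume G: "G \<subseteq> S"
          have "0 \<le> (t * real (card G) - 1)\<^sup>2 / (2 * t)" using t by simp
          also have "\<dots> = (t / 2) * (real (card G))\<^sup>2 + 1 / (2 * t) - real (card G)"
            using t by (simp add: power2_eq_square field_simps)
          finally have "real (card G) \<le> (t / 2) * (real (card G))\<^sup>2 + 1 / (2 * t)" by simp
          moreover have "0 \<le> (t / 2) * (real (card G))\<^sup>2" using t by simp
          ultimately show "of_bool (\<not> conflict_free R G) * F G
            \<le> (t / 2) * (real (card G))\<^sup>2 + (1 / (2 * t)) * of_bool (\<not> conflict_free R G)"
            using F G by (auto intro: order_trans)
        qed
        also have "\<dots> = (t / 2) * bexp p S (\<lambda>G. (real (card G))\<^sup>2) + (1 / (2 * t)) * bexp p S (\<lambda>G. of_bool (\<not> conflict_free R G))"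
          by (simp only: bexp_add bexp_cmult)
        also have "\<dots> \<le> (t / 2) * (1 / t) + (1 / (2 * t)) * t"
        proof (intro add_mono mult_left_mono)
          have "bexp p S (\<lambda>G. (real (card G))\<^sup>2) \<le> l\<^sup>2 + l"
            using bexp_card_variance[OF S] bexp_variance[OF S(1), of p "\<lambda>G. real (card G)"]
              bexp_card[OF S(1)] l by simp
          also have "\<dots> \<le> \<bar>U\<bar>\<^sup>2 + \<bar>U\<bar> + 1"
          proof -
            have "l\<^sup>2 \<le> \<bar>U\<bar>\<^sup>2" using ll lpos by (intro power_mono) auto
            then show ?thesis using ll by linarith
          qed
          finally show "bexp p S (\<lambda>G. (real (card G))\<^sup>2) \<le> 1 / t" by (simp add: t_def)
          show "bexp p S (\<lambda>G. of_bool (\<not> conflict_free R G)) \<le> t"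
            using bexp_conflict_le[OF S, of R] conf by simp
        qed (use t in auto)
        finally show ?thesis using t by simp
      qed
      have upper: "bexp p S F \<le> (c + \<epsilon>) * l powr a"
      proof -
        have "bexp p S F \<le> (c + d) * l powr a + (real N0 + 1)" using split u1 u2 by simp
        also have "real N0 + 1 \<le> d * l powr a" using X d by (simp add: field_simps)
        finally have "bexp p S F \<le> (c + 2 * d) * l powr a" by (simp add: algebra_simps)
        also have "\<dots> \<le> (c + \<epsilon>) * l powr a" using d by (intro mult_right_mono) auto
        finally show ?thesis .
      qed
      have lower: "(c - \<epsilon>) * l powr a \<le> bexp p S F"
      proof -
        define q where "q = (c - d) * ((1 - d) * l powr a)"
        have q0: "0 \<le> q" using d c by (simp add: q_def)
        have "(c - \<epsilon>) * l powr a \<le> (c - d * (1 + 3 * c)) * l powr a"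
          using d2 by (intro mult_right_mono) auto
        also have "\<dots> \<le> (c - d) * (1 - d) * (1 - 2 * d) * l powr a"
        proof (intro mult_right_mono)
          have "(1 - 3 * d) \<le> (1 - d) * (1 - 2 * d)" by (simp add: algebra_simps)
          then have "(c - d) * (1 - 3 * d) \<le> (c - d) * ((1 - d) * (1 - 2 * d))"
            using d c by (intro mult_left_mono) auto
          moreover have "c - d * (1 + 3 * c) \<le> (c - d) * (1 - 3 * d)" by (simp add: algebra_simps)
          ultimately show "c - d * (1 + 3 * c) \<le> (c - d) * (1 - d) * (1 - 2 * d)" by (simp add: mult.assoc)
        qed auto
        also have "\<dots> = q * (1 - 2 * d)" by (simp add: q_def algebra_simps)
        also have "\<dots> \<le> q * bexp p S (\<lambda>G. of_bool (conflict_free R G) * of_bool (\<bar>real (card G) - l\<bar> < d * l))"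
        proof (intro mult_left_mono bexp_typical S l lpos d q0)
          show "1 / (d\<^sup>2 * l) \<le> d"
          proof -
            have "1 / d ^ 3 \<le> l" using l0(2) ll by simp
            then show ?thesis using d(1) lpos by (simp add: field_simps power_numeral_reduce)
          qed
          show "p\<^sup>2 * real (card (conflicts R S)) \<le> d" using conf by simp
        qed
        also have "\<dots> = bexp p S (\<lambda>G. q * (of_bool (conflict_free R G) * of_bool (\<bar>real (card G) - l\<bar> < d * l)))"
          by (simp add: bexp_cmult)
        also have "\<dots> \<le> bexp p S (\<lambda>G. of_bool (conflict_free R G) * (1 * \<theta> (card G)))"
        proof (intro bexp_mono S)
          fix G :: "'a set"
          have "q \<le> \<theta> (card G)" if "\<bar>real (card G) - l\<bar> < d * l"
          proof -
            have g: "(1 - d) * l \<le> real (card G)" using that by (simp add: abs_less_iff algebra_simps)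
            have "1 / 2 * l \<le> (1 - d) * l" using d lpos by (intro mult_right_mono) auto
            then have "real N0 \<le> real (card G)" using g l0 ll by linarith
            then have "card G \<ge> N0" by simp
            have "(1 - d) * l powr a \<le> (1 - d) powr a * l powr a"
            proof (intro mult_right_mono)
              have "(1 - d) powr 1 \<le> (1 - d) powr a" using d a by (intro powr_mono') auto
              then show "1 - d \<le> (1 - d) powr a" using d by simp
            qed auto
            also have "\<dots> = ((1 - d) * l) powr a" using d lpos by (simp add: powr_mult)
            also have "\<dots> \<le> real (card G) powr a" using g d lpos a by (intro powr_mono2) auto
            finally have "q \<le> (c - d) * real (card G) powr a"
              unfolding q_def using d c by (intro mult_left_mono) auto
            then show ?thesis using low[OF \<open>card G \<ge> N0\<close>] by simp
          qed
          then show "q * (of_bool (conflict_free R G) * of_bool (\<bar>real (card G) - l\<bar> < d * l))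
              \<le> of_bool (conflict_free R G) * (1 * \<theta> (card G))" using bnd by auto
        qed
        also have "\<dots> \<le> bexp p S F"
          using main split F S by (simp add: bexp_nonneg)
        finally show ?thesis .
      qed
      show "\<bar>bexp p S F - c * l powr a\<bar> \<le> \<epsilon> * l powr a"
        using upper lower by (simp add: abs_le_iff algebra_simps)
    qed
  qed
qed

text \<open>Transfer from convergence in probability. This alone would not determine the mean; the assumption
  that the variance is at most the mean does, since a mean \<open>E\<close> at distance \<open>D\<close> from values taken with
  probability at least \<open>1 / 4\<close> forces \<open>D\<^sup>2 / 4 \<le> E\<close>, which for large \<open>l\<close> is impossible unless \<open>D\<close> is
  small compared with \<open>l powr a\<close>.\<close>

lemma bexp_prob_asymp:
  fixes \<psi> :: "real \<Rightarrow> nat \<Rightarrow> real"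
  assumes a: "0 < a" "a \<le> 1" and b: "0 < b"
    and lim: "\<And>\<delta>. 0 < \<delta> \<Longrightarrow> \<psi> \<delta> \<longlonglongrightarrow> 1"
    and \<epsilon>: "0 < \<epsilon>"
  shows "\<exists>l0>0. \<exists>\<eta>>0. \<exists>\<delta>>0. \<forall>(S :: 'a set) p l R F. finite S \<longrightarrow> 0 \<le> p \<longrightarrow> p \<le> 1 \<longrightarrow>
    l = p * real (card S) \<longrightarrow> l0 \<le> l \<longrightarrow> p\<^sup>2 * real (card (conflicts R S)) \<le> \<eta> \<longrightarrow>
    averages R S (\<lambda>G. of_bool (\<bar>F G / real (card G) powr a - b\<bar> < \<delta>)) (\<psi> \<delta>) \<longrightarrow>
    bexp p S (\<lambda>G. (F G - bexp p S F)\<^sup>2) \<le> bexp p S F \<longrightarrow>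
    \<bar>bexp p S F - b * l powr a\<bar> \<le> \<epsilon> * l powr a"
proof -
  define d where "d = Min {\<epsilon> / (2 * (2 * b + 2)), b / 2, 1 / 4}"
  have d: "0 < d" "d \<le> \<epsilon> / (2 * (2 * b + 2))" "d \<le> b / 2" "d \<le> 1 / 4"
  proof -
    show "0 < d" using b \<epsilon> by (simp add: d_def)
    have "d \<le> x" if "x \<in> {\<epsilon> / (2 * (2 * b + 2)), b / 2, 1 / 4}" for x
      unfolding d_def using that by (intro Min_le) simp_all
    then show "d \<le> \<epsilon> / (2 * (2 * b + 2))" "d \<le> b / 2" "d \<le> 1 / 4" by blast+
  qed
  have d2: "d * (2 * b + 2) \<le> \<epsilon> / 2" using d(2) b by (simp add: field_simps)
  have ev: "eventually (\<lambda>N. \<bar>\<psi> d N - 1\<bar> < 1/2) sequentially"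
    using tendstoD[OF lim[OF d(1)], of "1/2"] by (simp add: dist_real_def)
  then obtain M where M: "\<And>N. N \<ge> M \<Longrightarrow> \<bar>\<psi> d N - 1\<bar> < 1/2"
    unfolding eventually_sequentially by blast
  define N0 where "N0 = max M 1"
  have N0: "\<psi> d N \<ge> 1/2" if "N \<ge> N0" for N
  proof -
    have "\<bar>\<psi> d N - 1\<bar> < 1/2" using that by (intro M) (simp add: N0_def)
    then show ?thesis by linarith
  qed
  define t where "t = \<epsilon> / (8 * (b + \<epsilon>))"
  have t: "0 < t" "t < 1" "t * b \<le> \<epsilon> / 8" "t * (b + \<epsilon>) \<le> \<epsilon> / 8" using b \<epsilon> by (auto simp: t_def field_simps)
  define l0 where "l0 = Max {1, 1 / d ^ 3, 2 * real N0, (8 / (3 * t * \<epsilon>)) powr (1 / a)}"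
  have l0: "1 \<le> l0" "1 / d ^ 3 \<le> l0" "2 * real N0 \<le> l0" "(8 / (3 * t * \<epsilon>)) powr (1 / a) \<le> l0"
    by (auto simp: l0_def)
  have l0pos: "0 < l0" using l0 by linarith
  show ?thesis
  proof (rule exI[of _ l0], rule conjI[OF l0pos], rule exI[of _ d], rule conjI[OF d(1)],
      rule exI[of _ d], rule conjI[OF d(1)], intro allI impI)
    fix S :: "'a set" and p l :: real and R F
    assume S: "finite S" "0 \<le> p" "p \<le> 1" and l: "l = p * real (card S)" and ll: "l0 \<le> l"
      and conf: "p\<^sup>2 * real (card (conflicts R S)) \<le> d"
      and av: "averages R S (\<lambda>G. of_bool (\<bar>F G / real (card G) powr a - b\<bar> < d)) (\<psi> d)"
      and var: "bexp p S (\<lambda>G. (F G - bexp p S F)\<^sup>2) \<le> bexp p S F"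
    have lpos: "0 < l" "1 \<le> l" using l0 ll by auto
    define E where "E = bexp p S F"
    have E0: "0 \<le> E"
      using var bexp_nonneg[OF S(2,3), of S "\<lambda>G. (F G - bexp p S F)\<^sup>2"] by (simp add: E_def)
    define X where "X = l powr a"
    have X: "8 / (3 * t * \<epsilon>) \<le> X" "0 < X"
    proof -
      have "((8 / (3 * t * \<epsilon>)) powr (1 / a)) powr a \<le> l powr a"
        using l0 ll a by (intro powr_mono2) auto
      then show "8 / (3 * t * \<epsilon>) \<le> X" using a t \<epsilon> by (simp add: powr_powr X_def)
    qed (use lpos in \<open>auto simp: X_def\<close>)
    have X1: "1 / t \<le> 3 / 8 * \<epsilon> * X" using X t \<epsilon> by (simp add: field_simps)
    \<comment> \<open>Typical outcomes, of probability at least a quarter, put \<open>F\<close> in a short interval; if the mean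
      were far from it, the variance would exceed the mean.\<close>
    have key: "D \<le> t * E + 1 / t"
      if D: "0 \<le> D" and far: "\<And>x. (b - \<epsilon> / 2) * X \<le> x \<Longrightarrow> x \<le> (b + \<epsilon> / 2) * X \<Longrightarrow> D \<le> \<bar>x - E\<bar>" for D
    proof -
      define g where "g = (\<lambda>N. of_bool (\<bar>real N - l\<bar> < d * l) :: real)"
      have "D\<^sup>2 * (1 / 4) \<le> D\<^sup>2 * ((1 - 2 * d) / 2)" using d by (intro mult_left_mono) auto
      also have "\<dots> \<le> D\<^sup>2 * (bexp p S (\<lambda>G. of_bool (conflict_free R G) * g (card G)) / 2)"
        unfolding g_def
      proof (intro mult_left_mono divide_right_mono bexp_typical S l lpos d)
        show "1 / (d\<^sup>2 * l) \<le> d"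
          proof -
            have "1 / d ^ 3 \<le> l" using l0(2) ll by simp
            then show ?thesis using d(1) lpos by (simp add: field_simps power_numeral_reduce)
          qed
        show "p\<^sup>2 * real (card (conflicts R S)) \<le> d" using conf by simp
      qed auto
      also have "\<dots> = D\<^sup>2 * bexp p S (\<lambda>G. (1 / 2) * (of_bool (conflict_free R G) * g (card G)))"
        by (simp only: bexp_cmult)
      also have "\<dots> \<le> D\<^sup>2 * bexp p S (\<lambda>G. of_bool (conflict_free R G) * (g (card G) * \<psi> d (card G)))"
      proof (intro mult_left_mono bexp_mono S)
        fix G :: "'a set"
        have "\<psi> d (card G) \<ge> 1 / 2" if "\<bar>real (card G) - l\<bar> < d * l"
        proof -
          have g: "(1 - d) * l \<le> real (card G)" using that by (simp add: abs_less_iff algebra_simps)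
          have "1 / 2 * l \<le> (1 - d) * l" using d lpos by (intro mult_right_mono) auto
          then have "real N0 \<le> real (card G)" using g l0 ll by linarith
          then show ?thesis by (intro N0) simp
        qed
        then show "1 / 2 * (of_bool (conflict_free R G) * g (card G))
            \<le> of_bool (conflict_free R G) * (g (card G) * \<psi> d (card G))" by (auto simp: g_def)
      qed auto
      also have "\<dots> = D\<^sup>2 * bexp p S (\<lambda>G. of_bool (conflict_free R G) *
          (g (card G) * of_bool (\<bar>F G / real (card G) powr a - b\<bar> < d)))"
        using bexp_averages[OF S(1) av, of p g] by simp
      also have "\<dots> \<le> bexp p S (\<lambda>G. (F G - E)\<^sup>2)"
        unfolding bexp_cmult[symmetric]
      proof (intro bexp_mono S)
        fix G :: "'a set"
        have "D\<^sup>2 \<le> (F G - E)\<^sup>2" if N: "\<bar>real (card G) - l\<bar> < d * l" and Fb: "\<bar>F G / real (card G) powr a - b\<bar> < d"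
        proof -
          define n where "n = real (card G)"
          have n: "(1 - d) * l \<le> n" "n \<le> (1 + d) * l"
            using N by (auto simp: n_def abs_less_iff algebra_simps)
          have "0 < (1 - d) * l" using d lpos by (intro mult_pos_pos) auto
          then have npos: "0 < n" using n(1) by linarith
          have "(1 - d) * X \<le> (1 - d) powr a * l powr a"
            unfolding X_def
          proof (intro mult_right_mono)
            have "(1 - d) powr 1 \<le> (1 - d) powr a" using d a by (intro powr_mono') auto
            then show "1 - d \<le> (1 - d) powr a" using d by simp
          qed auto
          also have "\<dots> = ((1 - d) * l) powr a" using d lpos by (simp add: powr_mult)
          also have "\<dots> \<le> n powr a" using n d lpos a by (intro powr_mono2) auto
          finally have nlo: "(1 - d) * X \<le> n powr a" .
          have "n powr a \<le> ((1 + d) * l) powr a" using n npos a by (intro powr_mono2) auto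
          also have "\<dots> = (1 + d) powr a * l powr a" using d lpos by (simp add: powr_mult)
          also have "\<dots> \<le> (1 + d) * X"
            unfolding X_def
          proof (intro mult_right_mono)
            have "(1 + d) powr a \<le> (1 + d) powr 1" using d a by (intro powr_mono) auto
            then show "(1 + d) powr a \<le> 1 + d" using d by simp
          qed auto
          finally have nhi: "n powr a \<le> (1 + d) * X" .
          have na: "0 < n powr a" using npos by simp
          have FG: "(b - d) * n powr a \<le> F G" "F G \<le> (b + d) * n powr a"
            using Fb na unfolding n_def[symmetric] by (auto simp: abs_less_iff field_simps)
          have "(b - \<epsilon> / 2) * X \<le> (b - d) * (1 - d) * X"
          proof (intro mult_right_mono)
            have "(b - d) * (1 - d) = b - d * (1 + b) + d * d" by (simp add: algebra_simps)
            moreover have "d * (1 + b) \<le> d * (2 * b + 2)" using d b by (intro mult_left_mono) auto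
            ultimately show "b - \<epsilon> / 2 \<le> (b - d) * (1 - d)" using d2 by (smt (verit) zero_le_square)
          qed (use X in auto)
          also have "\<dots> \<le> (b - d) * n powr a" using nlo d b by (simp add: mult.assoc mult_left_mono)
          finally have lo: "(b - \<epsilon> / 2) * X \<le> F G" using FG by simp
          have "(b + d) * n powr a \<le> (b + d) * ((1 + d) * X)" using nhi d b by (intro mult_left_mono) auto
          also have "\<dots> \<le> (b + \<epsilon> / 2) * X"
            unfolding mult.assoc[symmetric]
          proof (intro mult_right_mono)
            have "d * d \<le> d * 1" using d by (intro mult_left_mono) auto
            moreover have "d * b \<ge> 0" using d b by simp
            moreover have "(b + d) * (1 + d) = b + d * (1 + b) + d * d" by (simp add: algebra_simps)
            ultimately show "(b + d) * (1 + d) \<le> b + \<epsilon> / 2" using d2 by (simp add: algebra_simps)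
          qed (use X in auto)
          finally have "F G \<le> (b + \<epsilon> / 2) * X" using FG by simp
          then have "D \<le> \<bar>F G - E\<bar>" using far lo by blast
          then have "D\<^sup>2 \<le> \<bar>F G - E\<bar>\<^sup>2" using D by (intro power_mono) auto
          then show ?thesis by simp
        qed
        then show "D\<^sup>2 * (of_bool (conflict_free R G) * (g (card G) * of_bool (\<bar>F G / real (card G) powr a - b\<bar> < d)))
          \<le> (F G - E)\<^sup>2" by (auto simp: g_def)
      qed
      also have "\<dots> \<le> E" using var by (simp add: E_def)
      finally have "D\<^sup>2 \<le> 4 * E" by simp
      also have "\<dots> \<le> (t * E + 1 / t)\<^sup>2"
      proof -
        have "(t * E + 1 / t)\<^sup>2 - 4 * E = (t * E - 1 / t)\<^sup>2" using t by (simp add: power2_eq_square field_simps)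
        moreover have "0 \<le> (t * E - 1 / t)\<^sup>2" by simp
        ultimately show ?thesis by linarith
      qed
      finally have sq: "D\<^sup>2 \<le> (t * E + 1 / t)\<^sup>2" .
      have "0 \<le> t * E + 1 / t" using t E0 by simp
      with sq show ?thesis by (rule power2_le_imp_le)
    qed
    have upper: "E \<le> (b + \<epsilon>) * X"
    proof (rule ccontr)
      assume "\<not> E \<le> (b + \<epsilon>) * X"
      then have big: "(b + \<epsilon>) * X < E" by simp
      have e: "(b + \<epsilon> / 2) * X \<le> (b + \<epsilon>) * X" using \<epsilon> X by (intro mult_right_mono) auto
      have "E - (b + \<epsilon> / 2) * X \<le> t * E + 1 / t"
        using big e by (intro key) auto
      then have 1: "(1 - t) * E \<le> (b + \<epsilon> / 2) * X + 3 / 8 * \<epsilon> * X" using X1 by (simp add: algebra_simps)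
      have "(b + \<epsilon> - \<epsilon> / 8) * X \<le> ((1 - t) * (b + \<epsilon>)) * X"
        using t(4) X by (intro mult_right_mono) (auto simp: algebra_simps)
      also have "\<dots> < (1 - t) * E" using big t by (simp add: mult.assoc)
      finally show False using 1 by (simp add: algebra_simps)
    qed
    have lower: "(b - \<epsilon>) * X \<le> E"
    proof (rule ccontr)
      assume "\<not> (b - \<epsilon>) * X \<le> E"
      then have small: "E < (b - \<epsilon>) * X" by simp
      have e: "(b - \<epsilon>) * X \<le> (b - \<epsilon> / 2) * X" using \<epsilon> X by (intro mult_right_mono) auto
      have "(b - \<epsilon> / 2) * X - E \<le> t * E + 1 / t"
        using small e by (intro key) auto
      then have 1: "(b - \<epsilon> / 2) * X \<le> (1 + t) * E + 3 / 8 * \<epsilon> * X" using X1 by (simp add: algebra_simps)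
      have "(1 + t) * E < (1 + t) * ((b - \<epsilon>) * X)" using small t by (intro mult_strict_left_mono) auto
      also have "\<dots> = (b - \<epsilon> + t * b - t * \<epsilon>) * X" by (simp add: algebra_simps)
      also have "\<dots> \<le> (b - \<epsilon> + \<epsilon> / 8) * X"
      proof (intro mult_right_mono)
        have "0 \<le> t * \<epsilon>" using t \<epsilon> by simp
        then show "b - \<epsilon> + t * b - t * \<epsilon> \<le> b - \<epsilon> + \<epsilon> / 8" using t(3) by linarith
      qed (use X in auto)
      finally show False using 1 by (simp add: algebra_simps)
    qed
    show "\<bar>bexp p S F - b * l powr a\<bar> \<le> \<epsilon> * l powr a"
      using upper lower unfolding E_def X_def by (simp add: abs_le_iff algebra_simps)
  qed
qed

section \<open>Chains and renewal\<close>

definition chain :: "('a \<Rightarrow> 'a \<Rightarrow> bool) \<Rightarrow> 'a set \<Rightarrow> bool" where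
  "chain R K \<longleftrightarrow> (\<forall>x\<in>K. \<forall>y\<in>K. x \<noteq> y \<longrightarrow> R x y \<or> R y x)"

lemma hereditary_chain: "hereditary (chain R)"
  unfolding hereditary_def chain_def by (meson empty_iff subsetD)

lemma telescope:
  fixes F :: "nat \<Rightarrow> real"
  shows "(\<Sum>s=1..t. F s - F (s - 1)) = F t - F 0"
proof (induction t)
  case (Suc t)
  then show ?case by (subst sum.cl_ivl_Suc) simp
qed simp

lemma abel_sum:
  fixes F :: "nat \<Rightarrow> real"
  assumes "F 0 = 0"
  shows "(\<Sum>s=1..t. (F s - F (s - 1)) * (real t - real s)) = (\<Sum>u<t. F u)"
proof (induction t)
  case (Suc t)
  have "(\<Sum>s=1..Suc t. (F s - F (s - 1)) * (real (Suc t) - real s))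
      = (\<Sum>s=1..t. (F s - F (s - 1)) * (real t - real s) + (F s - F (s - 1)))"
  proof -
    have "(\<Sum>s=1..Suc t. (F s - F (s - 1)) * (real (Suc t) - real s))
        = (\<Sum>s=1..t. (F s - F (s - 1)) * (real (Suc t) - real s))"
      by (subst sum.cl_ivl_Suc) simp
    also have "\<dots> = (\<Sum>s=1..t. (F s - F (s - 1)) * (real t - real s) + (F s - F (s - 1)))"
      by (intro sum.cong refl) (simp add: algebra_simps)
    finally show ?thesis .
  qed
  also have "\<dots> = (\<Sum>s=1..t. (F s - F (s - 1)) * (real t - real s)) + (F t - F 0)"
    by (simp only: sum.distrib telescope)
  finally show ?case using Suc assms by simp
qed simp

text \<open>Random chains that regenerate: the elements above \<open>z\<close> look like a copy of the whole order, moved by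
  \<open>\<sigma> z\<close> levels. The two instances are edges ordered by \<open>before\<close>, at the level of their last vertex,
  and points ordered coordinatewise, at the level of their coordinate sum.\<close>

locale renewal =
  fixes S :: "'a set" and \<sigma> :: "'a \<Rightarrow> nat" and prec :: "'a \<Rightarrow> 'a \<Rightarrow> bool" and sh :: "'a \<Rightarrow> 'a \<Rightarrow> 'a"
  assumes fin: "finite {x \<in> S. \<sigma> x \<le> t}"
    and pos: "x \<in> S \<Longrightarrow> 0 < \<sigma> x"
    and trans: "\<lbrakk>x \<in> S; y \<in> S; z \<in> S; prec x y; prec y z\<rbrakk> \<Longrightarrow> prec x z"
    and sh_bij: "z \<in> S \<Longrightarrow> bij_betw (sh z) S {x \<in> S. prec z x}"
    and sh_rank: "\<lbrakk>z \<in> S; x \<in> S\<rbrakk> \<Longrightarrow> \<sigma> (sh z x) = \<sigma> z + \<sigma> x"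
    and sh_prec: "\<lbrakk>z \<in> S; x \<in> S; y \<in> S\<rbrakk> \<Longrightarrow> prec (sh z x) (sh z y) \<longleftrightarrow> prec x y"
begin

definition ini :: "nat \<Rightarrow> 'a set" where "ini t = {x \<in> S. \<sigma> x \<le> t}"
definition up :: "'a \<Rightarrow> 'a set" where "up z = {x \<in> S. prec z x}"
abbreviation height :: "'a set \<Rightarrow> nat" where "height \<equiv> largest (chain prec)"
definition reach :: "real \<Rightarrow> nat \<Rightarrow> nat \<Rightarrow> real" where
  "reach p k u = bexp p (ini u) (\<lambda>G. of_bool (k \<le> height G))"
definition mean_height :: "real \<Rightarrow> nat \<Rightarrow> real" where
  "mean_height p t = bexp p (ini t) (\<lambda>G. real (height G))"

lemma ini_fin: "finite (ini t)" using fin by (simp add: ini_def)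
lemma ini_sub: "ini t \<subseteq> S" by (auto simp: ini_def)
lemma ini_mono: "s \<le> t \<Longrightarrow> ini s \<subseteq> ini t" by (auto simp: ini_def)
lemma ini_0: "ini 0 = {}" using pos by (fastforce simp: ini_def)
lemma fin_sub: "G \<subseteq> ini t \<Longrightarrow> finite G" using ini_fin finite_subset by blast

lemma up_rank:
  assumes "z \<in> S" "x \<in> S" "prec z x"
  shows "\<sigma> z < \<sigma> x"
proof -
  have "x \<in> sh z ` S" using sh_bij[OF assms(1)] assms by (auto simp: bij_betw_def)
  then obtain y where "y \<in> S" "x = sh z y" by auto
  then show ?thesis using sh_rank[OF assms(1)] pos by simp
qed

lemma up_shift:
  assumes "z \<in> S" "\<sigma> z \<le> t"
  shows "sh z ` ini (t - \<sigma> z) = ini t \<inter> up z"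
proof -
  have im: "sh z ` S = up z" and inj: "inj_on (sh z) S"
    using sh_bij[OF assms(1)] by (auto simp: bij_betw_def up_def)
  show ?thesis
  proof (intro equalityI subsetI)
    fix x assume "x \<in> sh z ` ini (t - \<sigma> z)"
    then obtain y where y: "y \<in> S" "\<sigma> y \<le> t - \<sigma> z" "x = sh z y" by (auto simp: ini_def)
    then show "x \<in> ini t \<inter> up z"
      using im sh_rank[OF assms(1) y(1)] assms by (auto simp: ini_def up_def)
  next
    fix x assume x: "x \<in> ini t \<inter> up z"
    then obtain y where y: "y \<in> S" "x = sh z y" using im by auto
    then show "x \<in> sh z ` ini (t - \<sigma> z)"
      using sh_rank[OF assms(1) y(1)] x by (auto simp: ini_def)
  qed
qed

lemma height_shift:
  assumes "z \<in> S" "G \<subseteq> S"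
  shows "height (sh z ` G) = height G"
proof (rule largest_image)
  have inj: "inj_on (sh z) S" using sh_bij[OF assms(1)] by (auto simp: bij_betw_def)
  then show "inj_on (sh z) G" using assms(2) inj_on_subset by blast
  fix K assume "K \<subseteq> G"
  then have "K \<subseteq> S" using assms by auto
  then have "sh z x = sh z y \<longleftrightarrow> x = y" "prec (sh z x) (sh z y) \<longleftrightarrow> prec x y" if "x \<in> K" "y \<in> K" for x y
    using that sh_prec[OF assms(1)] inj_on_eq_iff[OF inj] by blast+
  then show "chain prec (sh z ` K) \<longleftrightarrow> chain prec K"
    by (simp add: chain_def)
qed

text \<open>The shift identifies the part above \<open>z\<close> with an initial part of the whole order.\<close>

lemma bexp_fresh:
  assumes "z \<in> S" "\<sigma> z \<le> t"
  shows "bexp p (ini t \<inter> up z) (\<lambda>G. f (height G)) = bexp p (ini (t - \<sigma> z)) (\<lambda>G. f (height G))"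
proof -
  have inj: "inj_on (sh z) (ini (t - \<sigma> z))"
    using inj_on_subset[OF bij_betw_imp_inj_on[OF sh_bij[OF assms(1)]] ini_sub] .
  have "bexp p (ini t \<inter> up z) (\<lambda>G. f (height G)) = bexp p (ini (t - \<sigma> z)) (\<lambda>G. f (height (sh z ` G)))"
    unfolding up_shift[OF assms, symmetric] by (rule bexp_image[OF inj])
  also have "\<dots> = bexp p (ini (t - \<sigma> z)) (\<lambda>G. f (height G))"
    using ini_sub by (intro bexp_cong refl arg_cong[where f=f] height_shift[OF assms(1)]) blast
  finally show ?thesis .
qed

text \<open>Strong Markov property. The element \<open>z\<close> is found by looking at the levels up to \<open>s\<close> only,
  whereas everything above \<open>z\<close> has a level larger than \<open>s\<close>, so the part above \<open>z\<close> is independent of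
  the choice of \<open>z\<close>.\<close>

lemma bexp_decouple:
  assumes "s \<le> t"
    and z: "\<And>G. G \<subseteq> ini s \<Longrightarrow> A G \<noteq> 0 \<Longrightarrow> z G \<in> S \<and> \<sigma> (z G) = s"
  shows "bexp p (ini t) (\<lambda>G. A (G \<inter> ini s) * f (height (G \<inter> up (z (G \<inter> ini s)))))
    = bexp p (ini s) A * bexp p (ini (t - s)) (\<lambda>G. f (height G))"
proof -
  define D where "D = ini t - ini s"
  have D: "finite D" "ini s \<inter> D = {}" "ini t = ini s \<union> D"
    using ini_fin ini_mono[OF assms(1)] by (auto simp: D_def)
  have "bexp p (ini t) (\<lambda>G. A (G \<inter> ini s) * f (height (G \<inter> up (z (G \<inter> ini s)))))
      = bexp p (ini s) (\<lambda>G. bexp p D (\<lambda>G'. A ((G \<union> G') \<inter> ini s) * f (height ((G \<union> G') \<inter> up (z ((G \<union> G') \<inter> ini s))))))"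
    unfolding D(3) using ini_fin D by (intro bexp_union) auto
  also have "\<dots> = bexp p (ini s) (\<lambda>G. bexp p (ini (t - s)) (\<lambda>G. f (height G)) * A G)"
  proof (intro bexp_cong refl)
    fix G assume G: "G \<subseteq> ini s"
    have "bexp p D (\<lambda>G'. A ((G \<union> G') \<inter> ini s) * f (height ((G \<union> G') \<inter> up (z ((G \<union> G') \<inter> ini s)))))
        = bexp p D (\<lambda>G'. A G * f (height ((G \<union> G') \<inter> up (z G))))"
    proof (intro bexp_cong refl)
      fix G' assume "G' \<subseteq> D"
      then have "(G \<union> G') \<inter> ini s = G" using G D(2) by blast
      then show "A ((G \<union> G') \<inter> ini s) * f (height ((G \<union> G') \<inter> up (z ((G \<union> G') \<inter> ini s)))) =
        A G * f (height ((G \<union> G') \<inter> up (z G)))" by simp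
    qed
    also have "\<dots> = bexp p (ini (t - s)) (\<lambda>G. f (height G)) * A G"
    proof (cases "A G = 0")
      case False
      with z[OF G] have zG: "z G \<in> S" "\<sigma> (z G) = s" by auto
      have sub: "ini t \<inter> up (z G) \<subseteq> D"
      proof
        fix x assume x: "x \<in> ini t \<inter> up (z G)"
        then have "s < \<sigma> x" using up_rank[OF zG(1), of x] zG(2) by (simp add: up_def)
        then show "x \<in> D" using x by (simp add: D_def ini_def)
      qed
      have "bexp p D (\<lambda>G'. A G * f (height ((G \<union> G') \<inter> up (z G))))
          = bexp p D (\<lambda>G'. A G * f (height (G' \<inter> (ini t \<inter> up (z G)))))"
      proof (intro bexp_cong refl)
        fix G' assume "G' \<subseteq> D"
        have "G \<inter> up (z G) = {}" using G up_rank[OF zG(1)] zG(2) by (fastforce simp: ini_def up_def)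
        then have "(G \<union> G') \<inter> up (z G) = G' \<inter> (ini t \<inter> up (z G))"
          using \<open>G' \<subseteq> D\<close> D(3) by blast
        then show "A G * f (height ((G \<union> G') \<inter> up (z G))) = A G * f (height (G' \<inter> (ini t \<inter> up (z G))))"
          by simp
      qed
      also have "\<dots> = A G * bexp p (ini t \<inter> up (z G)) (\<lambda>G. f (height G))"
        using bexp_restrict[OF D(1) sub, of p "\<lambda>G. f (height G)"] by (simp add: bexp_cmult)
      also have "\<dots> = A G * bexp p (ini (t - s)) (\<lambda>G. f (height G))"
        using bexp_fresh[OF zG(1), of t p f] zG(2) assms(1) by simp
      finally show ?thesis by simp
    qed (use D in simp)
    finally show "bexp p D (\<lambda>G'. A ((G \<union> G') \<inter> ini s) * f (height ((G \<union> G') \<inter> up (z ((G \<union> G') \<inter> ini s)))))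
      = bexp p (ini (t - s)) (\<lambda>G. f (height G)) * A G" .
  qed
  also have "\<dots> = bexp p (ini s) A * bexp p (ini (t - s)) (\<lambda>G. f (height G))"
    using bexp_cmult[of p "ini s" "bexp p (ini (t - s)) (\<lambda>G. f (height G))" A]
    by (metis mult.commute)
  finally show ?thesis .
qed

text \<open>To be applied to sets \<open>G\<close> inside \<open>ini s\<close>, the only part of the random set that is known when level
  \<open>s\<close> is reached.\<close>

definition first :: "nat \<Rightarrow> nat \<Rightarrow> 'a set \<Rightarrow> bool" where
  "first k s G \<longleftrightarrow> k \<le> height G \<and> \<not> k \<le> height (G \<inter> ini (s - 1))"

text \<open>The last element of some chain of \<open>k\<close> elements; at the level where such a chain first exists,
  this element must have that level.\<close>

definition top :: "nat \<Rightarrow> nat \<Rightarrow> 'a set \<Rightarrow> 'a" where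
  "top k s G = (SOME z. z \<in> G \<and> \<sigma> z = s \<and>
     (\<exists>K\<subseteq>G. chain prec K \<and> card K = k \<and> z \<in> K \<and> (\<forall>x\<in>K. x \<noteq> z \<longrightarrow> prec x z)))"

lemma top:
  assumes G: "G \<subseteq> ini s" and f: "first k s G" and k: "1 \<le> k"
  shows "top k s G \<in> G" "\<sigma> (top k s G) = s"
    "\<exists>K\<subseteq>G. chain prec K \<and> card K = k \<and> top k s G \<in> K \<and> (\<forall>x\<in>K. x \<noteq> top k s G \<longrightarrow> prec x (top k s G))"
proof -
  have fG: "finite G" using G fin_sub by blast
  obtain K0 where K0: "K0 \<subseteq> G" "chain prec K0" "card K0 = height G"
    using largest_witness[OF hereditary_chain fG] by metis
  then obtain K where K: "K \<subseteq> K0" "card K = k"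
    using f by (metis first_def obtain_subset_with_card_n)
  have cK: "chain prec K" using K K0 hereditary_chain unfolding hereditary_def by blast
  have "\<not> K \<subseteq> ini (s - 1)"
  proof
    assume "K \<subseteq> ini (s - 1)"
    then have "card K \<le> height (G \<inter> ini (s - 1))"
      using K K0 fG cK by (intro largest_ge) auto
    then show False using f K by (simp add: first_def)
  qed
  then obtain z where z: "z \<in> K" "z \<notin> ini (s - 1)" by auto
  have "z \<in> G" using z K K0 by blast
  then have "z \<in> S" "\<sigma> z \<le> s" using G by (auto simp: ini_def)
  with z(2) \<open>z \<in> G\<close> have zS: "z \<in> G" "z \<in> S" "\<sigma> z = s" by (auto simp: ini_def)
  have "prec x z" if "x \<in> K" "x \<noteq> z" for x
  proof -
    have x: "x \<in> S" "\<sigma> x \<le> s" using that K K0 G by (auto simp: ini_def)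
    have "prec x z \<or> prec z x" using cK that z by (auto simp: chain_def)
    then show ?thesis using up_rank[OF zS(2) x(1)] x zS by auto
  qed
  then have "z \<in> G \<and> \<sigma> z = s \<and>
     (\<exists>K\<subseteq>G. chain prec K \<and> card K = k \<and> z \<in> K \<and> (\<forall>x\<in>K. x \<noteq> z \<longrightarrow> prec x z))"
    using zS z K K0 cK by blast
  from someI[where P = "\<lambda>z. z \<in> G \<and> \<sigma> z = s \<and>
     (\<exists>K\<subseteq>G. chain prec K \<and> card K = k \<and> z \<in> K \<and> (\<forall>x\<in>K. x \<noteq> z \<longrightarrow> prec x z))", OF this]
  show "top k s G \<in> G" "\<sigma> (top k s G) = s"
    "\<exists>K\<subseteq>G. chain prec K \<and> card K = k \<and> top k s G \<in> K \<and> (\<forall>x\<in>K. x \<noteq> top k s G \<longrightarrow> prec x (top k s G))"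
    unfolding top_def by auto
qed

lemma reach_0: "1 \<le> k \<Longrightarrow> reach p k 0 = 0"
  by (simp add: reach_def ini_0 largest_empty[OF hereditary_chain])

lemma reach_first:
  assumes "0 < s"
  shows "bexp p (ini s) (\<lambda>G. of_bool (first k s G)) = reach p k s - reach p k (s - 1)"
proof -
  have "bexp p (ini s) (\<lambda>G. of_bool (first k s G))
      = bexp p (ini s) (\<lambda>G. of_bool (k \<le> height G) - of_bool (k \<le> height (G \<inter> ini (s - 1))))"
  proof (intro bexp_cong refl)
    fix G assume "G \<subseteq> ini s"
    then have "height (G \<inter> ini (s - 1)) \<le> height G"
      using fin_sub by (intro largest_mono[OF hereditary_chain]) auto
    then show "of_bool (first k s G) = (of_bool (k \<le> height G) - of_bool (k \<le> height (G \<inter> ini (s - 1))) :: real)"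
      by (auto simp: first_def)
  qed
  then show ?thesis
    using bexp_restrict[OF ini_fin ini_mono, of "s - 1" s p "\<lambda>G. of_bool (k \<le> height G)"]
    by (simp add: bexp_diff reach_def)
qed

lemma reach_mono:
  assumes "0 \<le> p" "p \<le> 1" "s \<le> t"
  shows "reach p k s \<le> reach p k t"
proof -
  have "reach p k s = bexp p (ini t) (\<lambda>G. of_bool (k \<le> height (G \<inter> ini s)))"
    unfolding reach_def using bexp_restrict[OF ini_fin ini_mono[OF assms(3)], of p "\<lambda>G. of_bool (k \<le> height G)"] by simp
  also have "\<dots> \<le> reach p k t"
    unfolding reach_def
  proof (intro bexp_mono assms)
    fix G assume "G \<subseteq> ini t"
    then have "height (G \<inter> ini s) \<le> height G"
      using fin_sub by (intro largest_mono[OF hereditary_chain]) auto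
    then show "of_bool (k \<le> height (G \<inter> ini s)) \<le> (of_bool (k \<le> height G) :: real)" by auto
  qed
  finally show ?thesis .
qed

lemma reach_le_1:
  assumes "0 \<le> p" "p \<le> 1"
  shows "reach p k t \<le> 1"
proof -
  have "reach p k t \<le> bexp p (ini t) (\<lambda>_. 1)" unfolding reach_def using assms by (intro bexp_mono) auto
  then show ?thesis using ini_fin by simp
qed

lemma first_unique:
  assumes G: "G \<subseteq> ini t" and s: "s \<in> {1..t}" "s' \<in> {1..t}"
    and f: "first k s (G \<inter> ini s)" "first k s' (G \<inter> ini s')"
  shows "s = s'"
proof -
  have *: False if "u < v" "first k u (G \<inter> ini u)" "first k v (G \<inter> ini v)" for u v
  proof -
    have "height (G \<inter> ini u) \<le> height (G \<inter> ini v \<inter> ini (v - 1))"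
    proof (rule largest_mono[OF hereditary_chain])
      have "u \<le> v - 1" "u \<le> v" using that by auto
      then show "G \<inter> ini u \<subseteq> G \<inter> ini v \<inter> ini (v - 1)" using ini_mono by blast
    qed (use G fin_sub in auto)
    then show False using that by (auto simp: first_def)
  qed
  show ?thesis using *[of s s'] *[of s' s] f by (metis linorder_neqE_nat)
qed

lemma sum_first_le:
  assumes G: "G \<subseteq> ini t" and B: "0 \<le> B"
    and *: "\<And>s. s \<in> {1..t} \<Longrightarrow> first k s (G \<inter> ini s) \<Longrightarrow> f s \<le> B"
  shows "(\<Sum>s=1..t. of_bool (first k s (G \<inter> ini s)) * f s) \<le> (B :: real)"
proof (cases "\<exists>s\<in>{1..t}. first k s (G \<inter> ini s)")
  case True
  then obtain s where s: "s \<in> {1..t}" "first k s (G \<inter> ini s)" by auto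
  have "(\<Sum>s=1..t. of_bool (first k s (G \<inter> ini s)) * f s)
      = (\<Sum>s\<in>{s}. of_bool (first k s (G \<inter> ini s)) * f s)"
    using s first_unique[OF G] by (intro sum.mono_neutral_right) auto
  then show ?thesis using *[OF s] s by simp
next
  case False
  then show ?thesis using B by (auto intro!: sum_nonpos)
qed

lemma bexp_sum_first:
  assumes k: "1 \<le> k"
  shows "bexp p (ini t) (\<lambda>G. \<Sum>s=1..t. of_bool (first k s (G \<inter> ini s)) * f (height (G \<inter> up (top k s (G \<inter> ini s)))))
    = (\<Sum>s=1..t. (reach p k s - reach p k (s - 1)) * bexp p (ini (t - s)) (\<lambda>G. f (height G)))"
  unfolding bexp_sum
proof (intro sum.cong refl)
  fix s assume s: "s \<in> {1..t}"
  have "bexp p (ini t) (\<lambda>G. of_bool (first k s (G \<inter> ini s)) * f (height (G \<inter> up (top k s (G \<inter> ini s)))))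
      = bexp p (ini s) (\<lambda>G. of_bool (first k s G)) * bexp p (ini (t - s)) (\<lambda>G. f (height G))"
    using s top[OF _ _ k] ini_sub by (intro bexp_decouple) (auto simp: ini_def subset_iff)
  also have "bexp p (ini s) (\<lambda>G. of_bool (first k s G)) = reach p k s - reach p k (s - 1)"
    using s by (intro reach_first) auto
  finally show "bexp p (ini t) (\<lambda>G. of_bool (first k s (G \<inter> ini s)) * f (height (G \<inter> up (top k s (G \<inter> ini s)))))
    = (reach p k s - reach p k (s - 1)) * bexp p (ini (t - s)) (\<lambda>G. f (height G))" .
qed

text \<open>A chain of \<open>k\<close> elements ending in \<open>top k s\<close> can be continued by any chain above that element.\<close>

lemma height_split:
  assumes G: "G \<subseteq> ini t" and s: "first k s (G \<inter> ini s)" and k: "1 \<le> k"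
  shows "k + height (G \<inter> up (top k s (G \<inter> ini s))) \<le> height G"
proof -
  define z where "z = top k s (G \<inter> ini s)"
  have z: "z \<in> G \<inter> ini s" "\<sigma> z = s" using top[OF _ s k] by (auto simp: z_def)
  then have zS: "z \<in> S" using ini_sub by auto
  obtain K where K: "K \<subseteq> G \<inter> ini s" "chain prec K" "card K = k" "z \<in> K" "\<And>x. x \<in> K \<Longrightarrow> x \<noteq> z \<Longrightarrow> prec x z"
    using top(3)[OF _ s k] unfolding z_def by auto
  have fG: "finite G" using G fin_sub by blast
  obtain L where L: "L \<subseteq> G \<inter> up z" "chain prec L" "card L = height (G \<inter> up z)"
    using largest_witness[OF hereditary_chain, of "G \<inter> up z"] fG by auto
  have below: "prec x y" if "x \<in> K" "y \<in> L" for x y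
  proof (cases "x = z")
    case False
    have "x \<in> S" "y \<in> S" using that K(1) L(1) ini_sub unfolding up_def by blast+
    moreover have "prec z y" using that L(1) by (auto simp: up_def)
    ultimately have "x \<in> S" "y \<in> S" "prec z y" by simp_all
    then show ?thesis using trans[OF _ zS _ K(5)[OF that(1) False]] by blast
  qed (use that L in \<open>auto simp: up_def\<close>)
  have "K \<inter> L = {}"
  proof -
    have "\<sigma> x \<le> s" if "x \<in> K" for x using that K by (auto simp: ini_def)
    moreover have "s < \<sigma> x" if "x \<in> L" for x using that L up_rank[OF zS] z by (auto simp: up_def)
    ultimately show ?thesis by fastforce
  qed
  moreover have "finite K" "finite L" using K L fG finite_subset by (metis finite_Int)+
  ultimately have "card (K \<union> L) = k + height (G \<inter> up z)" using K L by (simp add: card_Un_disjoint)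
  moreover have "chain prec (K \<union> L)" using K(2) L(2) below unfolding chain_def by blast
  ultimately show ?thesis using K L fG largest_ge[of G "K \<union> L" "chain prec"] by (auto simp: z_def)
qed

text \<open>Complete a chain of \<open>k\<close> elements as early as possible, then start again above its last element.\<close>

lemma renewal_ge:
  assumes p: "0 \<le> p" "p \<le> 1" and k: "1 \<le> k"
  shows "(\<Sum>s=1..t. (reach p k s - reach p k (s - 1)) * (real k + mean_height p (t - s))) \<le> mean_height p t"
proof -
  have "(\<Sum>s=1..t. (reach p k s - reach p k (s - 1)) * (real k + mean_height p (t - s)))
      = bexp p (ini t) (\<lambda>G. \<Sum>s=1..t. of_bool (first k s (G \<inter> ini s)) *
          (real k + real (height (G \<inter> up (top k s (G \<inter> ini s))))))"
    using bexp_sum_first[OF k, of p t "\<lambda>h. real k + real h"] ini_fin by (simp add: bexp_add mean_height_def)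
  also have "\<dots> \<le> mean_height p t"
    unfolding mean_height_def using height_split[OF _ _ k]
    by (intro bexp_mono p sum_first_le) (auto simp flip: of_nat_add)
  finally show ?thesis .
qed

text \<open>The mean waiting time for a chain of \<open>k\<close> elements is the sum of \<open>1 - reach p k u\<close> over all \<open>u\<close>. If it
  is at most \<open>\<mu>\<close>, a step of \<open>k\<close> elements is completed at least once in \<open>\<mu>\<close> levels on average; the
  linear bound is preserved by the renewal inequality.\<close>

lemma mean_height_ge:
  assumes p: "0 \<le> p" "p \<le> 1" and k: "1 \<le> k"
    and \<mu>: "0 < \<mu>" "\<And>t. (\<Sum>u<t. 1 - reach p k u) \<le> \<mu>"
  shows "real k / \<mu> * real t - real k \<le> mean_height p t"
proof (induction t rule: less_induct)
  case (less t)
  have "real k / \<mu> * (real t - \<mu>) \<le> real k / \<mu> * (\<Sum>u<t. reach p k u)"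
    using \<mu>(2)[of t] \<mu>(1) by (intro mult_left_mono) (auto simp: sum_subtractf)
  also have "\<dots> = real k / \<mu> * (\<Sum>s=1..t. (reach p k s - reach p k (s - 1)) * (real t - real s))"
    by (simp only: abel_sum[where F = "reach p k", OF reach_0[OF k]])
  also have "\<dots> = (\<Sum>s=1..t. (reach p k s - reach p k (s - 1)) * (real k + (real k / \<mu> * real (t - s) - real k)))"
    unfolding sum_distrib_left by (intro sum.cong) (auto simp: of_nat_diff)
  also have "\<dots> \<le> (\<Sum>s=1..t. (reach p k s - reach p k (s - 1)) * (real k + mean_height p (t - s)))"
    using reach_mono[OF p] by (intro sum_mono mult_left_mono add_left_mono less.IH) auto
  also have "\<dots> \<le> mean_height p t" by (rule renewal_ge[OF p k])
  finally show ?case using \<mu>(1) by (simp add: field_simps)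
qed

lemma first_1:
  assumes G: "G \<subseteq> ini t" and ne: "G \<noteq> {}"
  shows "\<exists>s\<in>{1..t}. first 1 s (G \<inter> ini s)"
proof -
  have fG: "finite G" using G fin_sub by blast
  define s where "s = Min (\<sigma> ` G)"
  have "s \<in> \<sigma> ` G" unfolding s_def using fG ne by (intro Min_in) auto
  then obtain x where x: "x \<in> G" "\<sigma> x = s" by auto
  have s: "s \<in> {1..t}" using x G pos[of x] by (auto simp: ini_def)
  have "x \<in> ini s" using x G by (auto simp: ini_def)
  then have "card {x} \<le> height (G \<inter> ini s)"
    using x fG by (intro largest_ge) (auto simp: chain_def)
  moreover have "G \<inter> ini (s - 1) = {}"
  proof -
    have "s \<le> \<sigma> y" if "y \<in> G" for y unfolding s_def using that fG by (intro Min_le) auto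
    then show ?thesis using s by (fastforce simp: ini_def)
  qed
  then have "G \<inter> ini s \<inter> ini (s - 1) = {}" by auto
  ultimately have "first 1 s (G \<inter> ini s)" by (simp add: first_def largest_empty[OF hereditary_chain])
  then show ?thesis using s by blast
qed

lemma first_1_least:
  assumes G: "G \<subseteq> ini t" and s: "s \<in> {1..t}" "first 1 s (G \<inter> ini s)" and x: "x \<in> G"
  shows "s \<le> \<sigma> x"
proof (rule ccontr)
  assume "\<not> s \<le> \<sigma> x"
  then have "x \<in> G \<inter> ini s \<inter> ini (s - 1)" using x G by (auto simp: ini_def)
  then have "card {x} \<le> height (G \<inter> ini s \<inter> ini (s - 1))"
    using G fin_sub by (intro largest_ge) (auto simp: chain_def)
  then show False using s by (simp add: first_def)
qed

lemma reach_1: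
  assumes "0 \<le> p" "p \<le> 1"
  shows "1 - reach p 1 u = (1 - p) ^ card (ini u)"
proof -
  have "1 - reach p 1 u = bexp p (ini u) (\<lambda>G. 1 - of_bool (1 \<le> height G))"
    using ini_fin by (simp add: bexp_diff reach_def)
  also have "\<dots> = bexp p (ini u) (\<lambda>G. of_bool (G \<inter> ini u = {}))"
  proof (intro bexp_cong refl)
    fix G assume G: "G \<subseteq> ini u"
    show "1 - of_bool (1 \<le> height G) = (of_bool (G \<inter> ini u = {}) :: real)"
    proof (cases "G = {}")
      case False
      then obtain x where "x \<in> G" by auto
      then have "card {x} \<le> height G" using G fin_sub by (intro largest_ge) (auto simp: chain_def)
      then show ?thesis using False G by (auto simp: Int_absorb2)
    qed (simp add: largest_empty[OF hereditary_chain])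
  qed
  also have "\<dots> = (1 - p) ^ card (ini u)" using ini_fin by (intro bexp_prob_disjoint) auto
  finally show ?thesis .
qed

text \<open>For \<open>k = 1\<close> the renewal inequality is an equality if the element of least level is always an optimal
  start: replacing the first element of a chain by it leaves a chain.\<close>

lemma renewal_le:
  assumes p: "0 \<le> p" "p \<le> 1"
    and greedy: "\<And>x y z. \<lbrakk>x \<in> S; y \<in> S; z \<in> S; \<sigma> x \<le> \<sigma> y; prec y z\<rbrakk> \<Longrightarrow> prec x z"
  shows "mean_height p t \<le> (\<Sum>s=1..t. (reach p 1 s - reach p 1 (s - 1)) * (1 + mean_height p (t - s)))"
proof -
  have "mean_height p t \<le> bexp p (ini t) (\<lambda>G. \<Sum>s=1..t. of_bool (first 1 s (G \<inter> ini s)) *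
          (1 + real (height (G \<inter> up (top 1 s (G \<inter> ini s))))))"
    unfolding mean_height_def
  proof (intro bexp_mono p)
    fix G assume G: "G \<subseteq> ini t"
    define f where "f = (\<lambda>s. of_bool (first 1 s (G \<inter> ini s)) * (1 + real (height (G \<inter> up (top 1 s (G \<inter> ini s))))))"
    have fG: "finite G" using G fin_sub by blast
    have f0: "0 \<le> f s" for s by (simp add: f_def)
    show "real (height G) \<le> (\<Sum>s=1..t. f s)"
    proof (cases "G = {}")
      case False
      obtain s where s: "s \<in> {1..t}" "first 1 s (G \<inter> ini s)" using first_1[OF G False] by blast
      define z where "z = top 1 s (G \<inter> ini s)"
      have z: "z \<in> G" "\<sigma> z = s" using top[OF _ s(2)] by (auto simp: z_def)
      obtain K where K: "K \<subseteq> G" "chain prec K" "card K = height G"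
        using largest_witness[OF hereditary_chain fG] by metis
      have "height G \<le> 1 + height (G \<inter> up z)"
      proof (cases "K = {}")
        case False
        have fK: "finite K" using K fG finite_subset by blast
        have "Min (\<sigma> ` K) \<in> \<sigma> ` K" using fK False by (intro Min_in) auto
        then obtain x where x: "x \<in> K" "\<sigma> x = Min (\<sigma> ` K)" by auto
        have "K - {x} \<subseteq> G \<inter> up z"
        proof
          fix y assume y: "y \<in> K - {x}"
          have mem: "x \<in> S" "y \<in> S" "z \<in> S" using x y z K G ini_sub by blast+
          have "\<sigma> x \<le> \<sigma> y" unfolding x(2) using y fK by (intro Min_le) auto
          moreover have "prec x y \<or> prec y x" using K(2) x y by (auto simp: chain_def)
          ultimately have xy: "prec x y" using up_rank[OF mem(2,1)] by auto
          have "\<sigma> z \<le> \<sigma> x" using first_1_least[OF G s, of x] x K z by auto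
          then have "prec z y" using greedy[OF mem(3,1,2) _ xy] by blast
          then show "y \<in> G \<inter> up z" using y K mem by (auto simp: up_def)
        qed
        then have "card (K - {x}) \<le> height (G \<inter> up z)"
          using fG K(2) by (intro largest_ge) (auto simp: chain_def)
        then show ?thesis using K x fK by (simp add: card_Diff_singleton)
      qed (use K in simp)
      then have "real (height G) \<le> f s" using s by (simp add: f_def z_def)
      also have "\<dots> \<le> (\<Sum>s=1..t. f s)" using s f0 by (intro member_le_sum) auto
      finally show ?thesis .
    qed (use f0 in \<open>simp add: largest_empty[OF hereditary_chain] sum_nonneg\<close>)
  qed
  also have "\<dots> = (\<Sum>s=1..t. (reach p 1 s - reach p 1 (s - 1)) * (1 + mean_height p (t - s)))"
    using bexp_sum_first[of 1 p t "\<lambda>h. 1 + real h"] ini_fin by (simp add: bexp_add mean_height_def)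
  finally show ?thesis .
qed

text \<open>The level \<open>B\<close> truncates the waiting time, so that only a finite part of its mean enters; the
  truncated linear bound is preserved by \<open>renewal_le\<close>.\<close>

lemma mean_height_le:
  assumes p: "0 \<le> p" "p \<le> 1"
    and greedy: "\<And>x y z. \<lbrakk>x \<in> S; y \<in> S; z \<in> S; \<sigma> x \<le> \<sigma> y; prec y z\<rbrakk> \<Longrightarrow> prec x z"
    and \<mu>: "0 < \<mu>" "\<mu> = (\<Sum>u<B. 1 - reach p 1 u)"
  shows "mean_height p t \<le> (real t + real B) / \<mu>"
proof (induction t rule: less_induct)
  case (less t)
  define F where "F = reach p 1"
  have F: "F 0 = 0" "\<And>s t. s \<le> t \<Longrightarrow> F s \<le> F t" "\<And>t. F t \<le> 1" "\<And>t. 0 \<le> F t"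
    using reach_0[of 1 p] reach_mono[OF p] reach_le_1[OF p] by (auto simp: F_def)
      (metis le0 reach_0 le_numeral_extra(4))
  have "mean_height p t \<le> (\<Sum>s=1..t. (F s - F (s - 1)) * (1 + mean_height p (t - s)))"
    unfolding F_def by (rule renewal_le[OF p greedy])
  also have "\<dots> \<le> (\<Sum>s=1..t. (F s - F (s - 1)) * (1 + (real (t - s) + real B) / \<mu>))"
    using F by (intro sum_mono mult_left_mono add_left_mono less.IH) auto
  also have "\<dots> = (\<Sum>s=1..t. (1 + real B / \<mu>) * (F s - F (s - 1)) + (F s - F (s - 1)) * (real t - real s) / \<mu>)"
    by (intro sum.cong refl) (simp add: of_nat_diff divide_inverse algebra_simps)
  also have "\<dots> = (1 + real B / \<mu>) * F t + (\<Sum>u<t. F u) / \<mu>"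
    by (simp only: sum.distrib sum_distrib_left[symmetric] sum_divide_distrib[symmetric] abel_sum[where F = F, OF F(1)] telescope F(1))
      simp
  also have "\<dots> \<le> (real t + real B) / \<mu>"
  proof -
    have "(\<Sum>u<t. F u) + real B * F t \<le> (\<Sum>u<t. F u) + (\<Sum>u=t..<t+B. F u)"
      using sum_mono[of "{t..<t+B}" "\<lambda>_. F t" F] F(2) by simp
    also have "\<dots> = (\<Sum>u<t+B. F u)"
      using sum.atLeastLessThan_concat[of 0 t "t+B" F] by (simp add: lessThan_atLeast0)
    also have "\<dots> = (\<Sum>u<B. F u) + (\<Sum>u=B..<t+B. F u)"
      using sum.atLeastLessThan_concat[of 0 B "t+B" F] by (simp add: lessThan_atLeast0)
    also have "\<dots> \<le> (\<Sum>u<B. F u) + real t"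
      using sum_mono[of "{B..<t+B}" F "\<lambda>_. 1"] F(3) by simp
    finally have "(\<Sum>u<t. F u) + real B * F t \<le> (\<Sum>u<B. F u) + real t" .
    moreover have "(\<Sum>u<B. F u) = real B - \<mu>" using \<mu>(2) by (simp add: F_def sum_subtractf)
    moreover have "\<mu> * F t \<le> \<mu>" using F(3)[of t] \<mu>(1) by (simp add: mult_left_le)
    ultimately have "\<mu> * F t + real B * F t + (\<Sum>u<t. F u) \<le> real t + real B" by simp
    then have "(\<mu> * F t + real B * F t + (\<Sum>u<t. F u)) / \<mu> \<le> (real t + real B) / \<mu>"
      using \<mu>(1) by (intro divide_right_mono) auto
    then show ?thesis using \<mu>(1) by (simp add: add_divide_distrib distrib_right)
  qed
  finally show ?case .
qed

text \<open>Two greedy steps produce a chain of two elements. An event \<open>E\<close> on which such a chain exists although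
  nothing lies above the first greedy element contributes in addition.\<close>

lemma reach_2_ge:
  assumes p: "0 \<le> p" "p \<le> 1"
    and E: "\<And>G. G \<subseteq> ini t \<Longrightarrow> E G \<Longrightarrow> 2 \<le> height G"
    and trap: "\<And>G z. \<lbrakk>G \<subseteq> ini t; E G; z \<in> G; \<And>x. x \<in> G \<Longrightarrow> \<sigma> z \<le> \<sigma> x\<rbrakk> \<Longrightarrow> G \<inter> up z = {}"
  shows "(\<Sum>s=1..t. (reach p 1 s - reach p 1 (s - 1)) * reach p 1 (t - s)) + bexp p (ini t) (\<lambda>G. of_bool (E G))
    \<le> reach p 2 t"
proof -
  have "(\<Sum>s=1..t. (reach p 1 s - reach p 1 (s - 1)) * reach p 1 (t - s)) + bexp p (ini t) (\<lambda>G. of_bool (E G))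
      = bexp p (ini t) (\<lambda>G. (\<Sum>s=1..t. of_bool (first 1 s (G \<inter> ini s)) *
          of_bool (1 \<le> height (G \<inter> up (top 1 s (G \<inter> ini s))))) + of_bool (E G))"
    using bexp_sum_first[of 1 p t "\<lambda>h. of_bool (1 \<le> h)"] by (simp add: bexp_add reach_def)
  also have "\<dots> \<le> reach p 2 t"
    unfolding reach_def
  proof (intro bexp_mono p)
    fix G assume G: "G \<subseteq> ini t"
    have "(\<Sum>s=1..t. of_bool (first 1 s (G \<inter> ini s)) * of_bool (1 \<le> height (G \<inter> up (top 1 s (G \<inter> ini s)))))
      \<le> (of_bool (2 \<le> height G) - of_bool (E G) :: real)"
    proof (rule sum_first_le[OF G])
      show "0 \<le> (of_bool (2 \<le> height G) - of_bool (E G) :: real)" using E[OF G] by auto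
    next
      fix s assume s: "s \<in> {1..t}" "first 1 s (G \<inter> ini s)"
      define z where "z = top 1 s (G \<inter> ini s)"
      have z: "z \<in> G" "\<sigma> z = s" using top[OF _ s(2)] by (auto simp: z_def)
      have "\<not> E G" "2 \<le> height G" if h: "1 \<le> height (G \<inter> up z)"
      proof -
        have "G \<inter> up z \<noteq> {}" using h largest_empty[OF hereditary_chain] by (metis not_one_le_zero)
        then show "\<not> E G" using trap[OF G _ z(1)] first_1_least[OF G s] z by auto
        show "2 \<le> height G" using height_split[OF G s(2)] h by (simp add: z_def)
      qed
      then show "of_bool (1 \<le> height (G \<inter> up (top 1 s (G \<inter> ini s)))) \<le> (of_bool (2 \<le> height G) - of_bool (E G) :: real)"
        using E[OF G] by (auto simp: z_def)
    qed
    then show "(\<Sum>s=1..t. of_bool (first 1 s (G \<inter> ini s)) * of_bool (1 \<le> height (G \<inter> up (top 1 s (G \<inter> ini s)))))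
        + of_bool (E G) \<le> (of_bool (2 \<le> height G) :: real)" by simp
  qed
  finally show ?thesis .
qed

text \<open>Without \<open>e\<close> the assumption says that two elements are reached no later than the sum of two
  independent copies of the waiting time for one element, whose mean is at most \<open>2 * \<mu>\<close>. Every gain
  in probability at level \<open>u\<close> shortens the mean waiting time by that amount.\<close>

lemma two_step_time:
  assumes p: "0 \<le> p" "p \<le> 1"
    and \<mu>: "\<And>t. (\<Sum>u<t. 1 - reach p 1 u) \<le> \<mu>"
    and e: "\<And>t. (\<Sum>s=1..t. (reach p 1 s - reach p 1 (s - 1)) * reach p 1 (t - s)) + e t \<le> reach p 2 t"
  shows "(\<Sum>u<t. 1 - reach p 2 u) \<le> 2 * \<mu> - (\<Sum>u<t. e u)"
proof -
  define F where "F = reach p 1"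
  have F: "F 0 = 0" "\<And>s t. s \<le> t \<Longrightarrow> F s \<le> F t" "\<And>t. F t \<le> 1"
    using reach_0[of 1 p] reach_mono[OF p] reach_le_1[OF p] by (auto simp: F_def)
  have \<mu>0: "0 \<le> \<mu>" using \<mu>[of 0] by simp
  have f: "0 \<le> F s - F (s - 1)" for s using F(2)[of "s - 1" s] by simp
  have "(\<Sum>u<t. 1 - reach p 2 u) \<le> (\<Sum>u<t. 1 - (\<Sum>s=1..u. (F s - F (s - 1)) * F (u - s)) - e u)"
    using e unfolding F_def by (intro sum_mono) (simp add: algebra_simps)
  also have "\<dots> = (\<Sum>u<t. (1 - F u) + (\<Sum>s=1..u. (F s - F (s - 1)) * (1 - F (u - s))) - e u)"
  proof (intro sum.cong refl)
    fix u
    have "(\<Sum>s=1..u. (F s - F (s - 1)) * (1 - F (u - s))) = F u - (\<Sum>s=1..u. (F s - F (s - 1)) * F (u - s))"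
      using telescope[of F u] F(1) by (simp add: right_diff_distrib sum_subtractf)
    then show "1 - (\<Sum>s=1..u. (F s - F (s - 1)) * F (u - s)) - e u
      = 1 - F u + (\<Sum>s=1..u. (F s - F (s - 1)) * (1 - F (u - s))) - e u" by simp
  qed
  also have "\<dots> = (\<Sum>u<t. 1 - F u) + (\<Sum>u<t. \<Sum>s=1..u. (F s - F (s - 1)) * (1 - F (u - s))) - (\<Sum>u<t. e u)"
    by (simp add: sum.distrib sum_subtractf)
  also have "(\<Sum>u<t. \<Sum>s=1..u. (F s - F (s - 1)) * (1 - F (u - s)))
      = (\<Sum>u<t. \<Sum>s=1..t. of_bool (s \<le> u) * ((F s - F (s - 1)) * (1 - F (u - s))))"
    by (intro sum.cong sum.mono_neutral_cong_left) auto
  also have "\<dots> = (\<Sum>s=1..t. \<Sum>u<t. of_bool (s \<le> u) * ((F s - F (s - 1)) * (1 - F (u - s))))"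
    by (rule sum.swap)
  also have "\<dots> \<le> (\<Sum>s=1..t. (F s - F (s - 1)) * \<mu>)"
  proof (intro sum_mono)
    fix s assume s: "s \<in> {1..t}"
    have "(\<Sum>u<t. of_bool (s \<le> u) * ((F s - F (s - 1)) * (1 - F (u - s))))
        = (\<Sum>u=s..<t. (F s - F (s - 1)) * (1 - F (u - s)))"
      by (intro sum.mono_neutral_cong_right) auto
    also have "\<dots> = (\<Sum>u<t - s. (F s - F (s - 1)) * (1 - F u))"
      using s by (intro sum.reindex_bij_witness[of _ "\<lambda>u. u + s" "\<lambda>u. u - s"]) auto
    also have "\<dots> \<le> (F s - F (s - 1)) * \<mu>"
      using \<mu>[of "t - s"] f unfolding sum_distrib_left[symmetric] F_def by (intro mult_left_mono) auto
    finally show "(\<Sum>u<t. of_bool (s \<le> u) * ((F s - F (s - 1)) * (1 - F (u - s)))) \<le> (F s - F (s - 1)) * \<mu>" .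
  qed
  also have "\<dots> = F t * \<mu>" using telescope[of F t] F(1) by (simp only: sum_distrib_right[symmetric]) simp
  also have "\<dots> \<le> \<mu>" using F(3)[of t] \<mu>0 by (simp add: mult_left_le_one_le mult.commute mult_left_le)
  finally show ?thesis using \<mu>[of t] unfolding F_def by simp
qed

end

section \<open>The integral of \<open>exp (- (x ^ r))\<close> and sums of binomial powers\<close>

definition expint :: "nat \<Rightarrow> real \<Rightarrow> real" where
  "expint r y = integral {0..y} (\<lambda>x. exp (- (x ^ r)))"

lemma expint_integrable: "(\<lambda>x. exp (- (x ^ r))) integrable_on {a..b :: real}"
  by (intro integrable_continuous_interval continuous_intros)

lemma expint_diff:
  assumes "0 \<le> x" "x \<le> y"
  shows "expint r y - expint r x = integral {x..y} (\<lambda>x. exp (- (x ^ r)))"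
  using Henstock_Kurzweil_Integration.integral_combine[OF assms expint_integrable, of r] by (simp add: expint_def)

lemma expint_mono:
  assumes "0 \<le> x" "x \<le> y"
  shows "expint r x \<le> expint r y"
proof -
  have "0 \<le> integral {x..y} (\<lambda>x. exp (- (x ^ r)))"
    by (intro integral_nonneg expint_integrable) auto
  then show ?thesis using expint_diff[OF assms, of r] by linarith
qed

lemma expint_0: "expint r 0 = 0"
  by (simp add: expint_def)

lemma expint_step:
  assumes "0 \<le> x" "x \<le> y"
  shows "(y - x) * exp (- (y ^ r)) \<le> expint r y - expint r x"
    "expint r y - expint r x \<le> (y - x) * exp (- (x ^ r))"
proof -
  have "integral {x..y} (\<lambda>_. exp (- (y ^ r))) \<le> integral {x..y} (\<lambda>x. exp (- (x ^ r)))"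
    using assms by (intro integral_le expint_integrable) (auto intro: power_mono)
  then show "(y - x) * exp (- (y ^ r)) \<le> expint r y - expint r x"
    using assms by (simp add: expint_diff)
  have "integral {x..y} (\<lambda>x. exp (- (x ^ r))) \<le> integral {x..y} (\<lambda>_. exp (- (x ^ r)))"
    using assms by (intro integral_le expint_integrable) (auto intro: power_mono)
  then show "expint r y - expint r x \<le> (y - x) * exp (- (x ^ r))"
    using assms by (simp add: expint_diff)
qed

lemma gamma_kernel_continuous:
  fixes a :: real
  assumes "0 < a"
  shows "continuous_on {0..y} (\<lambda>t. t powr a * exp (- t))"
  using assms by (intro continuous_intros continuous_on_powr') auto

text \<open>Monotone convergence for the Euler integral, to have it as a limit of proper integrals.\<close>

lemma gamma_kernel_limit:
  fixes a :: real
  assumes "0 < a"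
  shows "((\<lambda>y. integral {0..y} (\<lambda>t. t powr a * exp (- t))) \<longlongrightarrow> Gamma (a + 1)) at_top"
    and "\<And>y. integral {0..y} (\<lambda>t. t powr a * exp (- t)) \<le> Gamma (a + 1)"
proof -
  define h where "h = (\<lambda>t :: real. t powr a * exp (- t))"
  have h0: "0 \<le> h t" for t by (simp add: h_def)
  have "((\<lambda>t. t powr (a + 1 - 1) / exp t) has_integral Gamma (a + 1)) {0..}"
    using assms by (intro Gamma_integral_real) auto
  then have H: "(h has_integral Gamma (a + 1)) {0..}"
    by (simp add: h_def exp_minus divide_inverse)
  have int: "h integrable_on {0..y}" for y
    unfolding h_def by (intro integrable_continuous_interval gamma_kernel_continuous assms)
  show le: "integral {0..y} h \<le> Gamma (a + 1)" for y
    using integral_subset_le[OF _ int, of y "{0..}"] H h0 by (auto simp: integral_unique integrable_on_def)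
  have mono: "integral {0..x} h \<le> integral {0..y} h" if "x \<le> y" for x y
    using that h0 int by (intro integral_subset_le) auto
  define f where "f = (\<lambda>(k::nat) t. if t \<in> {0..real k} then h t else 0)"
  have fi: "integral {0..} (f k) = integral {0..real k} h" for k
    unfolding f_def by (subst integral_restrict_Int) (simp add: Int_absorb1)
  have "h integrable_on {0..} \<and> (\<lambda>k. integral {0..} (f k)) \<longlonglongrightarrow> integral {0..} h"
  proof (rule monotone_convergence_increasing)
    show "f k integrable_on {0..}" for k
      unfolding f_def using int[of "real k"] by (subst integrable_restrict_Int) (simp add: Int_absorb1)
    show "f k x \<le> f (Suc k) x" for k x using h0 by (auto simp: f_def)
    show "(\<lambda>k. f k x) \<longlonglongrightarrow> h x" if "x \<in> {0..}" for x
    proof -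
      obtain n where "x \<le> real n" using real_arch_simple by blast
      then have "eventually (\<lambda>k. f k x = h x) sequentially"
        using that by (intro eventually_sequentiallyI[of n]) (auto simp: f_def)
      then show ?thesis by (simp add: tendsto_eventually)
    qed
    show "bounded (range (\<lambda>k. integral {0..} (f k)))"
    proof (rule boundedI)
      fix x assume "x \<in> range (\<lambda>k. integral {0..} (f k))"
      then obtain k where "x = integral {0..real k} h" using fi by auto
      then show "norm x \<le> Gamma (a + 1)"
        using le[of "real k"] mono[of 0 "real k"] by simp
    qed
  qed
  then have seq: "(\<lambda>k. integral {0..real k} h) \<longlonglongrightarrow> Gamma (a + 1)"
    using H fi by (simp add: integral_unique)
  show "((\<lambda>y. integral {0..y} h) \<longlongrightarrow> Gamma (a + 1)) at_top"
  proof (rule tendstoI)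
    fix e :: real assume "0 < e"
    then obtain k where k: "dist (integral {0..real k} h) (Gamma (a + 1)) < e"
      using tendstoD[OF seq, of e] by (auto simp: eventually_sequentially)
    show "eventually (\<lambda>y. dist (integral {0..y} h) (Gamma (a + 1)) < e) at_top"
      using eventually_ge_at_top[of "real k"]
    proof eventually_elim
      case (elim y)
      then show ?case using k le[of y] le[of "real k"] mono[OF elim] by (simp add: dist_real_def)
    qed
  qed
qed

text \<open>Integrate by parts and substitute \<open>t = x ^ r\<close>.\<close>

lemma expint_eq:
  assumes "0 \<le> y" "1 \<le> r"
  shows "expint r y = y * exp (- (y ^ r)) + integral {0..y ^ r} (\<lambda>t. t powr (1 / real r) * exp (- t))"
proof -
  have r: "0 < r" using assms by simp
  have "((\<lambda>x. (real r * x ^ (r - 1)) *\<^sub>R ((x ^ r) powr (1 / real r) * exp (- (x ^ r)))) has_integral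
      (integral {0 ^ r..y ^ r} (\<lambda>t. t powr (1 / real r) * exp (- t)))) {0..y}"
  proof (rule has_integral_substitution[where c = 0 and d = "y ^ r"])
    show "continuous_on {0..y ^ r} (\<lambda>t. t powr (1 / real r) * exp (- t))"
      using r by (intro gamma_kernel_continuous) auto
    show "((\<lambda>x. x ^ r) has_field_derivative real r * x ^ (r - 1)) (at x within {0..y})" for x
      by (auto intro!: derivative_eq_intros)
    show "(\<lambda>x. x ^ r) ` {0..y} \<subseteq> {0..y ^ r}" by (auto intro: power_mono)
  qed (use assms in \<open>auto intro: power_mono\<close>)
  then have "((\<lambda>x. real r * x ^ r * exp (- (x ^ r))) has_integral
      (integral {0 ^ r..y ^ r} (\<lambda>t. t powr (1 / real r) * exp (- t)))) {0..y}"
  proof (rule has_integral_eq[rotated])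
    fix x assume x: "x \<in> {0..y}"
    have "(x ^ r) powr (1 / real r) = x"
      using x r by (cases "x = 0") (auto simp: powr_realpow[symmetric] powr_powr)
    then show "(real r * x ^ (r - 1)) *\<^sub>R ((x ^ r) powr (1 / real r) * exp (- (x ^ r))) = real r * x ^ r * exp (- (x ^ r))"
      using r by (simp add: power_eq_if)
  qed
  then have A: "((\<lambda>x. real r * x ^ r * exp (- (x ^ r))) has_integral
      (integral {0..y ^ r} (\<lambda>t. t powr (1 / real r) * exp (- t)))) {0..y}"
    using r by (simp add: power_0_left)
  have "((\<lambda>x. exp (- (x ^ r)) - real r * x ^ r * exp (- (x ^ r))) has_integral
      (y * exp (- (y ^ r)) - 0 * exp (- (0 ^ r)))) {0..y}"
  proof (rule fundamental_theorem_of_calculus[OF assms(1)])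
    fix x
    have "((\<lambda>x. x * exp (- (x ^ r))) has_field_derivative
        (1 * exp (- (x ^ r)) + exp (- (x ^ r)) * - (real r * x ^ (r - 1)) * x)) (at x within {0..y})"
      by (auto intro!: derivative_eq_intros)
    also have "1 * exp (- (x ^ r)) + exp (- (x ^ r)) * - (real r * x ^ (r - 1)) * x
        = exp (- (x ^ r)) - real r * x ^ r * exp (- (x ^ r))"
      using r by (simp add: power_eq_if)
    finally show "((\<lambda>x. x * exp (- (x ^ r))) has_vector_derivative
        exp (- (x ^ r)) - real r * x ^ r * exp (- (x ^ r))) (at x within {0..y})"
      by (simp add: has_real_derivative_iff_has_vector_derivative)
  qed
  from has_integral_add[OF this A] show ?thesis
    by (auto simp: expint_def dest: integral_unique)
qed

lemma expint_tendsto: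
  assumes "1 \<le> r"
  shows "(expint r \<longlongrightarrow> Gamma (1 + 1 / real r)) at_top"
proof -
  have r: "0 < r" using assms by simp
  have lim: "filterlim (\<lambda>y::real. y ^ r) at_top at_top"
    by (intro filterlim_pow_at_top filterlim_ident r)
  have "((\<lambda>y::real. y * exp (- (y ^ r))) \<longlongrightarrow> 0) at_top"
  proof (rule tendsto_sandwich[where f = "\<lambda>_. 0" and h = "\<lambda>y. y ^ 1 / exp y"])
    show "((\<lambda>y::real. y ^ 1 / exp y) \<longlongrightarrow> 0) at_top" by (rule tendsto_power_div_exp_0)
    show "\<forall>\<^sub>F y::real in at_top. y * exp (- (y ^ r)) \<le> y ^ 1 / exp y"
      using eventually_ge_at_top[of 1]
    proof eventually_elim
      case (elim y)
      have "y ^ 1 \<le> y ^ r" using elim assms by (intro power_increasing) auto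
      then have "y * exp (- (y ^ r)) \<le> y * exp (- y)" using elim by (intro mult_left_mono) auto
      then show ?case by (simp add: exp_minus divide_inverse)
    qed
    show "\<forall>\<^sub>F y::real in at_top. 0 \<le> y * exp (- (y ^ r))"
      using eventually_ge_at_top[of 0] by eventually_elim auto
  qed auto
  moreover have "((\<lambda>y. integral {0..y ^ r} (\<lambda>t. t powr (1 / real r) * exp (- t))) \<longlongrightarrow> Gamma (1 / real r + 1)) at_top"
    using filterlim_compose[OF gamma_kernel_limit(1) lim] r by simp
  ultimately have "((\<lambda>y. y * exp (- (y ^ r)) + integral {0..y ^ r} (\<lambda>t. t powr (1 / real r) * exp (- t)))
      \<longlongrightarrow> 0 + Gamma (1 / real r + 1)) at_top"
    by (rule tendsto_add)
  then have "((\<lambda>y. y * exp (- (y ^ r)) + integral {0..y ^ r} (\<lambda>t. t powr (1 / real r) * exp (- t)))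
      \<longlongrightarrow> Gamma (1 + 1 / real r)) at_top" by (simp add: add.commute)
  then show ?thesis
  proof (rule tendsto_cong[THEN iffD1, rotated])
    show "\<forall>\<^sub>F y in at_top. y * exp (- (y ^ r)) + integral {0..y ^ r} (\<lambda>t. t powr (1 / real r) * exp (- t)) = expint r y"
      using eventually_ge_at_top[of 0] by eventually_elim (rule expint_eq[OF _ assms, symmetric])
  qed
qed

lemma expint_le_Gamma:
  assumes "1 \<le> r" "0 \<le> y"
  shows "expint r y \<le> Gamma (1 + 1 / real r)"
proof (rule tendsto_lowerbound[OF expint_tendsto[OF assms(1)]])
  show "\<forall>\<^sub>F x in at_top. expint r y \<le> expint r x"
    using eventually_ge_at_top[of y] by eventually_elim (use assms in \<open>auto intro: expint_mono\<close>)
qed simp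

lemma sum_exp_le:
  assumes "0 < c"
  shows "(\<Sum>u=1..t. exp (- ((c * real u) ^ r))) \<le> expint r (c * real t) / c"
proof (induction t)
  case (Suc t)
  have "c * exp (- ((c * real (Suc t)) ^ r)) \<le> expint r (c * real (Suc t)) - expint r (c * real t)"
    using expint_step(1)[of "c * real t" "c * real (Suc t)" r] assms by (simp add: algebra_simps)
  then have "exp (- ((c * real (Suc t)) ^ r)) \<le> expint r (c * real (Suc t)) / c - expint r (c * real t) / c"
    using assms by (simp add: field_simps)
  then show ?case using Suc by (subst sum.cl_ivl_Suc) simp
qed (simp add: expint_0)

lemma sum_exp_ge:
  assumes "0 < c"
  shows "expint r (c * real t) / c \<le> (\<Sum>u<t. exp (- ((c * real u) ^ r)))"
proof (induction t)
  case (Suc t)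
  have "expint r (c * real (Suc t)) - expint r (c * real t) \<le> c * exp (- ((c * real t) ^ r))"
    using expint_step(2)[of "c * real t" "c * real (Suc t)" r] assms by (simp add: algebra_simps)
  then have "expint r (c * real (Suc t)) / c - expint r (c * real t) / c \<le> exp (- ((c * real t) ^ r))"
    using assms by (simp add: field_simps)
  then show ?case using Suc by simp
qed (simp add: expint_0)

lemma binomial_power_le: "real (n choose r) \<le> real n ^ r / fact r"
proof -
  have "real ((n choose r) * fact r) \<le> real (n ^ r)"
    using binomial_fact_pow[of n r] by (subst of_nat_le_iff) simp
  then show ?thesis by (simp add: field_simps)
qed

lemma fact_binomial_prod: "fact r * real (n choose r) = (\<Prod>i=0..<r. real n - real i)"
  by (simp add: binomial_gbinomial gbinomial_prod_rev)

lemma binomial_power_ge: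
  assumes "r \<le> n"
  shows "real (n - r + 1) ^ r / fact r \<le> real (n choose r)"
proof -
  have "real (n - r + 1) ^ r = (\<Prod>i=0..<r. real (n - r + 1))" by simp
  also have "\<dots> \<le> (\<Prod>i=0..<r. real n - real i)"
    using assms by (intro prod_mono) (auto simp: of_nat_diff)
  finally show ?thesis unfolding fact_binomial_prod[symmetric] by (simp add: field_simps)
qed

text \<open>Use \<open>1 - p \<le> exp (- p)\<close>, bound the binomial coefficient below by a power and compare the sum with
  the integral of \<open>exp (- (x ^ r))\<close>. The terms with \<open>u < r\<close> are all \<open>1\<close> and give the summand \<open>r\<close>.\<close>

lemma sum_power_binomial_le:
  assumes r: "1 \<le> r" and p: "0 < p" "p \<le> 1"
  shows "(\<Sum>u<t. (1 - p) ^ (u choose r)) \<le> real r + Gamma (1 + 1 / real r) / (p / fact r) powr (1 / real r)"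
proof -
  define c where "c = (p / fact r) powr (1 / real r)"
  have c: "0 < c" "c ^ r = p / fact r"
    using p r by (auto simp: c_def powr_realpow[symmetric] powr_powr)
  have le: "(1 - p) ^ (u choose r) \<le> exp (- ((c * real (u - r + 1)) ^ r))" if "r \<le> u" for u
  proof -
    have "(1 - p) ^ (u choose r) \<le> exp (- p) ^ (u choose r)"
      using p exp_ge_add_one_self[of "- p"] by (intro power_mono) auto
    also have "\<dots> = exp (- (p * real (u choose r)))" by (simp add: exp_of_nat_mult[symmetric] mult.commute)
    also have "\<dots> \<le> exp (- (p * (real (u - r + 1) ^ r / fact r)))"
      unfolding exp_le_cancel_iff neg_le_iff_le
      using p by (intro mult_left_mono binomial_power_ge that) auto
    also have "p * (real (u - r + 1) ^ r / fact r) = (c * real (u - r + 1)) ^ r"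
      by (simp only: power_mult_distrib c(2)) simp
    finally show ?thesis .
  qed
  have "(\<Sum>u<t. (1 - p) ^ (u choose r)) \<le> (\<Sum>u<r + t. (1 - p) ^ (u choose r))"
    using p by (intro sum_mono2) auto
  also have "\<dots> = (\<Sum>u<r. (1 - p) ^ (u choose r)) + (\<Sum>u=r..<r + t. (1 - p) ^ (u choose r))"
    using sum.atLeastLessThan_concat[of 0 r "r + t" "\<lambda>u. (1 - p) ^ (u choose r)"] by (simp add: lessThan_atLeast0)
  also have "(\<Sum>u<r. (1 - p) ^ (u choose r)) \<le> (\<Sum>u<r. 1)"
    using p by (intro sum_mono power_le_one) auto
  also have "(\<Sum>u=r..<r + t. (1 - p) ^ (u choose r)) \<le> (\<Sum>u=r..<r + t. exp (- ((c * real (u - r + 1)) ^ r)))"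
    by (intro sum_mono le) auto
  also have "\<dots> = (\<Sum>u=1..t. exp (- ((c * real u) ^ r)))"
    by (intro sum.reindex_bij_witness[of _ "\<lambda>u. u + r - 1" "\<lambda>u. u - r + 1"]) auto
  also have "\<dots> \<le> expint r (c * real t) / c" by (rule sum_exp_le[OF c(1)])
  also have "\<dots> \<le> Gamma (1 + 1 / real r) / c"
    using expint_le_Gamma[OF r] c by (intro divide_right_mono) auto
  finally show ?thesis by (simp add: c_def)
qed

text \<open>Here the estimates are \<open>exp (- (p / (1 - p))) \<le> 1 - p\<close> and \<open>u choose r \<le> u ^ r / fact r\<close>.\<close>

lemma sum_power_binomial_ge:
  assumes r: "1 \<le> r" and p: "0 < p" "p < 1" and c: "c = (p / (1 - p) / fact r) powr (1 / real r)"
  shows "expint r (c * real t) / c \<le> (\<Sum>u<t. (1 - p) ^ (u choose r))"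
proof -
  have c0: "0 < c" "c ^ r = p / (1 - p) / fact r"
    using p r by (auto simp: c powr_realpow[symmetric] powr_powr)
  have ge: "exp (- ((c * real u) ^ r)) \<le> (1 - p) ^ (u choose r)" for u
  proof -
    have "exp (- (p / (1 - p))) \<le> 1 - p"
    proof -
      have "1 + p / (1 - p) \<le> exp (p / (1 - p))" by (rule exp_ge_add_one_self)
      moreover have "1 + p / (1 - p) = 1 / (1 - p)" using p by (simp add: field_simps)
      ultimately have "1 / (1 - p) \<le> exp (p / (1 - p))" by simp
      then show ?thesis using p by (simp add: exp_minus field_simps)
    qed
    then have "exp (- (p / (1 - p))) ^ (u choose r) \<le> (1 - p) ^ (u choose r)" by (intro power_mono) auto
    moreover have "exp (- (p / (1 - p))) ^ (u choose r) = exp (- (p / (1 - p) * real (u choose r)))"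
      by (simp add: exp_of_nat_mult[symmetric] mult.commute)
    moreover have "p / (1 - p) * real (u choose r) \<le> p / (1 - p) * (real u ^ r / fact r)"
      using binomial_power_le[of u r] p by (intro mult_left_mono) auto
    moreover have "p / (1 - p) * (real u ^ r / fact r) = (c * real u) ^ r"
      by (simp only: power_mult_distrib c0(2)) simp
    ultimately show ?thesis by (smt (verit) exp_le_cancel_iff)
  qed
  have "expint r (c * real t) / c \<le> (\<Sum>u<t. exp (- ((c * real u) ^ r)))" by (rule sum_exp_ge[OF c0(1)])
  also have "\<dots> \<le> (\<Sum>u<t. (1 - p) ^ (u choose r))" by (intro sum_mono ge)
  finally show ?thesis .
qed

lemma binomial_asymp: "(\<lambda>m. real (m choose r) / real m ^ r) \<longlonglongrightarrow> 1 / fact r"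
proof -
  have "(\<lambda>m. (\<Prod>i=0..<r. 1 - real i / real m) / fact r) \<longlonglongrightarrow> (\<Prod>i=0..<r. 1 - 0) / fact r"
    by (intro tendsto_intros lim_const_over_n) auto
  then have "(\<lambda>m. (\<Prod>i=0..<r. 1 - real i / real m) / fact r) \<longlonglongrightarrow> 1 / fact r" by simp
  then show ?thesis
  proof (rule Lim_transform_eventually)
    show "\<forall>\<^sub>F m in sequentially. (\<Prod>i=0..<r. 1 - real i / real m) / fact r = real (m choose r) / real m ^ r"
      using eventually_gt_at_top[of 0]
    proof eventually_elim
      case (elim m)
      have "(\<Prod>i=0..<r. 1 - real i / real m) = (\<Prod>i=0..<r. (real m - real i) / real m)"
        using elim by (intro prod.cong) (auto simp: field_simps)
      also have "\<dots> = (\<Prod>i=0..<r. real m - real i) / real m ^ r" by (simp add: prod_dividef)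
      also have "\<dots> = fact r * real (m choose r) / real m ^ r" by (simp add: fact_binomial_prod)
      finally show ?case by simp
    qed
  qed
qed

section \<open>Sequences of edges each ending before the next begins\<close>

text \<open>The edges of the complete \<open>r\<close>-uniform hypergraph on \<open>{1..m}\<close>.\<close>

definition redges :: "nat \<Rightarrow> nat \<Rightarrow> nat set set" where
  "redges r m = {e. e \<subseteq> {1..m} \<and> card e = r}"

lemma powr_at_top:
  fixes a :: real
  assumes "0 < a"
  shows "filterlim (\<lambda>x. x powr a) at_top at_top"
  unfolding filterlim_at_top
proof
  fix Z :: real
  show "\<forall>\<^sub>F x in at_top. Z \<le> x powr a"
    using eventually_ge_at_top[of "\<bar>Z\<bar> powr (1 / a)"]
  proof eventually_elim
    case (elim x)
    then have "(\<bar>Z\<bar> powr (1 / a)) powr a \<le> x powr a" using assms by (intro powr_mono2) auto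
    then show ?case using assms by (simp add: powr_powr)
  qed
qed

lemma finite_redges: "finite (redges r m)"
  by (rule finite_subset[of _ "Pow {1..m}"]) (auto simp: redges_def)

lemma card_redges: "card (redges r m) = m choose r"
  using n_subsets[of "{1..m}" r] by (simp add: redges_def)

definition before :: "nat set \<Rightarrow> nat set \<Rightarrow> bool" where
  "before e f \<longleftrightarrow> Max e < Min f"

definition possets :: "nat \<Rightarrow> nat set set" where
  "possets r = {e. finite e \<and> card e = r \<and> 0 \<notin> e}"

lemma possets_ini: "1 \<le> r \<Longrightarrow> {e \<in> possets r. Max e \<le> t} = redges r t"
proof (intro equalityI subsetI)
  fix e assume r: "1 \<le> r" and "e \<in> {e \<in> possets r. Max e \<le> t}"
  then have e: "finite e" "card e = r" "0 \<notin> e" "Max e \<le> t" by (auto simp: possets_def)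
  have "x \<in> {1..t}" if "x \<in> e" for x
    using Max_ge[OF e(1) that] e(3,4) that by (cases x) auto
  then show "e \<in> redges r t" using e by (auto simp: redges_def)
next
  fix e assume r: "1 \<le> r" and "e \<in> redges r t"
  then have e: "e \<subseteq> {1..t}" "card e = r" "finite e" by (auto simp: redges_def intro: finite_subset)
  have "e \<noteq> {}" using e r by auto
  then have "Max e \<in> e" using e by (intro Max_in) auto
  then show "e \<in> {e \<in> possets r. Max e \<le> t}" using e by (auto simp: possets_def)
qed

text \<open>The edges after \<open>z\<close> are those contained in the vertices beyond \<open>Max z\<close>, a translate of the vertex
  set.\<close>

lemma interval_renewal:
  assumes r: "1 \<le> r"
  shows "renewal (possets r) Max before (\<lambda>z e. (+) (Max z) ` e)"
proof
  have ne: "e \<noteq> {}" "finite e" "Min e \<le> Max e" "Max e \<in> e" "Min e \<in> e" "0 < Min e" if "e \<in> possets r" for e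
  proof -
    show e: "e \<noteq> {}" "finite e" using that r by (auto simp: possets_def)
    show "Max e \<in> e" "Min e \<in> e" using e by auto
    then show "Min e \<le> Max e" using e by auto
    show "0 < Min e" using \<open>Min e \<in> e\<close> that by (metis (no_types, lifting) mem_Collect_eq not_gr0 possets_def)
  qed
  have mono: "mono ((+) c)" for c :: nat by (auto simp: mono_def)
  have sh: "Max ((+) c ` e) = c + Max e" "Min ((+) c ` e) = c + Min e" if "e \<in> possets r" for c e
    using mono_Max_commute[OF mono, of e c] mono_Min_commute[OF mono, of e c] ne[OF that] by auto
  show "finite {x \<in> possets r. Max x \<le> t}" for t
    using finite_redges possets_ini[OF r] by simp
  show "0 < Max x" if "x \<in> possets r" for x using ne[OF that] by auto
  show "before x z" if "x \<in> possets r" "y \<in> possets r" "z \<in> possets r" "before x y" "before y z" for x y z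
    using that ne[of y] unfolding before_def by linarith
  show "Max ((+) (Max z) ` x) = Max z + Max x" if "z \<in> possets r" "x \<in> possets r" for z x
    using sh that by simp
  show "before ((+) (Max z) ` x) ((+) (Max z) ` y) = before x y"
    if "z \<in> possets r" "x \<in> possets r" "y \<in> possets r" for z x y
    using sh that by (simp add: before_def)
  show "bij_betw ((`) ((+) (Max z))) (possets r) {x \<in> possets r. before z x}" if z: "z \<in> possets r" for z
  proof (rule bij_betw_imageI)
    show "inj_on ((`) ((+) (Max z))) (possets r)"
      by (auto simp: inj_on_def inj_image_eq_iff)
    show "(`) ((+) (Max z)) ` possets r = {x \<in> possets r. before z x}"
    proof (intro equalityI subsetI)
      fix x assume "x \<in> (`) ((+) (Max z)) ` possets r"
      then obtain e where e: "e \<in> possets r" "x = (+) (Max z) ` e" by auto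
      have "x \<in> possets r" using e ne(6)[OF z] ne(4)[OF z] z by (auto simp: possets_def card_image)
      moreover have "before z x" using ne(6)[OF e(1)] sh(2)[OF e(1), of "Max z"] by (simp only: before_def e(2))
      ultimately show "x \<in> {x \<in> possets r. before z x}" by simp
    next
      fix x assume x: "x \<in> {x \<in> possets r. before z x}"
      then have lt: "Max z < y" if "y \<in> x" for y
      proof -
        have "Min x \<le> y" using that ne(2)[of x] x by (intro Min_le) auto
        then show ?thesis using x by (auto simp only: before_def mem_Collect_eq)
      qed
      define e where "e = (\<lambda>y. y - Max z) ` x"
      have "inj_on (\<lambda>y. y - Max z) x" using lt by (fastforce simp: inj_on_def)
      moreover have "0 \<notin> e"
      proof
        assume "0 \<in> e"
        then obtain y where "y \<in> x" "y - Max z = 0" by (auto simp: e_def)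
        with lt[of y] show False by simp
      qed
      ultimately have "e \<in> possets r" using x by (auto simp: e_def possets_def card_image)
      moreover have "x = (+) (Max z) ` e" using lt by (force simp: e_def image_image)
      ultimately show "x \<in> (`) ((+) (Max z)) ` possets r" by blast
    qed
  qed
qed

text \<open>No edge ends within the first \<open>u\<close> vertices with probability \<open>(1 - p) ^ (u choose r)\<close>, so the mean
  waiting time is the sum estimated in \<open>sum_power_binomial_le\<close> and \<open>sum_power_binomial_ge\<close>. The upper
  bound uses that the edge ending first is always an optimal start.\<close>

lemma interval_bounds:
  assumes r: "1 \<le> r"
  shows "0 < p \<Longrightarrow> p \<le> 1 \<Longrightarrow>
      real m / (real r + Gamma (1 + 1 / real r) / (p / fact r) powr (1 / real r)) - 1
        \<le> bexp p (redges r m) (\<lambda>G. real (largest (chain before) G))"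
    and "0 < p \<Longrightarrow> p < 1 \<Longrightarrow> c = (p / (1 - p) / fact r) powr (1 / real r) \<Longrightarrow> 0 < y \<Longrightarrow> y \<le> c * real B \<Longrightarrow>
      bexp p (redges r m) (\<lambda>G. real (largest (chain before) G)) \<le> c * (real m + real B) / expint r y"
proof -
  interpret renewal "possets r" Max before "\<lambda>z e. (+) (Max z) ` e" by (rule interval_renewal[OF r])
  have ini: "ini t = redges r t" for t unfolding ini_def by (rule possets_ini[OF r])
  have mh: "mean_height p m = bexp p (redges r m) (\<lambda>G. real (largest (chain before) G))"
    by (simp add: mean_height_def ini)
  have r1: "1 - reach p 1 u = (1 - p) ^ (u choose r)" if "0 \<le> p" "p \<le> 1" for u
    using reach_1[OF that] by (simp add: ini card_redges)
  show "real m / (real r + Gamma (1 + 1 / real r) / (p / fact r) powr (1 / real r)) - 1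
        \<le> bexp p (redges r m) (\<lambda>G. real (largest (chain before) G))" if p: "0 < p" "p \<le> 1"
  proof -
    define \<mu> where "\<mu> = real r + Gamma (1 + 1 / real r) / (p / fact r) powr (1 / real r)"
    have "0 \<le> Gamma (1 + 1 / real r)" using Gamma_real_pos[of "1 + 1 / real r"] r by (simp add: add_pos_nonneg less_imp_le)
    then have "0 < \<mu>" using r p by (auto simp: \<mu>_def intro!: add_pos_nonneg divide_nonneg_nonneg)
    moreover have "(\<Sum>u<t. 1 - reach p 1 u) \<le> \<mu>" for t
    proof -
      have "(\<Sum>u<t. 1 - reach p 1 u) = (\<Sum>u<t. (1 - p) ^ (u choose r))" using p by (intro sum.cong refl r1) auto
      then show ?thesis using sum_power_binomial_le[OF r p, of t] by (simp add: \<mu>_def)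
    qed
    ultimately have "real 1 / \<mu> * real m - real 1 \<le> mean_height p m"
      using p by (intro mean_height_ge) auto
    then show ?thesis by (simp add: mh \<mu>_def)
  qed
  show "bexp p (redges r m) (\<lambda>G. real (largest (chain before) G)) \<le> c * (real m + real B) / expint r y"
    if p: "0 < p" "p < 1" and c: "c = (p / (1 - p) / fact r) powr (1 / real r)" and y: "0 < y" "y \<le> c * real B"
  proof -
    have c0: "0 < c" using p by (simp add: c)
    define \<mu> where "\<mu> = (\<Sum>u<B. 1 - reach p 1 u)"
    have "0 < expint r y"
      using expint_step(1)[of 0 y r] y by (simp add: expint_0) (smt (verit) exp_gt_zero mult_pos_pos)
    moreover have "expint r y \<le> expint r (c * real B)" using y by (intro expint_mono) auto
    moreover have "expint r (c * real B) / c \<le> \<mu>"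
    proof -
      have "\<mu> = (\<Sum>u<B. (1 - p) ^ (u choose r))" unfolding \<mu>_def using p by (intro sum.cong refl r1) auto
      then show ?thesis using sum_power_binomial_ge[OF r p c, of B] by simp
    qed
    ultimately have \<mu>: "0 < expint r y / c" "expint r y / c \<le> \<mu>"
      using c0 divide_right_mono[of "expint r y" "expint r (c * real B)" c] by auto
    have "mean_height p m \<le> (real m + real B) / \<mu>"
    proof (rule mean_height_le)
      fix x y z assume "x \<in> possets r" "y \<in> possets r" "Max x \<le> Max y" "before y z"
      then show "before x z" by (simp add: before_def)
    qed (use p \<mu> \<mu>_def in auto)
    also have "\<dots> \<le> (real m + real B) / (expint r y / c)"
      using \<mu> by (intro divide_left_mono mult_pos_pos) auto
    finally show ?thesis using c0 by (simp add: mh field_simps)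
  qed
qed

lemma intensity_limits:
  assumes r: "1 \<le> r" and l: "0 < (l :: real)"
  shows "(\<lambda>m. l / real (m choose r)) \<longlonglongrightarrow> 0"
    and "(\<lambda>m. real m * (l / real (m choose r) / fact r) powr (1 / real r)) \<longlonglongrightarrow> l powr (1 / real r)"
    and "(\<lambda>m. real m * (l / real (m choose r) / (1 - l / real (m choose r)) / fact r) powr (1 / real r)) \<longlonglongrightarrow> l powr (1 / real r)"
proof -
  define p where "p = (\<lambda>m. l / real (m choose r))"
  have r0: "0 < r" using r by simp
  have pm: "(\<lambda>m. p m * real m ^ r) \<longlonglongrightarrow> l * fact r"
  proof (rule Lim_transform_eventually)
    have "(\<lambda>m. l / (real (m choose r) / real m ^ r)) \<longlonglongrightarrow> l / (1 / fact r)"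
      by (intro tendsto_intros binomial_asymp) auto
    then show "(\<lambda>m. l / (real (m choose r) / real m ^ r)) \<longlonglongrightarrow> l * fact r" by simp
  qed (auto simp: p_def)
  have inv: "(\<lambda>m. 1 / real m ^ r) \<longlonglongrightarrow> 0"
    using r0 by (intro tendsto_divide_0[OF tendsto_const] filterlim_at_top_imp_at_infinity
        filterlim_pow_at_top filterlim_real_sequentially)
  have p0: "p \<longlonglongrightarrow> 0"
  proof (rule Lim_transform_eventually)
    show "(\<lambda>m. p m * real m ^ r * (1 / real m ^ r)) \<longlonglongrightarrow> 0"
      using tendsto_mult[OF pm inv] by simp
    show "\<forall>\<^sub>F m in sequentially. p m * real m ^ r * (1 / real m ^ r) = p m"
      using eventually_gt_at_top[of 0] by eventually_elim simp
  qed
  then show "(\<lambda>m. l / real (m choose r)) \<longlonglongrightarrow> 0" by (simp add: p_def)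
  have root: "(\<lambda>m. real m * (q m / fact r) powr (1 / real r)) \<longlonglongrightarrow> l powr (1 / real r)"
    if q: "(\<lambda>m. q m * real m ^ r) \<longlonglongrightarrow> l * fact r" "\<forall>\<^sub>F m in sequentially. 0 \<le> q m" for q
  proof (rule Lim_transform_eventually)
    have "(\<lambda>m. q m * real m ^ r / fact r) \<longlonglongrightarrow> l * fact r / fact r" by (intro tendsto_intros q) auto
    then have "(\<lambda>m. (q m * real m ^ r / fact r) powr (1 / real r)) \<longlonglongrightarrow> (l * fact r / fact r) powr (1 / real r)"
      using l by (intro tendsto_powr) auto
    then show "(\<lambda>m. (q m * real m ^ r / fact r) powr (1 / real r)) \<longlonglongrightarrow> l powr (1 / real r)" by simp
    show "\<forall>\<^sub>F m in sequentially. (q m * real m ^ r / fact r) powr (1 / real r) = real m * (q m / fact r) powr (1 / real r)"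
      using eventually_gt_at_top[of 0] q(2)
    proof eventually_elim
      case (elim m)
      have "(real m ^ r) powr (1 / real r) = real m"
        using elim r0 by (simp add: powr_realpow[symmetric] powr_powr)
      then show ?case using elim powr_mult[of "q m / fact r" "real m ^ r" "1 / real r"] by (simp add: mult.commute)
    qed
  qed
  show "(\<lambda>m. real m * (l / real (m choose r) / fact r) powr (1 / real r)) \<longlonglongrightarrow> l powr (1 / real r)"
    using root[OF pm] l by (simp add: p_def)
  have "(\<lambda>m. p m * real m ^ r / (1 - p m)) \<longlonglongrightarrow> l * fact r / (1 - 0)"
    by (intro tendsto_intros pm p0) auto
  then have "(\<lambda>m. p m / (1 - p m) * real m ^ r) \<longlonglongrightarrow> l * fact r" by simp
  moreover have "\<forall>\<^sub>F m in sequentially. 0 \<le> p m / (1 - p m)"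
  proof -
    have "\<forall>\<^sub>F m in sequentially. p m < 1" using p0 by (rule order_tendstoD) simp
    then show ?thesis by eventually_elim (use l in \<open>simp add: p_def\<close>)
  qed
  ultimately show "(\<lambda>m. real m * (l / real (m choose r) / (1 - l / real (m choose r)) / fact r) powr (1 / real r)) \<longlonglongrightarrow> l powr (1 / real r)"
    using root[of "\<lambda>m. p m / (1 - p m)"] by (simp add: p_def)
qed

text \<open>The mean of \<open>F\<close> at a random hypergraph with mean number of edges \<open>l = p * (m choose r)\<close> is about
  \<open>b * l powr (1 / r)\<close> in the double limit where first \<open>m\<close> and then \<open>l\<close> tends to infinity. The order
  of these limits is the order of the quantifiers: how large \<open>m\<close> has to be depends on a bound \<open>U\<close> for
  \<open>l\<close>, as \<open>m\<close> must be large enough for disjoint edges to be typical.\<close>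

definition has_mean_constant :: "nat \<Rightarrow> (nat set set \<Rightarrow> real) \<Rightarrow> real \<Rightarrow> bool" where
  "has_mean_constant r F b \<longleftrightarrow> (\<forall>\<epsilon>>0. \<exists>l0>0. \<forall>U. \<exists>m0. \<forall>m\<ge>m0. \<forall>p. 0 \<le> p \<longrightarrow> p \<le> 1 \<longrightarrow>
     l0 \<le> p * real (m choose r) \<longrightarrow> p * real (m choose r) \<le> U \<longrightarrow>
     \<bar>bexp p (redges r m) F - b * (p * real (m choose r)) powr (1 / real r)\<bar>
       \<le> \<epsilon> * (p * real (m choose r)) powr (1 / real r))"

lemma has_mean_constantD:
  assumes "has_mean_constant r F b" "0 < \<epsilon>" "1 \<le> r"
  shows "\<exists>l0>0. \<forall>l\<ge>l0. eventually (\<lambda>m. 0 < l / real (m choose r) \<and> l / real (m choose r) < 1 \<and>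
     \<bar>bexp (l / real (m choose r)) (redges r m) F - b * l powr (1 / real r)\<bar> \<le> \<epsilon> * l powr (1 / real r)) sequentially"
proof -
  obtain l0 where l0: "l0 > 0" "\<And>U. \<exists>m0. \<forall>m\<ge>m0. \<forall>p. 0 \<le> p \<longrightarrow> p \<le> 1 \<longrightarrow>
     l0 \<le> p * real (m choose r) \<longrightarrow> p * real (m choose r) \<le> U \<longrightarrow>
     \<bar>bexp p (redges r m) F - b * (p * real (m choose r)) powr (1 / real r)\<bar>
       \<le> \<epsilon> * (p * real (m choose r)) powr (1 / real r)"
    using assms(1,2) unfolding has_mean_constant_def by metis
  show ?thesis
  proof (rule exI[of _ l0], rule conjI[OF l0(1)], intro allI impI)
    fix l assume l: "l0 \<le> l"
    then have lpos: "0 < l" using l0 by simp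
    obtain m0 where m0: "\<And>m p. m \<ge> m0 \<Longrightarrow> 0 \<le> p \<Longrightarrow> p \<le> 1 \<Longrightarrow>
     l0 \<le> p * real (m choose r) \<Longrightarrow> p * real (m choose r) \<le> l \<Longrightarrow>
     \<bar>bexp p (redges r m) F - b * (p * real (m choose r)) powr (1 / real r)\<bar>
       \<le> \<epsilon> * (p * real (m choose r)) powr (1 / real r)" using l0(2)[of l] by blast
    have "\<forall>\<^sub>F m in sequentially. l / real (m choose r) < 1"
      using intensity_limits(1)[OF assms(3) lpos] by (rule order_tendstoD) simp
    then show "eventually (\<lambda>m. 0 < l / real (m choose r) \<and> l / real (m choose r) < 1 \<and>
     \<bar>bexp (l / real (m choose r)) (redges r m) F - b * l powr (1 / real r)\<bar> \<le> \<epsilon> * l powr (1 / real r)) sequentially"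
      using eventually_ge_at_top[of m0] eventually_ge_at_top[of r]
    proof eventually_elim
      case (elim m)
      have C: "0 < real (m choose r)" using elim by simp
      then show ?case using m0[OF elim(2), of "l / real (m choose r)"] elim(1) l lpos by simp
    qed
  qed
qed

text \<open>Let \<open>m\<close> tend to infinity in both bounds with \<open>l\<close> fixed, then \<open>l\<close>. In the upper bound the truncation
  level is the fraction \<open>t\<close> of \<open>m\<close>; on the scale of one waiting time this still tends to infinity
  with \<open>l\<close>, and \<open>t\<close> is arbitrarily small.\<close>

lemma interval_constant:
  assumes r: "1 \<le> r" and b: "has_mean_constant r (\<lambda>G. real (largest (chain before) G)) b"
  shows "b = 1 / Gamma (1 + 1 / real r)"
proof (rule antisym)
  define g where "g = Gamma (1 + 1 / real r)"
  have g: "0 < g" unfolding g_def by (intro Gamma_real_pos add_pos_nonneg) auto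
  define a where "a = 1 / real r"
  have a: "0 < a" using r by (simp add: a_def)
  define p where "p = (\<lambda>l m. l / real (m choose r))"
  define E where "E = (\<lambda>p m. bexp p (redges r m) (\<lambda>G. real (largest (chain before) G)))"
  have large: "\<exists>l\<ge>l0. x \<le> l powr a" for x l0 :: real
  proof -
    define l where "l = max (max l0 1) (\<bar>x\<bar> powr (1 / a))"
    have "(\<bar>x\<bar> powr (1 / a)) powr a \<le> l powr a" using a by (intro powr_mono2) (auto simp: l_def)
    then have "x \<le> l powr a" using a by (simp add: powr_powr)
    then show ?thesis by (intro exI[of _ l]) (auto simp: l_def)
  qed
  show "1 / Gamma (1 + 1 / real r) \<le> b"
  proof (rule field_le_epsilon)
    fix e :: real assume "0 < e"
    then have e: "0 < e / 2" by simp
    have "\<exists>l0>0. \<forall>l\<ge>l0. eventually (\<lambda>m. 0 < p l m \<and> p l m < 1 \<and>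
     \<bar>E (p l m) m - b * l powr a\<bar> \<le> e / 2 * l powr a) sequentially"
      unfolding p_def E_def a_def by (rule has_mean_constantD[OF b e r])
    then obtain l0 where l0: "0 < l0" "\<And>l. l0 \<le> l \<Longrightarrow> eventually (\<lambda>m. 0 < p l m \<and> p l m < 1 \<and>
     \<bar>E (p l m) m - b * l powr a\<bar> \<le> e / 2 * l powr a) sequentially" by blast
    obtain l where l: "l0 \<le> l" "2 / e \<le> l powr a" using large by blast
    have lpos: "0 < l" using l l0 by simp
    define c where "c = (\<lambda>m. (p l m / fact r) powr a)"
    have mc: "(\<lambda>m. real m * c m) \<longlonglongrightarrow> l powr a"
      using intensity_limits(2)[OF r lpos] by (simp add: c_def p_def a_def)
    have c0: "c \<longlonglongrightarrow> 0"
    proof (rule Lim_transform_eventually)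
      show "(\<lambda>m. real m * c m * (1 / real m)) \<longlonglongrightarrow> 0"
        using tendsto_mult[OF mc lim_1_over_n] by simp
      show "\<forall>\<^sub>F m in sequentially. real m * c m * (1 / real m) = c m"
        using eventually_gt_at_top[of 0] by eventually_elim simp
    qed
    have "(\<lambda>m. real m * c m / (real r * c m + g) - 1) \<longlonglongrightarrow> l powr a / (real r * 0 + g) - 1"
      using g by (intro tendsto_intros mc c0) auto
    moreover have "eventually (\<lambda>m. real m * c m / (real r * c m + g) - 1 \<le> (b + e / 2) * l powr a) sequentially"
      using l0(2)[OF l(1)]
    proof eventually_elim
      case (elim m)
      have cpos: "0 < c m" using elim by (simp add: c_def)
      have "real m / (real r + g / c m) - 1 \<le> E (p l m) m"
        using interval_bounds(1)[OF r, of "p l m" m] elim by (simp add: E_def c_def g_def a_def)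
      moreover have "real m / (real r + g / c m) = real m * c m / (real r * c m + g)"
        using cpos g by (simp add: field_simps)
      moreover have "E (p l m) m - b * l powr a \<le> e / 2 * l powr a"
        using elim abs_ge_self[of "E (p l m) m - b * l powr a"] by linarith
      ultimately show ?case by (simp add: algebra_simps)
    qed
    ultimately have "l powr a / (real r * 0 + g) - 1 \<le> (b + e / 2) * l powr a"
      by (rule tendsto_upperbound) simp
    also have "(b + e / 2) * l powr a \<le> (b + e) * l powr a - 1"
      using l(2) \<open>0 < e\<close> by (simp add: field_simps)
    finally have "1 / g * l powr a \<le> (b + e) * l powr a" by simp
    then show "1 / Gamma (1 + 1 / real r) \<le> b + e"
      using lpos unfolding g_def[symmetric] by (subst (asm) mult_le_cancel_right) (auto simp: not_less)
  qed
  show "b \<le> 1 / Gamma (1 + 1 / real r)"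
  proof -
    have main: "b - e \<le> (1 + t) / g" if e: "0 < e" and t: "0 < t" for e t
    proof -
      have "\<exists>l0>0. \<forall>l\<ge>l0. eventually (\<lambda>m. 0 < p l m \<and> p l m < 1 \<and>
       \<bar>E (p l m) m - b * l powr a\<bar> \<le> e * l powr a) sequentially"
        unfolding p_def E_def a_def by (rule has_mean_constantD[OF b e r])
      then obtain l0 where l0: "0 < l0" "\<And>l. l0 \<le> l \<Longrightarrow> eventually (\<lambda>m. 0 < p l m \<and> p l m < 1 \<and>
       \<bar>E (p l m) m - b * l powr a\<bar> \<le> e * l powr a) sequentially" by blast
      have step: "b - e \<le> (1 + t) / expint r (t / 2 * l powr a)" if l: "l0 \<le> l" for l
      proof -
        have lpos: "0 < l" using l l0 by simp
        define X where "X = l powr a"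
        have X: "0 < X" using lpos by (simp add: X_def)
        define y where "y = t / 2 * X"
        have y: "0 < y" using t X by (simp add: y_def)
        define c where "c = (\<lambda>m. (p l m / (1 - p l m) / fact r) powr a)"
        have mc: "(\<lambda>m. real m * c m) \<longlonglongrightarrow> X"
          using intensity_limits(3)[OF r lpos] by (simp add: c_def p_def a_def X_def)
        have "eventually (\<lambda>m. X / 2 < real m * c m) sequentially"
          using mc by (rule order_tendstoD) (use X in simp)
        then have ev: "eventually (\<lambda>m. (b - e) * X \<le> real m * c m * (1 + t + 1 / real m) / expint r y) sequentially"
          using l0(2)[OF l] eventually_gt_at_top[of 0]
        proof eventually_elim
          case (elim m)
          define B where "B = nat \<lceil>t * real m\<rceil>"
          have "0 \<le> t * real m" using t by simp
          then have "0 \<le> \<lceil>t * real m\<rceil>" by linarith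
          then have "real B = of_int \<lceil>t * real m\<rceil>" by (simp add: B_def)
          then have B: "t * real m \<le> real B" "real B \<le> t * real m + 1" by linarith+
          have c0: "0 \<le> c m" by (simp add: c_def)
          have "y \<le> t * (real m * c m)" using elim(1) t by (simp add: y_def)
          also have "\<dots> \<le> c m * real B" using mult_left_mono[OF B(1) c0] by (simp add: ac_simps)
          finally have "E (p l m) m \<le> c m * (real m + real B) / expint r y"
            using interval_bounds(2)[OF r, of "p l m" "c m" y B m] elim y by (simp add: E_def c_def a_def)
          also have "\<dots> \<le> c m * (real m * (1 + t + 1 / real m)) / expint r y"
          proof (intro divide_right_mono mult_left_mono c0)
            show "real m + real B \<le> real m * (1 + t + 1 / real m)" using B(2) elim(3) by (simp add: algebra_simps)
            show "0 \<le> expint r y" using expint_mono[of 0 y r] y by (simp add: expint_0)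
          qed
          finally have "E (p l m) m \<le> real m * c m * (1 + t + 1 / real m) / expint r y"
            by (simp only: ac_simps)
          moreover have "- (E (p l m) m - b * X) \<le> e * X"
            unfolding X_def using elim abs_ge_minus_self[of "E (p l m) m - b * l powr a"] by linarith
          ultimately show ?case by (simp only: left_diff_distrib)
        qed
        have "(\<lambda>m. real m * c m * (1 + t + 1 / real m) / expint r y) \<longlonglongrightarrow> X * (1 + t + 0) / expint r y"
        proof -
          have "0 < expint r y"
            using expint_step(1)[of 0 y r] y by (simp add: expint_0) (smt (verit) exp_gt_zero mult_pos_pos)
          then show ?thesis by (intro tendsto_intros mc lim_1_over_n) auto
        qed
        then have "(b - e) * X \<le> X * (1 + t + 0) / expint r y"
          by (rule tendsto_lowerbound[OF _ ev]) simp
        then have "(b - e) * X \<le> (1 + t) / expint r y * X" by (simp add: mult.commute)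
        then show ?thesis using X unfolding y_def X_def[symmetric]
          by (subst (asm) mult_le_cancel_right) auto
      qed
      have "filterlim (\<lambda>l. t / 2 * l powr a) at_top at_top"
        using t by (intro filterlim_tendsto_pos_mult_at_top[OF tendsto_const] powr_at_top a) auto
      then have "((\<lambda>l. expint r (t / 2 * l powr a)) \<longlongrightarrow> g) at_top"
        using filterlim_compose[OF expint_tendsto[OF r]] by (simp add: g_def)
      then have "((\<lambda>l. (1 + t) / expint r (t / 2 * l powr a)) \<longlongrightarrow> (1 + t) / g) at_top"
        using g by (intro tendsto_intros) auto
      moreover have "\<forall>\<^sub>F l in at_top. b - e \<le> (1 + t) / expint r (t / 2 * l powr a)"
        using eventually_ge_at_top[of l0] by eventually_elim (rule step)
      ultimately show ?thesis by (rule tendsto_lowerbound) simp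
    qed
    show ?thesis
    proof (rule field_le_epsilon)
      fix e :: real assume e: "0 < e"
      have "b - e / 2 \<le> (1 + g * e / 2) / g" using main[of "e / 2" "g * e / 2"] e g by simp
      also have "\<dots> = 1 / g + e / 2" using g by (simp add: add_divide_distrib)
      finally show "b \<le> 1 / Gamma (1 + 1 / real r) + e" by (simp add: g_def)
    qed
  qed
qed

section \<open>Random matchings inside random hypergraphs\<close>

lemma order_isomorphic_sym:
  assumes "order_isomorphic M N"
  shows "order_isomorphic N M"
proof -
  obtain \<phi> where \<phi>: "bij_betw \<phi> (\<Union>M) (\<Union>N)" "strict_mono_on (\<Union>M) \<phi>" "(\<lambda>e. \<phi> ` e) ` M = N"
    using assms unfolding order_isomorphic_def by blast
  define \<psi> where "\<psi> = inv_into (\<Union>M) \<phi>"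
  have inv: "\<psi> (\<phi> x) = x" if "x \<in> \<Union>M" for x
    unfolding \<psi>_def using \<phi>(1) that by (auto simp: bij_betw_def intro!: inv_into_f_f)
  have "bij_betw \<psi> (\<Union>N) (\<Union>M)" unfolding \<psi>_def by (rule bij_betw_inv_into[OF \<phi>(1)])
  moreover have "strict_mono_on (\<Union>N) \<psi>"
  proof (rule strict_mono_onI)
    fix y z assume yz: "y \<in> \<Union>N" "z \<in> \<Union>N" "y < z"
    obtain a b where ab: "a \<in> \<Union>M" "b \<in> \<Union>M" "y = \<phi> a" "z = \<phi> b"
      using yz \<phi>(1) unfolding bij_betw_def by (metis imageE)
    have "a < b"
    proof (rule ccontr)
      assume "\<not> a < b"
      then have "b = a \<or> b < a" by auto
      then show False using strict_mono_onD[OF \<phi>(2) ab(2,1)] ab yz by auto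
    qed
    then show "\<psi> y < \<psi> z" using inv ab by simp
  qed
  moreover have "(\<lambda>e. \<psi> ` e) ` N = M"
  proof -
    have "\<psi> ` \<phi> ` e = e" if "e \<in> M" for e
    proof -
      have "\<psi> ` \<phi> ` e = (\<lambda>x. x) ` e" unfolding image_image using inv that by (intro image_cong) auto
      then show ?thesis by simp
    qed
    then have "(\<lambda>e. \<psi> ` \<phi> ` e) ` M = (\<lambda>e. e) ` M" by (intro image_cong) auto
    then show ?thesis unfolding \<phi>(3)[symmetric] image_image by simp
  qed
  ultimately show ?thesis unfolding order_isomorphic_def by blast
qed

lemma order_isomorphic_trans:
  assumes "order_isomorphic L M" "order_isomorphic M N"
  shows "order_isomorphic L N"
proof -
  obtain \<phi> where \<phi>: "bij_betw \<phi> (\<Union>L) (\<Union>M)" "strict_mono_on (\<Union>L) \<phi>" "(\<lambda>e. \<phi> ` e) ` L = M"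
    using assms unfolding order_isomorphic_def by blast
  obtain \<psi> where \<psi>: "bij_betw \<psi> (\<Union>M) (\<Union>N)" "strict_mono_on (\<Union>M) \<psi>" "(\<lambda>e. \<psi> ` e) ` M = N"
    using assms unfolding order_isomorphic_def by blast
  have "strict_mono_on (\<Union>L) (\<psi> \<circ> \<phi>)"
  proof (rule strict_mono_onI)
    fix x y assume xy: "x \<in> \<Union>L" "y \<in> \<Union>L" "x < y"
    have "\<phi> x \<in> \<Union>M" "\<phi> y \<in> \<Union>M" using xy \<phi>(1) unfolding bij_betw_def by blast+
    then show "(\<psi> \<circ> \<phi>) x < (\<psi> \<circ> \<phi>) y"
      using strict_mono_onD[OF \<psi>(2)] strict_mono_onD[OF \<phi>(2)] xy by simp
  qed
  moreover have "bij_betw (\<psi> \<circ> \<phi>) (\<Union>L) (\<Union>N)" using \<phi>(1) \<psi>(1) by (rule bij_betw_trans)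
  moreover have "(\<lambda>e. (\<psi> \<circ> \<phi>) ` e) ` L = N"
    using \<phi>(3) \<psi>(3) by (auto simp: image_comp[symmetric] image_image[symmetric])
  ultimately show ?thesis unfolding order_isomorphic_def by blast
qed

lemma order_isomorphic_image:
  assumes "strict_mono_on (\<Union>M) \<phi>"
  shows "order_isomorphic ((\<lambda>e. \<phi> ` e) ` M) N \<longleftrightarrow> order_isomorphic M N"
proof -
  have "inj_on \<phi> (\<Union>M)" using assms by (rule strict_mono_on_imp_inj_on)
  then have "bij_betw \<phi> (\<Union>M) (\<Union>((\<lambda>e. \<phi> ` e) ` M))" by (auto simp: bij_betw_def)
  then have "order_isomorphic M ((\<lambda>e. \<phi> ` e) ` M)" unfolding order_isomorphic_def using assms by blast
  from order_isomorphic_trans[OF this] order_isomorphic_trans[OF order_isomorphic_sym[OF this]]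
  show ?thesis by (rule iffI)
qed

lemma hereditary_clique: "hereditary (is_clique P)"
  unfolding hereditary_def is_clique_def by (meson empty_iff subsetD)

lemma max_clique_largest: "max_clique P = largest (is_clique P)"
  by (simp add: fun_eq_iff max_clique_def largest_def)

lemma max_clique_image:
  assumes "strict_mono_on (\<Union>M) \<phi>"
  shows "max_clique P ((\<lambda>e. \<phi> ` e) ` M) = max_clique P M"
  unfolding max_clique_largest
proof (rule largest_image)
  have inj: "inj_on \<phi> (\<Union>M)" using assms by (rule strict_mono_on_imp_inj_on)
  have eq: "\<phi> ` e = \<phi> ` f \<longleftrightarrow> e = f" if "e \<in> M" "f \<in> M" for e f
    using that inj by (intro inj_on_image_eq_iff) auto
  then show "inj_on (\<lambda>e. \<phi> ` e) M" by (auto simp: inj_on_def)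
  fix K assume K: "K \<subseteq> M"
  have "order_isomorphic {\<phi> ` e, \<phi> ` f} P \<longleftrightarrow> order_isomorphic {e, f} P" if "e \<in> K" "f \<in> K" for e f
  proof -
    have "strict_mono_on (\<Union>{e, f}) \<phi>" using assms K that by (auto simp: monotone_on_def)
    from order_isomorphic_image[OF this] show ?thesis by simp
  qed
  then show "is_clique P ((\<lambda>e. \<phi> ` e) ` K) \<longleftrightarrow> is_clique P K"
    using eq K unfolding is_clique_def by (simp add: subset_iff)
qed

definition matchings :: "nat \<Rightarrow> nat set \<Rightarrow> nat set set set" where
  "matchings r U = {M. is_matching r U M}"

lemma card_matching:
  assumes "is_matching r U M" "1 \<le> r"
  shows "card U = r * card M" "finite M"
proof -
  have U: "finite U" "partition_on U M" "\<forall>e\<in>M. card e = r" using assms by (auto simp: is_matching_def)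
  show "finite M" using U finite_elements by blast
  have "card (\<Union>M) = (\<Sum>e\<in>M. card e)"
    using U assms(2) by (intro card_Union_disjoint) (auto simp: partition_on_def pairwise_def disjnt_def
        intro: card_ge_0_finite)
  then show "card U = r * card M" using U by (simp add: partition_on_def)
qed

lemma finite_matchings: "finite U \<Longrightarrow> finite (matchings r U)"
  by (rule finite_subset[OF _ finitely_many_partition_on[of U]]) (auto simp: matchings_def is_matching_def)

lemma matching_image:
  assumes M: "is_matching r U M" and inj: "inj_on \<phi> U" and r: "1 \<le> r"
  shows "is_matching r (\<phi> ` U) ((\<lambda>e. \<phi> ` e) ` M)"
proof -
  have U: "finite U" "partition_on U M" "\<forall>e\<in>M. card e = r" using M by (auto simp: is_matching_def)
  have "{} \<notin> M" using U by (auto simp: partition_on_def)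
  then have "(\<lambda>e. \<phi> ` e) ` M - {{}} = (\<lambda>e. \<phi> ` e) ` M" by auto
  then have "partition_on (\<phi> ` U) ((\<lambda>e. \<phi> ` e) ` M)"
    using partition_on_inj_image[OF U(2) inj] by simp
  moreover have "card (\<phi> ` e) = r" if "e \<in> M" for e
  proof -
    have "e \<subseteq> U" using that U(2) by (auto simp: partition_on_def)
    then show ?thesis using inj U(3) that by (simp add: card_image inj_on_subset)
  qed
  ultimately show ?thesis using U by (auto simp: is_matching_def)
qed

text \<open>Relabelling the vertices monotonically turns matchings on any \<open>U\<close> into matchings on
  \<open>{1..card U}\<close>.\<close>

lemma sum_matchings_relabel:
  assumes U: "finite U" and r: "1 \<le> r"
    and F: "\<And>M \<phi>. is_matching r {1..card U} M \<Longrightarrow> strict_mono_on {1..card U} \<phi> \<Longrightarrow> F ((\<lambda>e. \<phi> ` e) ` M) = F M"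
  shows "(\<Sum>G\<in>matchings r U. F G) = (\<Sum>M\<in>matchings r {1..card U}. F M :: real)"
proof -
  obtain h where h: "bij_betw h {..<card U} U" "strict_mono_on {..<card U} h"
    using ex_bij_betw_strict_mono_card[OF U] .
  define \<phi> where "\<phi> = (\<lambda>i. h (i - 1))"
  have sm: "strict_mono_on {1..card U} \<phi>"
  proof (rule strict_mono_onI)
    fix x y :: nat assume "x \<in> {1..card U}" "y \<in> {1..card U}" "x < y"
    then show "\<phi> x < \<phi> y" unfolding \<phi>_def by (intro strict_mono_onD[OF h(2)]) auto
  qed
  have inj: "inj_on \<phi> {1..card U}" using sm by (rule strict_mono_on_imp_inj_on)
  have im: "\<phi> ` {1..card U} = U"
  proof -
    have "\<phi> ` {1..card U} = h ` (\<lambda>i. i - 1) ` {1..card U}" by (simp add: \<phi>_def image_image)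
    also have "(\<lambda>i. i - 1) ` {1..card U} = {..<card U}"
    proof (intro equalityI subsetI)
      fix x assume "x \<in> {..<card U}"
      then show "x \<in> (\<lambda>i. i - 1) ` {1..card U}" by (intro image_eqI[of _ _ "x + 1"]) auto
    qed auto
    finally show ?thesis using h(1) by (simp add: bij_betw_def)
  qed
  have eq: "\<phi> ` e = \<phi> ` f \<longleftrightarrow> e = f" if "e \<subseteq> {1..card U}" "f \<subseteq> {1..card U}" for e f
    using that inj by (rule inj_on_image_eq_iff[rotated])
  have sub: "\<And>M e. M \<in> matchings r {1..card U} \<Longrightarrow> e \<in> M \<Longrightarrow> e \<subseteq> {1..card U}"
    by (auto simp: matchings_def is_matching_def partition_on_def)
  have "bij_betw ((`) (\<lambda>e. \<phi> ` e)) (matchings r {1..card U}) (matchings r U)"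
  proof (rule bij_betw_imageI)
    show "inj_on ((`) (\<lambda>e. \<phi> ` e)) (matchings r {1..card U})"
    proof (rule inj_onI)
      fix M N assume MN: "M \<in> matchings r {1..card U}" "N \<in> matchings r {1..card U}"
        "(\<lambda>e. \<phi> ` e) ` M = (\<lambda>e. \<phi> ` e) ` N"
      have "inj_on (\<lambda>e. \<phi> ` e) (Pow {1..card U})" using eq by (auto simp: inj_on_def)
      then show "M = N" using MN sub[OF MN(1)] sub[OF MN(2)] by (subst (asm) inj_on_image_eq_iff) auto
    qed
    show "(`) (\<lambda>e. \<phi> ` e) ` matchings r {1..card U} = matchings r U"
    proof (intro equalityI subsetI)
      fix G assume "G \<in> (`) (\<lambda>e. \<phi> ` e) ` matchings r {1..card U}"
      then show "G \<in> matchings r U"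
        using matching_image[OF _ inj r] im by (auto simp: matchings_def)
    next
      fix G assume G: "G \<in> matchings r U"
      define \<psi> where "\<psi> = inv_into {1..card U} \<phi>"
      have "bij_betw \<phi> {1..card U} U" using inj im by (auto simp: bij_betw_def)
      then have \<psi>: "bij_betw \<psi> U {1..card U}" unfolding \<psi>_def by (rule bij_betw_inv_into)
      have "is_matching r {1..card U} ((\<lambda>e. \<psi> ` e) ` G)"
        using matching_image[of r U G \<psi>] G \<psi> r by (auto simp: bij_betw_def matchings_def)
      moreover have "(\<lambda>e. \<phi> ` e) ` (\<lambda>e. \<psi> ` e) ` G = G"
      proof -
        have "\<phi> ` \<psi> ` e = e" if "e \<in> G" for e
        proof -
          have "e \<subseteq> U" using that G by (auto simp: matchings_def is_matching_def partition_on_def)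
          then have "\<phi> (\<psi> x) = x" if "x \<in> e" for x
            unfolding \<psi>_def using that im by (intro f_inv_into_f) auto
          then have "(\<lambda>x. \<phi> (\<psi> x)) ` e = (\<lambda>x. x) ` e" by (intro image_cong) auto
          then show ?thesis by (simp add: image_image)
        qed
        then have "(\<lambda>e. \<phi> ` \<psi> ` e) ` G = (\<lambda>e. e) ` G" by (intro image_cong) auto
        then show ?thesis by (simp add: image_image)
      qed
      ultimately show "G \<in> (`) (\<lambda>e. \<phi> ` e) ` matchings r {1..card U}"
        unfolding matchings_def by (metis imageI mem_Collect_eq)
    qed
  qed
  then have "(\<Sum>G\<in>matchings r U. F G) = (\<Sum>M\<in>matchings r {1..card U}. F ((\<lambda>e. \<phi> ` e) ` M))"
    by (rule sum.reindex_bij_betw[symmetric])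
  also have "\<dots> = (\<Sum>M\<in>matchings r {1..card U}. F M)"
    using F sm by (intro sum.cong) (auto simp: matchings_def)
  finally show ?thesis .
qed

definition meet :: "nat set \<Rightarrow> nat set \<Rightarrow> bool" where
  "meet e f \<longleftrightarrow> e \<inter> f \<noteq> {}"

lemma generic_matchings:
  assumes r: "1 \<le> r"
  shows "{G. G \<subseteq> redges r m \<and> card G = N \<and> conflict_free meet G}
    = (\<Union>U\<in>{U. U \<subseteq> {1..m} \<and> card U = r * N}. matchings r U)"
proof (intro equalityI subsetI)
  fix G assume G: "G \<in> {G. G \<subseteq> redges r m \<and> card G = N \<and> conflict_free meet G}"
  have "is_matching r (\<Union>G) G"
    unfolding is_matching_def
  proof (intro conjI)
    show "finite (\<Union>G)" using G by (intro finite_subset[of "\<Union>G" "{1..m}"]) (auto simp: redges_def)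
    show "partition_on (\<Union>G) G"
      using G r by (intro partition_onI) (auto simp: conflict_free_def meet_def disjnt_def redges_def)
    show "\<forall>e\<in>G. card e = r" using G by (auto simp: redges_def)
  qed
  moreover have "card (\<Union>G) = r * N" using card_matching[OF calculation r] G by simp
  moreover have "\<Union>G \<subseteq> {1..m}" using G by (auto simp: redges_def)
  ultimately show "G \<in> (\<Union>U\<in>{U. U \<subseteq> {1..m} \<and> card U = r * N}. matchings r U)"
    by (auto simp: matchings_def)
next
  fix G assume "G \<in> (\<Union>U\<in>{U. U \<subseteq> {1..m} \<and> card U = r * N}. matchings r U)"
  then obtain U where U: "U \<subseteq> {1..m}" "card U = r * N" "is_matching r U G" by (auto simp: matchings_def)
  have "r * card G = r * N" using card_matching(1)[OF U(3) r] U(2) by metis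
  then have "card G = N" using r by simp
  moreover have "G \<subseteq> redges r m" using U by (auto simp: redges_def is_matching_def partition_on_def)
  moreover have "conflict_free meet G"
    using U(3) by (auto simp: conflict_free_def meet_def is_matching_def partition_on_def pairwise_def disjnt_def)
  ultimately show "G \<in> {G. G \<subseteq> redges r m \<and> card G = N \<and> conflict_free meet G}" by simp
qed

text \<open>A conflict-free set of \<open>N\<close> edges is a matching on its set of \<open>r * N\<close> vertices. For every possible
  vertex set the relabelled matchings are the same, so \<open>F\<close> has the same average on all of them.\<close>

lemma averages_matching:
  assumes r: "1 \<le> r"
    and F: "\<And>N M \<phi>. is_matching r {1..r * N} M \<Longrightarrow> strict_mono_on {1..r * N} \<phi> \<Longrightarrow> F ((\<lambda>e. \<phi> ` e) ` M) = F M"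
    and \<psi>: "\<And>N. (\<Sum>M\<in>matchings r {1..r * N}. F M) = \<psi> N * real (card (matchings r {1..r * N}))"
  shows "averages meet (redges r m) F \<psi>"
  unfolding averages_def
proof
  fix N
  define \<U> where "\<U> = {U. U \<subseteq> {1..m} \<and> card U = r * N}"
  have fU: "finite \<U>" "\<And>U. U \<in> \<U> \<Longrightarrow> finite U" by (auto simp: \<U>_def intro: finite_subset)
  have disj: "matchings r U \<inter> matchings r V = {}" if "U \<noteq> V" for U V
    using that by (auto simp: matchings_def is_matching_def partition_on_def)
  have *: "(\<Sum>G | G \<subseteq> redges r m \<and> card G = N \<and> conflict_free meet G. F' G)
      = real (card \<U>) * (\<Sum>M\<in>matchings r {1..r * N}. F' M)"
    if F': "\<And>M \<phi>. is_matching r {1..r * N} M \<Longrightarrow> strict_mono_on {1..r * N} \<phi> \<Longrightarrow> F' ((\<lambda>e. \<phi> ` e) ` M) = F' M"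
    for F' :: "nat set set \<Rightarrow> real"
  proof -
    have "(\<Sum>G | G \<subseteq> redges r m \<and> card G = N \<and> conflict_free meet G. F' G)
        = (\<Sum>U\<in>\<U>. \<Sum>G\<in>matchings r U. F' G)"
      unfolding generic_matchings[OF r] \<U>_def[symmetric]
      using fU finite_matchings disj by (intro sum.UNION_disjoint) auto
    also have "\<dots> = (\<Sum>U\<in>\<U>. \<Sum>M\<in>matchings r {1..r * N}. F' M)"
    proof (rule sum.cong[OF refl])
      fix U assume U: "U \<in> \<U>"
      have cU: "card U = r * N" using U by (simp add: \<U>_def)
      show "(\<Sum>G\<in>matchings r U. F' G) = (\<Sum>M\<in>matchings r {1..r * N}. F' M)"
        using sum_matchings_relabel[OF fU(2)[OF U] r, of F'] F' unfolding cU by blast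
    qed
    finally show ?thesis by simp
  qed
  have "real (card {G. G \<subseteq> redges r m \<and> card G = N \<and> conflict_free meet G})
      = real (card \<U>) * real (card (matchings r {1..r * N}))"
    using *[of "\<lambda>_. 1"] by simp
  then show "(\<Sum>G | G \<subseteq> redges r m \<and> card G = N \<and> conflict_free meet G. F G)
    = \<psi> N * real (card {G. G \<subseteq> redges r m \<and> card G = N \<and> conflict_free meet G})"
    using *[of F] F \<psi>[of N] by simp
qed

text \<open>A conflicting pair shares one of the \<open>m\<close> vertices, and a vertex lies in \<open>(m - 1) choose (r - 1)\<close>
  edges.\<close>

lemma card_conflicts_redges:
  assumes r: "1 \<le> r" and m: "1 \<le> m"
  shows "real (card (conflicts meet (redges r m))) \<le> (real (m choose r))\<^sup>2 * (real r)\<^sup>2 / real m"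
proof -
  define T where "T = (\<lambda>v. {e \<in> redges r m. v \<in> e})"
  have fT: "finite (T v)" for v using finite_redges by (auto simp: T_def)
  have cT: "card (T v) \<le> (m - 1) choose (r - 1)" if v: "v \<in> {1..m}" for v
  proof -
    have "card (T v) \<le> card {B. B \<subseteq> {1..m} - {v} \<and> card B = r - 1}"
    proof (rule card_inj_on_le)
      show "inj_on (\<lambda>e. e - {v}) (T v)" by (auto simp: inj_on_def T_def)
      show "(\<lambda>e. e - {v}) ` T v \<subseteq> {B. B \<subseteq> {1..m} - {v} \<and> card B = r - 1}"
        by (auto simp: T_def redges_def card_Diff_singleton)
    qed auto
    also have "\<dots> = (m - 1) choose (r - 1)" using v by (subst n_subsets) auto
    finally show ?thesis .
  qed
  have "conflicts meet (redges r m) \<subseteq> (\<Union>v\<in>{1..m}. T v \<times> T v)"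
    by (fastforce simp: conflicts_def meet_def T_def redges_def)
  then have "card (conflicts meet (redges r m)) \<le> card (\<Union>v\<in>{1..m}. T v \<times> T v)"
    using fT by (intro card_mono) auto
  also have "\<dots> \<le> (\<Sum>v\<in>{1..m}. card (T v \<times> T v))" by (intro card_UN_le) auto
  also have "\<dots> \<le> (\<Sum>v\<in>{1..m}. ((m - 1) choose (r - 1)) * ((m - 1) choose (r - 1)))"
    using cT by (intro sum_mono) (auto simp: card_cartesian_product intro!: mult_le_mono)
  finally have "card (conflicts meet (redges r m)) \<le> m * (((m - 1) choose (r - 1)) * ((m - 1) choose (r - 1)))"
    by simp
  then have "real (card (conflicts meet (redges r m))) \<le> real m * (real ((m - 1) choose (r - 1)))\<^sup>2"
    by (simp add: power2_eq_square flip: of_nat_mult)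
  also have "\<dots> = (real (m choose r))\<^sup>2 * (real r)\<^sup>2 / real m"
  proof -
    have "r * (m choose r) = m * ((m - 1) choose (r - 1))"
      using binomial_absorption[of "r - 1" "m"] r by simp
    then have "real (r * (m choose r)) = real (m * ((m - 1) choose (r - 1)))" by (rule arg_cong)
    then have eq: "real r * real (m choose r) = real m * real ((m - 1) choose (r - 1))"
      by (simp only: of_nat_mult)
    have "(real (m choose r))\<^sup>2 * (real r)\<^sup>2 = (real m * real ((m - 1) choose (r - 1)))\<^sup>2"
      unfolding eq[symmetric] by (simp add: power_mult_distrib)
    then show ?thesis using m by (simp add: power2_eq_square)
  qed
  finally show ?thesis .
qed

text \<open>The size of the largest clique is determined by the relabelled matching, clique size is hereditary,
  and the expected number of conflicts is at most \<open>l\<^sup>2 * r\<^sup>2 / m\<close>, so \<open>bexp_prob_asymp\<close> applies.\<close>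

theorem matching_mean_constant:
  assumes r: "1 \<le> r" and b: "is_limit_constant r P b"
  shows "has_mean_constant r (\<lambda>G. real (max_clique P G)) b"
  unfolding has_mean_constant_def
proof (intro allI impI)
  fix \<epsilon> :: real assume \<epsilon>: "0 < \<epsilon>"
  define a where "a = 1 / real r"
  have a: "0 < a" "a \<le> 1" using r by (auto simp: a_def)
  define good where "good = (\<lambda>\<delta> N. {M :: nat set set. \<bar>real (max_clique P M) / real N powr a - b\<bar> < \<delta>})"
  define \<psi> where "\<psi> = (\<lambda>\<delta> N. measure_pmf.prob (random_matching r N) (good \<delta> N))"
  have b0: "0 < b" using b by (simp add: is_limit_constant_def)
  have lim: "\<psi> \<delta> \<longlonglongrightarrow> 1" if "0 < \<delta>" for \<delta>
  proof -
    have "(\<lambda>n. measure_pmf.prob (random_matching r n)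
        {M. \<delta> \<le> \<bar>real (max_clique P M) / real n powr a - b\<bar>}) \<longlonglongrightarrow> 0"
      using b that unfolding is_limit_constant_def a_def by blast
    then have "(\<lambda>n. 1 - measure_pmf.prob (random_matching r n)
        {M. \<delta> \<le> \<bar>real (max_clique P M) / real n powr a - b\<bar>}) \<longlonglongrightarrow> 1 - 0"
      by (intro tendsto_intros)
    moreover have "1 - measure_pmf.prob (random_matching r n)
        {M :: nat set set. \<delta> \<le> \<bar>real (max_clique P M) / real n powr a - b\<bar>} = \<psi> \<delta> n" for n
    proof -
      have "good \<delta> n = - {M. \<delta> \<le> \<bar>real (max_clique P M) / real n powr a - b\<bar>}"
        by (auto simp: good_def)
      then show ?thesis unfolding \<psi>_def
        using measure_pmf.prob_compl[of "{M. \<delta> \<le> \<bar>real (max_clique P M) / real n powr a - b\<bar>}" "random_matching r n"]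
        by (simp add: Compl_eq_Diff_UNIV)
    qed
    ultimately show ?thesis by simp
  qed
  have av: "averages meet (redges r m) (\<lambda>G. of_bool (\<bar>real (max_clique P G) / real (card G) powr a - b\<bar> < \<delta>)) (\<psi> \<delta>)"
    for m \<delta>
  proof (rule averages_matching[OF r])
    fix N M and \<phi> :: "nat \<Rightarrow> nat"
    assume M: "is_matching r {1..r * N} M" and \<phi>: "strict_mono_on {1..r * N} \<phi>"
    have UM: "\<Union>M = {1..r * N}" using M by (auto simp: is_matching_def partition_on_def)
    have "inj_on \<phi> (\<Union>M)" unfolding UM using \<phi> by (rule strict_mono_on_imp_inj_on)
    have "\<phi> ` e = \<phi> ` f \<longleftrightarrow> e = f" if "e \<in> M" "f \<in> M" for e f
      using that \<open>inj_on \<phi> (\<Union>M)\<close> by (intro inj_on_image_eq_iff) auto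
    then have "inj_on (\<lambda>e. \<phi> ` e) M" by (auto simp: inj_on_def)
    then have "card ((\<lambda>e. \<phi> ` e) ` M) = card M" by (rule card_image)
    moreover have "max_clique P ((\<lambda>e. \<phi> ` e) ` M) = max_clique P M"
      using \<phi> UM by (intro max_clique_image) simp
    ultimately show "of_bool (\<bar>real (max_clique P ((\<lambda>e. \<phi> ` e) ` M)) / real (card ((\<lambda>e. \<phi> ` e) ` M)) powr a - b\<bar> < \<delta>)
      = (of_bool (\<bar>real (max_clique P M) / real (card M) powr a - b\<bar> < \<delta>) :: real)" by simp
  next
    fix N
    define A where "A = matchings r {1..r * N}"
    have fA: "finite A" unfolding A_def by (rule finite_matchings) simp
    have cM: "card M = N" if "M \<in> A" for M
    proof -
      have "is_matching r {1..r * N} M" using that by (simp add: A_def matchings_def)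
      from card_matching[OF this r] have "r * N = r * card M" by simp
      then show ?thesis using r by simp
    qed
    have "(\<Sum>M\<in>A. of_bool (\<bar>real (max_clique P M) / real (card M) powr a - b\<bar> < \<delta>))
        = (\<Sum>M\<in>A. of_bool (M \<in> good \<delta> N))"
      by (intro sum.cong) (auto simp: cM good_def)
    also have "\<dots> = real (card (A \<inter> good \<delta> N))"
      using fA by (simp add: of_bool_def sum.If_cases Int_def)
    also have "\<dots> = \<psi> \<delta> N * real (card A)"
    proof (cases "A = {}")
      case False
      have "random_matching r N = pmf_of_set A" by (simp add: random_matching_def A_def matchings_def)
      then have "\<psi> \<delta> N = real (card (A \<inter> good \<delta> N)) / real (card A)"
        using fA False by (simp add: \<psi>_def measure_pmf_of_set)
      then show ?thesis using fA False by simp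
    qed simp
    finally show "(\<Sum>M\<in>matchings r {1..r * N}. of_bool (\<bar>real (max_clique P M) / real (card M) powr a - b\<bar> < \<delta>))
        = \<psi> \<delta> N * real (card (matchings r {1..r * N}))" by (simp add: A_def)
  qed
  from bexp_prob_asymp[where \<psi> = \<psi> and 'a = "nat set", OF a b0 lim \<epsilon>]
  obtain l0 \<eta> \<delta> where l0: "0 < l0" "0 < \<eta>" and main:
    "\<forall>(S :: nat set set) p l R F. finite S \<longrightarrow> 0 \<le> p \<longrightarrow> p \<le> 1 \<longrightarrow>
    l = p * real (card S) \<longrightarrow> l0 \<le> l \<longrightarrow> p\<^sup>2 * real (card (conflicts R S)) \<le> \<eta> \<longrightarrow>
    averages R S (\<lambda>G. of_bool (\<bar>F G / real (card G) powr a - b\<bar> < \<delta>)) (\<psi> \<delta>) \<longrightarrow>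
    bexp p S (\<lambda>G. (F G - bexp p S F)\<^sup>2) \<le> bexp p S F \<longrightarrow>
    \<bar>bexp p S F - b * l powr a\<bar> \<le> \<epsilon> * l powr a"
    by - (drule meta_mp, assumption, elim exE conjE, rule that; assumption)
  show "\<exists>l0>0. \<forall>U. \<exists>m0. \<forall>m\<ge>m0. \<forall>p. 0 \<le> p \<longrightarrow> p \<le> 1 \<longrightarrow>
     l0 \<le> p * real (m choose r) \<longrightarrow> p * real (m choose r) \<le> U \<longrightarrow>
     \<bar>bexp p (redges r m) (\<lambda>G. real (max_clique P G)) - b * (p * real (m choose r)) powr (1 / real r)\<bar>
       \<le> \<epsilon> * (p * real (m choose r)) powr (1 / real r)"
  proof (rule exI[of _ l0], rule conjI[OF l0(1)], rule allI)
    fix U :: real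
    obtain m0 where m0: "U\<^sup>2 * (real r)\<^sup>2 / \<eta> \<le> real m0" using real_arch_simple by blast
    show "\<exists>m0. \<forall>m\<ge>m0. \<forall>p. 0 \<le> p \<longrightarrow> p \<le> 1 \<longrightarrow>
     l0 \<le> p * real (m choose r) \<longrightarrow> p * real (m choose r) \<le> U \<longrightarrow>
     \<bar>bexp p (redges r m) (\<lambda>G. real (max_clique P G)) - b * (p * real (m choose r)) powr (1 / real r)\<bar>
       \<le> \<epsilon> * (p * real (m choose r)) powr (1 / real r)"
    proof (intro exI[of _ "max 1 m0"] allI impI)
      fix m p
      assume m: "max 1 m0 \<le> m" and p: "0 \<le> p" "p \<le> 1"
        and l: "l0 \<le> p * real (m choose r)" "p * real (m choose r) \<le> U"
      show "\<bar>bexp p (redges r m) (\<lambda>G. real (max_clique P G)) - b * (p * real (m choose r)) powr (1 / real r)\<bar>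
       \<le> \<epsilon> * (p * real (m choose r)) powr (1 / real r)"
        unfolding a_def[symmetric]
      proof (rule main[rule_format, OF finite_redges p _ _ _ av])
        show "p * real (m choose r) = p * real (card (redges r m))" by (simp add: card_redges)
        show "l0 \<le> p * real (m choose r)" by (rule l)
        have "p\<^sup>2 * real (card (conflicts meet (redges r m))) \<le> p\<^sup>2 * ((real (m choose r))\<^sup>2 * (real r)\<^sup>2 / real m)"
          using card_conflicts_redges[OF r, of m] m by (intro mult_left_mono) auto
        also have "\<dots> = (p * real (m choose r))\<^sup>2 * (real r)\<^sup>2 / real m" by (simp add: power_mult_distrib)
        also have "\<dots> \<le> U\<^sup>2 * (real r)\<^sup>2 / real m"
          using l l0 by (intro divide_right_mono mult_right_mono power_mono) auto
        also have "\<dots> \<le> \<eta>"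
        proof -
          have "U\<^sup>2 * (real r)\<^sup>2 / \<eta> \<le> real m" using m0 m by (auto intro: order_trans)
          then have "U\<^sup>2 * (real r)\<^sup>2 \<le> \<eta> * real m" using l0(2) by (simp add: pos_divide_le_eq mult.commute)
          then show ?thesis using m by (simp add: pos_divide_le_eq)
        qed
        finally show "p\<^sup>2 * real (card (conflicts meet (redges r m))) \<le> \<eta>" .
        show "bexp p (redges r m) (\<lambda>G. (real (max_clique P G) - bexp p (redges r m) (\<lambda>G. real (max_clique P G)))\<^sup>2)
          \<le> bexp p (redges r m) (\<lambda>G. real (max_clique P G))"
          unfolding max_clique_largest
          by (rule largest_variance_le_mean[OF hereditary_clique finite_redges p])
      qed
    qed
  qed
qed

section \<open>Random points and common increasing subsequences\<close>

definition grid :: "nat \<Rightarrow> (nat \<Rightarrow> nat) \<Rightarrow> (nat \<Rightarrow> nat) set" where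
  "grid r u = PiE {..<r} (\<lambda>i. {1..u i})"

definition below :: "nat \<Rightarrow> (nat \<Rightarrow> nat) \<Rightarrow> (nat \<Rightarrow> nat) \<Rightarrow> bool" where
  "below r x y \<longleftrightarrow> (\<forall>i<r. x i < y i)"

definition share :: "nat \<Rightarrow> (nat \<Rightarrow> nat) \<Rightarrow> (nat \<Rightarrow> nat) \<Rightarrow> bool" where
  "share r x y \<longleftrightarrow> (\<exists>i<r. x i = y i)"

lemma finite_grid: "finite (grid r u)"
  unfolding grid_def by (intro finite_PiE) auto

lemma card_grid: "card (grid r u) = (\<Prod>i<r. u i)"
  unfolding grid_def by (subst card_PiE) auto

text \<open>Two random points agree in coordinate \<open>i\<close> with probability \<open>1 / u i\<close>.\<close>

lemma card_share_grid:
  assumes "\<And>i. i < r \<Longrightarrow> m \<le> u i" "1 \<le> m"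
  shows "real (card (conflicts (share r) (grid r u))) \<le> real r * (real (card (grid r u)))\<^sup>2 / real m"
proof -
  define T where "T = (\<lambda>i v. {x \<in> grid r u. x i = v})"
  define V where "V = real (card (grid r u))"
  have cT: "real (u i) * real (card (T i v)) = V" if i: "i < r" and v: "v \<in> {1..u i}" for i v
  proof -
    have "T i v = PiE {..<r} (\<lambda>j. if j = i then {v} else {1..u j})"
    proof (intro equalityI subsetI)
      fix x assume "x \<in> T i v"
      then have "x \<in> PiE {..<r} (\<lambda>i. {1..u i})" "x i = v" by (auto simp: T_def grid_def)
      then show "x \<in> PiE {..<r} (\<lambda>j. if j = i then {v} else {1..u j})" unfolding PiE_iff by simp
    next
      fix x assume "x \<in> PiE {..<r} (\<lambda>j. if j = i then {v} else {1..u j})"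
      then have x: "\<forall>j\<in>{..<r}. x j \<in> (if j = i then {v} else {1..u j})" "x \<in> extensional {..<r}"
        unfolding PiE_iff by blast+
      have "x i = v" using x(1) i by (metis lessThan_iff singletonD)
      moreover have "x j \<in> {1..u j}" if "j < r" for j
        using x(1)[rule_format, of j] that v \<open>x i = v\<close> by (cases "j = i") auto
      ultimately show "x \<in> T i v" using x(2) by (simp add: T_def grid_def PiE_iff)
    qed
    then have "card (T i v) = (\<Prod>j<r. card (if j = i then {v} else {1..u j}))"
      by (simp only: card_PiE finite_lessThan)
    also have "\<dots> = card (if i = i then {v} else {1..u i}) * (\<Prod>j\<in>{..<r} - {i}. card (if j = i then {v} else {1..u j}))"
      using i by (intro prod.remove) auto
    also have "(\<Prod>j\<in>{..<r} - {i}. card (if j = i then {v} else {1..u j})) = (\<Prod>j\<in>{..<r} - {i}. u j)"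
      by (intro prod.cong) auto
    finally have c: "card (T i v) = (\<Prod>j\<in>{..<r} - {i}. u j)" by simp
    have "(\<Prod>j<r. u j) = u i * (\<Prod>j\<in>{..<r} - {i}. u j)" using i by (intro prod.remove) auto
    then have "u i * card (T i v) = card (grid r u)" unfolding card_grid c by (rule sym)
    then have "real (u i * card (T i v)) = V" unfolding V_def by (rule arg_cong)
    then show ?thesis by simp
  qed
  have fT: "finite (T i v)" for i v using finite_grid by (auto simp: T_def)
  have "conflicts (share r) (grid r u) \<subseteq> (\<Union>i<r. \<Union>v\<in>{1..u i}. T i v \<times> T i v)"
  proof
    fix d assume "d \<in> conflicts (share r) (grid r u)"
    then obtain x y i where d: "d = (x, y)" "x \<in> grid r u" "y \<in> grid r u" "i < r" "x i = y i"
      by (auto simp: conflicts_def share_def)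
    have "x i \<in> {1..u i}" using d(2,4) by (simp add: grid_def PiE_iff)
    moreover have "x \<in> T i (x i)" "y \<in> T i (x i)" using d by (simp_all add: T_def)
    ultimately show "d \<in> (\<Union>i<r. \<Union>v\<in>{1..u i}. T i v \<times> T i v)" using d(4) unfolding d(1) by blast
  qed
  then have "card (conflicts (share r) (grid r u)) \<le> card (\<Union>i<r. \<Union>v\<in>{1..u i}. T i v \<times> T i v)"
    using fT by (intro card_mono) auto
  also have "\<dots> \<le> (\<Sum>i<r. card (\<Union>v\<in>{1..u i}. T i v \<times> T i v))" by (intro card_UN_le) auto
  also have "\<dots> \<le> (\<Sum>i<r. \<Sum>v\<in>{1..u i}. card (T i v \<times> T i v))" by (intro sum_mono card_UN_le) auto
  finally have "real (card (conflicts (share r) (grid r u))) \<le> real (\<Sum>i<r. \<Sum>v\<in>{1..u i}. card (T i v \<times> T i v))"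
    by (rule of_nat_mono)
  also have "\<dots> = (\<Sum>i<r. \<Sum>v\<in>{1..u i}. (real (card (T i v)))\<^sup>2)"
    by (simp add: card_cartesian_product power2_eq_square)
  also have "\<dots> = (\<Sum>i<r. \<Sum>v\<in>{1..u i}. (V / real (u i))\<^sup>2)"
  proof (intro sum.cong refl)
    fix i v assume iv: "i \<in> {..<r}" "v \<in> {1..u i}"
    then have "real (card (T i v)) = V / real (u i)" using cT[of i v] by (simp add: field_simps)
    then show "(real (card (T i v)))\<^sup>2 = (V / real (u i))\<^sup>2" by simp
  qed
  also have "\<dots> = (\<Sum>i<r. V\<^sup>2 / real (u i))"
    by (intro sum.cong) (auto simp: power2_eq_square)
  also have "\<dots> \<le> (\<Sum>i<r. V\<^sup>2 / real m)"
  proof (intro sum_mono divide_left_mono)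
    fix i assume "i \<in> {..<r}"
    then have "m \<le> u i" using assms(1) by simp
    then show "real m \<le> real (u i)" "0 < real (u i) * real m" using assms(2) by auto
  qed auto
  finally show ?thesis by (simp add: V_def)
qed

lemma subseq_set_subset: "subseq xs ys \<Longrightarrow> set xs \<subseteq> set ys"
  by (induction rule: list_emb.induct) auto

lemma subseq_sorted_wrt: "subseq xs ys \<Longrightarrow> sorted_wrt R ys \<Longrightarrow> sorted_wrt R xs"
proof (induction rule: list_emb.induct)
  case (list_emb_Cons2 x y xs ys)
  then show ?case using subseq_set_subset[of xs ys] by auto
qed auto

text \<open>A common subsequence is a set of letters on which all position functions increase together.\<close>

lemma subseq_iff_positions:
  assumes ys: "distinct ys" and pos: "\<And>j. j < length ys \<Longrightarrow> pos (ys ! j) = j"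
  shows "subseq xs ys \<longleftrightarrow> set xs \<subseteq> set ys \<and> sorted_wrt (\<lambda>v w. pos v < (pos w :: nat)) xs"
proof
  assume s: "subseq xs ys"
  have "sorted_wrt (\<lambda>v w. pos v < pos w) ys"
    unfolding sorted_wrt_iff_nth_less using pos by auto
  then show "set xs \<subseteq> set ys \<and> sorted_wrt (\<lambda>v w. pos v < pos w) xs"
    using subseq_sorted_wrt[OF s] subseq_set_subset[OF s] by blast
next
  assume *: "set xs \<subseteq> set ys \<and> sorted_wrt (\<lambda>v w. pos v < pos w) xs"
  have mem: "pos v < length ys \<and> ys ! pos v = v" if "v \<in> set ys" for v
    using that pos by (auto simp: in_set_conv_nth)
  have "subseq (map pos xs) [0..<length ys]"
    using * mem by (intro sorted_subset_imp_subseq) (auto simp: sorted_wrt_map)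
  then have "subseq (map ((!) ys) (map pos xs)) (map ((!) ys) [0..<length ys])" by (rule subseq_map)
  moreover have "map ((!) ys) (map pos xs) = xs"
    using * mem by (auto simp: o_def intro!: map_idI)
  ultimately show "subseq xs ys" by (simp add: map_nth)
qed

definition position :: "nat list \<Rightarrow> nat \<Rightarrow> nat" where
  "position xs v = inv_into {..<length xs} ((!) xs) v"

lemma position:
  assumes "xs \<in> permutations_of_set {1..N}"
  shows "length xs = N" "distinct xs" "set xs = {1..N}"
    "j < N \<Longrightarrow> position xs (xs ! j) = j"
    "v \<in> {1..N} \<Longrightarrow> position xs v < N \<and> xs ! position xs v = v"
proof -
  show d: "distinct xs" "set xs = {1..N}" using assms by (auto simp: permutations_of_set_def)
  show l: "length xs = N" using distinct_card[OF d(1)] d(2) by simp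
  have inj: "inj_on ((!) xs) {..<length xs}" using d(1) by (auto simp: inj_on_def nth_eq_iff_index_eq)
  show "position xs (xs ! j) = j" if "j < N"
    unfolding position_def using that inj l by (intro inv_into_f_f) auto
  show "position xs v < N \<and> xs ! position xs v = v" if "v \<in> {1..N}"
  proof -
    have "v \<in> (!) xs ` {..<length xs}" using that d(2) by (metis lessThan_iff in_set_conv_nth image_eqI)
    then show ?thesis unfolding position_def
      using inv_into_into[of v "(!) xs" "{..<length xs}"] f_inv_into_f[of v "(!) xs" "{..<length xs}"] l by simp
  qed
qed

text \<open>The point set with the given coordinate values \<open>h i 0 < h i 1 < \<dots>\<close> whose points, listed by
  increasing \<open>i\<close>-th coordinate, are labelled as in the \<open>i\<close>-th word.\<close>

definition pt :: "nat \<Rightarrow> (nat \<Rightarrow> nat \<Rightarrow> nat) \<Rightarrow> (nat \<Rightarrow> nat list) \<Rightarrow> nat \<Rightarrow> (nat \<Rightarrow> nat)" where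
  "pt r h \<pi> v = (\<lambda>i\<in>{..<r}. if i = 0 then h 0 (v - 1) else h i (position (\<pi> (i - 1)) v))"

text \<open>A point is below another one if and only if its label is smaller, which is the coordinate \<open>0\<close>, and
  it comes earlier in each word. So the label sets of chains are the sets of letters of common
  increasing subsequences.\<close>

lemma lcis_eq_chain:
  assumes r: "2 \<le> r" and h: "\<And>i. i < r \<Longrightarrow> strict_mono_on {..<N} (h i)"
    and \<pi>: "\<And>i. i < r - 1 \<Longrightarrow> \<pi> i \<in> permutations_of_set {1..N}"
  shows "inj_on (pt r h \<pi>) {1..N}" "largest (chain (below r)) (pt r h \<pi> ` {1..N}) = lcis (r - 1) \<pi>"
proof -
  have hl: "h i x < h i y \<longleftrightarrow> x < y" if "i < r" "x < N" "y < N" for i x y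
    using strict_mono_onD[OF h[OF that(1)], of x y] strict_mono_onD[OF h[OF that(1)], of y x] that
    by (cases x y rule: linorder_cases) auto
  have P: "below r (pt r h \<pi> v) (pt r h \<pi> w) \<longleftrightarrow> v < w \<and> (\<forall>i<r-1. position (\<pi> i) v < position (\<pi> i) w)"
    if "v \<in> {1..N}" "w \<in> {1..N}" for v w
  proof -
    have "below r (pt r h \<pi> v) (pt r h \<pi> w) \<longleftrightarrow> (\<forall>i<r. if i = 0 then v < w else position (\<pi> (i - 1)) v < position (\<pi> (i - 1)) w)"
      unfolding below_def
    proof (intro all_cong)
      fix i assume i: "i < r"
      show "(pt r h \<pi> v i < pt r h \<pi> w i) = (if i = 0 then v < w else position (\<pi> (i - 1)) v < position (\<pi> (i - 1)) w)"
      proof (cases "i = 0")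
        case True
        have "h 0 (v - 1) < h 0 (w - 1) \<longleftrightarrow> v - 1 < w - 1" using i True that by (intro hl) auto
        also have "\<dots> \<longleftrightarrow> v < w" using that by auto
        finally show ?thesis using i True by (simp add: pt_def)
      next
        case False
        then have "\<pi> (i - 1) \<in> permutations_of_set {1..N}" using i by (intro \<pi>) auto
        from position(5)[OF this] show ?thesis using i that False hl[of i] by (simp add: pt_def)
      qed
    qed
    also have "\<dots> \<longleftrightarrow> v < w \<and> (\<forall>i<r-1. position (\<pi> i) v < position (\<pi> i) w)"
    proof (intro iffI conjI allI impI)
      assume *: "\<forall>i<r. if i = 0 then v < w else position (\<pi> (i - 1)) v < position (\<pi> (i - 1)) w"
      show "v < w" using *[rule_format, of 0] r by simp
      show "position (\<pi> i) v < position (\<pi> i) w" if "i < r - 1" for i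
        using *[rule_format, of "i + 1"] that by simp
    qed auto
    finally show ?thesis .
  qed
  show inj: "inj_on (pt r h \<pi>) {1..N}"
  proof (rule inj_onI)
    fix v w assume vw: "v \<in> {1..N}" "w \<in> {1..N}" "pt r h \<pi> v = pt r h \<pi> w"
    then have "pt r h \<pi> v 0 = pt r h \<pi> w 0" by simp
    then have "h 0 (v - 1) = h 0 (w - 1)" using r by (simp add: pt_def)
    moreover have N: "v - 1 < N" "w - 1 < N" "0 < r" using vw r by auto
    ultimately have "\<not> v - 1 < w - 1" "\<not> w - 1 < v - 1"
      using hl[OF N(3,1,2)] hl[OF N(3,2,1)] by simp_all
    then show "v = w" using vw by auto
  qed
  have S: "subseq xs (\<pi> i) \<longleftrightarrow> set xs \<subseteq> {1..N} \<and> sorted_wrt (\<lambda>v w. position (\<pi> i) v < position (\<pi> i) w) xs"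
    if "i < r - 1" for i xs
    using subseq_iff_positions[of "\<pi> i" "position (\<pi> i)" xs] position[OF \<pi>[OF that]] by auto
  have "card ` {K. K \<subseteq> pt r h \<pi> ` {1..N} \<and> chain (below r) K}
      = length ` {xs. sorted_wrt (<) xs \<and> (\<forall>i<r-1. subseq xs (\<pi> i))}"
  proof (intro equalityI subsetI)
    fix n assume "n \<in> card ` {K. K \<subseteq> pt r h \<pi> ` {1..N} \<and> chain (below r) K}"
    then obtain K where K: "K \<subseteq> pt r h \<pi> ` {1..N}" "chain (below r) K" "n = card K" by auto
    then obtain J where J: "J \<subseteq> {1..N}" "K = pt r h \<pi> ` J" by (auto simp: subset_image_iff)
    have fJ: "finite J" using J finite_subset by blast
    define xs where "xs = sorted_list_of_set J"
    have xs: "sorted_wrt (<) xs" "set xs = J" "length xs = card J" using fJ by (auto simp: xs_def)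
    have "n = length xs" using K(3) J inj xs by (simp add: card_image inj_on_subset)
    moreover have "subseq xs (\<pi> i)" if i: "i < r - 1" for i
      unfolding S[OF i]
    proof (intro conjI)
      show "set xs \<subseteq> {1..N}" using xs J by simp
      show "sorted_wrt (\<lambda>v w. position (\<pi> i) v < position (\<pi> i) w) xs"
      proof (rule sorted_wrt_mono_rel[OF _ xs(1)])
        fix v w assume vw: "v \<in> set xs" "w \<in> set xs" "v < w"
        then have in1: "v \<in> {1..N}" "w \<in> {1..N}" using xs J by auto
        have ne: "pt r h \<pi> v \<noteq> pt r h \<pi> w" using inj_onD[OF inj _ in1] vw by auto
        have "below r (pt r h \<pi> v) (pt r h \<pi> w) \<or> below r (pt r h \<pi> w) (pt r h \<pi> v)"
          using K(2) J xs vw ne by (auto simp: chain_def)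
        then show "position (\<pi> i) v < position (\<pi> i) w"
          unfolding P[OF in1] P[OF in1(2,1)] using vw i by auto
      qed
    qed
    ultimately show "n \<in> length ` {xs. sorted_wrt (<) xs \<and> (\<forall>i<r-1. subseq xs (\<pi> i))}"
      using xs by blast
  next
    fix n assume "n \<in> length ` {xs. sorted_wrt (<) xs \<and> (\<forall>i<r-1. subseq xs (\<pi> i))}"
    then obtain xs where xs: "n = length xs" "sorted_wrt (<) xs" "\<And>i. i < r - 1 \<Longrightarrow> subseq xs (\<pi> i)" by auto
    have sub: "set xs \<subseteq> {1..N}" using xs(3)[of 0] S[of 0 xs] r by auto
    have "distinct xs" using xs(2) by (simp add: strict_sorted_iff)
    then have "n = card (pt r h \<pi> ` set xs)"
      using xs(1) inj sub by (simp add: card_image inj_on_subset distinct_card)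
    moreover have lt: "below r (pt r h \<pi> (xs ! a)) (pt r h \<pi> (xs ! b))" if "a < b" "b < length xs" for a b
    proof -
      have "xs ! a \<in> {1..N}" "xs ! b \<in> {1..N}" using sub that nth_mem by (meson less_trans subsetD)+
      moreover have "xs ! a < xs ! b" using xs(2) that by (simp add: sorted_wrt_iff_nth_less)
      moreover have "position (\<pi> i) (xs ! a) < position (\<pi> i) (xs ! b)" if "i < r - 1" for i
        using xs(3)[OF that] S[OF that] \<open>a < b\<close> \<open>b < length xs\<close> by (simp add: sorted_wrt_iff_nth_less)
      ultimately show ?thesis using P by blast
    qed
    then have "chain (below r) (pt r h \<pi> ` set xs)"
    proof -
      have "below r (pt r h \<pi> v) (pt r h \<pi> w) \<or> below r (pt r h \<pi> w) (pt r h \<pi> v)"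
        if "v \<in> set xs" "w \<in> set xs" "v \<noteq> w" for v w
      proof -
        obtain a b where "a < length xs" "b < length xs" "v = xs ! a" "w = xs ! b" using \<open>v \<in> set xs\<close> \<open>w \<in> set xs\<close>
          by (auto simp: in_set_conv_nth)
        then show ?thesis using lt[of a b] lt[of b a] \<open>v \<noteq> w\<close> by (cases a b rule: linorder_cases) auto
      qed
      then show ?thesis unfolding chain_def by fastforce
    qed
    ultimately show "n \<in> card ` {K. K \<subseteq> pt r h \<pi> ` {1..N} \<and> chain (below r) K}"
      using sub by blast
  qed
  then show "largest (chain (below r)) (pt r h \<pi> ` {1..N}) = lcis (r - 1) \<pi>"
    by (simp add: largest_def lcis_def)
qed

definition perms :: "nat \<Rightarrow> nat \<Rightarrow> (nat \<Rightarrow> nat list) set" where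
  "perms k N = PiE_dflt {..<k} [] (\<lambda>_. permutations_of_set {1..N})"

lemma perms: "\<pi> \<in> perms k N \<Longrightarrow> i < k \<Longrightarrow> \<pi> i \<in> permutations_of_set {1..N}"
  by (auto simp: perms_def PiE_dflt_def)

lemma finite_perms: "finite (perms k N)" "perms k N \<noteq> {}"
proof -
  show "finite (perms k N)" unfolding perms_def by (intro finite_PiE_dflt) auto
  have "(\<lambda>i. if i < k then [1..<Suc N] else []) \<in> perms k N"
    by (auto simp: perms_def PiE_dflt_def permutations_of_set_def)
  then show "perms k N \<noteq> {}" by auto
qed

lemma random_permutations_eq: "random_permutations k N = pmf_of_set (perms k N)"
  unfolding random_permutations_def perms_def by (intro Pi_pmf_of_set) auto

text \<open>The sets of \<open>N\<close> points that have the prescribed sets \<open>A i\<close> of \<open>i\<close>-th coordinates and use each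
  coordinate value once.\<close>

definition grids :: "nat \<Rightarrow> (nat \<Rightarrow> nat set) \<Rightarrow> nat \<Rightarrow> (nat \<Rightarrow> nat) set set" where
  "grids r A N = {G. card G = N \<and> (\<forall>x\<in>G. x \<in> extensional {..<r}) \<and> conflict_free (share r) G \<and>
     (\<forall>i<r. (\<lambda>x. x i) ` G = A i)}"

text \<open>Coordinate \<open>0\<close> numbers the points; the order in which the numbered points appear along each other
  coordinate is an arbitrary permutation, and these \<open>r - 1\<close> permutations determine the set.\<close>

lemma bij_grids:
  assumes r: "2 \<le> r" and h: "\<And>i. i < r \<Longrightarrow> strict_mono_on {..<N} (h i)"
    and A: "\<And>i. i < r \<Longrightarrow> A i = h i ` {..<N}"
  shows "bij_betw (\<lambda>\<pi>. pt r h \<pi> ` {1..N}) (perms (r - 1) N) (grids r A N)"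
proof (rule bij_betw_imageI)
  have hi: "inj_on (h i) {..<N}" if "i < r" for i by (rule strict_mono_on_imp_inj_on[OF h[OF that]])
  have pt0: "pt r h \<pi> v 0 = h 0 (v - 1)" for \<pi> v using r by (simp add: pt_def)
  have pti: "pt r h \<pi> v (Suc i) = h (Suc i) (position (\<pi> i) v)" if "i < r - 1" for \<pi> v i
    proof -
      have "Suc i < r" using that by linarith
      then show ?thesis by (simp add: pt_def)
    qed
  have pos: "position (\<pi> i) v < N" "\<pi> i ! position (\<pi> i) v = v"
    if "\<pi> \<in> perms (r - 1) N" "i < r - 1" "v \<in> {1..N}" for \<pi> i v
    using position(5)[OF perms[OF that(1,2)] that(3)] by auto
  show "inj_on (\<lambda>\<pi>. pt r h \<pi> ` {1..N}) (perms (r - 1) N)"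
  proof (rule inj_onI)
    fix \<pi> \<rho> assume m: "\<pi> \<in> perms (r - 1) N" "\<rho> \<in> perms (r - 1) N"
      and eq: "pt r h \<pi> ` {1..N} = pt r h \<rho> ` {1..N}"
    have pteq: "pt r h \<pi> v = pt r h \<rho> v" if v: "v \<in> {1..N}" for v
    proof -
      have "pt r h \<pi> v \<in> pt r h \<rho> ` {1..N}" using eq v by auto
      then obtain w where w: "w \<in> {1..N}" "pt r h \<pi> v = pt r h \<rho> w" by auto
      then have "h 0 (v - 1) = h 0 (w - 1)" using pt0 by metis
      moreover have N: "v - 1 \<in> {..<N}" "w - 1 \<in> {..<N}" "0 < r" using v w r by auto
      ultimately have "v - 1 = w - 1" by (intro inj_onD[OF hi[OF N(3)] _ N(1,2)])
      then have "v = w" using v w by auto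
      then show ?thesis using w by simp
    qed
    show "\<pi> = \<rho>"
    proof
      fix i
      show "\<pi> i = \<rho> i"
      proof (cases "i < r - 1")
        case True
        have peq: "position (\<pi> i) v = position (\<rho> i) v" if v: "v \<in> {1..N}" for v
        proof -
          have "h (Suc i) (position (\<pi> i) v) = h (Suc i) (position (\<rho> i) v)"
            using pteq[OF v] pti[OF True] by metis
          moreover have "Suc i < r" using True by linarith
          ultimately show ?thesis
            using inj_onD[OF hi[of "Suc i"], of "position (\<pi> i) v" "position (\<rho> i) v"]
              pos(1)[OF m(1) True v] pos(1)[OF m(2) True v] by simp
        qed
        note l = position[OF perms[OF m(1) True]] position[OF perms[OF m(2) True]]
        show ?thesis
        proof (rule nth_equalityI)
          show "length (\<pi> i) = length (\<rho> i)" using l by simp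
          fix j assume j: "j < length (\<pi> i)"
          have v: "\<pi> i ! j \<in> {1..N}" using nth_mem[OF j] l by simp
          have "position (\<pi> i) (\<pi> i ! j) = j" using j l by simp
          then have "position (\<rho> i) (\<pi> i ! j) = j" using peq[OF v] by simp
          then show "\<pi> i ! j = \<rho> i ! j" using pos(2)[OF m(2) True v] by simp
        qed
      next
        case False
        then show ?thesis using m by (auto simp: perms_def PiE_dflt_def)
      qed
    qed
  qed
  show "(\<lambda>\<pi>. pt r h \<pi> ` {1..N}) ` perms (r - 1) N = grids r A N"
  proof (intro equalityI subsetI)
    fix G assume "G \<in> (\<lambda>\<pi>. pt r h \<pi> ` {1..N}) ` perms (r - 1) N"
    then obtain \<pi> where \<pi>: "\<pi> \<in> perms (r - 1) N" "G = pt r h \<pi> ` {1..N}" by auto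
    have inj: "inj_on (pt r h \<pi>) {1..N}" using lcis_eq_chain(1)[OF r h perms[OF \<pi>(1)]] by simp
    have coord: "v = w" if "v \<in> {1..N}" "w \<in> {1..N}" "i < r" "pt r h \<pi> v i = pt r h \<pi> w i" for v w i
    proof (cases i)
      case 0
      have N: "v - 1 \<in> {..<N}" "w - 1 \<in> {..<N}" "0 < r" using that r by auto
      have "h 0 (v - 1) = h 0 (w - 1)" using that(4) pt0 unfolding 0 by metis
      then have "v - 1 = w - 1" by (rule inj_onD[OF hi[OF N(3)] _ N(1,2)])
      then show ?thesis using that by auto
    next
      case (Suc j)
      then have j: "j < r - 1" using that by auto
      have "position (\<pi> j) v = position (\<pi> j) w"
      proof (rule inj_onD[OF hi[OF that(3)]])
        show "h i (position (\<pi> j) v) = h i (position (\<pi> j) w)"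
          using that(4) pti[OF j] unfolding Suc by metis
      qed (use pos(1)[OF \<pi>(1) j] that in auto)
      then show ?thesis using pos(2)[OF \<pi>(1) j] that by metis
    qed
    have proj: "(\<lambda>x. x i) ` G = A i" if i: "i < r" for i
    proof -
      have "(\<lambda>x. x i) ` G \<subseteq> A i"
      proof
        fix y assume "y \<in> (\<lambda>x. x i) ` G"
        then obtain v where v: "v \<in> {1..N}" "y = pt r h \<pi> v i" by (auto simp: \<pi>(2))
        show "y \<in> A i"
        proof (cases i)
          case 0 then show ?thesis using v pt0 A[OF i] by auto
        next
          case (Suc j) then show ?thesis using v pti[of j \<pi> v] pos(1)[OF \<pi>(1), of j v] A[OF i] i by auto
        qed
      qed
      moreover have "card ((\<lambda>x. x i) ` G) = N"
      proof -
        have "inj_on (\<lambda>v. pt r h \<pi> v i) {1..N}" using coord[OF _ _ i] by (auto simp: inj_on_def)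
        then show ?thesis unfolding \<pi>(2) image_image by (simp add: card_image)
      qed
      moreover have "card (A i) = N" using A[OF i] hi[OF i] by (simp add: card_image)
      moreover have "finite (A i)" using A[OF i] by simp
      ultimately show ?thesis by (intro card_subset_eq) auto
    qed
    show "G \<in> grids r A N"
      unfolding grids_def mem_Collect_eq
    proof (intro conjI)
      show "card G = N" using inj by (simp add: \<pi>(2) card_image)
      show "\<forall>x\<in>G. x \<in> extensional {..<r}" by (auto simp: \<pi>(2) pt_def)
      show "conflict_free (share r) G"
        unfolding conflict_free_def share_def
      proof (intro ballI impI notI)
        fix x y assume "x \<in> G" "y \<in> G" and ne: "x \<noteq> y" and "\<exists>i<r. x i = y i"
        then obtain v w i where vw: "v \<in> {1..N}" "w \<in> {1..N}" "x = pt r h \<pi> v" "y = pt r h \<pi> w" "i < r" "x i = y i"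
          unfolding \<pi>(2) by blast
        then have "v = w" using coord[OF vw(1,2,5)] by simp
        then show False using ne vw by simp
      qed
      show "\<forall>i<r. (\<lambda>x. x i) ` G = A i" using proj by blast
    qed
  next
    fix G assume "G \<in> grids r A N"
    then have G: "card G = N" "\<And>x. x \<in> G \<Longrightarrow> x \<in> extensional {..<r}" "conflict_free (share r) G"
      "\<And>i. i < r \<Longrightarrow> (\<lambda>x. x i) ` G = A i" by (auto simp: grids_def)
    have cinj: "inj_on (\<lambda>x. x i) G" if "i < r" for i
      using G(3) that by (auto simp: conflict_free_def share_def inj_on_def)
    \<comment> \<open>\<open>f i j\<close> is the point whose \<open>i\<close>-th coordinate is the \<open>j\<close>-th smallest; \<open>lab\<close> numbers the
      points by their first coordinate.\<close>
    define f where "f = (\<lambda>i j. inv_into G (\<lambda>x. x i) (h i j))"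
    have f: "f i j \<in> G" "f i j i = h i j" if "i < r" "j < N" for i j
    proof -
      have "h i j \<in> (\<lambda>x. x i) ` G" using G(4)[OF that(1)] A[OF that(1)] that(2) by auto
      from inv_into_into[OF this] f_inv_into_f[OF this]
      show "f i j \<in> G" "f i j i = h i j" by (simp_all add: f_def)
    qed
    have fbij: "bij_betw (f i) {..<N} G" if i: "i < r" for i
    proof (rule bij_betw_imageI)
      show "inj_on (f i) {..<N}"
      proof (rule inj_onI)
        fix a b assume ab: "a \<in> {..<N}" "b \<in> {..<N}" "f i a = f i b"
        then have "h i a = h i b" using f(2)[OF i, of a] f(2)[OF i, of b] by simp
        then show "a = b" by (rule inj_onD[OF hi[OF i] _ ab(1,2)])
      qed
      show "f i ` {..<N} = G"
      proof (intro equalityI subsetI)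
        fix x assume x: "x \<in> G"
        then have "x i \<in> A i" using G(4)[OF i] by auto
        then obtain j where j: "j < N" "x i = h i j" using A[OF i] by auto
        have "f i j i = x i" using f(2)[OF i j(1)] j(2) by simp
        then have "f i j = x" by (rule inj_onD[OF cinj[OF i] _ f(1)[OF i j(1)] x])
        then show "x \<in> f i ` {..<N}" using j by auto
      qed (use f(1)[OF i] in auto)
    qed
    define lab where "lab = (\<lambda>x. Suc (inv_into {..<N} (f 0) x))"
    have lab: "lab x \<in> {1..N}" "f 0 (lab x - 1) = x" if "x \<in> G" for x
    proof -
      have "x \<in> f 0 ` {..<N}" using fbij[of 0] r that by (auto simp: bij_betw_def)
      then show "lab x \<in> {1..N}" "f 0 (lab x - 1) = x"
        unfolding lab_def using inv_into_into[of x "f 0" "{..<N}"] f_inv_into_f[of x "f 0" "{..<N}"] by auto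
    qed
    have labbij: "bij_betw lab G {1..N}"
    proof (rule bij_betw_imageI)
      show "inj_on lab G" using lab(2) by (intro inj_onI) metis
      then have "card (lab ` G) = card {1..N}" using G(1) by (simp add: card_image)
      then show "lab ` G = {1..N}" using lab(1) by (intro card_subset_eq) auto
    qed
    define \<pi> where "\<pi> = (\<lambda>i. if i < r - 1 then map (\<lambda>j. lab (f (Suc i) j)) [0..<N] else [])"
    have \<pi>: "\<pi> \<in> perms (r - 1) N"
    proof -
      have "\<pi> i \<in> permutations_of_set {1..N}" if i: "i < r - 1" for i
      proof -
        have "bij_betw (\<lambda>j. lab (f (Suc i) j)) {..<N} {1..N}"
          using bij_betw_trans[OF fbij[of "Suc i"] labbij] i by (simp add: o_def)
        then show ?thesis
          using i by (auto simp: permutations_of_set_def \<pi>_def distinct_map bij_betw_def atLeast0LessThan)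
      qed
      then show ?thesis by (auto simp: perms_def PiE_dflt_def \<pi>_def)
    qed
    have "pt r h \<pi> (lab x) = x" if x: "x \<in> G" for x
    proof
      fix i
      show "pt r h \<pi> (lab x) i = x i"
      proof (cases "i < r")
        case False
        then show ?thesis using G(2)[OF x] by (simp add: pt_def extensional_def)
      next
        case i: True
        show ?thesis
        proof (cases i)
          case 0
          have "lab x - 1 < N" using lab(1)[OF x] by auto
          then show ?thesis using f(2)[of 0 "lab x - 1"] lab(2)[OF x] 0 i by (simp add: pt0)
        next
          case (Suc k)
          then have k: "k < r - 1" using i by simp
          obtain j where j: "j < N" "f i j = x" using fbij[OF i] x by (auto simp: bij_betw_def)
          have "\<pi> k ! j = lab x" using j k Suc by (simp add: \<pi>_def)
          then have "position (\<pi> k) (lab x) = j" using position(4)[OF perms[OF \<pi> k] j(1)] by simp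
          then show ?thesis using pti[OF k, of \<pi> "lab x"] Suc f(2)[OF i j(1)] j(2) by simp
        qed
      qed
    qed
    then have "pt r h \<pi> ` (lab ` G) = (\<lambda>x. x) ` G" unfolding image_image by (intro image_cong) auto
    then have "pt r h \<pi> ` {1..N} = G" using labbij by (simp add: bij_betw_def)
    then show "G \<in> (\<lambda>\<pi>. pt r h \<pi> ` {1..N}) ` perms (r - 1) N" using \<pi> by blast
  qed
qed

definition mean_lcis :: "nat \<Rightarrow> nat \<Rightarrow> real" where
  "mean_lcis r N = measure_pmf.expectation (random_permutations (r - 1) N) (\<lambda>\<pi>. real (lcis (r - 1) \<pi>))"

lemma mean_lcis_sum:
  "(\<Sum>\<pi>\<in>perms (r - 1) N. real (lcis (r - 1) \<pi>)) = mean_lcis r N * real (card (perms (r - 1) N))"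
  using finite_perms[of "r - 1" N]
  by (simp add: mean_lcis_def random_permutations_eq integral_pmf_of_set)

text \<open>Sort the conflict-free sets of \<open>N\<close> points by their sets of coordinates. Each class is in bijection
  with the tuples of \<open>r - 1\<close> permutations, which turns the longest chain into the longest common
  increasing subsequence.\<close>

lemma averages_points:
  assumes r: "2 \<le> r"
  shows "averages (share r) (grid r u) (\<lambda>G. real (largest (chain (below r)) G)) (mean_lcis r)"
  unfolding averages_def
proof
  fix N
  define \<A> where "\<A> = PiE {..<r} (\<lambda>i. {B. B \<subseteq> {1..u i} \<and> card B = N})"
  have f\<A>: "finite \<A>" unfolding \<A>_def by (intro finite_PiE) auto
  have eq: "{G. G \<subseteq> grid r u \<and> card G = N \<and> conflict_free (share r) G} = (\<Union>A\<in>\<A>. grids r A N \<inter> {G. G \<subseteq> grid r u})"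
  proof (intro equalityI subsetI)
    fix G assume "G \<in> {G. G \<subseteq> grid r u \<and> card G = N \<and> conflict_free (share r) G}"
    then have G: "G \<subseteq> grid r u" "card G = N" "conflict_free (share r) G" by auto
    define A where "A = (\<lambda>i\<in>{..<r}. (\<lambda>x. x i) ` G)"
    have "A \<in> \<A>"
      unfolding \<A>_def
    proof (rule PiE_I)
      fix i assume i: "i \<in> {..<r}"
      have "inj_on (\<lambda>x. x i) G" using G(3) i by (auto simp: conflict_free_def share_def inj_on_def)
      then have "card (A i) = N" using i G(2) by (simp add: A_def card_image)
      moreover have "A i \<subseteq> {1..u i}" using G(1) i by (auto simp: A_def grid_def)
      ultimately show "A i \<in> {B. B \<subseteq> {1..u i} \<and> card B = N}" by simp
    qed (auto simp: A_def)
    moreover have "G \<in> grids r A N" using G by (auto simp: grids_def A_def grid_def PiE_def)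
    ultimately show "G \<in> (\<Union>A\<in>\<A>. grids r A N \<inter> {G. G \<subseteq> grid r u})" using G by blast
  next
    fix G assume "G \<in> (\<Union>A\<in>\<A>. grids r A N \<inter> {G. G \<subseteq> grid r u})"
    then show "G \<in> {G. G \<subseteq> grid r u \<and> card G = N \<and> conflict_free (share r) G}" by (auto simp: grids_def)
  qed
  have in_grid: "grids r A N \<inter> {G. G \<subseteq> grid r u} = grids r A N" if A: "A \<in> \<A>" for A
  proof -
    have "G \<subseteq> grid r u" if G: "G \<in> grids r A N" for G
    proof
      fix x assume x: "x \<in> G"
      have "x i \<in> {1..u i}" if "i < r" for i
      proof -
        have "x i \<in> A i" using G x that by (auto simp: grids_def)
        moreover have "A i \<subseteq> {1..u i}" using A that by (auto simp: \<A>_def PiE_iff)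
        ultimately show ?thesis by blast
      qed
      then show "x \<in> grid r u" using G x by (auto simp: grid_def PiE_iff grids_def)
    qed
    then show ?thesis by auto
  qed
  have disj: "grids r A N \<inter> grids r B N = {}" if AB: "A \<in> \<A>" "B \<in> \<A>" "A \<noteq> B" for A B
  proof (rule ccontr)
    assume "grids r A N \<inter> grids r B N \<noteq> {}"
    then obtain G where "G \<in> grids r A N" "G \<in> grids r B N" by auto
    then have "A i = B i" if "i < r" for i using that by (auto simp: grids_def)
    then have "A = B" using AB by (intro PiE_ext[of A "{..<r}" _ B]) (auto simp: \<A>_def)
    then show False using AB by simp
  qed
  have part: "bij_betw (\<lambda>\<pi>. pt r h \<pi> ` {1..N}) (perms (r - 1) N) (grids r A N) \<and>
      (\<forall>\<pi>\<in>perms (r - 1) N. largest (chain (below r)) (pt r h \<pi> ` {1..N}) = lcis (r - 1) \<pi>)"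
    if "\<And>i. i < r \<Longrightarrow> strict_mono_on {..<N} (h i)" "\<And>i. i < r \<Longrightarrow> A i = h i ` {..<N}" for A h
  proof (intro conjI ballI)
    show "bij_betw (\<lambda>\<pi>. pt r h \<pi> ` {1..N}) (perms (r - 1) N) (grids r A N)"
      using that by (rule bij_grids[OF r])
    show "largest (chain (below r)) (pt r h \<pi> ` {1..N}) = lcis (r - 1) \<pi>" if "\<pi> \<in> perms (r - 1) N" for \<pi>
      using \<open>\<And>i. i < r \<Longrightarrow> strict_mono_on {..<N} (h i)\<close> perms[OF that] by (rule lcis_eq_chain(2)[OF r])
  qed
  have ex: "\<exists>h. (\<forall>i<r. strict_mono_on {..<N} (h i)) \<and> (\<forall>i<r. A i = h i ` {..<N})" if A: "A \<in> \<A>" for A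
  proof -
    have "\<exists>g. strict_mono_on {..<N} g \<and> A i = g ` {..<N}" if i: "i < r" for i
    proof -
      have Ai: "finite (A i)" "card (A i) = N" using A i by (auto simp: \<A>_def PiE_iff intro: finite_subset)
      obtain g where "bij_betw g {..<card (A i)} (A i)" "strict_mono_on {..<card (A i)} g"
        using ex_bij_betw_strict_mono_card[OF Ai(1)] .
      then show ?thesis using Ai(2) by (auto simp: bij_betw_def)
    qed
    then show ?thesis by metis
  qed
  have block: "(\<Sum>G\<in>grids r A N. real (largest (chain (below r)) G)) = mean_lcis r N * real (card (grids r A N))"
    if A: "A \<in> \<A>" for A
  proof -
    obtain h where h: "\<forall>i<r. strict_mono_on {..<N} (h i)" "\<forall>i<r. A i = h i ` {..<N}" using ex[OF A] by blast
    have bij: "bij_betw (\<lambda>\<pi>. pt r h \<pi> ` {1..N}) (perms (r - 1) N) (grids r A N)"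
      and L: "\<And>\<pi>. \<pi> \<in> perms (r - 1) N \<Longrightarrow> largest (chain (below r)) (pt r h \<pi> ` {1..N}) = lcis (r - 1) \<pi>"
      using part[of h A] h by blast+
    have "(\<Sum>G\<in>grids r A N. real (largest (chain (below r)) G))
        = (\<Sum>\<pi>\<in>perms (r - 1) N. real (largest (chain (below r)) (pt r h \<pi> ` {1..N})))"
      by (rule sum.reindex_bij_betw[OF bij, symmetric])
    also have "\<dots> = (\<Sum>\<pi>\<in>perms (r - 1) N. real (lcis (r - 1) \<pi>))" by (rule sum.cong[OF refl]) (simp only: L)
    also have "\<dots> = mean_lcis r N * real (card (grids r A N))"
      unfolding mean_lcis_sum bij_betw_same_card[OF bij] ..
    finally show ?thesis .
  qed
  have fin: "finite (grids r A N)" if "A \<in> \<A>" for A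
  proof -
    have "grids r A N \<subseteq> Pow (grid r u)" using in_grid[OF that] by auto
    then show ?thesis using finite_grid finite_subset by blast
  qed
  have eq': "{G. G \<subseteq> grid r u \<and> card G = N \<and> conflict_free (share r) G} = (\<Union>A\<in>\<A>. grids r A N)"
    unfolding eq using in_grid by auto
  have "(\<Sum>G\<in>(\<Union>A\<in>\<A>. grids r A N). real (largest (chain (below r)) G))
      = (\<Sum>A\<in>\<A>. \<Sum>G\<in>grids r A N. real (largest (chain (below r)) G))"
    using f\<A> fin disj by (intro sum.UNION_disjoint) auto
  also have "\<dots> = (\<Sum>A\<in>\<A>. mean_lcis r N * real (card (grids r A N)))" by (intro sum.cong block) auto
  also have "\<dots> = mean_lcis r N * real (\<Sum>A\<in>\<A>. card (grids r A N))" by (simp add: sum_distrib_left)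
  also have "(\<Sum>A\<in>\<A>. card (grids r A N)) = card (\<Union>A\<in>\<A>. grids r A N)"
    using f\<A> fin disj by (intro card_UN_disjoint[symmetric]) auto
  finally show "(\<Sum>G | G \<subseteq> grid r u \<and> card G = N \<and> conflict_free (share r) G. real (largest (chain (below r)) G))
    = mean_lcis r N * real (card {G. G \<subseteq> grid r u \<and> card G = N \<and> conflict_free (share r) G})"
    unfolding eq' .
qed

lemma mean_lcis_bounds:
  assumes "2 \<le> r"
  shows "0 \<le> mean_lcis r N \<and> mean_lcis r N \<le> real N"
proof -
  have le: "lcis (r - 1) \<pi> \<le> N" if "\<pi> \<in> perms (r - 1) N" for \<pi>
  proof -
    define h :: "nat \<Rightarrow> nat \<Rightarrow> nat" where "h = (\<lambda>i j. j)"
    have "strict_mono_on {..<N} (h i)" for i by (auto simp: h_def strict_mono_on_def monotone_on_def)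
    from lcis_eq_chain(2)[OF assms this perms[OF that]]
    have "lcis (r - 1) \<pi> = largest (chain (below r)) (pt r h \<pi> ` {1..N})" by simp
    also have "\<dots> \<le> card (pt r h \<pi> ` {1..N})" by (intro largest_le_card hereditary_chain) auto
    also have "\<dots> \<le> N" using card_image_le[of "{1..N}" "pt r h \<pi>"] by simp
    finally show ?thesis .
  qed
  define C where "C = real (card (perms (r - 1) N))"
  have C: "0 < C" using finite_perms[of "r - 1" N] by (simp add: C_def card_gt_0_iff)
  have "(\<Sum>\<pi>\<in>perms (r - 1) N. real (lcis (r - 1) \<pi>)) \<le> (\<Sum>\<pi>\<in>perms (r - 1) N. real N)"
    using le by (intro sum_mono) simp
  then have "mean_lcis r N * C \<le> real N * C" unfolding mean_lcis_sum C_def by (simp add: mult.commute)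
  moreover have "0 * C \<le> mean_lcis r N * C" unfolding C_def mean_lcis_sum[symmetric] by (simp add: sum_nonneg)
  ultimately show ?thesis using C by (metis mult_le_cancel_right_pos)
qed

text \<open>The analogue of \<open>has_mean_constant\<close> for chains of points in boxes whose side lengths all tend to
  infinity. The proportions of the sides are arbitrary: the order structure of a random set of
  points, no two of which share a coordinate, does not depend on them.\<close>

definition has_chain_constant :: "nat \<Rightarrow> real \<Rightarrow> bool" where
  "has_chain_constant r c \<longleftrightarrow> (\<forall>\<epsilon>>0. \<exists>l0>0. \<forall>U. \<exists>m0. \<forall>u p. (\<forall>i<r. m0 \<le> u i) \<longrightarrow> 0 \<le> p \<longrightarrow> p \<le> 1 \<longrightarrow>
     l0 \<le> p * real (\<Prod>i<r. u i) \<longrightarrow> p * real (\<Prod>i<r. u i) \<le> U \<longrightarrow>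
     \<bar>bexp p (grid r u) (\<lambda>G. real (largest (chain (below r)) G)) - c * (p * real (\<Prod>i<r. u i)) powr (1 / real r)\<bar>
       \<le> \<epsilon> * (p * real (\<Prod>i<r. u i)) powr (1 / real r))"

theorem points_mean_constant:
  assumes r: "2 \<le> r" and c: "is_bollobas_winkler_constant r c"
  shows "has_chain_constant r c"
  unfolding has_chain_constant_def
proof (intro allI impI)
  fix \<epsilon> :: real assume \<epsilon>: "0 < \<epsilon>"
  define a where "a = 1 / real r"
  have a: "0 < a" "a \<le> 1" using r by (simp_all add: a_def)
  have c0: "0 < c" using c by (simp add: is_bollobas_winkler_constant_def)
  have lim: "(\<lambda>N. mean_lcis r N / real N powr a) \<longlonglongrightarrow> c"
  proof -
    have "(\<lambda>n. mean_lcis r n) \<sim>[at_top] (\<lambda>n. c * real n powr a)"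
      using c by (simp add: is_bollobas_winkler_constant_def mean_lcis_def a_def)
    then have "(\<lambda>x. if mean_lcis r x = 0 \<and> c * real x powr a = 0 then 1 else mean_lcis r x / (c * real x powr a)) \<longlonglongrightarrow> 1"
      by (rule asymp_equivD)
    then have "(\<lambda>x. c * (if mean_lcis r x = 0 \<and> c * real x powr a = 0 then 1 else mean_lcis r x / (c * real x powr a))) \<longlonglongrightarrow> c * 1"
      by (intro tendsto_intros)
    then have "(\<lambda>x. c * (if mean_lcis r x = 0 \<and> c * real x powr a = 0 then 1 else mean_lcis r x / (c * real x powr a))) \<longlonglongrightarrow> c"
      by simp
    then show ?thesis
    proof (rule Lim_transform_eventually)
      show "\<forall>\<^sub>F x in sequentially. c * (if mean_lcis r x = 0 \<and> c * real x powr a = 0 then 1 else mean_lcis r x / (c * real x powr a))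
          = mean_lcis r x / real x powr a"
        using eventually_gt_at_top[of 0] by eventually_elim (use c0 in auto)
    qed
  qed
  from bexp_mean_asymp[where 'a = "nat \<Rightarrow> nat" and \<theta> = "mean_lcis r", OF a c0 lim mean_lcis_bounds[OF r] \<epsilon>]
  obtain l0 where l0: "0 < l0" and main: "\<forall>U. \<exists>\<eta>>0. \<forall>(S :: (nat \<Rightarrow> nat) set) p l R F. finite S \<longrightarrow> 0 \<le> p \<longrightarrow> p \<le> 1 \<longrightarrow>
    l = p * real (card S) \<longrightarrow> l0 \<le> l \<longrightarrow> l \<le> U \<longrightarrow> p\<^sup>2 * real (card (conflicts R S)) \<le> \<eta> \<longrightarrow>
    averages R S F (mean_lcis r) \<longrightarrow> (\<forall>G\<subseteq>S. 0 \<le> F G \<and> F G \<le> real (card G)) \<longrightarrow>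
    \<bar>bexp p S F - c * l powr a\<bar> \<le> \<epsilon> * l powr a"
    by (elim exE conjE) (rule that; assumption)
  show "\<exists>l0>0. \<forall>U. \<exists>m0. \<forall>u p. (\<forall>i<r. m0 \<le> u i) \<longrightarrow> 0 \<le> p \<longrightarrow> p \<le> 1 \<longrightarrow>
     l0 \<le> p * real (\<Prod>i<r. u i) \<longrightarrow> p * real (\<Prod>i<r. u i) \<le> U \<longrightarrow>
     \<bar>bexp p (grid r u) (\<lambda>G. real (largest (chain (below r)) G)) - c * (p * real (\<Prod>i<r. u i)) powr (1 / real r)\<bar>
       \<le> \<epsilon> * (p * real (\<Prod>i<r. u i)) powr (1 / real r)"
  proof (rule exI[of _ l0], rule conjI[OF l0], rule allI)
    fix U :: real
    from main[rule_format, of U] obtain \<eta> where \<eta>: "0 < \<eta>" and step: "\<forall>(S :: (nat \<Rightarrow> nat) set) p l R F. finite S \<longrightarrow> 0 \<le> p \<longrightarrow> p \<le> 1 \<longrightarrow>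
      l = p * real (card S) \<longrightarrow> l0 \<le> l \<longrightarrow> l \<le> U \<longrightarrow> p\<^sup>2 * real (card (conflicts R S)) \<le> \<eta> \<longrightarrow>
      averages R S F (mean_lcis r) \<longrightarrow> (\<forall>G\<subseteq>S. 0 \<le> F G \<and> F G \<le> real (card G)) \<longrightarrow>
      \<bar>bexp p S F - c * l powr a\<bar> \<le> \<epsilon> * l powr a" by (elim exE conjE) (rule that; assumption)
    obtain m0 where m0: "real r * U\<^sup>2 / \<eta> \<le> real m0" using real_arch_simple by blast
    show "\<exists>m0. \<forall>u p. (\<forall>i<r. m0 \<le> u i) \<longrightarrow> 0 \<le> p \<longrightarrow> p \<le> 1 \<longrightarrow>
     l0 \<le> p * real (\<Prod>i<r. u i) \<longrightarrow> p * real (\<Prod>i<r. u i) \<le> U \<longrightarrow>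
     \<bar>bexp p (grid r u) (\<lambda>G. real (largest (chain (below r)) G)) - c * (p * real (\<Prod>i<r. u i)) powr (1 / real r)\<bar>
       \<le> \<epsilon> * (p * real (\<Prod>i<r. u i)) powr (1 / real r)"
    proof (rule exI[of _ "max 1 m0"], intro allI impI)
      fix u p
      assume u: "\<forall>i<r. max 1 m0 \<le> u i" and p: "0 \<le> p" "p \<le> 1"
        and l: "l0 \<le> p * real (\<Prod>i<r. u i)" "p * real (\<Prod>i<r. u i) \<le> U"
      have conf: "p\<^sup>2 * real (card (conflicts (share r) (grid r u))) \<le> \<eta>"
      proof -
        have "p\<^sup>2 * real (card (conflicts (share r) (grid r u))) \<le> p\<^sup>2 * (real r * (real (card (grid r u)))\<^sup>2 / real (max 1 m0))"
          using u by (intro mult_left_mono card_share_grid) auto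
        also have "\<dots> = real r * (p * real (\<Prod>i<r. u i))\<^sup>2 / real (max 1 m0)"
          by (simp add: card_grid power_mult_distrib)
        also have "\<dots> \<le> real r * U\<^sup>2 / real (max 1 m0)"
          using l l0 by (intro divide_right_mono mult_left_mono power_mono) auto
        also have "\<dots> \<le> \<eta>"
        proof -
          have "real r * U\<^sup>2 / \<eta> \<le> real (max 1 m0)" using m0 by (auto intro: order_trans)
          then have "real r * U\<^sup>2 \<le> \<eta> * real (max 1 m0)" using \<eta> by (simp only: pos_divide_le_eq mult.commute)
          then show ?thesis by (subst pos_divide_le_eq) auto
        qed
        finally show ?thesis .
      qed
      have bnd: "\<forall>G\<subseteq>grid r u. 0 \<le> real (largest (chain (below r)) G) \<and> real (largest (chain (below r)) G) \<le> real (card G)"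
      proof (intro allI impI)
        fix G assume "G \<subseteq> grid r u"
        then have "finite G" using finite_grid finite_subset by blast
        then show "0 \<le> real (largest (chain (below r)) G) \<and> real (largest (chain (below r)) G) \<le> real (card G)"
          using largest_le_card[OF hereditary_chain] by auto
      qed
      have size: "p * real (\<Prod>i<r. u i) = p * real (card (grid r u))" by (simp add: card_grid)
      show "\<bar>bexp p (grid r u) (\<lambda>G. real (largest (chain (below r)) G)) - c * (p * real (\<Prod>i<r. u i)) powr (1 / real r)\<bar>
       \<le> \<epsilon> * (p * real (\<Prod>i<r. u i)) powr (1 / real r)"
        unfolding a_def[symmetric]
        by (rule step[THEN spec, THEN spec, THEN spec, THEN spec, THEN spec, THEN mp, OF finite_grid,
            THEN mp, OF p(1), THEN mp, OF p(2), THEN mp, OF size, THEN mp, OF l(1), THEN mp, OF l(2),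
            THEN mp, OF conf, THEN mp, OF averages_points[OF r], THEN mp, OF bnd])
    qed
  qed
qed

section \<open>Cliques of partite patterns and chains of points\<close>

definition elt :: "nat set \<Rightarrow> nat \<Rightarrow> nat" where
  "elt e i = sorted_list_of_set e ! i"

lemma elt_eqI:
  assumes "strict_mono_on {..<r} g" "i < r"
  shows "elt (g ` {..<r}) i = g i"
proof -
  have "sorted_wrt (<) (map g [0..<r])"
    unfolding sorted_wrt_iff_nth_less using strict_mono_onD[OF assms(1)] by simp
  moreover have "card (g ` {..<r}) = r" using strict_mono_on_imp_inj_on[OF assms(1)] by (simp add: card_image)
  ultimately have "sorted_list_of_set (g ` {..<r}) = map g [0..<r]"
    by (subst sorted_list_of_set_unique[symmetric]) (auto simp: atLeast0LessThan)
  then show ?thesis using assms(2) by (simp add: elt_def)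
qed

lemma elt:
  assumes "finite e" "card e = r"
  shows "strict_mono_on {..<r} (elt e)" "elt e ` {..<r} = e"
proof -
  have l: "length (sorted_list_of_set e) = r" "set (sorted_list_of_set e) = e"
    "sorted_wrt (<) (sorted_list_of_set e)" using assms by auto
  show "strict_mono_on {..<r} (elt e)"
    using l(1,3) by (intro strict_mono_onI) (auto simp: elt_def sorted_wrt_iff_nth_less)
  have "elt e ` {..<r} = (!) (sorted_list_of_set e) ` {..<length (sorted_list_of_set e)}"
    using l(1) by (simp add: elt_def)
  also have "\<dots> = e" using l(2) by (auto simp: set_conv_nth)
  finally show "elt e ` {..<r} = e" .
qed

text \<open>The two edges of an \<open>r\<close>-partite pattern; \<open>s i\<close> tells which of them comes first in block \<open>i\<close>.\<close>

definition edgeA :: "nat \<Rightarrow> (nat \<Rightarrow> bool) \<Rightarrow> nat \<Rightarrow> nat" where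
  "edgeA r s i = (if s i then 2 * i + 1 else 2 * i + 2)"

definition edgeB :: "nat \<Rightarrow> (nat \<Rightarrow> bool) \<Rightarrow> nat \<Rightarrow> nat" where
  "edgeB r s i = (if s i then 2 * i + 2 else 2 * i + 1)"

text \<open>Contiguous pairs can tile \<open>{1..2 * r}\<close> in one way only, by induction from the left end.\<close>

lemma blocks_of_size_two:
  fixes r i :: nat and Js :: "nat set set"
  assumes part: "partition_on {1..2 * r} Js" and two: "\<And>J. J \<in> Js \<Longrightarrow> \<exists>a. J = {a, a + 1}"
  shows "i < r \<Longrightarrow> {2 * i + 1, 2 * i + 2} \<in> Js"
proof (induction i rule: less_induct)
  case (less i)
  have U: "\<Union>Js = {1..2 * r}" and D: "\<And>J J'. J \<in> Js \<Longrightarrow> J' \<in> Js \<Longrightarrow> J \<noteq> J' \<Longrightarrow> J \<inter> J' = {}"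
    using part by (auto simp: partition_on_def pairwise_def disjnt_def)
  have "2 * i + 1 \<in> \<Union>Js" using U less.prems by auto
  then obtain J where J: "J \<in> Js" "2 * i + 1 \<in> J" by auto
  then obtain a where a: "J = {a, a + 1}" using two by blast
  have "a = 2 * i + 1"
  proof (rule ccontr)
    assume "a \<noteq> 2 * i + 1"
    then have ai: "a = 2 * i" using J(2) a by auto
    show False
    proof (cases i)
      case 0
      then have "0 \<in> \<Union>Js" using ai a J by auto
      then show False using U by auto
    next
      case (Suc k)
      have k: "{2 * k + 1, 2 * k + 2} \<in> Js" using less Suc by auto
      have "a \<in> J \<inter> {2 * k + 1, 2 * k + 2}" using a ai Suc by auto
      then have "J = {2 * k + 1, 2 * k + 2}" using D[OF J(1) k] by auto
      then show False using J(2) Suc by auto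
    qed
  qed
  then show ?case using J(1) a by simp
qed

text \<open>All blocks have size two, so block \<open>i\<close> consists of one vertex of each edge, in one of two orders.\<close>

lemma partite_structure:
  assumes r: "1 \<le> r" and P: "is_pattern r P" and ty: "has_type P (replicate_mset r 1)"
  obtains s where "P = {edgeA r s ` {..<r}, edgeB r s ` {..<r}}"
proof -
  obtain Js where Js: "is_block_partition P Js" "replicate_mset r 1 = image_mset (\<lambda>J. card J div 2) (mset_set Js)"
    using ty unfolding has_type_def by blast
  have M: "is_matching r {1..2 * r} P" "card P = 2" using P by (auto simp: is_pattern_def)
  have UP: "\<Union>P = {1..2 * r}" and DP: "\<And>e f. e \<in> P \<Longrightarrow> f \<in> P \<Longrightarrow> e \<noteq> f \<Longrightarrow> e \<inter> f = {}"
    using M by (auto simp: is_matching_def partition_on_def pairwise_def disjnt_def)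
  have fJ: "finite Js"
  proof (rule ccontr)
    assume "infinite Js"
    then have "replicate_mset r (1 :: nat) = {#}" using Js(2) by simp
    then show False using r by simp
  qed
  have block: "\<exists>a. J = {a, a + 1} \<and> (\<exists>e\<in>P. \<exists>f\<in>P. e \<noteq> f \<and> a \<in> e \<and> a + 1 \<in> f)" if J: "J \<in> Js" for J
  proof -
    have "card J div 2 \<in># image_mset (\<lambda>J. card J div 2) (mset_set Js)" using J fJ by simp
    then have c: "card J div 2 = 1" unfolding Js(2)[symmetric] by (simp add: in_replicate_mset split: if_splits)
    have "is_block P J" using Js(1) J by (simp add: is_block_partition_def)
    then obtain a k e f where b: "e \<in> P" "f \<in> P" "e \<noteq> f" "J = {a..<a + 2 * k}"
      "{a..<a + k} \<subseteq> e" "{a + k..<a + 2 * k} \<subseteq> f" unfolding is_block_def by blast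
    have "k = 1" using c b(4) by simp
    then have "J = {a, a + 1}" "a \<in> e" "a + 1 \<in> f" using b(4-6) by auto
    then show ?thesis using b(1-3) by blast
  qed
  have part: "partition_on {1..2 * r} Js" using Js(1) UP by (simp add: is_block_partition_def)
  obtain e f where ef: "P = {e, f}" "e \<noteq> f" using M(2) by (meson card_2_iff)
  have dis: "e \<inter> f = {}" using DP[of e f] ef by auto
  have one: "(2 * i + 1 \<in> e \<and> 2 * i + 2 \<in> f) \<or> (2 * i + 2 \<in> e \<and> 2 * i + 1 \<in> f)" if i: "i < r" for i
  proof -
    have "{2 * i + 1, 2 * i + 2} \<in> Js"
      using block by (intro blocks_of_size_two[OF part _ i]) blast
    from block[OF this]
    obtain a e' f' where a: "{2 * i + 1, 2 * i + 2} = {a, a + 1}" "e' \<in> P" "f' \<in> P" "e' \<noteq> f'" "a \<in> e'" "a + 1 \<in> f'"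
      by (elim exE conjE bexE) (rule that; assumption)
    have "a = 2 * i + 1" using a(1) by (auto simp: doubleton_eq_iff)
    then show ?thesis using a ef by auto
  qed
  define s where "s = (\<lambda>i. 2 * i + 1 \<in> e)"
  have Ae: "edgeA r s i \<in> e" "edgeB r s i \<in> f" if "i < r" for i
    using one[OF that] dis by (auto simp: edgeA_def edgeB_def s_def)
  have cov: "v \<in> edgeA r s ` {..<r} \<union> edgeB r s ` {..<r}" if v: "v \<in> {1..2 * r}" for v
  proof -
    define i where "i = (v - 1) div 2"
    have "i < r" "v = 2 * i + 1 \<or> v = 2 * i + 2" using v by (auto simp: i_def)
    then have "v = edgeA r s i \<or> v = edgeB r s i" "i < r" by (auto simp: edgeA_def edgeB_def)
    then show ?thesis by auto
  qed
  have sub: "e \<subseteq> {1..2 * r}" "f \<subseteq> {1..2 * r}" using UP ef by auto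
  have "e = edgeA r s ` {..<r}"
  proof
    show "e \<subseteq> edgeA r s ` {..<r}"
    proof
      fix v assume v: "v \<in> e"
      then have "v \<notin> edgeB r s ` {..<r}" using Ae dis by blast
      then show "v \<in> edgeA r s ` {..<r}" using cov[of v] v sub by blast
    qed
  qed (use Ae in auto)
  moreover have "f = edgeB r s ` {..<r}"
  proof
    show "f \<subseteq> edgeB r s ` {..<r}"
    proof
      fix v assume v: "v \<in> f"
      then have "v \<notin> edgeA r s ` {..<r}" using Ae dis by blast
      then show "v \<in> edgeB r s ` {..<r}" using cov[of v] v sub by blast
    qed
  qed (use Ae in auto)
  ultimately show ?thesis using that[of s] ef by simp
qed

definition sign_less :: "nat \<Rightarrow> (nat \<Rightarrow> bool) \<Rightarrow> (nat \<Rightarrow> nat) \<Rightarrow> (nat \<Rightarrow> nat) \<Rightarrow> bool" where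
  "sign_less r s x y \<longleftrightarrow> (\<forall>i<r. if s i then x i < y i else y i < x i)"

text \<open>Vertex \<open>2 * i + 1\<close> of the pattern is mapped to the smaller one of \<open>x i\<close> and \<open>y i\<close> and vertex \<open>2 * i + 2\<close> to
  the larger one.\<close>

lemma partite_isomorphic:
  assumes sg: "sign_less r s x y"
    and gap: "\<And>i j. i < j \<Longrightarrow> j < r \<Longrightarrow> max (x i) (y i) < min (x j) (y j)"
  shows "order_isomorphic {edgeA r s ` {..<r}, edgeB r s ` {..<r}} {x ` {..<r}, y ` {..<r}}"
proof -
  define \<phi> where "\<phi> = (\<lambda>v. let i = (v - 1) div 2 in if odd v then min (x i) (y i) else max (x i) (y i))"
  have sgi: "if s i then x i < y i else y i < x i" if "i < r" for i using sg that by (simp add: sign_less_def)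
  have A: "\<phi> (edgeA r s i) = x i" "\<phi> (edgeB r s i) = y i" if "i < r" for i
    using sgi[OF that] by (auto simp: \<phi>_def edgeA_def edgeB_def Let_def split: if_splits)
  have sm: "strict_mono_on {1..2 * r} \<phi>"
  proof (rule strict_mono_onI)
    fix v w assume vw: "v \<in> {1..2 * r}" "w \<in> {1..2 * r}" "v < w"
    define i where "i = (v - 1) div 2"
    define j where "j = (w - 1) div 2"
    have ij: "i \<le> j" "j < r" using vw by (auto simp: i_def j_def intro: div_le_mono)
    have v: "\<phi> v = (if odd v then min (x i) (y i) else max (x i) (y i))"
      and w: "\<phi> w = (if odd w then min (x j) (y j) else max (x j) (y j))"
      by (simp_all add: \<phi>_def i_def j_def Let_def)
    show "\<phi> v < \<phi> w"
    proof (cases "i = j")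
      case True
      obtain v' w' where vw': "v = Suc v'" "w = Suc w'" using vw by (metis not0_implies_Suc atLeastAtMost_iff not_one_le_zero)
      then have "v' div 2 = w' div 2" "v' < w'" using True vw by (simp_all add: i_def j_def)
      then have "even v'" "odd w'" by presburger+
      then have "odd v" "even w" using vw' by simp_all
      then show ?thesis using v w True sgi[OF ij(2)] by (auto split: if_splits)
    next
      case False
      then have "max (x i) (y i) < min (x j) (y j)" using gap ij by simp
      then show ?thesis using v w by auto
    qed
  qed
  have U: "\<Union>{edgeA r s ` {..<r}, edgeB r s ` {..<r}} \<subseteq> {1..2 * r}" by (auto simp: edgeA_def edgeB_def)
  have im: "\<phi> ` edgeA r s ` {..<r} = x ` {..<r}" "\<phi> ` edgeB r s ` {..<r} = y ` {..<r}"
    unfolding image_image using A by (auto intro!: image_cong)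
  have sm': "strict_mono_on (\<Union>{edgeA r s ` {..<r}, edgeB r s ` {..<r}}) \<phi>"
    using sm U by (meson monotone_on_subset)
  have "bij_betw \<phi> (\<Union>{edgeA r s ` {..<r}, edgeB r s ` {..<r}}) (\<Union>{x ` {..<r}, y ` {..<r}})"
    using strict_mono_on_imp_inj_on[OF sm'] im by (auto simp: bij_betw_def image_Un)
  then show ?thesis unfolding order_isomorphic_def using sm' im by (intro exI[of _ \<phi>]) auto
qed

text \<open>An order isomorphism maps the \<open>i\<close>-th vertex of an edge to the \<open>i\<close>-th vertex of its image, so
  comparisons between the two edges carry over. As \<open>{e, f}\<close> is unordered, the signs are known
  only up to exchanging \<open>e\<close> and \<open>f\<close>.\<close>

lemma isomorphic_partite:
  assumes iso: "order_isomorphic {e, f} {edgeA r s ` {..<r}, edgeB r s ` {..<r}}"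
  shows "(sign_less r s (elt e) (elt f) \<or> sign_less r s (elt f) (elt e)) \<and>
    (\<forall>i. Suc i < r \<longrightarrow> elt e i < elt f (Suc i) \<and> elt f i < elt e (Suc i))"
proof -
  obtain \<psi> where \<psi>: "strict_mono_on (\<Union>{edgeA r s ` {..<r}, edgeB r s ` {..<r}}) \<psi>"
    "(\<lambda>e. \<psi> ` e) ` {edgeA r s ` {..<r}, edgeB r s ` {..<r}} = {e, f}"
    using order_isomorphic_sym[OF iso] unfolding order_isomorphic_def by blast
  have lt: "\<psi> (g i) < \<psi> (h j)" if "i < r" "j < r" "g i < h j" "g = edgeA r s \<or> g = edgeB r s" "h = edgeA r s \<or> h = edgeB r s" for g h i j
    using that by (intro strict_mono_onD[OF \<psi>(1)]) auto
  define x where "x = (\<lambda>i. \<psi> (edgeA r s i))"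
  define y where "y = (\<lambda>i. \<psi> (edgeB r s i))"
  have smx: "strict_mono_on {..<r} x" "strict_mono_on {..<r} y"
  proof -
    have "x i < x j" "y i < y j" if "i < j" "j < r" for i j
      using lt[of i j "edgeA r s" "edgeA r s"] lt[of i j "edgeB r s" "edgeB r s"] that
      by (simp_all add: x_def y_def) (auto simp: edgeA_def edgeB_def)
    then show "strict_mono_on {..<r} x" "strict_mono_on {..<r} y" by (auto intro!: strict_mono_onI)
  qed
  have sets: "\<psi> ` edgeA r s ` {..<r} = x ` {..<r}" "\<psi> ` edgeB r s ` {..<r} = y ` {..<r}"
    by (simp_all add: x_def y_def image_image)
  have sg: "sign_less r s x y"
    unfolding sign_less_def x_def y_def
  proof (intro allI impI)
    fix i assume "i < r"
    then show "if s i then \<psi> (edgeA r s i) < \<psi> (edgeB r s i) else \<psi> (edgeB r s i) < \<psi> (edgeA r s i)"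
      using lt[of i i "edgeA r s" "edgeB r s"] lt[of i i "edgeB r s" "edgeA r s"] by (cases "s i") (simp_all add: edgeA_def edgeB_def)
  qed
  have gap: "x i < y (Suc i)" "y i < x (Suc i)" if "Suc i < r" for i
    using lt[of i "Suc i" "edgeA r s" "edgeB r s"] lt[of i "Suc i" "edgeB r s" "edgeA r s"] that
    by (simp_all add: x_def y_def) (auto simp: edgeA_def edgeB_def)
  have "{x ` {..<r}, y ` {..<r}} = {e, f}" using \<psi>(2) sets by simp
  then consider "e = x ` {..<r}" "f = y ` {..<r}" | "e = y ` {..<r}" "f = x ` {..<r}"
    by (auto simp: doubleton_eq_iff)
  then show ?thesis
  proof cases
    case 1
    then have "elt e i = x i" "elt f i = y i" if "i < r" for i using elt_eqI smx that by auto
    then show ?thesis using sg gap by (auto simp: sign_less_def)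
  next
    case 2
    then have "elt e i = y i" "elt f i = x i" if "i < r" for i using elt_eqI smx that by auto
    then show ?thesis using sg gap by (auto simp: sign_less_def)
  qed
qed

text \<open>Reversing the coordinates with negative sign turns the signed order into the coordinatewise
  order.\<close>

definition place :: "nat \<Rightarrow> (nat \<Rightarrow> bool) \<Rightarrow> nat \<Rightarrow> (nat \<Rightarrow> nat) \<Rightarrow> nat \<Rightarrow> nat" where
  "place r s k x i = i * k + (if s i then x i else k + 1 - x i)"

lemma place_window:
  assumes "x \<in> grid r (\<lambda>_. k)" "i < r"
  shows "i * k < place r s k x i" "place r s k x i \<le> (i + 1) * k"
proof -
  have "x i \<in> {1..k}" using assms by (auto simp: grid_def PiE_iff)
  then show "i * k < place r s k x i" "place r s k x i \<le> (i + 1) * k" by (auto simp: place_def)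
qed

lemma place_gap:
  assumes "x \<in> grid r (\<lambda>_. k)" "y \<in> grid r (\<lambda>_. k)" "i < j" "j < r"
  shows "place r s k x i < place r s k y j"
proof -
  have "place r s k x i \<le> (i + 1) * k" using place_window[OF assms(1)] assms by simp
  also have "\<dots> \<le> j * k" using assms by (intro mult_right_mono) auto
  also have "\<dots> < place r s k y j" using place_window[OF assms(2,4)] by simp
  finally show ?thesis .
qed

lemma place_strict_mono:
  assumes "x \<in> grid r (\<lambda>_. k)"
  shows "strict_mono_on {..<r} (place r s k x)"
  using place_gap[OF assms assms] by (intro strict_mono_onI) auto

lemma bexp_mono_set:
  assumes "finite S" "A \<subseteq> S" "0 \<le> p" "p \<le> 1" "\<And>G. G \<subseteq> S \<Longrightarrow> F (G \<inter> A) \<le> F G"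
  shows "bexp p A F \<le> bexp p S F"
proof -
  have "bexp p A F = bexp p S (\<lambda>G. F (G \<inter> A))" using bexp_restrict[OF assms(1,2), of p F] by simp
  also have "\<dots> \<le> bexp p S F" using assms by (intro bexp_mono) auto
  finally show ?thesis .
qed

text \<open>Cut the vertex set into \<open>r\<close> equal intervals: the edges with a vertex in each interval form a
  random set of points in a cube, and chains of such points are cliques.\<close>

lemma partite_lower:
  assumes p: "0 \<le> p" "p \<le> 1" and P: "P = {edgeA r s ` {..<r}, edgeB r s ` {..<r}}"
  shows "bexp p (grid r (\<lambda>_. k)) (\<lambda>G. real (largest (chain (below r)) G))
    \<le> bexp p (redges r (r * k)) (\<lambda>G. real (max_clique P G))"
proof -
  define B where "B = grid r (\<lambda>_. k)"
  define E where "E = (\<lambda>x. place r s k x ` {..<r})"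
  have elt: "elt (E x) i = place r s k x i" if "x \<in> B" "i < r" for x i
    using elt_eqI[OF place_strict_mono] that unfolding B_def E_def by blast
  have inj: "inj_on E B"
  proof (rule inj_onI)
    fix x y assume xy: "x \<in> B" "y \<in> B" "E x = E y"
    have "x i = y i" if i: "i < r" for i
    proof -
      have "place r s k x i = place r s k y i" using elt xy i by metis
      moreover have "x i \<in> {1..k}" "y i \<in> {1..k}" using xy i by (auto simp: B_def grid_def PiE_iff)
      ultimately show ?thesis by (auto simp: place_def split: if_splits)
    qed
    then show "x = y" using xy by (intro PiE_ext[of x "{..<r}" _ y]) (auto simp: B_def grid_def)
  qed
  have EB: "E ` B \<subseteq> redges r (r * k)"
  proof
    fix e assume "e \<in> E ` B"
    then obtain x where x: "x \<in> B" "e = E x" by auto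
    have "card e = r" using strict_mono_on_imp_inj_on[OF place_strict_mono[of x r k s]] x
      by (simp add: E_def card_image B_def)
    moreover have "place r s k x i \<in> {1..r * k}" if i: "i < r" for i
    proof -
      have "(i + 1) * k \<le> r * k" using i by (intro mult_right_mono) auto
      then show ?thesis using place_window[of x r k i s] x i by (auto simp: B_def)
    qed
    ultimately show "e \<in> redges r (r * k)" by (auto simp: redges_def x(2) E_def)
  qed
  have iso: "order_isomorphic {E x, E y} P" if xy: "x \<in> B" "y \<in> B" "below r x y" for x y
  proof -
    have "order_isomorphic P {E x, E y}"
      unfolding P E_def
    proof (rule partite_isomorphic)
      show "sign_less r s (place r s k x) (place r s k y)"
        unfolding sign_less_def
      proof (intro allI impI)
        fix i assume i: "i < r"
        have "x i < y i" "x i \<in> {1..k}" "y i \<in> {1..k}" using xy i by (auto simp: B_def grid_def PiE_iff below_def)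
        then show "if s i then place r s k x i < place r s k y i else place r s k y i < place r s k x i"
          by (auto simp: place_def)
      qed
      show "max (place r s k x i) (place r s k y i) < min (place r s k x j) (place r s k y j)"
        if "i < j" "j < r" for i j using place_gap that xy(1,2) unfolding B_def by simp
    qed
    then show ?thesis by (rule order_isomorphic_sym)
  qed
  have le: "largest (chain (below r)) G \<le> max_clique P (E ` G)" if G: "G \<subseteq> B" for G
  proof -
    have fG: "finite G" using G finite_grid finite_subset unfolding B_def by blast
    obtain K where K: "K \<subseteq> G" "chain (below r) K" "card K = largest (chain (below r)) G"
      using largest_witness[OF hereditary_chain fG] by metis
    have "is_clique P (E ` K)"
      unfolding is_clique_def
    proof (intro ballI impI)
      fix e f assume ef: "e \<in> E ` K" "f \<in> E ` K" "e \<noteq> f"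
      then obtain x y where xy: "x \<in> K" "y \<in> K" "e = E x" "f = E y" "x \<noteq> y" by auto
      then have "below r x y \<or> below r y x" using K(2) by (auto simp: chain_def)
      moreover have "x \<in> B" "y \<in> B" using xy K G by auto
      ultimately show "order_isomorphic {e, f} P" using iso[of x y] iso[of y x] xy by (auto simp: insert_commute)
    qed
    then have "card (E ` K) \<le> max_clique P (E ` G)"
      unfolding max_clique_largest using fG K by (intro largest_ge) auto
    moreover have "card (E ` K) = card K" using K G inj by (intro card_image) (auto intro: inj_on_subset)
    ultimately show ?thesis using K by simp
  qed
  have "bexp p B (\<lambda>G. real (largest (chain (below r)) G)) \<le> bexp p B (\<lambda>G. real (max_clique P (E ` G)))"
    using p le by (intro bexp_mono) auto
  also have "\<dots> = bexp p (E ` B) (\<lambda>G. real (max_clique P G))" by (rule bexp_image[OF inj, symmetric])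
  also have "\<dots> \<le> bexp p (redges r (r * k)) (\<lambda>G. real (max_clique P G))"
    unfolding max_clique_largest
  proof (intro bexp_mono_set finite_redges EB p)
    fix G assume "G \<subseteq> redges r (r * k)"
    then have "finite G" using finite_redges finite_subset by blast
    then show "real (largest (is_clique P) (G \<inter> E ` B)) \<le> real (largest (is_clique P) G)"
      by (simp add: largest_mono[OF hereditary_clique])
  qed
  finally show ?thesis by (simp add: B_def)
qed

text \<open>Each window \<open>W j\<close> is embedded in a box, so its statistic has mean and variance at most \<open>M\<close>; the
  windows are boundedly many, and \<open>bexp_max_le\<close> controls their maximum.\<close>

lemma cover_bound:
  assumes S: "finite S" "0 \<le> p" "p \<le> 1" and J: "finite J"
    and W: "\<And>j. j \<in> J \<Longrightarrow> W j \<subseteq> S" "\<And>j. j \<in> J \<Longrightarrow> inj_on (\<tau> j) (W j)"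
      "\<And>j. j \<in> J \<Longrightarrow> \<tau> j ` W j \<subseteq> grid r (v j)"
    and cov: "\<And>G. G \<subseteq> S \<Longrightarrow> \<exists>j\<in>J. F G \<le> real (largest (chain (below r)) (\<tau> j ` (G \<inter> W j)))"
    and M: "\<And>j. j \<in> J \<Longrightarrow> bexp p (grid r (v j)) (\<lambda>G. real (largest (chain (below r)) G)) \<le> M"
  shows "bexp p S F \<le> M + real (card J) * sqrt M"
proof -
  define L where "L = (\<lambda>G. real (largest (chain (below r)) G))"
  have tr: "bexp p S (\<lambda>G. g (L (\<tau> j ` (G \<inter> W j)))) = bexp p (\<tau> j ` W j) (\<lambda>G. g (L G))" if "j \<in> J" for j g
  proof -
    have "bexp p S (\<lambda>G. g (L (\<tau> j ` (G \<inter> W j)))) = bexp p (W j) (\<lambda>G. g (L (\<tau> j ` G)))"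
      using bexp_restrict[OF S(1) W(1)[OF that], of p "\<lambda>G. g (L (\<tau> j ` G))"] .
    also have "\<dots> = bexp p (\<tau> j ` W j) (\<lambda>G. g (L G))"
      using bexp_image[OF W(2)[OF that], of p "\<lambda>G. g (L G)"] by simp
    finally show ?thesis .
  qed
  have mean: "bexp p (\<tau> j ` W j) L \<le> M" if j: "j \<in> J" for j
  proof -
    have "bexp p (\<tau> j ` W j) L \<le> bexp p (grid r (v j)) L"
    proof (intro bexp_mono_set finite_grid W(3) j S)
      fix G assume "G \<subseteq> grid r (v j)"
      then have "finite G" using finite_grid finite_subset by blast
      then show "L (G \<inter> \<tau> j ` W j) \<le> L G" by (simp add: L_def largest_mono[OF hereditary_chain])
    qed
    also have "\<dots> \<le> M" using M[OF j] by (simp add: L_def)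
    finally show ?thesis .
  qed
  show ?thesis
  proof (rule bexp_max_le[OF S J, where H = "\<lambda>j G. L (\<tau> j ` (G \<inter> W j))"])
    show "\<exists>j\<in>J. F G \<le> L (\<tau> j ` (G \<inter> W j))" if "G \<subseteq> S" for G using cov[OF that] by (simp add: L_def)
    fix j assume j: "j \<in> J"
    have e: "bexp p S (\<lambda>G. L (\<tau> j ` (G \<inter> W j))) = bexp p (\<tau> j ` W j) L" using tr[OF j, of "\<lambda>x. x"] by simp
    then show "bexp p S (\<lambda>G. L (\<tau> j ` (G \<inter> W j))) \<le> M" using mean[OF j] by simp
    have "bexp p S (\<lambda>G. (L (\<tau> j ` (G \<inter> W j)) - bexp p S (\<lambda>G. L (\<tau> j ` (G \<inter> W j))))\<^sup>2)
        = bexp p (\<tau> j ` W j) (\<lambda>G. (L G - bexp p (\<tau> j ` W j) L)\<^sup>2)"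
      unfolding e using tr[OF j, of "\<lambda>x. (x - bexp p (\<tau> j ` W j) L)\<^sup>2"] by simp
    also have "\<dots> \<le> bexp p (\<tau> j ` W j) L"
      unfolding L_def using finite_subset[OF W(1)[OF j] S(1)] S(2,3)
      by (intro largest_variance_le_mean[OF hereditary_chain]) auto
    also have "\<dots> \<le> M" by (rule mean[OF j])
    finally show "bexp p S (\<lambda>G. (L (\<tau> j ` (G \<inter> W j)) - bexp p S (\<lambda>G. L (\<tau> j ` (G \<inter> W j))))\<^sup>2) \<le> M" .
  qed
qed

text \<open>Candidates for rounded intervals, in units of a length \<open>k\<close>: interval \<open>i\<close> starts at \<open>\<alpha> i\<close> and has
  length \<open>u i\<close>. Rounding may let neighbouring intervals overlap in one unit, so that the total length
  of intervals inside \<open>{1..K * k}\<close> is bounded by \<open>K + r\<close> only.\<close>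

definition windows :: "nat \<Rightarrow> nat \<Rightarrow> ((nat \<Rightarrow> nat) \<times> (nat \<Rightarrow> nat)) set" where
  "windows r K = {(\<alpha>, u). \<alpha> \<in> PiE {..<r} (\<lambda>_. {0..K}) \<and> u \<in> PiE {..<r} (\<lambda>_. {1..K + r}) \<and> (\<Sum>i<r. u i) \<le> K + r}"

lemma finite_windows: "finite (windows r K)"
proof (rule finite_subset)
  show "windows r K \<subseteq> PiE {..<r} (\<lambda>_. {0..K}) \<times> PiE {..<r} (\<lambda>_. {1..K + r})" by (auto simp: windows_def)
  show "finite (PiE {..<r} (\<lambda>_. {0..K}) \<times> PiE {..<r} (\<lambda>_. {1..K + r}))"
    by (intro finite_cartesian_product finite_PiE) auto
qed

lemma window_sum:
  fixes \<alpha> \<beta> :: "nat \<Rightarrow> nat"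
  assumes "\<And>i. i < r \<Longrightarrow> \<alpha> i \<le> \<beta> i" "\<And>i. Suc i < r \<Longrightarrow> \<beta> i \<le> \<alpha> (Suc i) + 1"
  shows "Suc j \<le> r \<Longrightarrow> (\<Sum>i<Suc j. \<beta> i - \<alpha> i) \<le> \<beta> j + j"
proof (induction j)
  case (Suc j)
  have "(\<Sum>i<Suc (Suc j). \<beta> i - \<alpha> i) \<le> \<beta> j + j + (\<beta> (Suc j) - \<alpha> (Suc j))" using Suc by simp
  also have "\<dots> \<le> \<beta> (Suc j) + Suc j" using assms(1)[of "Suc j"] assms(2)[of j] Suc.prems by simp
  finally show ?case .
qed simp

text \<open>The cuts between the consecutive coordinates of a clique are rounded to multiples of \<open>k\<close>,
  which leaves a bounded number of possibilities as \<open>k\<close> grows.\<close>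

lemma clique_window:
  assumes r: "1 \<le> r" and k: "1 \<le> k" and C: "C \<subseteq> redges r (K * k)" "is_clique {edgeA r s ` {..<r}, edgeB r s ` {..<r}} C"
  shows "\<exists>(\<alpha>, u)\<in>windows r K. \<forall>e\<in>C. \<forall>i<r. \<alpha> i * k < elt e i \<and> elt e i \<le> (\<alpha> i + u i) * k"
proof (cases "C = {}")
  case True
  have "((\<lambda>i\<in>{..<r}. 0), (\<lambda>i\<in>{..<r}. 1)) \<in> windows r K" by (auto simp: windows_def)
  then show ?thesis using True by auto
next
  case False
  have fC: "finite C" using C finite_redges finite_subset by blast
  have e: "strict_mono_on {..<r} (elt e)" "elt e ` {..<r} = e" "e \<subseteq> {1..K * k}" if "e \<in> C" for e
  proof -
    have "e \<in> redges r (K * k)" using that C(1) by blast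
    then have *: "e \<subseteq> {1..K * k}" "card e = r" unfolding redges_def by blast+
    then have "finite e" using finite_subset by blast
    from elt[OF this *(2)] *(1) show "strict_mono_on {..<r} (elt e)" "elt e ` {..<r} = e" "e \<subseteq> {1..K * k}" .
  qed
  have e_in: "elt e i \<in> e" if "e \<in> C" "i < r" for e i
  proof -
    have "elt e i \<in> elt e ` {..<r}" using that by simp
    then show ?thesis unfolding e(2)[OF that(1)] .
  qed
  define mx where "mx = (\<lambda>i. Max ((\<lambda>e. elt e i) ` C))"
  have mx: "elt e i \<le> mx i" if "e \<in> C" for e i unfolding mx_def using that fC by (intro Max_ge) auto
  have mx_in: "\<exists>f\<in>C. elt f i = mx i" for i
  proof -
    have "mx i \<in> (\<lambda>e. elt e i) ` C" unfolding mx_def using fC False by (intro Max_in) auto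
    then show ?thesis by auto
  qed
  have mxK: "mx i \<le> K * k" "1 \<le> mx i" if "i < r" for i
  proof -
    obtain f where f: "f \<in> C" "elt f i = mx i" using mx_in by blast
    then have "mx i \<in> f" using e_in[OF f(1) that] by simp
    then show "mx i \<le> K * k" "1 \<le> mx i" using e(3)[OF f(1)] by auto
  qed
  have next_gt: "mx i < elt e (Suc i)" if "e \<in> C" "Suc i < r" for e i
  proof -
    obtain f where f: "f \<in> C" "elt f i = mx i" using mx_in by blast
    show ?thesis
    proof (cases "e = f")
      case True
      then show ?thesis using strict_mono_onD[OF e(1)[OF that(1)], of i "Suc i"] that f by simp
    next
      case False
      then have "order_isomorphic {e, f} {edgeA r s ` {..<r}, edgeB r s ` {..<r}}"
        using C(2) that f by (simp add: is_clique_def)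
      from isomorphic_partite[OF this] show ?thesis using that f by auto
    qed
  qed
  \<comment> \<open>All \<open>i\<close>-th vertices lie after the largest \<open>i - 1\<close>-st vertex, even of another edge, and up to the
    largest \<open>i\<close>-th vertex; round these cuts outwards.\<close>
  define \<alpha> where "\<alpha> = (\<lambda>i. if i = 0 then 0 else mx (i - 1) div k)"
  define \<beta> where "\<beta> = (\<lambda>i. (mx i + k - 1) div k)"
  have \<beta>: "mx i \<le> \<beta> i * k" for i
  proof -
    have "mx i + k - 1 < ((mx i + k - 1) div k + 1) * k" using k by (simp add: dividend_less_div_times add.commute)
    then show ?thesis unfolding \<beta>_def using k by (simp add: algebra_simps)
  qed
  have \<alpha>: "\<alpha> i * k < elt e i" if "e \<in> C" "i < r" for e i
  proof (cases i)
    case 0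
    have "elt e 0 \<in> e" using e_in[OF that] 0 by simp
    then show ?thesis using 0 e(3)[OF that(1)] by (auto simp: \<alpha>_def)
  next
    case (Suc j)
    have "\<alpha> i * k \<le> mx j" using Suc by (simp add: \<alpha>_def div_times_less_eq_dividend)
    also have "\<dots> < elt e i" using next_gt[OF that(1), of j] that Suc by simp
    finally show ?thesis .
  qed
  have lt: "\<alpha> i < \<beta> i" if i: "i < r" for i
  proof -
    obtain f where f: "f \<in> C" using False by blast
    have "\<alpha> i * k < \<beta> i * k" using \<alpha>[OF f i] mx[OF f, of i] \<beta>[of i] by linarith
    then show ?thesis by simp
  qed
  have step: "\<beta> i \<le> \<alpha> (Suc i) + 1" for i
  proof -
    have "(mx i + k - 1) div k \<le> (mx i + k) div k" by (intro div_le_mono) simp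
    then show ?thesis using k by (simp add: \<alpha>_def \<beta>_def)
  qed
  have \<beta>K: "\<beta> i \<le> K" if i: "i < r" for i
  proof -
    have "\<beta> i \<le> (K * k + k - 1) div k" unfolding \<beta>_def using mxK[OF i] by (intro div_le_mono) simp
    also have "\<dots> = K"
    proof -
      have eq: "K * k + k - 1 = (k - 1) + K * k" using k by simp
      have "(k - 1) div k = 0" using k by (intro div_less) simp
      then show ?thesis unfolding eq using k by (subst div_mult_self1) auto
    qed
    finally show ?thesis .
  qed
  define u where "u = (\<lambda>i. \<beta> i - \<alpha> i)"
  have "(\<Sum>i<r. u i) \<le> K + r"
  proof -
    have "(\<Sum>i<Suc (r - 1). \<beta> i - \<alpha> i) \<le> \<beta> (r - 1) + (r - 1)"
      using lt step r by (intro window_sum[of r]) (auto simp: less_imp_le)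
    also have "\<dots> \<le> K + r" using \<beta>K[of "r - 1"] r by simp
    finally show ?thesis using r by (simp add: u_def)
  qed
  then have win: "(restrict \<alpha> {..<r}, restrict u {..<r}) \<in> windows r K"
  proof -
    have "\<alpha> i \<le> K" "1 \<le> u i" "u i \<le> K + r" if "i < r" for i
      using lt[OF that] \<beta>K[OF that] by (auto simp: u_def)
    then show ?thesis using \<open>(\<Sum>i<r. u i) \<le> K + r\<close> by (auto simp: windows_def)
  qed
  have "\<alpha> i * k < elt e i \<and> elt e i \<le> (\<alpha> i + u i) * k" if "e \<in> C" "i < r" for e i
  proof -
    have "elt e i \<le> \<beta> i * k" using mx[OF that(1), of i] \<beta>[of i] by linarith
    moreover have "\<alpha> i + u i = \<beta> i" using lt[OF that(2)] by (simp add: u_def)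
    ultimately show ?thesis using \<alpha>[OF that] by simp
  qed
  then show ?thesis using win by (intro bexI[of _ "(restrict \<alpha> {..<r}, restrict u {..<r})"]) auto
qed

text \<open>Inside a fixed window, the coordinates of the edge within its intervals, reversed where the sign is
  negative, form a random set of points in a box, and cliques become chains.\<close>

lemma partite_upper:
  assumes r: "1 \<le> r" and k: "1 \<le> k" and p: "0 \<le> p" "p \<le> 1"
    and P: "P = {edgeA r s ` {..<r}, edgeB r s ` {..<r}}"
    and M: "\<And>u. (\<forall>i<r. 1 \<le> u i) \<Longrightarrow> (\<Sum>i<r. u i) \<le> K + r \<Longrightarrow>
      bexp p (grid r (\<lambda>i. u i * k)) (\<lambda>G. real (largest (chain (below r)) G)) \<le> M"
  shows "bexp p (redges r (K * k)) (\<lambda>G. real (max_clique P G)) \<le> M + real (card (windows r K)) * sqrt M"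
proof -
  define \<tau> where "\<tau> = (\<lambda>(\<alpha>, u) e. \<lambda>i\<in>{..<r}. if s i then elt e i - \<alpha> i * k else (\<alpha> i + u i) * k + 1 - elt e i)"
  define W where "W = (\<lambda>(\<alpha>, u). {e \<in> redges r (K * k). \<forall>i<r. \<alpha> i * k < elt e i \<and> elt e i \<le> (\<alpha> i + u i) * k})"
  have e: "elt e ` {..<r} = e" if "e \<in> redges r m" for e m
    using that elt(2)[of e r] by (auto simp: redges_def intro: finite_subset)
  have inj: "inj_on (\<tau> (\<alpha>, u)) (W (\<alpha>, u))" for \<alpha> u
  proof (rule inj_onI)
    fix e f assume ef: "e \<in> W (\<alpha>, u)" "f \<in> W (\<alpha>, u)" "\<tau> (\<alpha>, u) e = \<tau> (\<alpha>, u) f"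
    have "elt e i = elt f i" if i: "i < r" for i
    proof -
      have "\<tau> (\<alpha>, u) e i = \<tau> (\<alpha>, u) f i" using ef(3) by simp
      moreover have "\<alpha> i * k < elt e i" "elt e i \<le> (\<alpha> i + u i) * k" "\<alpha> i * k < elt f i" "elt f i \<le> (\<alpha> i + u i) * k"
        using ef(1,2) i by (auto simp: W_def)
      ultimately show ?thesis using i by (auto simp: \<tau>_def split: if_splits)
    qed
    then have "elt e ` {..<r} = elt f ` {..<r}" by (intro image_cong) auto
    then show "e = f" using e ef(1,2) by (auto simp: W_def)
  qed
  have "bexp p (redges r (K * k)) (\<lambda>G. real (max_clique P G)) \<le> M + real (card (windows r K)) * sqrt M"
  proof (rule cover_bound[OF finite_redges p finite_windows, where W = W and \<tau> = \<tau> and v = "\<lambda>(\<alpha>, u) i. u i * k"])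
    fix j assume j: "j \<in> windows r K"
    obtain \<alpha> u where au: "j = (\<alpha>, u)" by force
    have u: "\<forall>i<r. 1 \<le> u i" "(\<Sum>i<r. u i) \<le> K + r" using j by (auto simp: au windows_def PiE_iff)
    show "W j \<subseteq> redges r (K * k)" by (auto simp: W_def au)
    show "inj_on (\<tau> j) (W j)" unfolding au by (rule inj)
    show "\<tau> j ` W j \<subseteq> grid r ((\<lambda>(\<alpha>, u) i. u i * k) j)"
    proof
      fix x assume "x \<in> \<tau> j ` W j"
      then obtain e where ew: "e \<in> W j" "x = \<tau> j e" by auto
      have "x i \<in> {1..u i * k}" if i: "i < r" for i
      proof -
        have "\<alpha> i * k < elt e i" "elt e i \<le> \<alpha> i * k + u i * k"
          using ew i by (auto simp: W_def au distrib_right)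
        then show ?thesis using i by (auto simp: ew(2) \<tau>_def au distrib_right)
      qed
      then show "x \<in> grid r ((\<lambda>(\<alpha>, u) i. u i * k) j)" by (auto simp: grid_def au PiE_iff ew(2) \<tau>_def)
    qed
    show "bexp p (grid r ((\<lambda>(\<alpha>, u) i. u i * k) j)) (\<lambda>G. real (largest (chain (below r)) G)) \<le> M"
      using M[OF u] by (simp add: au)
  next
    fix G assume G: "G \<subseteq> redges r (K * k)"
    then have fG: "finite G" using finite_redges finite_subset by blast
    obtain C where C: "C \<subseteq> G" "is_clique P C" "card C = max_clique P G"
      using largest_witness[OF hereditary_clique fG] unfolding max_clique_largest by metis
    have CP: "C \<subseteq> redges r (K * k)" using C G by auto
    obtain \<alpha> u where au: "(\<alpha>, u) \<in> windows r K"
      "\<And>e i. e \<in> C \<Longrightarrow> i < r \<Longrightarrow> \<alpha> i * k < elt e i \<and> elt e i \<le> (\<alpha> i + u i) * k"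
      using clique_window[OF r k CP C(2)[unfolded P]] by auto
    have CW: "C \<subseteq> G \<inter> W (\<alpha>, u)" using C CP au(2) by (auto simp: W_def)
    have "chain (below r) (\<tau> (\<alpha>, u) ` C)"
    proof -
      have sb: "below r (\<tau> (\<alpha>, u) e) (\<tau> (\<alpha>, u) f)" if ef: "e \<in> C" "f \<in> C" "sign_less r s (elt e) (elt f)" for e f
        unfolding below_def
      proof (intro allI impI)
        fix i assume i: "i < r"
        have "if s i then elt e i < elt f i else elt f i < elt e i" using ef(3) i by (simp add: sign_less_def)
        then show "\<tau> (\<alpha>, u) e i < \<tau> (\<alpha>, u) f i"
          using au(2)[OF ef(1) i] au(2)[OF ef(2) i] i by (auto simp: \<tau>_def split: if_splits)
      qed
      have "below r (\<tau> (\<alpha>, u) e) (\<tau> (\<alpha>, u) f) \<or> below r (\<tau> (\<alpha>, u) f) (\<tau> (\<alpha>, u) e)"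
        if ef: "e \<in> C" "f \<in> C" "e \<noteq> f" for e f
      proof -
        have "order_isomorphic {e, f} {edgeA r s ` {..<r}, edgeB r s ` {..<r}}"
          using C(2) ef by (simp add: is_clique_def P)
        from isomorphic_partite[OF this] show ?thesis using sb ef by blast
      qed
      then show ?thesis unfolding chain_def by blast
    qed
    then have "card (\<tau> (\<alpha>, u) ` C) \<le> largest (chain (below r)) (\<tau> (\<alpha>, u) ` (G \<inter> W (\<alpha>, u)))"
      using fG CW by (intro largest_ge) auto
    moreover have "card (\<tau> (\<alpha>, u) ` C) = card C"
    proof (rule card_image)
      have "C \<subseteq> W (\<alpha>, u)" using CW by simp
      then show "inj_on (\<tau> (\<alpha>, u)) C" by (rule inj_on_subset[OF inj])
    qed
    ultimately have "real (max_clique P G) \<le> real (largest (chain (below r)) (\<tau> (\<alpha>, u) ` (G \<inter> W (\<alpha>, u))))"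
      using C(3) by simp
    then show "\<exists>j\<in>windows r K. real (max_clique P G) \<le> real (largest (chain (below r)) (\<tau> j ` (G \<inter> W j)))"
      using au(1) by blast
  qed
  then show ?thesis .
qed

section \<open>The constant of a partite pattern\<close>

text \<open>The density \<open>\<rho> / k ^ r\<close> puts \<open>\<rho>\<close> points into a cube of side \<open>k\<close> on average, and \<open>\<rho>\<close> times the product
  of the \<open>u i\<close> into the box with sides \<open>u i * k\<close>. By the inequality of arithmetic and geometric means
  the \<open>r\<close>-th root of that product is at most \<open>(K + r) / r\<close>, whatever the shape of the box.\<close>

lemma grid_limit:
  assumes r: "2 \<le> r" and hc: "has_chain_constant r c" and c: "0 < c" and \<epsilon>: "0 < \<epsilon>"
  shows "\<exists>\<rho>0>0. \<forall>\<rho>\<ge>\<rho>0. eventually (\<lambda>k. 1 \<le> k \<and> 0 < \<rho> / real k ^ r \<and> \<rho> / real k ^ r \<le> 1 / 2 \<and>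
    (c - \<epsilon>) * \<rho> powr (1 / real r) \<le> bexp (\<rho> / real k ^ r) (grid r (\<lambda>_. k)) (\<lambda>G. real (largest (chain (below r)) G)) \<and>
    (\<forall>u. (\<forall>i<r. 1 \<le> u i) \<longrightarrow> (\<Sum>i<r. u i) \<le> K + r \<longrightarrow>
      bexp (\<rho> / real k ^ r) (grid r (\<lambda>i. u i * k)) (\<lambda>G. real (largest (chain (below r)) G))
        \<le> (c + \<epsilon>) * (real (K + r) / real r) * \<rho> powr (1 / real r))) sequentially"
proof -
  define a where "a = 1 / real r"
  have a: "0 < a" using r by (simp add: a_def)
  define L where "L = (\<lambda>G. real (largest (chain (below r)) G))"
  obtain l0 where l0: "0 < l0" and lim: "\<forall>U. \<exists>m0. \<forall>u p. (\<forall>i<r. m0 \<le> u i) \<longrightarrow> 0 \<le> p \<longrightarrow> p \<le> 1 \<longrightarrow>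
     l0 \<le> p * real (\<Prod>i<r. u i) \<longrightarrow> p * real (\<Prod>i<r. u i) \<le> U \<longrightarrow>
     \<bar>bexp p (grid r u) L - c * (p * real (\<Prod>i<r. u i)) powr a\<bar> \<le> \<epsilon> * (p * real (\<Prod>i<r. u i)) powr a"
    using hc \<epsilon> unfolding has_chain_constant_def a_def L_def by blast
  have "eventually (\<lambda>k. 1 \<le> k \<and> 0 < \<rho> / real k ^ r \<and> \<rho> / real k ^ r \<le> 1 / 2 \<and>
    (c - \<epsilon>) * \<rho> powr a \<le> bexp (\<rho> / real k ^ r) (grid r (\<lambda>_. k)) L \<and>
    (\<forall>u. (\<forall>i<r. 1 \<le> u i) \<longrightarrow> (\<Sum>i<r. u i) \<le> K + r \<longrightarrow>
      bexp (\<rho> / real k ^ r) (grid r (\<lambda>i. u i * k)) L \<le> (c + \<epsilon>) * (real (K + r) / real r) * \<rho> powr a)) sequentially"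
    if \<rho>: "l0 \<le> \<rho>" for \<rho>
  proof -
    have \<rho>0: "0 < \<rho>" using \<rho> l0 by simp
    obtain m0 where m0: "\<And>u p. (\<forall>i<r. m0 \<le> u i) \<Longrightarrow> 0 \<le> p \<Longrightarrow> p \<le> 1 \<Longrightarrow>
     l0 \<le> p * real (\<Prod>i<r. u i) \<Longrightarrow> p * real (\<Prod>i<r. u i) \<le> \<rho> * real (K + r) ^ r \<Longrightarrow>
     \<bar>bexp p (grid r u) L - c * (p * real (\<Prod>i<r. u i)) powr a\<bar> \<le> \<epsilon> * (p * real (\<Prod>i<r. u i)) powr a"
      using lim[rule_format, of "\<rho> * real (K + r) ^ r"] by blast
    have "(\<lambda>k. \<rho> / real k ^ r) \<longlonglongrightarrow> 0"
      using r by (intro tendsto_divide_0[OF tendsto_const] filterlim_at_top_imp_at_infinity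
        filterlim_pow_at_top filterlim_real_sequentially) auto
    then have "eventually (\<lambda>k. \<rho> / real k ^ r < 1 / 2) sequentially" by (rule order_tendstoD) simp
    then show ?thesis
      using eventually_ge_at_top[of "max 1 m0"]
    proof eventually_elim
      case (elim k)
      have k: "1 \<le> k" "m0 \<le> k" using elim(2) by auto
      define p where "p = \<rho> / real k ^ r"
      have p: "0 < p" "p \<le> 1 / 2" using elim(1) \<rho>0 k by (auto simp: p_def)
      have gen: "\<bar>bexp p (grid r (\<lambda>i. u i * k)) L - c * (\<rho> * real (\<Prod>i<r. u i)) powr a\<bar> \<le> \<epsilon> * (\<rho> * real (\<Prod>i<r. u i)) powr a"
        if u: "\<forall>i<r. 1 \<le> u i" "(\<Sum>i<r. u i) \<le> K + r" for u
      proof -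
        have eq: "p * real (\<Prod>i<r. u i * k) = \<rho> * real (\<Prod>i<r. u i)"
          using k by (simp add: p_def prod.distrib)
        have ui: "u i \<le> K + r" if "i < r" for i
        proof -
          have "u i \<le> (\<Sum>i<r. u i)" using that by (intro member_le_sum) auto
          then show ?thesis using u(2) by simp
        qed
        have "1 \<le> (\<Prod>i<r. u i)" using u(1) by (intro prod_ge_1) auto
        then have "1 \<le> real (\<Prod>i<r. u i)" by (metis of_nat_1 of_nat_le_iff)
        then have "\<rho> * 1 \<le> \<rho> * real (\<Prod>i<r. u i)" using \<rho>0 by (intro mult_left_mono) auto
        moreover have "(\<Prod>i<r. u i) \<le> (\<Prod>i<r. K + r)" using ui by (intro prod_mono) auto
        then have "real (\<Prod>i<r. u i) \<le> real (K + r) ^ r" by (metis card_lessThan of_nat_le_iff of_nat_power prod_constant)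
        then have "\<rho> * real (\<Prod>i<r. u i) \<le> \<rho> * real (K + r) ^ r" using \<rho>0 by (intro mult_left_mono) auto
        moreover have "\<forall>i<r. m0 \<le> u i * k" using u(1) k by (metis le_trans mult_le_mono mult_1)
        ultimately show ?thesis using m0[of "\<lambda>i. u i * k" p] p \<rho> unfolding eq by simp
      qed
      have "(c - \<epsilon>) * \<rho> powr a \<le> bexp p (grid r (\<lambda>_. k)) L"
        using gen[of "\<lambda>_. 1"] by (simp add: abs_le_iff left_diff_distrib)
      moreover have "bexp p (grid r (\<lambda>i. u i * k)) L \<le> (c + \<epsilon>) * (real (K + r) / real r) * \<rho> powr a"
        if u: "\<forall>i<r. 1 \<le> u i" "(\<Sum>i<r. u i) \<le> K + r" for u
      proof -
        define y where "y = real (\<Prod>i<r. u i)"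
        have "y powr a \<le> real (K + r) / real r"
        proof -
          have "(\<Prod>i<r. real (u i)) powr (1 / real (card {..<r})) \<le> (\<Sum>i<r. real (u i) / real (card {..<r}))"
          proof (intro arith_geom_mean)
            have "0 \<in> {..<r}" using r by simp
            then show "{..<r} \<noteq> {}" by blast
          qed auto
          then have "y powr a \<le> real (\<Sum>i<r. u i) / real r" by (simp add: y_def a_def sum_divide_distrib)
          also have "\<dots> \<le> real (K + r) / real r" using u(2) by (intro divide_right_mono of_nat_mono) auto
          finally show ?thesis .
        qed
        then have "\<rho> powr a * y powr a \<le> \<rho> powr a * (real (K + r) / real r)"
          by (rule mult_left_mono) simp
        moreover have "0 \<le> y" by (simp add: y_def prod_nonneg)
        ultimately have "(\<rho> * y) powr a \<le> real (K + r) / real r * \<rho> powr a"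
          using \<rho>0 by (simp add: powr_mult mult.commute)
        then have "(c + \<epsilon>) * (\<rho> * y) powr a \<le> (c + \<epsilon>) * (real (K + r) / real r * \<rho> powr a)"
          using c \<epsilon> by (intro mult_left_mono) auto
        moreover have "bexp p (grid r (\<lambda>i. u i * k)) L \<le> (c + \<epsilon>) * (\<rho> * y) powr a"
          using gen[OF u] unfolding y_def by (simp add: abs_le_iff distrib_right)
        ultimately show ?thesis by (simp add: mult.assoc)
      qed
      ultimately show ?case using k p by (simp add: p_def)
    qed
  qed
  then show ?thesis using l0 unfolding a_def L_def by blast
qed

text \<open>Divide by \<open>\<rho> powr (1 / r)\<close> and let \<open>\<rho>\<close> tend to infinity, which removes the fluctuations and the
  additive constant. Then dividing by \<open>K\<close> and letting \<open>K\<close> tend to infinity removes the rounding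
  error, and finally \<open>\<epsilon>\<close> tends to \<open>0\<close>.\<close>

lemma asymp_compare:
  fixes A c :: real and r :: nat
  assumes r: "1 \<le> r" and H: "\<And>K \<epsilon>. 1 \<le> K \<Longrightarrow> 0 < \<epsilon> \<Longrightarrow> \<exists>C D \<rho>0. \<forall>\<rho>\<ge>\<rho>0.
    A * real K * \<rho> powr (1 / real r) \<le> (c + \<epsilon>) * (real (K + r) / real r) * \<rho> powr (1 / real r)
      + \<epsilon> * real K * \<rho> powr (1 / real r) + C * sqrt (\<rho> powr (1 / real r)) + D"
  shows "A \<le> c / real r"
proof -
  define a where "a = 1 / real r"
  have a: "0 < a" using r by (simp add: a_def)
  have K: "A * real K \<le> (c + \<epsilon>) * (real (K + r) / real r) + \<epsilon> * real K" if "1 \<le> K" "0 < \<epsilon>" for K \<epsilon>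
  proof -
    define B where "B = (c + \<epsilon>) * (real (K + r) / real r) + \<epsilon> * real K"
    note Ke = that
    obtain C D \<rho>0 where ineq: "\<And>\<rho>. \<rho>0 \<le> \<rho> \<Longrightarrow> A * real K * \<rho> powr a \<le> B * \<rho> powr a + C * sqrt (\<rho> powr a) + D"
      using H[OF Ke] unfolding a_def B_def distrib_right by blast
    have "((\<lambda>X. B + C * sqrt X / X + D / X) \<longlongrightarrow> B) at_top" by real_asymp
    moreover have "eventually (\<lambda>X. A * real K \<le> B + C * sqrt X / X + D / X) at_top"
      using eventually_ge_at_top[of "max 1 (\<bar>\<rho>0\<bar> powr a)"]
    proof eventually_elim
      case (elim X)
      define \<rho> where "\<rho> = X powr (1 / a)"
      have X: "0 < X" "\<rho> powr a = X" using elim a by (auto simp: \<rho>_def powr_powr)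
      have "(\<bar>\<rho>0\<bar> powr a) powr (1 / a) \<le> X powr (1 / a)" using elim a by (intro powr_mono2) auto
      then have "\<rho>0 \<le> \<rho>" using a by (simp add: powr_powr \<rho>_def)
      from ineq[OF this] show ?case using X by (simp add: field_simps)
    qed
    ultimately show ?thesis unfolding B_def[symmetric] by (rule tendsto_lowerbound) simp
  qed
  have e: "A \<le> (c + \<epsilon>) / real r + \<epsilon>" if "0 < \<epsilon>" for \<epsilon>
  proof (rule tendsto_lowerbound)
    show "(\<lambda>K. (c + \<epsilon>) * (1 / real r + 1 / real K) + \<epsilon>) \<longlonglongrightarrow> (c + \<epsilon>) / real r + \<epsilon>"
      using tendsto_add[OF tendsto_mult[OF tendsto_const[of "c + \<epsilon>"] tendsto_add[OF tendsto_const[of "1 / real r"] lim_1_over_n]] tendsto_const[of \<epsilon>]]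
      by simp
    show "\<forall>\<^sub>F K in sequentially. A \<le> (c + \<epsilon>) * (1 / real r + 1 / real K) + \<epsilon>"
      using eventually_ge_at_top[of 1]
    proof eventually_elim
      case (elim K)
      have "(c + \<epsilon>) * (real (K + r) / real r) + \<epsilon> * real K = ((c + \<epsilon>) * (1 / real r + 1 / real K) + \<epsilon>) * real K"
        using elim r by (simp add: field_simps)
      then have "A * real K \<le> ((c + \<epsilon>) * (1 / real r + 1 / real K) + \<epsilon>) * real K" using K[OF elim that] by simp
      then show ?case using elim by simp
    qed
  qed simp
  have "((\<lambda>\<epsilon>. (c + \<epsilon>) / real r + \<epsilon>) \<longlongrightarrow> (c + 0) / real r + 0) (at_right 0)"
    using r by (intro tendsto_intros) auto
  moreover have "\<forall>\<^sub>F \<epsilon> in at_right 0. A \<le> (c + \<epsilon>) / real r + \<epsilon>"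
    using eventually_at_right_less[of "0::real"] by eventually_elim (rule e)
  ultimately have "A \<le> (c + 0) / real r + 0" by (rule tendsto_lowerbound) simp
  then show ?thesis by simp
qed

lemma root_scale:
  assumes "1 \<le> r" "0 \<le> x"
  shows "(x * real K ^ r / fact r) powr (1 / real r) = x powr (1 / real r) * real K / fact r powr (1 / real r)"
proof -
  have "(real K ^ r) powr (1 / real r) = real K"
    using assms(1) by (cases "K = 0") (auto simp: powr_realpow[symmetric] powr_powr power_0_left)
  then show ?thesis using assms by (simp add: powr_divide powr_mult)
qed

lemma intensity_redges:
  assumes K: "1 \<le> K"
  shows "(\<lambda>k. \<rho> / real k ^ r * real (K * k choose r)) \<longlonglongrightarrow> \<rho> * real K ^ r / fact r"
proof -
  have "filterlim (\<lambda>k. K * k) sequentially sequentially"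
    using K by (intro filterlim_subseq strict_monoI) auto
  from filterlim_compose[OF binomial_asymp[of r] this]
  have lim: "(\<lambda>k. real (K * k choose r) / real (K * k) ^ r) \<longlonglongrightarrow> 1 / fact r" .
  have "(\<lambda>k. \<rho> * real K ^ r * (real (K * k choose r) / real (K * k) ^ r)) \<longlonglongrightarrow> \<rho> * real K ^ r * (1 / fact r)"
    by (rule tendsto_mult[OF tendsto_const lim])
  moreover have "\<rho> * real K ^ r * (real (K * k choose r) / real (K * k) ^ r) = \<rho> / real k ^ r * real (K * k choose r)" for k
    using K by (simp add: power_mult_distrib)
  ultimately show ?thesis by simp
qed

text \<open>On \<open>K * k\<close> vertices with density \<open>\<rho> / k ^ r\<close> the mean number of edges tends to \<open>\<rho> * K ^ r / fact r\<close>
  as \<open>k\<close> grows, which is the origin of the factor \<open>fact r powr (1 / r)\<close>. For the lower bound on \<open>b\<close> take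
  \<open>K = r\<close>, for the upper bound let \<open>K\<close> tend to infinity.\<close>

theorem partite_constant:
  assumes r: "2 \<le> r" and P: "P = {edgeA r s ` {..<r}, edgeB r s ` {..<r}}"
    and hb: "has_mean_constant r (\<lambda>G. real (max_clique P G)) b" and b: "0 < b"
    and hc: "has_chain_constant r c" and c: "0 < c"
  shows "b = c * fact r powr (1 / real r) / real r"
proof -
  define a where "a = 1 / real r"
  have a: "0 < a" using r by (simp add: a_def)
  define f where "f = fact r powr a"
  have f: "1 \<le> f" using fact_ge_1[of r, where 'a = real] a unfolding f_def by (intro ge_one_powr_ge_zero) auto
  define E where "E = (\<lambda>p m. bexp p (redges r m) (\<lambda>G. real (max_clique P G)))"
  have mean: "\<exists>\<rho>0>0. \<forall>\<rho>\<ge>\<rho>0. eventually (\<lambda>k. \<bar>E (\<rho> / real k ^ r) (K * k) - b * (\<rho> / real k ^ r * real (K * k choose r)) powr a\<bar>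
      \<le> \<epsilon> * (\<rho> / real k ^ r * real (K * k choose r)) powr a) sequentially"
    if K: "1 \<le> K" and \<epsilon>: "0 < \<epsilon>" for K \<epsilon>
  proof -
    obtain l0 where l0: "0 < l0" and lim: "\<forall>U. \<exists>m0. \<forall>m\<ge>m0. \<forall>p. 0 \<le> p \<longrightarrow> p \<le> 1 \<longrightarrow>
       l0 \<le> p * real (m choose r) \<longrightarrow> p * real (m choose r) \<le> U \<longrightarrow>
       \<bar>E p m - b * (p * real (m choose r)) powr a\<bar> \<le> \<epsilon> * (p * real (m choose r)) powr a"
      using hb \<epsilon> unfolding has_mean_constant_def E_def a_def by blast
    show ?thesis
    proof (intro exI[of _ "l0 * fact r * 2"] conjI allI impI)
      show "0 < l0 * fact r * 2" using l0 by simp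
      fix \<rho> assume \<rho>: "l0 * fact r * 2 \<le> \<rho>"
      have "0 < l0 * fact r * 2" using l0 by simp
      then have \<rho>0: "0 < \<rho>" using \<rho> by linarith
      define V where "V = \<rho> * real K ^ r / fact r"
      have "l0 * fact r < \<rho> * 1" using \<rho> l0 \<open>0 < l0 * fact r * 2\<close> by linarith
      also have "\<dots> \<le> \<rho> * real K ^ r" using \<rho>0 K by (intro mult_left_mono one_le_power) auto
      finally have "l0 < V" by (simp add: V_def field_simps)
      have conv: "(\<lambda>k. \<rho> / real k ^ r * real (K * k choose r)) \<longlonglongrightarrow> V" unfolding V_def by (rule intensity_redges[OF K])
      obtain m0 where m0: "\<And>m p. m0 \<le> m \<Longrightarrow> 0 \<le> p \<Longrightarrow> p \<le> 1 \<Longrightarrow>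
         l0 \<le> p * real (m choose r) \<Longrightarrow> p * real (m choose r) \<le> V + 1 \<Longrightarrow>
         \<bar>E p m - b * (p * real (m choose r)) powr a\<bar> \<le> \<epsilon> * (p * real (m choose r)) powr a"
        using lim[rule_format, of "V + 1"] by blast
      have "(\<lambda>k. \<rho> / real k ^ r) \<longlonglongrightarrow> 0"
        using r by (intro tendsto_divide_0[OF tendsto_const] filterlim_at_top_imp_at_infinity
          filterlim_pow_at_top filterlim_real_sequentially) auto
      then have "eventually (\<lambda>k. \<rho> / real k ^ r < 1) sequentially" by (rule order_tendstoD) simp
      moreover have "eventually (\<lambda>k. l0 < \<rho> / real k ^ r * real (K * k choose r)) sequentially"
        using conv \<open>l0 < V\<close> by (rule order_tendstoD)
      moreover have "eventually (\<lambda>k. \<rho> / real k ^ r * real (K * k choose r) < V + 1) sequentially"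
        using conv by (rule order_tendstoD) simp
      ultimately show "eventually (\<lambda>k. \<bar>E (\<rho> / real k ^ r) (K * k) - b * (\<rho> / real k ^ r * real (K * k choose r)) powr a\<bar>
        \<le> \<epsilon> * (\<rho> / real k ^ r * real (K * k choose r)) powr a) sequentially"
        using eventually_ge_at_top[of m0]
      proof eventually_elim
        case (elim k)
        have "k \<le> K * k" using K by simp
        then have "m0 \<le> K * k" using elim(4) by (rule order_trans[rotated])
        then show ?case using elim \<rho>0 by (intro m0) auto
      qed
    qed
  qed
  have Vconv: "(\<lambda>k. (\<rho> / real k ^ r * real (K * k choose r)) powr a) \<longlonglongrightarrow> \<rho> powr a * real K / f"
    if "1 \<le> K" "0 < \<rho>" for K \<rho>
  proof -
    have "(\<lambda>k. (\<rho> / real k ^ r * real (K * k choose r)) powr a) \<longlonglongrightarrow> (\<rho> * real K ^ r / fact r) powr a"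
      using that by (intro tendsto_powr intensity_redges tendsto_const) auto
    then show ?thesis using root_scale[of r \<rho> K] r that by (simp add: a_def f_def)
  qed
  have "b / f \<le> c / real r"
  proof (rule asymp_compare)
    fix K :: nat and \<epsilon> :: real assume K: "1 \<le> K" and \<epsilon>: "0 < \<epsilon>"
    obtain \<rho>1 where \<rho>1: "0 < \<rho>1" "\<And>\<rho>. \<rho>1 \<le> \<rho> \<Longrightarrow> eventually (\<lambda>k. \<bar>E (\<rho> / real k ^ r) (K * k) - b * (\<rho> / real k ^ r * real (K * k choose r)) powr a\<bar>
      \<le> \<epsilon> * (\<rho> / real k ^ r * real (K * k choose r)) powr a) sequentially"
      using mean[OF K \<epsilon>] by blast
    obtain \<rho>2 where \<rho>2: "0 < \<rho>2" "\<forall>\<rho>\<ge>\<rho>2. eventually (\<lambda>k. 1 \<le> k \<and> 0 < \<rho> / real k ^ r \<and> \<rho> / real k ^ r \<le> 1 / 2 \<and>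
      (c - \<epsilon>) * \<rho> powr a \<le> bexp (\<rho> / real k ^ r) (grid r (\<lambda>_. k)) (\<lambda>G. real (largest (chain (below r)) G)) \<and>
      (\<forall>u. (\<forall>i<r. 1 \<le> u i) \<longrightarrow> (\<Sum>i<r. u i) \<le> K + r \<longrightarrow>
        bexp (\<rho> / real k ^ r) (grid r (\<lambda>i. u i * k)) (\<lambda>G. real (largest (chain (below r)) G))
          \<le> (c + \<epsilon>) * (real (K + r) / real r) * \<rho> powr a)) sequentially"
      using grid_limit[OF r hc c \<epsilon>, of K] unfolding a_def by blast
    define m where "m = (c + \<epsilon>) * (real (K + r) / real r)"
    define C where "C = real (card (windows r K)) * sqrt m"
    have "b / f * real K * \<rho> powr a \<le> m * \<rho> powr a + \<epsilon> * real K * \<rho> powr a + C * sqrt (\<rho> powr a) + 0"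
      if \<rho>: "max \<rho>1 \<rho>2 \<le> \<rho>" for \<rho>
    proof -
      have \<rho>': "\<rho>1 \<le> \<rho>" "\<rho>2 \<le> \<rho>" using \<rho> by simp_all
      have \<rho>0: "0 < \<rho>" using \<rho>' \<rho>1(1) by linarith
      have ev: "eventually (\<lambda>k. (b - \<epsilon>) * (\<rho> / real k ^ r * real (K * k choose r)) powr a
          \<le> m * \<rho> powr a + C * sqrt (\<rho> powr a)) sequentially"
        using \<rho>1(2)[OF \<rho>'(1)] \<rho>2(2)[rule_format, OF \<rho>'(2)]
      proof eventually_elim
        case (elim k)
        have "E (\<rho> / real k ^ r) (K * k) \<le> m * \<rho> powr a + real (card (windows r K)) * sqrt (m * \<rho> powr a)"
          unfolding E_def
        proof (rule partite_upper[OF _ _ _ _ P])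
          show "1 \<le> r" using r by simp
          from elim(2) have *: "1 \<le> k" "0 < \<rho> / real k ^ r" "\<rho> / real k ^ r \<le> 1 / 2" by blast+
          show "1 \<le> k" "0 \<le> \<rho> / real k ^ r" "\<rho> / real k ^ r \<le> 1" using * by linarith+
          show "bexp (\<rho> / real k ^ r) (grid r (\<lambda>i. u i * k)) (\<lambda>G. real (largest (chain (below r)) G)) \<le> m * \<rho> powr a"
            if "\<forall>i<r. 1 \<le> u i" "(\<Sum>i<r. u i) \<le> K + r" for u
            using elim(2) that unfolding m_def by blast
        qed
        then show ?case using elim(1) by (simp add: C_def real_sqrt_mult abs_le_iff left_diff_distrib)
      qed
      have "(b - \<epsilon>) * (\<rho> powr a * real K / f) \<le> m * \<rho> powr a + C * sqrt (\<rho> powr a)"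
        by (rule tendsto_upperbound[OF tendsto_mult[OF tendsto_const Vconv[OF K \<rho>0]] ev]) simp
      moreover have "\<epsilon> * (\<rho> powr a * real K / f) \<le> \<epsilon> * (\<rho> powr a * real K)"
      proof (intro mult_left_mono)
        have "\<rho> powr a * real K / f \<le> \<rho> powr a * real K / 1"
          using f by (intro divide_left_mono) auto
        then show "\<rho> powr a * real K / f \<le> \<rho> powr a * real K" by simp
      qed (use \<epsilon> in auto)
      moreover have "(b - \<epsilon>) * (\<rho> powr a * real K / f) = b * (\<rho> powr a * real K / f) - \<epsilon> * (\<rho> powr a * real K / f)"
        by (rule left_diff_distrib)
      moreover have "b / f * real K * \<rho> powr a = b * (\<rho> powr a * real K / f)"
        "\<epsilon> * real K * \<rho> powr a = \<epsilon> * (\<rho> powr a * real K)" by simp_all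
      ultimately show ?thesis by linarith
    qed
    then show "\<exists>C D \<rho>0. \<forall>\<rho>\<ge>\<rho>0. b / f * real K * \<rho> powr (1 / real r) \<le> (c + \<epsilon>) * (real (K + r) / real r) * \<rho> powr (1 / real r)
      + \<epsilon> * real K * \<rho> powr (1 / real r) + C * sqrt (\<rho> powr (1 / real r)) + D"
      unfolding m_def a_def by blast
  qed (use r in simp)
  moreover have "c \<le> b * (real r / f)"
  proof -
    have e: "c - \<epsilon> \<le> (b + \<epsilon>) * (real r / f)" if \<epsilon>: "0 < \<epsilon>" for \<epsilon>
    proof -
      have r1: "1 \<le> r" using r by simp
      obtain \<rho>1 where \<rho>1: "0 < \<rho>1" "\<And>\<rho>. \<rho>1 \<le> \<rho> \<Longrightarrow> eventually (\<lambda>k. \<bar>E (\<rho> / real k ^ r) (r * k) - b * (\<rho> / real k ^ r * real (r * k choose r)) powr a\<bar>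
        \<le> \<epsilon> * (\<rho> / real k ^ r * real (r * k choose r)) powr a) sequentially"
        using mean[OF r1 \<epsilon>] by blast
      obtain \<rho>2 where \<rho>2: "0 < \<rho>2" "\<forall>\<rho>\<ge>\<rho>2. eventually (\<lambda>k. 1 \<le> k \<and> 0 < \<rho> / real k ^ r \<and> \<rho> / real k ^ r \<le> 1 / 2 \<and>
        (c - \<epsilon>) * \<rho> powr a \<le> bexp (\<rho> / real k ^ r) (grid r (\<lambda>_. k)) (\<lambda>G. real (largest (chain (below r)) G)) \<and>
        (\<forall>u. (\<forall>i<r. 1 \<le> u i) \<longrightarrow> (\<Sum>i<r. u i) \<le> 0 + r \<longrightarrow>
          bexp (\<rho> / real k ^ r) (grid r (\<lambda>i. u i * k)) (\<lambda>G. real (largest (chain (below r)) G))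
            \<le> (c + \<epsilon>) * (real (0 + r) / real r) * \<rho> powr a)) sequentially"
        using grid_limit[OF r hc c \<epsilon>, of 0] unfolding a_def by blast
      define \<rho> where "\<rho> = max \<rho>1 \<rho>2"
      have \<rho>: "\<rho>1 \<le> \<rho>" "\<rho>2 \<le> \<rho>" "0 < \<rho>" using \<rho>1 \<rho>2 by (auto simp: \<rho>_def)
      have ev: "eventually (\<lambda>k. (c - \<epsilon>) * \<rho> powr a \<le> (b + \<epsilon>) * (\<rho> / real k ^ r * real (r * k choose r)) powr a) sequentially"
        using \<rho>1(2)[OF \<rho>(1)] \<rho>2(2)[rule_format, OF \<rho>(2)]
      proof eventually_elim
        case (elim k)
        have "(c - \<epsilon>) * \<rho> powr a \<le> E (\<rho> / real k ^ r) (r * k)"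
          using elim(2) partite_lower[OF _ _ P, of "\<rho> / real k ^ r" k] unfolding E_def by linarith
        then show ?case using elim(1) by (simp add: abs_le_iff distrib_right)
      qed
      have "(c - \<epsilon>) * \<rho> powr a \<le> (b + \<epsilon>) * (\<rho> powr a * real r / f)"
        by (rule tendsto_lowerbound[OF tendsto_mult[OF tendsto_const Vconv[OF r1 \<rho>(3)]] ev]) simp
      then have "(c - \<epsilon>) * \<rho> powr a \<le> ((b + \<epsilon>) * (real r / f)) * \<rho> powr a" by (simp add: mult_ac)
      then show ?thesis by (rule mult_right_le_imp_le) (use \<rho>(3) in simp)
    qed
    have "((\<lambda>\<epsilon>. (b + \<epsilon>) * (real r / f) - (c - \<epsilon>)) \<longlongrightarrow> (b + 0) * (real r / f) - (c - 0)) (at_right 0)"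
      by (intro tendsto_intros)
    moreover have "\<forall>\<^sub>F \<epsilon> in at_right 0. 0 \<le> (b + \<epsilon>) * (real r / f) - (c - \<epsilon>)"
      using eventually_at_right_less[of "0::real"] by eventually_elim (use e in simp)
    ultimately have "0 \<le> (b + 0) * (real r / f) - (c - 0)" by (rule tendsto_lowerbound) simp
    then show ?thesis by simp
  qed
  ultimately show ?thesis using f r unfolding f_def[symmetric] a_def[symmetric] by (simp add: field_simps)
qed

section \<open>Points of bounded coordinate sum\<close>

definition points :: "nat \<Rightarrow> (nat \<Rightarrow> nat) set" where
  "points r = {x. x \<in> extensional {..<r} \<and> (\<forall>i<r. 1 \<le> x i)}"

definition level :: "nat \<Rightarrow> (nat \<Rightarrow> nat) \<Rightarrow> nat" where
  "level r x = (\<Sum>i<r. x i)"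

definition shift :: "nat \<Rightarrow> (nat \<Rightarrow> nat) \<Rightarrow> (nat \<Rightarrow> nat) \<Rightarrow> (nat \<Rightarrow> nat)" where
  "shift r z x = (\<lambda>i\<in>{..<r}. z i + x i)"

lemma level_ge: "i < r \<Longrightarrow> x i \<le> level r x"
  unfolding level_def by (intro member_le_sum) auto

lemma points_in_grid: "{x \<in> points r. level r x \<le> t} \<subseteq> grid r (\<lambda>_. t)"
proof
  fix x assume x: "x \<in> {x \<in> points r. level r x \<le> t}"
  have "x i \<in> {1..t}" if "i < r" for i using x that level_ge[OF that, of x] by (auto simp: points_def)
  then show "x \<in> grid r (\<lambda>_. t)" using x by (auto simp: grid_def PiE_iff points_def)
qed

text \<open>The points above \<open>z\<close> are the translates of all points by \<open>z\<close>.\<close>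

lemma points_renewal:
  assumes r: "1 \<le> r"
  shows "renewal (points r) (level r) (below r) (shift r)"
proof
  show "finite {x \<in> points r. level r x \<le> t}" for t
    using points_in_grid finite_grid by (rule finite_subset)
  show "0 < level r x" if "x \<in> points r" for x
    using level_ge[of 0 r x] that r by (fastforce simp: points_def)
  show "below r x z" if "below r x y" "below r y z" for x y z
    using that less_trans unfolding below_def by blast
  show "level r (shift r z x) = level r z + level r x" for z x
    by (simp add: level_def shift_def sum.distrib)
  show "below r (shift r z x) (shift r z y) = below r x y" for z x y
    by (simp add: below_def shift_def)
  show "bij_betw (shift r z) (points r) {x \<in> points r. below r z x}" if z: "z \<in> points r" for z
  proof (rule bij_betw_imageI)
    show "inj_on (shift r z) (points r)"
    proof (rule inj_onI)
      fix x y assume xy: "x \<in> points r" "y \<in> points r" "shift r z x = shift r z y"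
      have "x i = y i" if "i < r" for i
        using fun_cong[OF xy(3), of i] that by (simp add: shift_def)
      then show "x = y" using xy by (intro extensionalityI[of x "{..<r}" y]) (auto simp: points_def)
    qed
    show "shift r z ` points r = {x \<in> points r. below r z x}"
    proof (intro equalityI subsetI)
      fix x assume "x \<in> shift r z ` points r"
      then show "x \<in> {x \<in> points r. below r z x}" by (fastforce simp: points_def shift_def below_def)
    next
      fix x assume x: "x \<in> {x \<in> points r. below r z x}"
      define y where "y = (\<lambda>i\<in>{..<r}. x i - z i)"
      have "y \<in> points r" using x by (auto simp: y_def points_def below_def Suc_le_eq)
      moreover have "shift r z y = x"
      proof (rule extensionalityI[of _ "{..<r}"])
        fix i assume "i \<in> {..<r}"
        then have "z i < x i" using x by (simp add: below_def)
        then show "shift r z y i = x i" using \<open>i \<in> {..<r}\<close> by (simp add: shift_def y_def)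
      qed (use x in \<open>auto simp: shift_def points_def\<close>)
      ultimately show "x \<in> shift r z ` points r" by blast
    qed
  qed
qed

text \<open>An \<open>r\<close>-subset of \<open>{1..u}\<close> is determined by its gaps, which are positive with sum at most \<open>u\<close>. Hence
  the first point appears no later than the first edge does.\<close>

lemma card_points_ge:
  assumes r: "1 \<le> r"
  shows "u choose r \<le> card {x \<in> points r. level r x \<le> u}"
proof -
  define gp where "gp = (\<lambda>e. \<lambda>i\<in>{..<r}. if i = 0 then elt e 0 else elt e i - elt e (i - 1))"
  have el: "strict_mono_on {..<r} (elt e)" "elt e ` {..<r} = e" "e \<subseteq> {1..u}" if "e \<in> redges r u" for e
  proof -
    have *: "e \<subseteq> {1..u}" "card e = r" using that unfolding redges_def by blast+
    then have "finite e" using finite_subset by blast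
    from elt[OF this *(2)] *(1) show "strict_mono_on {..<r} (elt e)" "elt e ` {..<r} = e" "e \<subseteq> {1..u}" .
  qed
  have psum: "(\<Sum>i<Suc j. gp e i) = elt e j" if e: "e \<in> redges r u" and j: "j < r" for e j
    using j
  proof (induction j)
    case 0 then show ?case by (simp add: gp_def)
  next
    case (Suc j)
    have "elt e j < elt e (Suc j)" using Suc.prems by (intro strict_mono_onD[OF el(1)[OF e]]) auto
    then show ?case using Suc by (simp add: gp_def)
  qed
  have "card (redges r u) \<le> card {x \<in> points r. level r x \<le> u}"
  proof (rule card_inj_on_le)
    show "inj_on gp (redges r u)"
    proof (rule inj_onI)
      fix e f assume ef: "e \<in> redges r u" "f \<in> redges r u" "gp e = gp f"
      have "elt e j = elt f j" if "j < r" for j using psum[OF ef(1) that] psum[OF ef(2) that] ef(3) by simp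
      then have "elt e ` {..<r} = elt f ` {..<r}" by (intro image_cong) auto
      then show "e = f" using el(2)[OF ef(1)] el(2)[OF ef(2)] by simp
    qed
    show "gp ` redges r u \<subseteq> {x \<in> points r. level r x \<le> u}"
    proof
      fix x assume "x \<in> gp ` redges r u"
      then obtain e where e: "e \<in> redges r u" "x = gp e" by auto
      have mem: "elt e i \<in> {1..u}" if "i < r" for i using el(2,3)[OF e(1)] that by blast
      have "1 \<le> gp e i" if i: "i < r" for i
      proof (cases i)
        case 0 then show ?thesis using mem[of 0] i by (simp add: gp_def)
      next
        case (Suc j)
        have "elt e j < elt e i" using Suc i by (intro strict_mono_onD[OF el(1)[OF e(1)]]) auto
        then show ?thesis using Suc i by (simp add: gp_def)
      qed
      moreover have "level r x \<le> u"
        using psum[OF e(1), of "r - 1"] mem[of "r - 1"] r by (simp add: level_def e(2))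
      ultimately show "x \<in> {x \<in> points r. level r x \<le> u}" using e(2) by (auto simp: points_def gp_def)
    qed
    show "finite {x \<in> points r. level r x \<le> u}" using points_in_grid finite_grid by (rule finite_subset)
  qed
  then show ?thesis by (simp add: card_redges)
qed

text \<open>The cell number \<open>d\<close> in the division of the points into cubes of side \<open>q\<close>.\<close>

definition cube :: "nat \<Rightarrow> nat \<Rightarrow> (nat \<Rightarrow> nat) \<Rightarrow> (nat \<Rightarrow> nat) set" where
  "cube r q d = PiE {..<r} (\<lambda>i. {d i * q + 1..(d i + 1) * q})"

lemma card_cube: "card (cube r q d) = q ^ r"
proof -
  have "card (cube r q d) = (\<Prod>i<r. card {d i * q + 1..(d i + 1) * q})" unfolding cube_def by (subst card_PiE) auto
  also have "\<dots> = (\<Prod>i<r. q)" by (intro prod.cong) auto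
  finally show ?thesis by simp
qed

lemma cube_mem: "x \<in> cube r q d \<Longrightarrow> i < r \<Longrightarrow> d i * q < x i \<and> x i \<le> (d i + 1) * q"
  by (auto simp: cube_def PiE_iff Suc_le_eq)

lemma level_cube_le:
  assumes "x \<in> cube r q d" "(\<Sum>i<r. d i + 1) \<le> D"
  shows "level r x \<le> D * q"
proof -
  have "level r x \<le> (\<Sum>i<r. (d i + 1) * q)" unfolding level_def using cube_mem[OF assms(1)] by (intro sum_mono) auto
  also have "\<dots> = (\<Sum>i<r. d i + 1) * q" by (simp add: sum_distrib_right)
  also have "\<dots> \<le> D * q" using assms(2) by (rule mult_right_mono) simp
  finally show ?thesis .
qed

lemma bexp_indep:
  assumes "finite A" "finite B" "A \<inter> B = {}"
  shows "bexp p (A \<union> B) (\<lambda>G. f (G \<inter> A) * g (G \<inter> B)) = bexp p A f * bexp p B g"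
proof -
  have "bexp p (A \<union> B) (\<lambda>G. f (G \<inter> A) * g (G \<inter> B))
      = bexp p A (\<lambda>G. bexp p B (\<lambda>G'. f ((G \<union> G') \<inter> A) * g ((G \<union> G') \<inter> B)))"
    by (rule bexp_union[OF assms])
  also have "\<dots> = bexp p A (\<lambda>G. bexp p B g * f G)"
  proof (intro bexp_cong refl)
    fix G assume G: "G \<subseteq> A"
    have "bexp p B (\<lambda>G'. f ((G \<union> G') \<inter> A) * g ((G \<union> G') \<inter> B)) = bexp p B (\<lambda>G'. f G * g G')"
    proof (rule bexp_cong[OF refl])
      fix G' assume "G' \<subseteq> B"
      then have "(G \<union> G') \<inter> A = G" "(G \<union> G') \<inter> B = G'" using G assms(3) by blast+
      then show "f ((G \<union> G') \<inter> A) * g ((G \<union> G') \<inter> B) = f G * g G'" by simp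
    qed
    then show "bexp p B (\<lambda>G'. f ((G \<union> G') \<inter> A) * g ((G \<union> G') \<inter> B)) = bexp p B g * f G"
      by (simp add: bexp_cmult mult.commute)
  qed
  also have "\<dots> = bexp p B g * bexp p A f" by (rule bexp_cmult)
  finally show ?thesis by (simp add: mult.commute)
qed

text \<open>Sum over the element that is present alone.\<close>

lemma bexp_singleton_ge:
  assumes A: "finite A" and p: "0 \<le> p" "p \<le> 1"
  shows "real (card A) * p * (1 - p) ^ card A \<le> bexp p A (\<lambda>G. of_bool (card G = 1))"
proof -
  have "real (card A) * p * (1 - p) ^ card A = (\<Sum>x\<in>A. p * (1 - p) ^ card A)" by simp
  also have "\<dots> \<le> (\<Sum>x\<in>A. p * (1 - p) ^ card (A - {x}))"
    using p A by (intro sum_mono mult_left_mono power_decreasing card_mono) auto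
  also have "\<dots> = (\<Sum>G\<in>(\<lambda>x. {x}) ` A. p ^ card G * (1 - p) ^ card (A - G) * of_bool (card G = 1))"
    by (subst sum.reindex) auto
  also have "\<dots> \<le> bexp p A (\<lambda>G. of_bool (card G = 1))"
    unfolding bexp_def using A p by (intro sum_mono2) auto
  finally show ?thesis .
qed

lemma exp_le_one_minus_power:
  assumes "0 \<le> p" "p \<le> 1 / 2"
  shows "exp (- (2 * p * real n)) \<le> (1 - p) ^ n"
proof -
  have "exp (- (2 * p)) \<le> 1 - p"
  proof -
    have "1 + 2 * p \<le> exp (2 * p)" by (rule exp_ge_add_one_self)
    moreover have "1 \<le> (1 - p) * (1 + 2 * p)"
    proof -
      have "(1 - p) * (1 + 2 * p) = 1 + p * (1 - 2 * p)" by (simp add: algebra_simps)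
      moreover have "0 \<le> p * (1 - 2 * p)" using assms by simp
      ultimately show ?thesis by linarith
    qed
    ultimately have "1 \<le> (1 - p) * exp (2 * p)"
      using assms mult_left_mono[of "1 + 2 * p" "exp (2 * p)" "1 - p"] by linarith
    then show ?thesis by (simp add: exp_minus field_simps)
  qed
  then have "exp (- (2 * p)) ^ n \<le> (1 - p) ^ n" by (intro power_mono) auto
  then show ?thesis by (simp add: exp_of_nat_mult[symmetric] mult.commute mult.assoc)
qed

text \<open>Four independent events. Each of the three sets contains a mean number of points between \<open>1\<close> and
  \<open>c\<close>, and \<open>B\<close> at most \<open>M * c\<close>, so none of their probabilities can be small.\<close>

lemma trap_probability:
  assumes fin: "finite A1" "finite A2" "finite A3" "finite B"
    and dis: "A1 \<inter> A2 = {}" "A1 \<inter> A3 = {}" "A2 \<inter> A3 = {}" "A1 \<inter> B = {}" "A2 \<inter> B = {}" "A3 \<inter> B = {}"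
    and card: "card A1 = N" "card A2 = N" "card A3 = N" "real (card B) \<le> M * real N"
    and p: "0 \<le> p" "p \<le> 1 / 2" "1 \<le> p * real N" "p * real N \<le> c"
  shows "exp (- (2 * c)) * (1 - exp (- 1))\<^sup>2 * exp (- (2 * (M * c)))
    \<le> bexp p (A1 \<union> (A2 \<union> (A3 \<union> B))) (\<lambda>G. of_bool (card (G \<inter> A1) = 1 \<and> G \<inter> A2 \<noteq> {} \<and> G \<inter> A3 \<noteq> {} \<and> G \<inter> B = {}))"
proof -
  have p1: "p \<le> 1" using p by simp
  have q: "1 - (1 - p) ^ N \<ge> 1 - exp (- 1)"
  proof -
    have "(1 - p) ^ N \<le> exp (- p) ^ N" using exp_ge_add_one_self[of "- p"] p by (intro power_mono) auto
    also have "\<dots> = exp (- (p * real N))" by (simp add: exp_of_nat_mult[symmetric] mult.commute)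
    also have "\<dots> \<le> exp (- 1)" using p(3) by simp
    finally show ?thesis by simp
  qed
  have ne: "bexp p A (\<lambda>G. of_bool (G \<noteq> {})) = 1 - (1 - p) ^ card A" if "finite A" for A :: "'a set"
  proof -
    have "bexp p A (\<lambda>G. of_bool (G \<noteq> {})) = bexp p A (\<lambda>G. 1 - of_bool (G \<inter> A = {}))"
      by (intro bexp_cong refl) (auto simp: Int_absorb2)
    then show ?thesis using that bexp_prob_disjoint[of A A p] by (simp add: bexp_diff)
  qed
  have "bexp p (A1 \<union> (A2 \<union> (A3 \<union> B))) (\<lambda>G. of_bool (card (G \<inter> A1) = 1 \<and> G \<inter> A2 \<noteq> {} \<and> G \<inter> A3 \<noteq> {} \<and> G \<inter> B = {}))
      = bexp p (A1 \<union> (A2 \<union> (A3 \<union> B))) (\<lambda>G. of_bool (card (G \<inter> A1) = 1) *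
         (\<lambda>G. of_bool (G \<inter> A2 \<noteq> {}) * (\<lambda>G. of_bool (G \<inter> A3 \<noteq> {}) * of_bool (G \<inter> B = {})) (G \<inter> (A3 \<union> B))) (G \<inter> (A2 \<union> (A3 \<union> B))))"
  proof (intro bexp_cong refl)
    fix G
    have "G \<inter> (A2 \<union> (A3 \<union> B)) \<inter> A2 = G \<inter> A2" "G \<inter> (A2 \<union> (A3 \<union> B)) \<inter> (A3 \<union> B) \<inter> A3 = G \<inter> A3"
      "G \<inter> (A2 \<union> (A3 \<union> B)) \<inter> (A3 \<union> B) \<inter> B = G \<inter> B" by blast+
    then show "of_bool (card (G \<inter> A1) = 1 \<and> G \<inter> A2 \<noteq> {} \<and> G \<inter> A3 \<noteq> {} \<and> G \<inter> B = {})
      = (of_bool (card (G \<inter> A1) = 1) *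
         (\<lambda>G. of_bool (G \<inter> A2 \<noteq> {}) * (\<lambda>G. of_bool (G \<inter> A3 \<noteq> {}) * of_bool (G \<inter> B = {})) (G \<inter> (A3 \<union> B))) (G \<inter> (A2 \<union> (A3 \<union> B))) :: real)"
      by auto
  qed
  also have "\<dots> = bexp p A1 (\<lambda>G. of_bool (card G = 1)) * (bexp p A2 (\<lambda>G. of_bool (G \<noteq> {})) *
      (bexp p A3 (\<lambda>G. of_bool (G \<noteq> {})) * bexp p B (\<lambda>G. of_bool (G = {}))))"
    using fin dis by (subst bexp_indep, blast, blast, blast)+ (rule refl)
  also have "bexp p B (\<lambda>G. of_bool (G = {})) = (1 - p) ^ card B"
  proof -
    have "bexp p B (\<lambda>G. of_bool (G = {})) = bexp p B (\<lambda>G. of_bool (G \<inter> B = {}))"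
      by (intro bexp_cong refl) (auto simp: Int_absorb2)
    then show ?thesis using bexp_prob_disjoint[of B B p] fin by simp
  qed
  finally have eq: "bexp p (A1 \<union> (A2 \<union> (A3 \<union> B))) (\<lambda>G. of_bool (card (G \<inter> A1) = 1 \<and> G \<inter> A2 \<noteq> {} \<and> G \<inter> A3 \<noteq> {} \<and> G \<inter> B = {}))
      = bexp p A1 (\<lambda>G. of_bool (card G = 1)) * ((1 - (1 - p) ^ N) * ((1 - (1 - p) ^ N) * (1 - p) ^ card B))"
    using fin card by (simp add: ne)
  have "exp (- (2 * c)) * (1 - exp (- 1))\<^sup>2 * exp (- (2 * (M * c)))
      = exp (- (2 * c)) * ((1 - exp (- 1)) * ((1 - exp (- 1)) * exp (- (2 * (M * c)))))"
    by (simp add: power2_eq_square mult.assoc)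
  also have "\<dots> \<le> bexp p A1 (\<lambda>G. of_bool (card G = 1)) * ((1 - (1 - p) ^ N) * ((1 - (1 - p) ^ N) * (1 - p) ^ card B))"
  proof (intro mult_mono)
    show "1 - exp (- 1) \<le> 1 - (1 - p) ^ N" "1 - exp (- 1) \<le> 1 - (1 - p) ^ N" using q by auto
    have "exp (- (2 * c)) \<le> 1 * exp (- (2 * p * real N))" using p(4) by simp
    also have "\<dots> \<le> (p * real N) * (1 - p) ^ N"
      using p(3) exp_le_one_minus_power[OF p(1,2), of N] p(1) by (intro mult_mono) auto
    also have "\<dots> \<le> bexp p A1 (\<lambda>G. of_bool (card G = 1))"
      using bexp_singleton_ge[OF fin(1) p(1) p1] card(1) by (simp add: mult.commute)
    finally show "exp (- (2 * c)) \<le> bexp p A1 (\<lambda>G. of_bool (card G = 1))" .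
    have "p * real (card B) \<le> p * (M * real N)" using card(4) p(1) by (intro mult_left_mono)
    also have "\<dots> = M * (p * real N)" by simp
    also have "\<dots> \<le> M * c"
    proof (intro mult_left_mono p(4))
      show "0 \<le> M"
      proof (rule ccontr)
        assume "\<not> 0 \<le> M"
        moreover have "0 < real N" using p(3) by (cases "N = 0") auto
        ultimately have "M * real N < 0" by (simp add: mult_neg_pos)
        then show False using card(4) by linarith
      qed
    qed
    finally have "exp (- (2 * (M * c))) \<le> exp (- (2 * p * real (card B)))" by simp
    also have "\<dots> \<le> (1 - p) ^ card B" by (rule exp_le_one_minus_power[OF p(1,2)])
    finally show "exp (- (2 * (M * c))) \<le> (1 - p) ^ card B" .
  qed (use p p1 q power_le_one[of "1 - p" N] in \<open>auto intro!: bexp_nonneg mult_nonneg_nonneg\<close>)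
  finally show ?thesis unfolding eq .
qed

text \<open>The greedy chain starts with the point of least level. With the probability bounded below here this
  is the only point of a cube \<open>A\<close>, and nothing lies above it; starting in a cube \<open>A'\<close> instead, a chain
  of two points ends in a cube \<open>C\<close>.\<close>

lemma trap:
  assumes r: "2 \<le> r" and q: "1 \<le> q" and p: "0 \<le> p" "p \<le> 1 / 2" "1 \<le> p * real (q ^ r)" "p * real (q ^ r) \<le> c"
    and t: "(3 * r + 3) * q \<le> t" "t \<le> (3 * r + 4) * q"
  shows "(\<Sum>s=1..t. (renewal.reach (points r) (level r) (below r) p 1 s - renewal.reach (points r) (level r) (below r) p 1 (s - 1))
      * renewal.reach (points r) (level r) (below r) p 1 (t - s))
    + exp (- (2 * c)) * (1 - exp (- 1))\<^sup>2 * exp (- (2 * (real (3 * r + 4) ^ r * c)))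
    \<le> renewal.reach (points r) (level r) (below r) p 2 t"
proof -
  have r1: "1 \<le> r" using r by simp
  interpret renewal "points r" "level r" "below r" "shift r" by (rule points_renewal[OF r1])
  \<comment> \<open>\<open>A\<close> has the lowest levels but is too far out in coordinate \<open>0\<close> to have \<open>A'\<close> or \<open>C\<close> above it. \<open>A'\<close> lies
    high in coordinate \<open>1\<close>, to be of later level than \<open>A\<close>, and \<open>C\<close> is above \<open>A'\<close> in every coordinate.\<close>
  define dA where "dA = (\<lambda>i::nat. if i = 0 then 3 else 0 :: nat)"
  define dA' where "dA' = (\<lambda>i::nat. if i = 1 then r + 3 else 0)"
  define dC where "dC = (\<lambda>i::nat. if i = 1 then r + 4 else 1)"
  define A where "A = cube r q dA"
  define A' where "A' = cube r q dA'"
  define C where "C = cube r q dC"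
  define B where "B = ini t - (A \<union> A' \<union> C)"
  have m0: "0 < r" "1 < r" using r by auto
  have split0: "(\<Sum>i<r. f i) = f 0 + f 1 + (\<Sum>i\<in>{..<r} - {0, 1}. f i)" for f :: "nat \<Rightarrow> nat"
  proof -
    have "(\<Sum>i<r. f i) = f 0 + (\<Sum>i\<in>{..<r} - {0}. f i)" using m0 by (intro sum.remove) auto
    also have "(\<Sum>i\<in>{..<r} - {0}. f i) = f 1 + (\<Sum>i\<in>{..<r} - {0} - {1}. f i)" using m0 by (intro sum.remove) auto
    also have "{..<r} - {0} - {1} = {..<r} - {0, 1}" by auto
    finally show ?thesis by simp
  qed
  have crest: "card ({..<r} - {0, 1}) = r - 2" using m0 by (subst card_Diff_subset) auto
  have sA: "(\<Sum>i<r. dA i + 1) \<le> r + 3"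
  proof -
    have "(\<Sum>i\<in>{..<r} - {0, 1}. dA i + 1) = (\<Sum>i\<in>{..<r} - {0, 1}. 1)" by (intro sum.cong) (auto simp: dA_def)
    then show ?thesis unfolding split0 using crest r by (simp add: dA_def)
  qed
  have sA': "(\<Sum>i<r. dA' i + 1) \<le> 3 * r + 3"
  proof -
    have "(\<Sum>i\<in>{..<r} - {0, 1}. dA' i + 1) = (\<Sum>i\<in>{..<r} - {0, 1}. 1)" by (intro sum.cong) (auto simp: dA'_def)
    then show ?thesis unfolding split0 using crest r by (simp add: dA'_def)
  qed
  have sC: "(\<Sum>i<r. dC i + 1) \<le> 3 * r + 3"
  proof -
    have "(\<Sum>i\<in>{..<r} - {0, 1}. dC i + 1) = (\<Sum>i\<in>{..<r} - {0, 1}. 2)" by (intro sum.cong) (auto simp: dC_def)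
    then show ?thesis unfolding split0 using crest r by (simp add: dC_def)
  qed
  have pts: "cube r q d \<subseteq> points r" for d
  proof
    fix x assume x: "x \<in> cube r q d"
    have "1 \<le> x i" if "i < r" for i using cube_mem[OF x that] by linarith
    moreover have "x \<in> extensional {..<r}" using x unfolding cube_def PiE_iff by blast
    ultimately show "x \<in> points r" by (simp add: points_def)
  qed
  have lA: "level r x \<le> (r + 3) * q" if "x \<in> A" for x using level_cube_le[OF that[unfolded A_def] sA] .
  have lA': "level r x \<le> (3 * r + 3) * q" if "x \<in> A'" for x using level_cube_le[OF that[unfolded A'_def] sA'] .
  have lC: "level r x \<le> (3 * r + 3) * q" if "x \<in> C" for x using level_cube_le[OF that[unfolded C_def] sC] .
  have big: "(r + 3) * q < level r x" if "x \<in> A' \<union> C" for x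
  proof -
    have "(r + 3) * q < x 1"
    proof (cases "x \<in> A'")
      case True
      then have "dA' 1 * q < x 1" using cube_mem[of x r q dA' 1] m0 unfolding A'_def by blast
      then show ?thesis by (simp add: dA'_def)
    next
      case False
      then have "dC 1 * q < x 1" using cube_mem[of x r q dC 1] m0 that unfolding C_def by blast
      then have "(r + 4) * q < x 1" by (simp add: dC_def)
      moreover have "(r + 3) * q \<le> (r + 4) * q" by (intro mult_right_mono) auto
      ultimately show ?thesis by linarith
    qed
    then show ?thesis using level_ge[of 1 r x] m0 by linarith
  qed
  have sub: "A \<subseteq> ini t" "A' \<subseteq> ini t" "C \<subseteq> ini t"
  proof -
    have "(r + 3) * q \<le> (3 * r + 3) * q" by (intro mult_right_mono) auto
    then have l: "x \<in> A \<union> A' \<union> C \<Longrightarrow> level r x \<le> t" for x using lA[of x] lA'[of x] lC[of x] t(1) by (elim UnE) linarith+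
    have "A \<union> A' \<union> C \<subseteq> points r" using pts unfolding A_def A'_def C_def by blast
    with l have "A \<union> A' \<union> C \<subseteq> ini t" unfolding ini_def by blast
    then show "A \<subseteq> ini t" "A' \<subseteq> ini t" "C \<subseteq> ini t" by blast+
  qed
  have cA: "3 * q < x 0" if "x \<in> A" for x
    using cube_mem[OF that[unfolded A_def] m0(1)] by (simp add: dA_def)
  have cA': "x 0 \<le> q" if "x \<in> A'" for x
    using cube_mem[OF that[unfolded A'_def] m0(1)] by (simp add: dA'_def)
  have cC: "q < x 0" "x 0 \<le> 2 * q" if "x \<in> C" for x
    using cube_mem[OF that[unfolded C_def] m0(1)] by (simp_all add: dC_def)
  have below_A: "\<not> below r x y" if "x \<in> A" "y \<in> A' \<union> C" for x y
  proof
    assume "below r x y"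
    then have "x 0 < y 0" using m0 by (simp add: below_def)
    moreover have "y 0 \<le> 2 * q" using that(2) cA' cC by (fastforce)
    ultimately show False using cA[OF that(1)] by linarith
  qed
  have below_C: "below r x y" if xy: "x \<in> A'" "y \<in> C" for x y
    unfolding below_def
  proof (intro allI impI)
    fix i assume i: "i < r"
    have "x i \<le> (dA' i + 1) * q" "dC i * q < y i" using cube_mem[of x r q dA' i] cube_mem[of y r q dC i] xy i by (auto simp: A'_def C_def)
    moreover have "(dA' i + 1) * q \<le> dC i * q" by (intro mult_right_mono) (auto simp: dA'_def dC_def)
    ultimately show "x i < y i" by linarith
  qed
  define E where "E = (\<lambda>G. card (G \<inter> A) = 1 \<and> G \<inter> A' \<noteq> {} \<and> G \<inter> C \<noteq> {} \<and> G \<inter> B = {})"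
  have "(\<Sum>s=1..t. (reach p 1 s - reach p 1 (s - 1)) * reach p 1 (t - s)) + bexp p (ini t) (\<lambda>G. of_bool (E G)) \<le> reach p 2 t"
  proof (rule reach_2_ge)
    fix G assume G: "G \<subseteq> ini t" and EG: "E G"
    obtain x y where xy: "x \<in> G" "x \<in> A'" "y \<in> G" "y \<in> C" using EG unfolding E_def by blast
    have "x \<noteq> y" using cA'[OF xy(2)] cC(1)[OF xy(4)] by auto
    moreover have "chain (below r) {x, y}" using below_C[OF xy(2,4)] by (auto simp: chain_def)
    ultimately show "2 \<le> height G" using largest_ge[of G "{x, y}" "chain (below r)"] fin_sub[OF G] xy by simp
  next
    fix G z assume G: "G \<subseteq> ini t" and EG: "E G" and z: "z \<in> G" "\<And>x. x \<in> G \<Longrightarrow> level r z \<le> level r x"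
    obtain a where a: "G \<inter> A = {a}" using EG unfolding E_def by (meson card_1_singletonE)
    have cov: "x \<in> A \<union> (A' \<union> C)" if "x \<in> G" for x using EG that G unfolding E_def B_def by blast
    have "z \<in> A"
    proof (rule ccontr)
      assume "z \<notin> A"
      then have "z \<in> A' \<union> C" using cov[OF z(1)] by blast
      from big[OF this] have "(r + 3) * q < level r z" .
      moreover have "a \<in> G" "a \<in> A" using a by blast+
      ultimately show False using z(2)[of a] lA[of a] by linarith
    qed
    then have za: "z = a" using a z by blast
    show "G \<inter> up z = {}"
    proof (rule ccontr)
      assume "G \<inter> up z \<noteq> {}"
      then obtain x where x: "x \<in> G" "below r z x" by (auto simp: up_def)
      have "x \<noteq> z" using x(2) m0 by (auto simp: below_def)
      then have "x \<in> A' \<union> C" using cov[OF x(1)] a x(1) za by blast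
      then show False using below_A[OF \<open>z \<in> A\<close>] x(2) by blast
    qed
  qed (use p in auto)
  moreover have "exp (- (2 * c)) * (1 - exp (- 1))\<^sup>2 * exp (- (2 * (real (3 * r + 4) ^ r * c))) \<le> bexp p (ini t) (\<lambda>G. of_bool (E G))"
  proof -
    have U: "ini t = A \<union> (A' \<union> (C \<union> B))" using sub unfolding B_def by blast
    have f: "finite A" "finite A'" "finite C" "finite B" using sub ini_fin finite_subset unfolding B_def by blast+
    have d1: "A \<inter> A' = {}" using cA cA' by fastforce
    have d2: "A \<inter> C = {}" using cA cC by fastforce
    have d3: "A' \<inter> C = {}" using cA' cC by fastforce
    have "card B \<le> card (grid r (\<lambda>_. t))"
    proof (rule card_mono[OF finite_grid])
      show "B \<subseteq> grid r (\<lambda>_. t)" using points_in_grid[of r t] unfolding B_def ini_def by blast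
    qed
    also have "\<dots> = t ^ r" by (simp add: card_grid)
    also have "\<dots> \<le> ((3 * r + 4) * q) ^ r" using t(2) by (intro power_mono) auto
    finally have "real (card B) \<le> real (((3 * r + 4) * q) ^ r)" by (rule of_nat_mono)
    also have "\<dots> = real (3 * r + 4) ^ r * real (q ^ r)" by (simp only: power_mult_distrib of_nat_mult of_nat_power)
    finally have cB: "real (card B) \<le> real (3 * r + 4) ^ r * real (q ^ r)" .
    show ?thesis
      unfolding U E_def
      by (rule trap_probability[where N = "q ^ r"])
        (use f d1 d2 d3 cB p in \<open>auto simp: A_def A'_def C_def card_cube B_def\<close>)
  qed
  ultimately show ?thesis by linarith
qed

section \<open>The strict inequality\<close>

text \<open>A chain lies below its top element, and rounding up the coordinates of the top element gives a box
  at the origin, with side lengths \<open>u\<close> from a bounded list of possibilities.\<close>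

lemma simplex_upper:
  assumes r: "1 \<le> r" and k: "1 \<le> k" and p: "0 \<le> p" "p \<le> 1"
    and M: "\<And>u. (\<forall>i<r. 1 \<le> u i) \<Longrightarrow> (\<Sum>i<r. u i) \<le> K + r \<Longrightarrow>
      bexp p (grid r (\<lambda>i. u i * k)) (\<lambda>G. real (largest (chain (below r)) G)) \<le> M"
  shows "bexp p {x \<in> points r. level r x \<le> K * k} (\<lambda>G. real (largest (chain (below r)) G))
    \<le> M + real (card (windows r K)) * sqrt M"
proof -
  define S where "S = {x \<in> points r. level r x \<le> K * k}"
  have fS: "finite S" unfolding S_def using points_in_grid finite_grid by (rule finite_subset)
  define W where "W = (\<lambda>(\<alpha> :: nat \<Rightarrow> nat, u). S \<inter> grid r (\<lambda>i. u i * k))"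
  have "bexp p S (\<lambda>G. real (largest (chain (below r)) G)) \<le> M + real (card (windows r K)) * sqrt M"
  proof (rule cover_bound[OF fS p finite_windows, where W = W and \<tau> = "\<lambda>_ x. x" and v = "\<lambda>(\<alpha>, u) i. u i * k"])
    fix j assume j: "j \<in> windows r K"
    obtain \<alpha> u where au: "j = (\<alpha>, u)" by force
    have u: "\<forall>i<r. 1 \<le> u i" "(\<Sum>i<r. u i) \<le> K + r" using j by (auto simp: au windows_def PiE_iff)
    show "W j \<subseteq> S" "(\<lambda>x. x) ` W j \<subseteq> grid r ((\<lambda>(\<alpha>, u) i. u i * k) j)" by (auto simp: W_def au)
    show "inj_on (\<lambda>x. x) (W j)" by simp
    show "bexp p (grid r ((\<lambda>(\<alpha>, u) i. u i * k) j)) (\<lambda>G. real (largest (chain (below r)) G)) \<le> M"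
      using M[OF u] by (simp add: au)
  next
    fix G assume G: "G \<subseteq> S"
    then have fG: "finite G" using fS finite_subset by blast
    obtain C where C: "C \<subseteq> G" "chain (below r) C" "card C = largest (chain (below r)) G"
      using largest_witness[OF hereditary_chain fG] by metis
    have fC: "finite C" using C(1) fG finite_subset by blast
    have "\<exists>(\<alpha>, u)\<in>windows r K. C \<subseteq> G \<inter> W (\<alpha>, u)"
    proof (cases "C = {}")
      case True
      have "((\<lambda>i\<in>{..<r}. 0), (\<lambda>i\<in>{..<r}. 1)) \<in> windows r K" by (auto simp: windows_def)
      then show ?thesis using True by auto
    next
      case False
      have "Max (level r ` C) \<in> level r ` C" using fC False by (intro Max_in) auto
      then obtain z where z: "z \<in> C" "level r z = Max (level r ` C)" by auto
      have zS: "z \<in> points r" "level r z \<le> K * k" using z(1) C(1) G unfolding S_def by blast+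
      have top: "x i \<le> z i" if x: "x \<in> C" and i: "i < r" for x i
      proof (cases "x = z")
        case False
        then have "below r x z \<or> below r z x" using C(2) x z(1) by (auto simp: chain_def)
        moreover have "\<not> below r z x"
        proof
          assume "below r z x"
          then have "level r z < level r x"
            unfolding level_def using i by (intro sum_strict_mono) (auto simp: below_def)
          moreover have "level r x \<le> level r z" unfolding z(2) using x fC by (intro Max_ge) auto
          ultimately show False by simp
        qed
        ultimately show ?thesis using i by (auto simp: below_def less_imp_le)
      qed simp
      define u where "u = (\<lambda>i\<in>{..<r}. (z i + k - 1) div k)"
      have zi: "1 \<le> z i" if "i < r" for i using zS(1) that by (simp add: points_def)
      have up: "z i \<le> u i * k" if "i < r" for i
      proof -
        have "z i + k - 1 < ((z i + k - 1) div k + 1) * k" using k by (simp add: dividend_less_div_times add.commute)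
        then show ?thesis using k that by (simp add: u_def algebra_simps)
      qed
      have lo: "u i * k \<le> z i + k" if "i < r" for i
      proof -
        have "u i * k \<le> z i + k - 1" using that by (simp add: u_def)
        then show ?thesis by linarith
      qed
      have u1: "1 \<le> u i" if "i < r" for i
      proof (rule ccontr)
        assume "\<not> 1 \<le> u i"
        then have "u i = 0" by simp
        then show False using up[OF that] zi[OF that] by simp
      qed
      have "(\<Sum>i<r. u i) * k = (\<Sum>i<r. u i * k)" by (simp add: sum_distrib_right)
      also have "\<dots> \<le> (\<Sum>i<r. z i + k)" using lo by (intro sum_mono) auto
      also have "\<dots> = level r z + r * k" by (simp add: sum.distrib level_def)
      also have "\<dots> \<le> (K + r) * k" using zS(2) by (simp add: distrib_right)
      finally have su: "(\<Sum>i<r. u i) \<le> K + r" using k by simp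
      have uK: "u i \<le> K + r" if "i < r" for i
      proof -
        have "u i \<le> (\<Sum>i<r. u i)" using that by (intro member_le_sum) auto
        then show ?thesis using su by simp
      qed
      have "((\<lambda>i\<in>{..<r}. 0), u) \<in> windows r K"
        using u1 uK su by (auto simp: windows_def PiE_iff u_def)
      moreover have "C \<subseteq> G \<inter> W ((\<lambda>i\<in>{..<r}. 0), u)"
      proof
        fix x assume x: "x \<in> C"
        then have xS: "x \<in> S" "x \<in> G" "x \<in> points r" using C(1) G unfolding S_def by blast+
        have "x i \<in> {1..u i * k}" if "i < r" for i
          using top[OF x that] up[OF that] xS(3) that by (auto simp: points_def)
        then have "x \<in> grid r (\<lambda>i. u i * k)" using xS(3) by (simp add: grid_def PiE_iff points_def)
        then show "x \<in> G \<inter> W ((\<lambda>i\<in>{..<r}. 0), u)" using xS by (simp add: W_def)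
      qed
      ultimately show ?thesis by blast
    qed
    then obtain j where j: "j \<in> windows r K" "C \<subseteq> G \<inter> W j" by blast
    have "card C \<le> largest (chain (below r)) (G \<inter> W j)" using fG j(2) C(2) by (intro largest_ge) auto
    then show "\<exists>j\<in>windows r K. real (largest (chain (below r)) G) \<le> real (largest (chain (below r)) ((\<lambda>x. x) ` (G \<inter> W j)))"
      using j(1) C(3) by (intro bexI[of _ j]) auto
  qed
  then show ?thesis by (simp add: S_def)
qed

text \<open>Cubes of side \<open>q\<close> about \<open>p powr (- 1 / r)\<close> contain a mean number of points between \<open>1\<close> and \<open>2 ^ r\<close>, so the
  probability \<open>\<delta>\<close> of the trap does not depend on \<open>p\<close>. It is gained on \<open>q\<close> consecutive levels, hence the
  saving is at least \<open>\<delta> * p powr (- 1 / r)\<close>, of the same order as the waiting time itself.\<close>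

lemma two_step_gain:
  assumes r: "2 \<le> r"
  shows "\<exists>D>0. D < 2 * (Gamma (1 + 1 / real r) * fact r powr (1 / real r)) \<and>
    (\<forall>p t. 0 < p \<longrightarrow> p \<le> 1 / 2 \<longrightarrow>
      (\<Sum>u<t. 1 - renewal.reach (points r) (level r) (below r) p 2 u) \<le> 2 * real r + D * p powr (- 1 / real r))"
proof -
  have r1: "1 \<le> r" using r by simp
  interpret renewal "points r" "level r" "below r" "shift r" by (rule points_renewal[OF r1])
  define a where "a = 1 / real r"
  have a: "0 < a" "a * real r = 1" using r by (simp_all add: a_def)
  define g where "g = Gamma (1 + 1 / real r) * fact r powr a"
  have "0 < Gamma (1 + 1 / real r)" by (intro Gamma_real_pos add_pos_nonneg) auto
  then have g: "0 < g" by (simp add: g_def)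
  define \<delta> where "\<delta> = exp (- (2 * 2 ^ r)) * (1 - exp (- 1))\<^sup>2 * exp (- (2 * (real (3 * r + 4) ^ r * 2 ^ r)))"
  have "exp (- 1) < (1 :: real)" by simp
  then have \<delta>: "0 < \<delta>" by (simp add: \<delta>_def)
  \<comment> \<open>The minimum with \<open>g\<close> only ensures that \<open>D\<close> is positive.\<close>
  define D where "D = 2 * g - min \<delta> g"
  have "(\<Sum>u<t. 1 - reach p 2 u) \<le> 2 * real r + D * p powr (- a)" if p: "0 < p" "p \<le> 1 / 2" for p t
  proof -
    have p': "0 \<le> p" "p \<le> 1" using p by auto
    define \<mu> where "\<mu> = real r + g * p powr (- a)"
    have \<mu>: "(\<Sum>u<t. 1 - reach p 1 u) \<le> \<mu>" for t
    proof -
      have "(\<Sum>u<t. 1 - reach p 1 u) \<le> (\<Sum>u<t. (1 - p) ^ (u choose r))"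
      proof (intro sum_mono)
        fix u
        have "1 - reach p 1 u = (1 - p) ^ card (ini u)" by (rule reach_1[OF p'])
        also have "\<dots> \<le> (1 - p) ^ (u choose r)"
          unfolding ini_def using p' card_points_ge[OF r1] by (intro power_decreasing) auto
        finally show "1 - reach p 1 u \<le> (1 - p) ^ (u choose r)" .
      qed
      also have "\<dots> \<le> real r + Gamma (1 + 1 / real r) / (p / fact r) powr a"
        unfolding a_def by (rule sum_power_binomial_le[OF r1 p(1) p'(2)])
      also have "Gamma (1 + 1 / real r) / (p / fact r) powr a = g * p powr (- a)"
      proof -
        have "(p / fact r) powr a = p powr a / fact r powr a" using p by (simp add: powr_divide)
        then show ?thesis by (simp add: powr_minus g_def divide_inverse mult.assoc)
      qed
      finally show ?thesis by (simp add: \<mu>_def)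
    qed
    define y where "y = p powr (- a)"
    have y: "1 \<le> y" "y ^ r = 1 / p"
    proof -
      have "p powr 0 \<le> p powr (- a)" using p p' a by (intro powr_mono') auto
      then show "1 \<le> y" using p by (simp add: y_def)
      have "y ^ r = y powr real r" using p by (simp add: y_def powr_realpow)
      also have "\<dots> = p powr (- 1)" using a by (simp add: y_def powr_powr)
      also have "\<dots> = 1 / p" using powr_minus_divide[of p 1] p by simp
      finally show "y ^ r = 1 / p" .
    qed
    \<comment> \<open>The side of the cubes, with \<open>1 \<le> p * q ^ r \<le> 2 ^ r\<close>.\<close>
    define q where "q = nat \<lceil>y\<rceil>"
    have "real q = of_int \<lceil>y\<rceil>" using y(1) by (simp add: q_def)
    then have q: "y \<le> real q" "real q \<le> 2 * y" using y(1) by linarith+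
    have q1: "1 \<le> q" using q y(1) by linarith
    have "y ^ r \<le> real q ^ r" using q y(1) by (intro power_mono) auto
    then have pq1: "1 \<le> p * real (q ^ r)" using y(2) p by (simp add: field_simps)
    have "real q ^ r \<le> (2 * y) ^ r" using q by (intro power_mono) auto
    then have pq2: "p * real (q ^ r) \<le> 2 ^ r" using y(2) p by (simp add: power_mult_distrib field_simps)
    define e where "e = (\<lambda>t. if t \<in> {(3 * r + 3) * q..<(3 * r + 4) * q} then \<delta> else 0)"
    have e0: "0 \<le> e t" for t using \<delta> by (simp add: e_def)
    have conv: "(\<Sum>s=1..t. (reach p 1 s - reach p 1 (s - 1)) * reach p 1 (t - s)) + e t \<le> reach p 2 t" for t
    proof (cases "t \<in> {(3 * r + 3) * q..<(3 * r + 4) * q}")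
      case True
      then show ?thesis using trap[OF r q1 p'(1) p(2) pq1 pq2, of t] by (simp add: e_def \<delta>_def)
    next
      case False
      then have "e t = 0" unfolding e_def by (rule if_not_P)
      then show ?thesis using reach_2_ge[OF p', of t "\<lambda>_. False"] ini_fin by simp
    qed
    define T where "T = max t ((3 * r + 4) * q)"
    have "(\<Sum>u<t. 1 - reach p 2 u) \<le> (\<Sum>u<T. 1 - reach p 2 u)"
      using reach_le_1[OF p'] by (intro sum_mono2) (auto simp: T_def)
    also have "\<dots> \<le> 2 * \<mu> - (\<Sum>u<T. e u)" by (rule two_step_time[OF p' \<mu> conv])
    also have "(\<Sum>u<T. e u) = (\<Sum>u\<in>{(3 * r + 3) * q..<(3 * r + 4) * q}. \<delta>)"
    proof (rule sum.mono_neutral_cong_right)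
      show "{(3 * r + 3) * q..<(3 * r + 4) * q} \<subseteq> {..<T}" by (auto simp: T_def)
    qed (auto simp: e_def)
    also have "\<dots> = real q * \<delta>" by (simp add: algebra_simps)
    also have "2 * \<mu> - real q * \<delta> \<le> 2 * \<mu> - y * min \<delta> g"
      using q y(1) \<delta> g by (intro diff_left_mono mult_mono) auto
    also have "\<dots> = 2 * real r + D * p powr (- a)" by (simp add: \<mu>_def D_def y_def algebra_simps)
    finally show ?thesis .
  qed
  moreover have "0 < D" "D < 2 * g" using g \<delta> by (auto simp: D_def)
  ultimately show ?thesis unfolding g_def a_def by (intro exI[of _ D]) auto
qed

text \<open>Compare the lower bound from renewal in steps of two points with the upper bound from covering by
  boxes, both for points of coordinate sum at most \<open>K * k\<close> at density \<open>\<rho> / k ^ r\<close>.\<close>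

theorem points_constant_gt:
  assumes r: "2 \<le> r" and hc: "has_chain_constant r c" and c: "0 < c"
  shows "1 / Gamma (1 + 1 / real r) < c * fact r powr (1 / real r) / real r"
proof -
  have r1: "1 \<le> r" using r by simp
  interpret renewal "points r" "level r" "below r" "shift r" by (rule points_renewal[OF r1])
  define a where "a = 1 / real r"
  have a: "0 < a" "a * real r = 1" using r by (simp_all add: a_def)
  define f where "f = fact r powr a"
  have f: "0 < f" by (simp add: f_def)
  define g where "g = Gamma (1 + 1 / real r)"
  have g: "0 < g" unfolding g_def by (intro Gamma_real_pos add_pos_nonneg) auto
  obtain D where D: "0 < D" "D < 2 * (g * f)" and time: "\<And>p t. 0 < p \<Longrightarrow> p \<le> 1 / 2 \<Longrightarrow>
      (\<Sum>u<t. 1 - reach p 2 u) \<le> 2 * real r + D * p powr (- a)"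
    using two_step_gain[OF r] unfolding g_def f_def a_def by auto
  have "2 / D \<le> c / real r"
  proof (rule asymp_compare[OF r1])
    fix K :: nat and \<epsilon> :: real assume K: "1 \<le> K" and \<epsilon>: "0 < \<epsilon>"
    obtain \<rho>2 where \<rho>2: "0 < \<rho>2" "\<forall>\<rho>\<ge>\<rho>2. eventually (\<lambda>k. 1 \<le> k \<and> 0 < \<rho> / real k ^ r \<and> \<rho> / real k ^ r \<le> 1 / 2 \<and>
      (c - \<epsilon>) * \<rho> powr a \<le> bexp (\<rho> / real k ^ r) (grid r (\<lambda>_. k)) (\<lambda>G. real (largest (chain (below r)) G)) \<and>
      (\<forall>u. (\<forall>i<r. 1 \<le> u i) \<longrightarrow> (\<Sum>i<r. u i) \<le> K + r \<longrightarrow>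
        bexp (\<rho> / real k ^ r) (grid r (\<lambda>i. u i * k)) (\<lambda>G. real (largest (chain (below r)) G))
          \<le> (c + \<epsilon>) * (real (K + r) / real r) * \<rho> powr a)) sequentially"
      using grid_limit[OF r hc c \<epsilon>, of K] unfolding a_def by blast
    define m where "m = (c + \<epsilon>) * (real (K + r) / real r)"
    define C where "C = real (card (windows r K)) * sqrt m"
    have "2 / D * real K * \<rho> powr a \<le> m * \<rho> powr a + \<epsilon> * real K * \<rho> powr a + C * sqrt (\<rho> powr a) + 2"
      if \<rho>: "\<rho>2 \<le> \<rho>" for \<rho>
    proof -
      have \<rho>0: "0 < \<rho>" using \<rho> \<rho>2 by simp
      define D' where "D' = D * \<rho> powr (- a)"
      have D': "0 < D'" using D \<rho>0 by (simp add: D'_def)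
      have ev: "eventually (\<lambda>k. 2 * real K / (2 * real r / real k + D') - 2 \<le> m * \<rho> powr a + C * sqrt (\<rho> powr a)) sequentially"
        using \<rho>2(2)[rule_format, OF \<rho>]
      proof eventually_elim
        case (elim k)
        define p where "p = \<rho> / real k ^ r"
        from elim have k: "1 \<le> k" and p: "0 < p" "p \<le> 1 / 2" unfolding p_def by blast+
        have p': "0 \<le> p" "p \<le> 1" using p by auto
        have "(real k ^ r) powr a = real k"
          using k a by (simp add: powr_realpow[symmetric] powr_powr mult.commute)
        then have "p powr a = \<rho> powr a / real k"
          using \<rho>0 by (simp add: p_def powr_divide)
        then have "p powr (- a) = \<rho> powr (- a) * real k" by (simp add: powr_minus divide_inverse mult.commute)
        then have t: "(\<Sum>u<t. 1 - reach p 2 u) \<le> 2 * real r + D' * real k" for t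
          using time[OF p, of t] by (simp add: D'_def mult.assoc)
        have "real 2 / (2 * real r + D' * real k) * real (K * k) - real 2 \<le> mean_height p (K * k)"
          using D' r t by (intro mean_height_ge[OF p']) (auto intro: add_pos_nonneg)
        also have "\<dots> \<le> m * \<rho> powr a + real (card (windows r K)) * sqrt (m * \<rho> powr a)"
          unfolding mean_height_def ini_def
        proof (rule simplex_upper[OF r1 k p'])
          show "bexp p (grid r (\<lambda>i. u i * k)) (\<lambda>G. real (largest (chain (below r)) G)) \<le> m * \<rho> powr a"
            if "\<forall>i<r. 1 \<le> u i" "(\<Sum>i<r. u i) \<le> K + r" for u
            using elim that unfolding m_def p_def by blast
        qed
        also have "real 2 / (2 * real r + D' * real k) * real (K * k) = 2 * real K / (2 * real r / real k + D')"
        proof -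
          have "2 * real r / real k + D' = (2 * real r + D' * real k) / real k" using k by (simp add: field_simps)
          then show ?thesis by simp
        qed
        finally show ?case by (simp add: C_def real_sqrt_mult)
      qed
      have "(\<lambda>k. 2 * real K / (2 * real r / real k + D') - 2) \<longlonglongrightarrow> 2 * real K / (0 + D') - 2"
        using D' by (intro tendsto_intros lim_const_over_n) auto
      then have "2 * real K / (0 + D') - 2 \<le> m * \<rho> powr a + C * sqrt (\<rho> powr a)"
        by (rule tendsto_upperbound[OF _ ev]) simp
      moreover have "2 * real K / (0 + D') = 2 / D * real K * \<rho> powr a"
        using \<rho>0 by (simp add: D'_def powr_minus field_simps)
      moreover have "0 \<le> \<epsilon> * real K * \<rho> powr a" using \<epsilon> by simp
      ultimately show ?thesis by linarith
    qed
    then show "\<exists>C D' \<rho>0. \<forall>\<rho>\<ge>\<rho>0. 2 / D * real K * \<rho> powr (1 / real r) \<le> (c + \<epsilon>) * (real (K + r) / real r) * \<rho> powr (1 / real r)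
      + \<epsilon> * real K * \<rho> powr (1 / real r) + C * sqrt (\<rho> powr (1 / real r)) + D'"
      unfolding m_def a_def by blast
  qed
  moreover have "1 / (g * f) < 2 / D"
    using D g f by (simp add: field_simps)
  ultimately have "1 / (g * f) < c / real r" by linarith
  then have "1 / (g * f) * f < c / real r * f" using f by (intro mult_strict_right_mono)
  moreover have "1 / (g * f) * f = 1 / g" "c / real r * f = c * f / real r" using f by simp_all
  ultimately have "1 / g < c * f / real r" by simp
  then show ?thesis unfolding g_def f_def a_def .
qed

section \<open>Patterns with a single block\<close>

text \<open>The only block is all of \<open>{1..2 * r}\<close>, and its two runs of length \<open>r\<close> exhaust the two edges.\<close>

lemma single_block_structure:
  assumes r: "1 \<le> r" and P: "is_pattern r P" and ty: "has_type P {#r#}"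
  shows "P = {{1..r}, {r + 1..2 * r}}"
proof -
  obtain Js where Js: "is_block_partition P Js" "{#r#} = image_mset (\<lambda>J. card J div 2) (mset_set Js)"
    using ty unfolding has_type_def by blast
  have M: "is_matching r {1..2 * r} P" "card P = 2" using P by (auto simp: is_pattern_def)
  have UP: "\<Union>P = {1..2 * r}" and cP: "\<And>e. e \<in> P \<Longrightarrow> card e = r"
    using M by (auto simp: is_matching_def partition_on_def)
  have fin: "finite e" if "e \<in> P" for e using that UP by (metis Union_upper finite_atLeastAtMost finite_subset)
  have "size (mset_set Js) = 1" using arg_cong[OF Js(2), of size] by simp
  then have "card Js = 1" by simp
  then obtain J where J: "Js = {J}" by (meson card_1_singletonE)
  have cJ: "card J div 2 = r" using Js(2) J by simp
  have JU: "J = {1..2 * r}" using Js(1) J UP by (simp add: is_block_partition_def partition_on_def)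
  have "is_block P J" using Js(1) J by (simp add: is_block_partition_def)
  then obtain a k e f where b: "e \<in> P" "f \<in> P" "e \<noteq> f" "J = {a..<a + 2 * k}"
      "{a..<a + k} \<subseteq> e" "{a + k..<a + 2 * k} \<subseteq> f" unfolding is_block_def by blast
  have k: "k = r" using cJ b(4) by simp
  have "Min J = a" using b(4) k r by (intro Min_eqI) auto
  moreover have "Min J = 1" using JU r by (intro Min_eqI) auto
  ultimately have a: "a = 1" by simp
  have "{1..r} = e"
  proof (rule card_subset_eq[OF fin[OF b(1)]])
    show "{1..r} \<subseteq> e" using b(5) unfolding a k by auto
  qed (simp add: cP[OF b(1)])
  moreover have "{r + 1..2 * r} = f"
  proof (rule card_subset_eq[OF fin[OF b(2)]])
    show "{r + 1..2 * r} \<subseteq> f" using b(6) unfolding a k by auto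
  qed (simp add: cP[OF b(2)])
  moreover have "P = {e, f}"
  proof -
    have "finite P" using M(2) by (intro card_ge_0_finite) simp
    then have "{e, f} = P" using b(1-3) M(2) by (intro card_subset_eq) auto
    then show ?thesis by simp
  qed
  ultimately show ?thesis by simp
qed

text \<open>The isomorphism maps the first \<open>r\<close> vertices increasingly onto the earlier edge and the others
  onto the later one; conversely an increasing map preserves that one edge precedes the other.\<close>

lemma single_block_isomorphic:
  assumes r: "1 \<le> r" and e: "finite e" "card e = r" and f: "finite f" "card f = r"
  shows "order_isomorphic {e, f} {{1..r}, {r + 1..2 * r}} \<longleftrightarrow> before e f \<or> before f e"
proof -
  have ne: "e \<noteq> {}" "f \<noteq> {}" using r e f by auto
  have one: "order_isomorphic {{1..r}, {r + 1..2 * r}} {e, f}"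
    if b: "before e f" and e: "finite e" "card e = r" "e \<noteq> {}" and f: "finite f" "card f = r" "f \<noteq> {}" for e f
  proof -
    define \<phi> where "\<phi> = (\<lambda>v. if v \<le> r then elt e (v - 1) else elt f (v - r - 1))"
    have mem: "elt e i \<in> e" "elt f i \<in> f" if "i < r" for i
      using elt(2)[OF e(1,2)] elt(2)[OF f(1,2)] that by blast+
    have lt: "x < y" if "x \<in> e" "y \<in> f" for x y
    proof -
      have "x \<le> Max e" "Min f \<le> y" using that e f by auto
      then show ?thesis using b unfolding before_def by linarith
    qed
    have sm: "strict_mono_on {1..2 * r} \<phi>"
    proof (rule strict_mono_onI)
      fix v w :: nat assume vw: "v \<in> {1..2 * r}" "w \<in> {1..2 * r}" "v < w"
      consider "w \<le> r" | "v \<le> r" "r < w" | "r < v" using vw by linarith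
      then show "\<phi> v < \<phi> w"
      proof cases
        case 1
        then show ?thesis using vw by (auto simp: \<phi>_def intro!: strict_mono_onD[OF elt(1)[OF e(1,2)]])
      next
        case 2
        then have "\<phi> v = elt e (v - 1)" "\<phi> w = elt f (w - r - 1)" "v - 1 < r" "w - r - 1 < r"
          using vw by (auto simp: \<phi>_def)
        then show ?thesis using lt[OF mem(1) mem(2)] by simp
      next
        case 3
        then show ?thesis using vw by (auto simp: \<phi>_def intro!: strict_mono_onD[OF elt(1)[OF f(1,2)]])
      qed
    qed
    have im1: "\<phi> ` {1..r} = e"
    proof -
      have "\<phi> ` {1..r} = \<phi> ` Suc ` {..<r}" by (simp add: image_Suc_lessThan)
      also have "\<dots> = elt e ` {..<r}" unfolding image_image by (intro image_cong) (auto simp: \<phi>_def)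
      finally show ?thesis using elt(2)[OF e(1,2)] by simp
    qed
    have im2: "\<phi> ` {r + 1..2 * r} = f"
    proof -
      have "{r + 1..2 * r} = (\<lambda>i. i + (r + 1)) ` {0..<r}"
        by (subst image_add_atLeastLessThan') auto
      then have "\<phi> ` {r + 1..2 * r} = (\<lambda>i. \<phi> (i + (r + 1))) ` {..<r}" by (simp add: image_image atLeast0LessThan)
      also have "\<dots> = elt f ` {..<r}" by (intro image_cong) (auto simp: \<phi>_def)
      finally show ?thesis using elt(2)[OF f(1,2)] by simp
    qed
    have U: "\<Union>{{1..r}, {r + 1..2 * r}} = {1..2 * r}" by auto
    have "\<phi> ` {1..2 * r} = e \<union> f" unfolding U[symmetric] using im1 im2 by (simp add: image_Un)
    then have "bij_betw \<phi> {1..2 * r} (\<Union>{e, f})"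
      using strict_mono_on_imp_inj_on[OF sm] by (simp add: bij_betw_def)
    then show ?thesis unfolding order_isomorphic_def U using sm im1 im2 by (intro exI[of _ \<phi>]) simp
  qed
  show ?thesis
  proof
    assume "before e f \<or> before f e"
    then show "order_isomorphic {e, f} {{1..r}, {r + 1..2 * r}}"
      using one[of e f] one[of f e] e f ne by (auto intro: order_isomorphic_sym simp: insert_commute)
  next
    assume "order_isomorphic {e, f} {{1..r}, {r + 1..2 * r}}"
    then have "order_isomorphic {{1..r}, {r + 1..2 * r}} {e, f}" by (rule order_isomorphic_sym)
    then obtain \<psi> where \<psi>: "strict_mono_on (\<Union>{{1..r}, {r + 1..2 * r}}) \<psi>"
      "(\<lambda>e. \<psi> ` e) ` {{1..r}, {r + 1..2 * r}} = {e, f}"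
      unfolding order_isomorphic_def by (elim exE conjE)
    have im: "{\<psi> ` {1..r}, \<psi> ` {r + 1..2 * r}} = {e, f}" using \<psi>(2) by simp
    have "before (\<psi> ` {1..r}) (\<psi> ` {r + 1..2 * r})"
    proof -
      have "Max (\<psi> ` {1..r}) \<in> \<psi> ` {1..r}" "Min (\<psi> ` {r + 1..2 * r}) \<in> \<psi> ` {r + 1..2 * r}"
        using r by (auto intro!: Max_in Min_in)
      then obtain v w where "v \<in> {1..r}" "w \<in> {r + 1..2 * r}" "Max (\<psi> ` {1..r}) = \<psi> v" "Min (\<psi> ` {r + 1..2 * r}) = \<psi> w"
        by blast
      then show ?thesis unfolding before_def using strict_mono_onD[OF \<psi>(1), of v w] by auto
    qed
    then show "before e f \<or> before f e" using im by (auto simp: doubleton_eq_iff)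
  qed
qed

lemma max_clique_single_block:
  assumes r: "1 \<le> r" and G: "G \<subseteq> redges r m"
  shows "max_clique {{1..r}, {r + 1..2 * r}} G = largest (chain before) G"
  unfolding max_clique_largest
proof (rule largest_cong)
  fix K assume K: "K \<subseteq> G"
  have e: "finite e \<and> card e = r" if "e \<in> K" for e
  proof -
    have "e \<in> redges r m" using that K G by blast
    then have "e \<subseteq> {1..m}" "card e = r" unfolding redges_def by blast+
    then show ?thesis using finite_subset[of e "{1..m}"] by simp
  qed
  have "order_isomorphic {e, f} {{1..r}, {r + 1..2 * r}} \<longleftrightarrow> before e f \<or> before f e" if "e \<in> K" "f \<in> K" for e f
    using single_block_isomorphic[OF r] e[OF that(1)] e[OF that(2)] by blast
  then show "is_clique {{1..r}, {r + 1..2 * r}} K \<longleftrightarrow> chain before K"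
    unfolding is_clique_def chain_def by blast
qed

theorem proposition1p11:
  fixes r :: nat and P :: "nat set set" and b :: real
  assumes "r \<ge> 2"
    and "is_pattern r P"
    and "collectable r P"
    and "is_limit_constant r P b"
  shows "(has_type P {#r#} \<longrightarrow> b = 1 / Gamma ((real r + 1) / real r)) \<and>
         (has_type P (replicate_mset r 1) \<longrightarrow>
            (\<forall>c. is_bollobas_winkler_constant r c \<longrightarrow>
                 b = c * fact r powr (1 / real r) / real r \<and>
                 c * fact r powr (1 / real r) / real r > 1 / Gamma ((real r + 1) / real r)))"
proof -
  have r: "2 \<le> r" "1 \<le> r" using assms(1) by auto
  have gam: "(real r + 1) / real r = 1 + 1 / real r" using r by (simp add: field_simps)
  have b: "0 < b" using assms(4) by (simp add: is_limit_constant_def)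
  have hb: "has_mean_constant r (\<lambda>G. real (max_clique P G)) b"
    by (rule matching_mean_constant[OF r(2) assms(4)])
  show ?thesis
  proof (intro conjI impI allI)
    assume "has_type P {#r#}"
    then have P: "P = {{1..r}, {r + 1..2 * r}}" by (rule single_block_structure[OF r(2) assms(2)])
    have "bexp p (redges r m) (\<lambda>G. real (max_clique P G)) = bexp p (redges r m) (\<lambda>G. real (largest (chain before) G))" for p m
    proof (rule bexp_cong[OF refl])
      fix G assume "G \<subseteq> redges r m"
      then show "real (max_clique P G) = real (largest (chain before) G)"
        unfolding P by (simp only: max_clique_single_block[OF r(2)])
    qed
    then have "has_mean_constant r (\<lambda>G. real (largest (chain before) G)) b"
      using hb unfolding has_mean_constant_def by simp
    then show "b = 1 / Gamma ((real r + 1) / real r)"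
      unfolding gam by (rule interval_constant[OF r(2)])
  next
    fix c assume ty: "has_type P (replicate_mset r 1)" and bw: "is_bollobas_winkler_constant r c"
    obtain s where P: "P = {edgeA r s ` {..<r}, edgeB r s ` {..<r}}"
      using partite_structure[OF r(2) assms(2) ty] .
    have c: "0 < c" using bw by (simp add: is_bollobas_winkler_constant_def)
    have hc: "has_chain_constant r c" by (rule points_mean_constant[OF r(1) bw])
    show "b = c * fact r powr (1 / real r) / real r" by (rule partite_constant[OF r(1) P hb b hc c])
    show "1 / Gamma ((real r + 1) / real r) < c * fact r powr (1 / real r) / real r"
      unfolding gam by (rule points_constant_gt[OF r(1) hc c])
  qed
qed

end
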